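(* Let $K$ be a commutative ring. The functor $R\mapsto R[\Sigma]$ gives an equivalence of categories between the category of symmetric monoidal partition functors valued in $K$-modules and the category of connected commutative cocommutative $\mathbb N$-graded $K$-bialgebras.
   Context: Partitions. A partition $\Lambda=(X,\sim_\Lambda)$ is a finite set $X$ with an equivalence relation; its classes are called blocks. A morphism $f\colon\Lambda\to\Omega=(Y,\sim_\Omega)$ is a bijection $f\colon X\to Y$ with $x\sim_\Lambda x'\Rightarrow f(x)\sim_\Omega f(x')$. There is a (unique) 2-isomorphism $f\Rightarrow g$ between morphisms $f,g\colon\Lambda\to\Omega$ exactly when $f(x)\sim_\Omega g(x)$ for all $x$. This defines a $(2,1)$-category $\mathcal P$; functors from $\mathcal P$ to an ordinary category identify 2-isomorphic morphisms. Write $\Lambda\le\Omega$ if $X=Y$ and the identity is a morphism $\Lambda\to\Omega$. $\Lambda\cap\Gamma$ is the coarsest common refinement; $\Lambda\sqcup\Omega$ the disjoint union. $\underline m$ is $[m]=\{1,\dots,m\}$ with the indiscrete relation ($\underline 0$ empty). $\underline i\sqcup\underline j\le\underline{i+j}$ denotes the morphism sending $\underline i$ to the first $i$ and $\underline j$ to the last $j$ elements. $\Sigma_\Lambda$ is the group of bijections of $X$ preserving every block; $\sigma\Lambda$ is the partition transported along $\sigma$. Partition functors. A partition functor $M$ with values in $K$-modules consists of $K$-modules $M(\Lambda)$, a contravariant functor $M^*$ (restrictions) and a covariant functor $M_*$ (transfers) from $\mathcal P$ to $K$-modules with common values $M(\Lambda)$, with $M_*(f)=M^*(f^{-1})$ for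 isomorphisms $f$, and for $\Gamma,\Lambda\le\Omega$ $$M^*(\Gamma\le\Omega)M_*(\Lambda\le\Omega)=\sum_{[\sigma]\in\Sigma_\Gamma\backslash\Sigma_\Omega/\Sigma_\Lambda}M_*(\Gamma\cap\sigma\Lambda\le\Gamma)\,M_*(\sigma)\,M^*(\sigma^{-1}\Gamma\cap\Lambda\le\Lambda).$$ A symmetric monoidal partition functor valued in $K$-modules is such an $R$ with an isomorphism $K\cong R(\underline0)$ and isomorphisms $R(\Lambda)\otimes_KR(\Omega)\xrightarrow{\cong}R(\Lambda\sqcup\Omega)$, $x\otimes y\mapsto x\boxtimes y$, natural in pairs of restrictions and pairs of transfers, associative, unital and symmetric. Morphisms preserve all structure. Write $R(m)=R(\underline m)$. $R[\Sigma]=\bigoplus_{m\ge0}R(m)$ has multiplication $xy=R_*(\underline i\sqcup\underline j\le\underline{i+j})(x\boxtimes y)$ for $x\in R(i)$, $y\in R(j)$, and comultiplication with $(i,j)$-component $R(i+j)\to R(i)\otimes_KR(j)$ given by $R^*(\underline i\sqcup\underline j\le\underline{i+j})$ followed by the inverse of the external product isomorphism; unit and counit are given by $R(0)\cong K$. A connected commutative cocommutative $\mathbb N$-graded $K$-bialgebra is $A_*=\bigoplus_{i\in\mathbb N}A_i$ with $A_0=K$, with graded multiplication, comultiplication $A_*\to A_*\otimes_KA_*$, unit $K\to A_*$ and counit $A_*\to K$ making it a cocommutative comonoid in $\mathbb N$-graded commutative $K$-algebras (commutative and cocommutative without signs). *)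

theory Defs
  imports "HOL-Algebra.Module" "HOL-Algebra.AbelCoset"
    "HOL-Library.Nat_Bijection" "HOL-Combinatorics.Permutations"
begin

section \<open>Categories, functors and equivalences\<close>

text \<open>Hom-sets of distinct pairs of objects need not be disjoint, so composition and the action
  of a functor on arrows take the objects involved as arguments:
  if f is in Hom X Y and g is in Hom Y Z, then Comp X Y Z g f is in Hom X Z.\<close>

record ('o, 'a) cat =
  Obj :: "'o set"
  Hom :: "'o \<Rightarrow> 'o \<Rightarrow> 'a set"
  Ident :: "'o \<Rightarrow> 'a"
  Comp :: "'o \<Rightarrow> 'o \<Rightarrow> 'o \<Rightarrow> 'a \<Rightarrow> 'a \<Rightarrow> 'a"

definition is_category :: "('o, 'a) cat \<Rightarrow> bool" where
  "is_category C \<longleftrightarrow>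
    (\<forall>X\<in>Obj C. Ident C X \<in> Hom C X X) \<and>
    (\<forall>X\<in>Obj C. \<forall>Y\<in>Obj C. \<forall>Z\<in>Obj C. \<forall>f\<in>Hom C X Y. \<forall>g\<in>Hom C Y Z. Comp C X Y Z g f \<in> Hom C X Z) \<and>
    (\<forall>X\<in>Obj C. \<forall>Y\<in>Obj C. \<forall>f\<in>Hom C X Y.
       Comp C X X Y f (Ident C X) = f \<and> Comp C X Y Y (Ident C Y) f = f) \<and>
    (\<forall>W\<in>Obj C. \<forall>X\<in>Obj C. \<forall>Y\<in>Obj C. \<forall>Z\<in>Obj C.
       \<forall>f\<in>Hom C W X. \<forall>g\<in>Hom C X Y. \<forall>h\<in>Hom C Y Z.
         Comp C W Y Z h (Comp C W X Y g f) = Comp C W X Z (Comp C X Y Z h g) f)"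

definition is_functor ::
  "('o, 'a) cat \<Rightarrow> ('p, 'b) cat \<Rightarrow> ('o \<Rightarrow> 'p) \<Rightarrow> ('o \<Rightarrow> 'o \<Rightarrow> 'a \<Rightarrow> 'b) \<Rightarrow> bool" where
  "is_functor C D Fo Fa \<longleftrightarrow>
    (\<forall>X\<in>Obj C. Fo X \<in> Obj D) \<and>
    (\<forall>X\<in>Obj C. \<forall>Y\<in>Obj C. \<forall>f\<in>Hom C X Y. Fa X Y f \<in> Hom D (Fo X) (Fo Y)) \<and>
    (\<forall>X\<in>Obj C. Fa X X (Ident C X) = Ident D (Fo X)) \<and>
    (\<forall>X\<in>Obj C. \<forall>Y\<in>Obj C. \<forall>Z\<in>Obj C. \<forall>f\<in>Hom C X Y. \<forall>g\<in>Hom C Y Z.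
       Fa X Z (Comp C X Y Z g f) = Comp D (Fo X) (Fo Y) (Fo Z) (Fa Y Z g) (Fa X Y f))"

definition is_iso :: "('o, 'a) cat \<Rightarrow> 'o \<Rightarrow> 'o \<Rightarrow> 'a \<Rightarrow> bool" where
  "is_iso C X Y f \<longleftrightarrow> f \<in> Hom C X Y \<and>
    (\<exists>g\<in>Hom C Y X. Comp C X Y X g f = Ident C X \<and> Comp C Y X Y f g = Ident C Y)"

definition is_natural_iso ::
  "('o, 'a) cat \<Rightarrow> ('p, 'b) cat \<Rightarrow> ('o \<Rightarrow> 'p) \<Rightarrow> ('o \<Rightarrow> 'o \<Rightarrow> 'a \<Rightarrow> 'b) \<Rightarrow>
    ('o \<Rightarrow> 'p) \<Rightarrow> ('o \<Rightarrow> 'o \<Rightarrow> 'a \<Rightarrow> 'b) \<Rightarrow> ('o \<Rightarrow> 'b) \<Rightarrow> bool" where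
  "is_natural_iso C D Fo Fa Go Ga \<alpha> \<longleftrightarrow>
    (\<forall>X\<in>Obj C. is_iso D (Fo X) (Go X) (\<alpha> X)) \<and>
    (\<forall>X\<in>Obj C. \<forall>Y\<in>Obj C. \<forall>f\<in>Hom C X Y.
       Comp D (Fo X) (Fo Y) (Go Y) (\<alpha> Y) (Fa X Y f) =
       Comp D (Fo X) (Go X) (Go Y) (Ga X Y f) (\<alpha> X))"

definition is_equivalence ::
  "('o, 'a) cat \<Rightarrow> ('p, 'b) cat \<Rightarrow> ('o \<Rightarrow> 'p) \<Rightarrow> ('o \<Rightarrow> 'o \<Rightarrow> 'a \<Rightarrow> 'b) \<Rightarrow> bool" where
  "is_equivalence C D Fo Fa \<longleftrightarrow>
    is_category C \<and> is_category D \<and> is_functor C D Fo Fa \<and>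
    (\<exists>Go Ga. is_functor D C Go Ga \<and>
      (\<exists>\<alpha>. is_natural_iso C C (\<lambda>X. X) (\<lambda>X Y f. f)
             (\<lambda>X. Go (Fo X)) (\<lambda>X Y f. Ga (Fo X) (Fo Y) (Fa X Y f)) \<alpha>) \<and>
      (\<exists>\<beta>. is_natural_iso D D (\<lambda>X. Fo (Go X)) (\<lambda>X Y f. Fa (Go X) (Go Y) (Ga X Y f))
             (\<lambda>X. X) (\<lambda>X Y f. f) \<beta>))"


section \<open>Linear maps and tensor products\<close>

text \<open>The ring structure fields of a module record (multiplication and one) carry no
  meaning for modules; as usual they are left unspecified.\<close>

definition mod_hom ::
  "('k, 'r) ring_scheme \<Rightarrow> ('k, 'm) module \<Rightarrow> ('k, 'n) module \<Rightarrow> ('m \<Rightarrow> 'n) set" where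
  "mod_hom K M N = {f \<in> carrier M \<rightarrow> carrier N.
     (\<forall>x\<in>carrier M. \<forall>y\<in>carrier M. f (x \<oplus>\<^bsub>M\<^esub> y) = f x \<oplus>\<^bsub>N\<^esub> f y) \<and>
     (\<forall>k\<in>carrier K. \<forall>x\<in>carrier M. f (k \<odot>\<^bsub>M\<^esub> x) = k \<odot>\<^bsub>N\<^esub> f x)}"

definition mod_iso ::
  "('k, 'r) ring_scheme \<Rightarrow> ('k, 'm) module \<Rightarrow> ('k, 'n) module \<Rightarrow> ('m \<Rightarrow> 'n) set" where
  "mod_iso K M N = {f \<in> mod_hom K M N. bij_betw f (carrier M) (carrier N)}"

text \<open>Linear maps, each represented by one function (undefined off the carrier).\<close>

definition mod_hom_ext ::
  "('k, 'r) ring_scheme \<Rightarrow> ('k, 'm) module \<Rightarrow> ('k, 'n) module \<Rightarrow> ('m \<Rightarrow> 'n) set" where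
  "mod_hom_ext K M N = mod_hom K M N \<inter> extensional (carrier M)"

definition bilinear_map ::
  "('k, 'r) ring_scheme \<Rightarrow> ('k, 'm) module \<Rightarrow> ('k, 'n) module \<Rightarrow> ('k, 'p) module \<Rightarrow>
    ('m \<Rightarrow> 'n \<Rightarrow> 'p) \<Rightarrow> bool" where
  "bilinear_map K M N P f \<longleftrightarrow>
     (\<forall>x\<in>carrier M. (\<lambda>y. f x y) \<in> mod_hom K N P) \<and>
     (\<forall>y\<in>carrier N. (\<lambda>x. f x y) \<in> mod_hom K M P)"

definition self_mod :: "('k, 'r) ring_scheme \<Rightarrow> ('k, 'k) module" where
  "self_mod K = \<lparr>carrier = carrier K, monoid.mult = undefined, one = undefined,
     zero = \<zero>\<^bsub>K\<^esub>, add = add K, smult = monoid.mult K\<rparr>"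

definition free_mod :: "('k, 'r) ring_scheme \<Rightarrow> 's set \<Rightarrow> ('k, 's \<Rightarrow> 'k) module" where
  "free_mod K S = \<lparr>
     carrier = {\<phi>. (\<forall>s. \<phi> s \<in> carrier K) \<and> finite {s. \<phi> s \<noteq> \<zero>\<^bsub>K\<^esub>} \<and> {s. \<phi> s \<noteq> \<zero>\<^bsub>K\<^esub>} \<subseteq> S},
     monoid.mult = undefined, one = undefined,
     zero = (\<lambda>_. \<zero>\<^bsub>K\<^esub>), add = (\<lambda>\<phi> \<psi> s. \<phi> s \<oplus>\<^bsub>K\<^esub> \<psi> s), smult = (\<lambda>k \<phi> s. k \<otimes>\<^bsub>K\<^esub> \<phi> s)\<rparr>"

definition free_gen :: "('k, 'r) ring_scheme \<Rightarrow> 's \<Rightarrow> 's \<Rightarrow> 'k" where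
  "free_gen K s = (\<lambda>t. if t = s then \<one>\<^bsub>K\<^esub> else \<zero>\<^bsub>K\<^esub>)"

definition gen_submod :: "('k, 'r) ring_scheme \<Rightarrow> ('k, 'm) module \<Rightarrow> 'm set \<Rightarrow> 'm set" where
  "gen_submod K M T = \<Inter> {H. submodule H K M \<and> T \<subseteq> H}"

definition quot_mod :: "('k, 'm) module \<Rightarrow> 'm set \<Rightarrow> ('k, 'm set) module" where
  "quot_mod M H = \<lparr>carrier = a_rcosets\<^bsub>M\<^esub> H, monoid.mult = undefined, one = undefined,
     zero = H, add = set_add M, smult = (\<lambda>k C. \<Union>x\<in>C. H +>\<^bsub>M\<^esub> (k \<odot>\<^bsub>M\<^esub> x))\<rparr>"

definition tensor_rels ::
  "('k, 'r) ring_scheme \<Rightarrow> ('k, 'm) module \<Rightarrow> ('k, 'n) module \<Rightarrow> ('m \<times> 'n \<Rightarrow> 'k) set" where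
  "tensor_rels K M N = (let F = free_mod K (carrier M \<times> carrier N); d = free_gen K in
     {d (x \<oplus>\<^bsub>M\<^esub> x', y) \<ominus>\<^bsub>F\<^esub> (d (x, y) \<oplus>\<^bsub>F\<^esub> d (x', y)) | x x' y.
        x \<in> carrier M \<and> x' \<in> carrier M \<and> y \<in> carrier N} \<union>
     {d (x, y \<oplus>\<^bsub>N\<^esub> y') \<ominus>\<^bsub>F\<^esub> (d (x, y) \<oplus>\<^bsub>F\<^esub> d (x, y')) | x y y'.
        x \<in> carrier M \<and> y \<in> carrier N \<and> y' \<in> carrier N} \<union>
     {d (k \<odot>\<^bsub>M\<^esub> x, y) \<ominus>\<^bsub>F\<^esub> k \<odot>\<^bsub>F\<^esub> d (x, y) | k x y.
        k \<in> carrier K \<and> x \<in> carrier M \<and> y \<in> carrier N} \<union>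
     {d (x, k \<odot>\<^bsub>N\<^esub> y) \<ominus>\<^bsub>F\<^esub> k \<odot>\<^bsub>F\<^esub> d (x, y) | k x y.
        k \<in> carrier K \<and> x \<in> carrier M \<and> y \<in> carrier N})"

type_synonym ('k, 'm, 'n) tens = "('m \<times> 'n \<Rightarrow> 'k) set"

definition tensor ::
  "('k, 'r) ring_scheme \<Rightarrow> ('k, 'm) module \<Rightarrow> ('k, 'n) module \<Rightarrow> ('k, ('k, 'm, 'n) tens) module" where
  "tensor K M N = (let F = free_mod K (carrier M \<times> carrier N) in
     quot_mod F (gen_submod K F (tensor_rels K M N)))"

definition ptens ::
  "('k, 'r) ring_scheme \<Rightarrow> ('k, 'm) module \<Rightarrow> ('k, 'n) module \<Rightarrow> 'm \<Rightarrow> 'n \<Rightarrow> ('k, 'm, 'n) tens" where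
  "ptens K M N x y = (let F = free_mod K (carrier M \<times> carrier N) in
     gen_submod K F (tensor_rels K M N) +>\<^bsub>F\<^esub> free_gen K (x, y))"

text \<open>The linear map out of a tensor product induced by a bilinear map.\<close>

definition tens_lift ::
  "('k, 'r) ring_scheme \<Rightarrow> ('k, 'm) module \<Rightarrow> ('k, 'n) module \<Rightarrow> ('k, 'p) module \<Rightarrow>
    ('m \<Rightarrow> 'n \<Rightarrow> 'p) \<Rightarrow> ('k, 'm, 'n) tens \<Rightarrow> 'p" where
  "tens_lift K M N P f = (THE h. h \<in> mod_hom_ext K (tensor K M N) P \<and>
     (\<forall>x\<in>carrier M. \<forall>y\<in>carrier N. h (ptens K M N x y) = f x y))"

definition tens_map ::
  "('k, 'r) ring_scheme \<Rightarrow> ('k, 'm) module \<Rightarrow> ('k, 'n) module \<Rightarrow> ('k, 'm2) module \<Rightarrow> ('k, 'n2) module \<Rightarrow>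
    ('m \<Rightarrow> 'm2) \<Rightarrow> ('n \<Rightarrow> 'n2) \<Rightarrow> ('k, 'm, 'n) tens \<Rightarrow> ('k, 'm2, 'n2) tens" where
  "tens_map K M N M' N' f g =
     tens_lift K M N (tensor K M' N') (\<lambda>x y. ptens K M' N' (f x) (g y))"

definition tens_swap ::
  "('k, 'r) ring_scheme \<Rightarrow> ('k, 'm) module \<Rightarrow> ('k, 'n) module \<Rightarrow>
    ('k, 'm, 'n) tens \<Rightarrow> ('k, 'n, 'm) tens" where
  "tens_swap K M N = tens_lift K M N (tensor K N M) (\<lambda>x y. ptens K N M y x)"

definition tens_assoc ::
  "('k, 'r) ring_scheme \<Rightarrow> ('k, 'm) module \<Rightarrow> ('k, 'n) module \<Rightarrow> ('k, 'p) module \<Rightarrow>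
    ('k, ('k, 'm, 'n) tens, 'p) tens \<Rightarrow> ('k, 'm, ('k, 'n, 'p) tens) tens" where
  "tens_assoc K M N P =
     tens_lift K (tensor K M N) P (tensor K M (tensor K N P))
       (\<lambda>u z. tens_lift K M N (tensor K M (tensor K N P))
                (\<lambda>x y. ptens K M (tensor K N P) x (ptens K N P y z)) u)"


section \<open>Partitions\<close>

text \<open>Finite sets are represented by finite subsets of nat, closed under disjoint union by the
  bijection between nat + nat and nat; every finite partition is isomorphic to one of these.\<close>

record part =
  pts :: "nat set"
  eqv :: "(nat \<times> nat) set"

definition is_part :: "part \<Rightarrow> bool" where
  "is_part \<Lambda> \<longleftrightarrow> finite (pts \<Lambda>) \<and> equiv (pts \<Lambda>) (eqv \<Lambda>)"

definition pmor :: "part \<Rightarrow> part \<Rightarrow> (nat \<Rightarrow> nat) \<Rightarrow> bool" where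
  "pmor \<Lambda> \<Omega> f \<longleftrightarrow> is_part \<Lambda> \<and> is_part \<Omega> \<and> bij_betw f (pts \<Lambda>) (pts \<Omega>) \<and>
     (\<forall>(x, x')\<in>eqv \<Lambda>. (f x, f x') \<in> eqv \<Omega>)"

text \<open>In particular, functions that agree on the points of the source are 2-isomorphic.\<close>

definition two_iso :: "part \<Rightarrow> part \<Rightarrow> (nat \<Rightarrow> nat) \<Rightarrow> (nat \<Rightarrow> nat) \<Rightarrow> bool" where
  "two_iso \<Lambda> \<Omega> f g \<longleftrightarrow> (\<forall>x\<in>pts \<Lambda>. (f x, g x) \<in> eqv \<Omega>)"

definition piso :: "part \<Rightarrow> part \<Rightarrow> (nat \<Rightarrow> nat) \<Rightarrow> bool" where
  "piso \<Lambda> \<Omega> f \<longleftrightarrow> pmor \<Lambda> \<Omega> f \<and> pmor \<Omega> \<Lambda> (inv_into (pts \<Lambda>) f)"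

definition prefines :: "part \<Rightarrow> part \<Rightarrow> bool" where
  "prefines \<Lambda> \<Omega> \<longleftrightarrow> pts \<Lambda> = pts \<Omega> \<and> pmor \<Lambda> \<Omega> id"

definition pmeet :: "part \<Rightarrow> part \<Rightarrow> part" where
  "pmeet \<Lambda> \<Gamma> = \<lparr>pts = pts \<Lambda>, eqv = eqv \<Lambda> \<inter> eqv \<Gamma>\<rparr>"

definition ptransport :: "(nat \<Rightarrow> nat) \<Rightarrow> part \<Rightarrow> part" where
  "ptransport \<sigma> \<Lambda> = \<lparr>pts = \<sigma> ` pts \<Lambda>, eqv = map_prod \<sigma> \<sigma> ` eqv \<Lambda>\<rparr>"

definition indiscrete :: "nat \<Rightarrow> part" where
  "indiscrete m = \<lparr>pts = {1..m}, eqv = {1..m} \<times> {1..m}\<rparr>"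

abbreviation inl :: "nat \<Rightarrow> nat" where "inl x \<equiv> sum_encode (Inl x)"
abbreviation inr :: "nat \<Rightarrow> nat" where "inr x \<equiv> sum_encode (Inr x)"

definition copair :: "(nat \<Rightarrow> nat) \<Rightarrow> (nat \<Rightarrow> nat) \<Rightarrow> nat \<Rightarrow> nat" where
  "copair f g z = (case sum_decode z of Inl x \<Rightarrow> f x | Inr y \<Rightarrow> g y)"

definition psum :: "part \<Rightarrow> part \<Rightarrow> part"  (infixr \<open>\<squnion>\<^sub>p\<close> 65) where
  "\<Lambda> \<squnion>\<^sub>p \<Omega> = \<lparr>pts = inl ` pts \<Lambda> \<union> inr ` pts \<Omega>,
     eqv = map_prod inl inl ` eqv \<Lambda> \<union> map_prod inr inr ` eqv \<Omega>\<rparr>"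

definition psum_map :: "(nat \<Rightarrow> nat) \<Rightarrow> (nat \<Rightarrow> nat) \<Rightarrow> nat \<Rightarrow> nat" where
  "psum_map f g = copair (\<lambda>x. inl (f x)) (\<lambda>y. inr (g y))"

definition passoc :: "nat \<Rightarrow> nat" where
  "passoc = copair (copair inl (\<lambda>y. inr (inl y))) (\<lambda>z. inr (inr z))"

definition pswap :: "nat \<Rightarrow> nat" where
  "pswap = copair inr inl"

text \<open>When one of the summands is empty, the codiagonal is the unit isomorphism.\<close>

definition pcodiag :: "nat \<Rightarrow> nat" where
  "pcodiag = copair id id"

text \<open>The function underlying the morphism from the disjoint union of indiscrete i and
  indiscrete j to indiscrete (i + j).\<close>

definition pconcat :: "nat \<Rightarrow> nat \<Rightarrow> nat" where
  "pconcat i = copair id (\<lambda>y. i + y)"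

definition block_perms :: "part \<Rightarrow> (nat \<Rightarrow> nat) set" where
  "block_perms \<Lambda> = {\<sigma>. \<sigma> permutes pts \<Lambda> \<and> (\<forall>x\<in>pts \<Lambda>. (x, \<sigma> x) \<in> eqv \<Lambda>)}"

text \<open>T is a set of representatives for the double cosets of the block permutations of Omega
  by those of Gamma (left) and Lambda (right).\<close>

definition dcoset_reps :: "part \<Rightarrow> part \<Rightarrow> part \<Rightarrow> (nat \<Rightarrow> nat) set \<Rightarrow> bool" where
  "dcoset_reps \<Gamma> \<Omega> \<Lambda> T \<longleftrightarrow> T \<subseteq> block_perms \<Omega> \<and>
     (\<forall>\<sigma>\<in>block_perms \<Omega>. \<exists>!\<tau>. \<tau> \<in> T \<and>
        (\<exists>\<gamma>\<in>block_perms \<Gamma>. \<exists>\<delta>\<in>block_perms \<Lambda>. \<tau> = \<gamma> \<circ> \<sigma> \<circ> \<delta>))"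


section \<open>Partition functors\<close>

text \<open>For a morphism f from Lambda to Omega, res Lambda Omega f maps the value at Omega to the value
  at Lambda, and tr Lambda Omega f goes the other way. Values of these functions off the carriers are
  irrelevant.\<close>

record ('k, 'v) pfun =
  val :: "part \<Rightarrow> ('k, 'v) module"
  res :: "part \<Rightarrow> part \<Rightarrow> (nat \<Rightarrow> nat) \<Rightarrow> 'v \<Rightarrow> 'v"
  tr :: "part \<Rightarrow> part \<Rightarrow> (nat \<Rightarrow> nat) \<Rightarrow> 'v \<Rightarrow> 'v"

locale partition_functor = cring K
  for K :: "'k ring" and M :: "('k, 'v, 'e) pfun_scheme" +
  assumes val_module: "is_part \<Lambda> \<Longrightarrow> module K (val M \<Lambda>)"
    and res_hom: "pmor \<Lambda> \<Omega> f \<Longrightarrow> res M \<Lambda> \<Omega> f \<in> mod_hom K (val M \<Omega>) (val M \<Lambda>)"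
    and res_id: "is_part \<Lambda> \<Longrightarrow> x \<in> carrier (val M \<Lambda>) \<Longrightarrow> res M \<Lambda> \<Lambda> id x = x"
    and res_comp: "pmor \<Lambda> \<Omega> f \<Longrightarrow> pmor \<Omega> \<Gamma> g \<Longrightarrow> x \<in> carrier (val M \<Gamma>) \<Longrightarrow>
      res M \<Lambda> \<Gamma> (g \<circ> f) x = res M \<Lambda> \<Omega> f (res M \<Omega> \<Gamma> g x)"
    and res_two_iso: "pmor \<Lambda> \<Omega> f \<Longrightarrow> pmor \<Lambda> \<Omega> g \<Longrightarrow> two_iso \<Lambda> \<Omega> f g \<Longrightarrow> x \<in> carrier (val M \<Omega>) \<Longrightarrow>
      res M \<Lambda> \<Omega> f x = res M \<Lambda> \<Omega> g x"
    and tr_hom: "pmor \<Lambda> \<Omega> f \<Longrightarrow> tr M \<Lambda> \<Omega> f \<in> mod_hom K (val M \<Lambda>) (val M \<Omega>)"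
    and tr_id: "is_part \<Lambda> \<Longrightarrow> x \<in> carrier (val M \<Lambda>) \<Longrightarrow> tr M \<Lambda> \<Lambda> id x = x"
    and tr_comp: "pmor \<Lambda> \<Omega> f \<Longrightarrow> pmor \<Omega> \<Gamma> g \<Longrightarrow> x \<in> carrier (val M \<Lambda>) \<Longrightarrow>
      tr M \<Lambda> \<Gamma> (g \<circ> f) x = tr M \<Omega> \<Gamma> g (tr M \<Lambda> \<Omega> f x)"
    and tr_two_iso: "pmor \<Lambda> \<Omega> f \<Longrightarrow> pmor \<Lambda> \<Omega> g \<Longrightarrow> two_iso \<Lambda> \<Omega> f g \<Longrightarrow> x \<in> carrier (val M \<Lambda>) \<Longrightarrow>
      tr M \<Lambda> \<Omega> f x = tr M \<Lambda> \<Omega> g x"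
    and tr_iso: "piso \<Lambda> \<Omega> f \<Longrightarrow> x \<in> carrier (val M \<Lambda>) \<Longrightarrow>
      tr M \<Lambda> \<Omega> f x = res M \<Omega> \<Lambda> (inv_into (pts \<Lambda>) f) x"
    and double_coset: "prefines \<Gamma> \<Omega> \<Longrightarrow> prefines \<Lambda> \<Omega> \<Longrightarrow> dcoset_reps \<Gamma> \<Omega> \<Lambda> T \<Longrightarrow> x \<in> carrier (val M \<Lambda>) \<Longrightarrow>
      res M \<Gamma> \<Omega> id (tr M \<Lambda> \<Omega> id x) =
      (\<Oplus>\<^bsub>val M \<Gamma>\<^esub>\<sigma>\<in>T.
         tr M (pmeet \<Gamma> (ptransport \<sigma> \<Lambda>)) \<Gamma> id
          (tr M (pmeet (ptransport (inv_into UNIV \<sigma>) \<Gamma>) \<Lambda>) (pmeet \<Gamma> (ptransport \<sigma> \<Lambda>)) \<sigma>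
            (res M (pmeet (ptransport (inv_into UNIV \<sigma>) \<Gamma>) \<Lambda>) \<Lambda> id x)))"

text \<open>The field kunit is the isomorphism from K to the value at the empty partition, and ext holds
  the external product isomorphisms, defined on tensor products.\<close>

record ('k, 'v) smpf = "('k, 'v) pfun" +
  kunit :: "'k \<Rightarrow> 'v"
  ext :: "part \<Rightarrow> part \<Rightarrow> ('k, 'v, 'v) tens \<Rightarrow> 'v"

definition box :: "'k ring \<Rightarrow> ('k, 'v) smpf \<Rightarrow> part \<Rightarrow> part \<Rightarrow> 'v \<Rightarrow> 'v \<Rightarrow> 'v" where
  "box K R \<Lambda> \<Omega> x y = ext R \<Lambda> \<Omega> (ptens K (val R \<Lambda>) (val R \<Omega>) x y)"

locale symmetric_monoidal_partition_functor = partition_functor K R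
  for K :: "'k ring" and R :: "('k, 'v) smpf" +
  assumes kunit_iso: "kunit R \<in> mod_iso K (self_mod K) (val R (indiscrete 0))"
    and ext_iso: "is_part \<Lambda> \<Longrightarrow> is_part \<Omega> \<Longrightarrow>
      ext R \<Lambda> \<Omega> \<in> mod_iso K (tensor K (val R \<Lambda>) (val R \<Omega>)) (val R (\<Lambda> \<squnion>\<^sub>p \<Omega>))"
    and box_res: "pmor \<Lambda> \<Lambda>' f \<Longrightarrow> pmor \<Omega> \<Omega>' g \<Longrightarrow> x \<in> carrier (val R \<Lambda>') \<Longrightarrow> y \<in> carrier (val R \<Omega>') \<Longrightarrow>
      res R (\<Lambda> \<squnion>\<^sub>p \<Omega>) (\<Lambda>' \<squnion>\<^sub>p \<Omega>') (psum_map f g) (box K R \<Lambda>' \<Omega>' x y) =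
      box K R \<Lambda> \<Omega> (res R \<Lambda> \<Lambda>' f x) (res R \<Omega> \<Omega>' g y)"
    and box_tr: "pmor \<Lambda> \<Lambda>' f \<Longrightarrow> pmor \<Omega> \<Omega>' g \<Longrightarrow> x \<in> carrier (val R \<Lambda>) \<Longrightarrow> y \<in> carrier (val R \<Omega>) \<Longrightarrow>
      tr R (\<Lambda> \<squnion>\<^sub>p \<Omega>) (\<Lambda>' \<squnion>\<^sub>p \<Omega>') (psum_map f g) (box K R \<Lambda> \<Omega> x y) =
      box K R \<Lambda>' \<Omega>' (tr R \<Lambda> \<Lambda>' f x) (tr R \<Omega> \<Omega>' g y)"
    and box_assoc: "is_part \<Lambda> \<Longrightarrow> is_part \<Omega> \<Longrightarrow> is_part \<Gamma> \<Longrightarrow>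
      x \<in> carrier (val R \<Lambda>) \<Longrightarrow> y \<in> carrier (val R \<Omega>) \<Longrightarrow> z \<in> carrier (val R \<Gamma>) \<Longrightarrow>
      tr R ((\<Lambda> \<squnion>\<^sub>p \<Omega>) \<squnion>\<^sub>p \<Gamma>) (\<Lambda> \<squnion>\<^sub>p (\<Omega> \<squnion>\<^sub>p \<Gamma>)) passoc
        (box K R (\<Lambda> \<squnion>\<^sub>p \<Omega>) \<Gamma> (box K R \<Lambda> \<Omega> x y) z) =
      box K R \<Lambda> (\<Omega> \<squnion>\<^sub>p \<Gamma>) x (box K R \<Omega> \<Gamma> y z)"
    and box_unit_left: "is_part \<Lambda> \<Longrightarrow> k \<in> carrier K \<Longrightarrow> x \<in> carrier (val R \<Lambda>) \<Longrightarrow>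
      tr R (indiscrete 0 \<squnion>\<^sub>p \<Lambda>) \<Lambda> pcodiag (box K R (indiscrete 0) \<Lambda> (kunit R k) x) =
      k \<odot>\<^bsub>val R \<Lambda>\<^esub> x"
    and box_unit_right: "is_part \<Lambda> \<Longrightarrow> k \<in> carrier K \<Longrightarrow> x \<in> carrier (val R \<Lambda>) \<Longrightarrow>
      tr R (\<Lambda> \<squnion>\<^sub>p indiscrete 0) \<Lambda> pcodiag (box K R \<Lambda> (indiscrete 0) x (kunit R k)) =
      k \<odot>\<^bsub>val R \<Lambda>\<^esub> x"
    and box_sym: "is_part \<Lambda> \<Longrightarrow> is_part \<Omega> \<Longrightarrow> x \<in> carrier (val R \<Lambda>) \<Longrightarrow> y \<in> carrier (val R \<Omega>) \<Longrightarrow>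
      tr R (\<Lambda> \<squnion>\<^sub>p \<Omega>) (\<Omega> \<squnion>\<^sub>p \<Lambda>) pswap (box K R \<Lambda> \<Omega> x y) = box K R \<Omega> \<Lambda> y x"

definition smpf_mor :: "'k ring \<Rightarrow> ('k, 'v) smpf \<Rightarrow> ('k, 'v) smpf \<Rightarrow> (part \<Rightarrow> 'v \<Rightarrow> 'v) \<Rightarrow> bool" where
  "smpf_mor K R S \<eta> \<longleftrightarrow>
     \<eta> \<in> (\<Pi>\<^sub>E \<Lambda>\<in>Collect is_part. mod_hom_ext K (val R \<Lambda>) (val S \<Lambda>)) \<and>
     (\<forall>\<Lambda> \<Omega> f. pmor \<Lambda> \<Omega> f \<longrightarrow>
        (\<forall>x\<in>carrier (val R \<Omega>). \<eta> \<Lambda> (res R \<Lambda> \<Omega> f x) = res S \<Lambda> \<Omega> f (\<eta> \<Omega> x)) \<and>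
        (\<forall>x\<in>carrier (val R \<Lambda>). \<eta> \<Omega> (tr R \<Lambda> \<Omega> f x) = tr S \<Lambda> \<Omega> f (\<eta> \<Lambda> x))) \<and>
     (\<forall>k\<in>carrier K. \<eta> (indiscrete 0) (kunit R k) = kunit S k) \<and>
     (\<forall>\<Lambda> \<Omega>. is_part \<Lambda> \<longrightarrow> is_part \<Omega> \<longrightarrow>
        (\<forall>x\<in>carrier (val R \<Lambda>). \<forall>y\<in>carrier (val R \<Omega>).
           \<eta> (\<Lambda> \<squnion>\<^sub>p \<Omega>) (box K R \<Lambda> \<Omega> x y) = box K S \<Lambda> \<Omega> (\<eta> \<Lambda> x) (\<eta> \<Omega> y)))"

definition smpf_cat :: "'k ring \<Rightarrow> (('k, 'v) smpf, part \<Rightarrow> 'v \<Rightarrow> 'v) cat" where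
  "smpf_cat K = \<lparr>
     Obj = {R. symmetric_monoidal_partition_functor K R},
     Hom = (\<lambda>R S. {\<eta>. smpf_mor K R S \<eta>}),
     Ident = (\<lambda>R. \<lambda>\<Lambda>\<in>Collect is_part. \<lambda>x\<in>carrier (val R \<Lambda>). x),
     Comp = (\<lambda>R S T \<theta> \<eta>. \<lambda>\<Lambda>\<in>Collect is_part. compose (carrier (val R \<Lambda>)) (\<theta> \<Lambda>) (\<eta> \<Lambda>))\<rparr>"


section \<open>Connected commutative cocommutative graded bialgebras\<close>

text \<open>A graded module is the family of its homogeneous pieces. The (i, j)-components of the
  multiplication and comultiplication are gmult i j, bilinear from degrees i and j to degree i + j,
  and gcomult i j, from degree i + j to the tensor product of degrees i and j. The counit vanishes in
  positive degrees; gcounit is its degree 0 part.\<close>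

record ('k, 'v) gbialg =
  piece :: "nat \<Rightarrow> ('k, 'v) module"
  gmult :: "nat \<Rightarrow> nat \<Rightarrow> 'v \<Rightarrow> 'v \<Rightarrow> 'v"
  gunit :: "'k \<Rightarrow> 'v"
  gcomult :: "nat \<Rightarrow> nat \<Rightarrow> 'v \<Rightarrow> ('k, 'v, 'v) tens"
  gcounit :: "'v \<Rightarrow> 'k"

abbreviation piece_tensor ::
  "'k ring \<Rightarrow> ('k, 'v) gbialg \<Rightarrow> nat \<Rightarrow> nat \<Rightarrow> ('k, ('k, 'v, 'v) tens) module" where
  "piece_tensor K A i j \<equiv> tensor K (piece A i) (piece A j)"

text \<open>The multiplication of the tensor square of a graded algebra, without signs: the product of
  x1 (x) x2 and y1 (x) y2 is x1 y1 (x) x2 y2, where x1, x2, y1, y2 have degrees a, b, c, d.\<close>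

definition tens_gmult ::
  "'k ring \<Rightarrow> ('k, 'v) gbialg \<Rightarrow> nat \<Rightarrow> nat \<Rightarrow> nat \<Rightarrow> nat \<Rightarrow>
    ('k, 'v, 'v) tens \<Rightarrow> ('k, 'v, 'v) tens \<Rightarrow> ('k, 'v, 'v) tens" where
  "tens_gmult K A a b c d u v =
     tens_lift K (piece A a) (piece A b) (piece_tensor K A (a + c) (b + d))
       (\<lambda>x1 x2. tens_lift K (piece A c) (piece A d) (piece_tensor K A (a + c) (b + d))
          (\<lambda>y1 y2. ptens K (piece A (a + c)) (piece A (b + d)) (gmult A a c x1 y1) (gmult A b d x2 y2)) v) u"

locale connected_graded_bialgebra = cring K
  for K :: "'k ring" and A :: "('k, 'v) gbialg" +
  assumes piece_module: "module K (piece A n)"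
    and gmult_bilinear: "bilinear_map K (piece A i) (piece A j) (piece A (i + j)) (gmult A i j)"
    and gcomult_hom: "gcomult A i j \<in> mod_hom K (piece A (i + j)) (piece_tensor K A i j)"
    and gcounit_hom: "gcounit A \<in> mod_hom K (piece A 0) (self_mod K)"
    and connected: "gunit A \<in> mod_iso K (self_mod K) (piece A 0)"
    and gmult_assoc: "x \<in> carrier (piece A i) \<Longrightarrow> y \<in> carrier (piece A j) \<Longrightarrow> z \<in> carrier (piece A l) \<Longrightarrow>
      gmult A (i + j) l (gmult A i j x y) z = gmult A i (j + l) x (gmult A j l y z)"
    and gmult_comm: "x \<in> carrier (piece A i) \<Longrightarrow> y \<in> carrier (piece A j) \<Longrightarrow>
      gmult A i j x y = gmult A j i y x"
    and gmult_unit: "k \<in> carrier K \<Longrightarrow> x \<in> carrier (piece A n) \<Longrightarrow>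
      gmult A 0 n (gunit A k) x = k \<odot>\<^bsub>piece A n\<^esub> x"
    and gcomult_coassoc: "x \<in> carrier (piece A (i + j + l)) \<Longrightarrow>
      tens_assoc K (piece A i) (piece A j) (piece A l)
        (tens_map K (piece A (i + j)) (piece A l) (piece_tensor K A i j) (piece A l)
           (gcomult A i j) id (gcomult A (i + j) l x)) =
      tens_map K (piece A i) (piece A (j + l)) (piece A i) (piece_tensor K A j l)
        id (gcomult A j l) (gcomult A i (j + l) x)"
    and gcomult_cocomm: "x \<in> carrier (piece A (i + j)) \<Longrightarrow>
      tens_swap K (piece A i) (piece A j) (gcomult A i j x) = gcomult A j i x"
    and gcomult_counit: "x \<in> carrier (piece A n) \<Longrightarrow>
      tens_lift K (piece A 0) (piece A n) (piece A n)
        (\<lambda>a b. gcounit A a \<odot>\<^bsub>piece A n\<^esub> b) (gcomult A 0 n x) = x"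
    and gcomult_gmult: "x \<in> carrier (piece A i) \<Longrightarrow> y \<in> carrier (piece A j) \<Longrightarrow> m + n = i + j \<Longrightarrow>
      gcomult A m n (gmult A i j x y) =
      (\<Oplus>\<^bsub>piece_tensor K A m n\<^esub>q\<in>{(a, b, c, d). a + b = i \<and> c + d = j \<and> a + c = m \<and> b + d = n}.
         case q of (a, b, c, d) \<Rightarrow> tens_gmult K A a b c d (gcomult A a b x) (gcomult A c d y))"
    and gcomult_one: "gcomult A 0 0 (gunit A \<one>\<^bsub>K\<^esub>) =
      ptens K (piece A 0) (piece A 0) (gunit A \<one>\<^bsub>K\<^esub>) (gunit A \<one>\<^bsub>K\<^esub>)"
    and gcounit_gmult: "x \<in> carrier (piece A 0) \<Longrightarrow> y \<in> carrier (piece A 0) \<Longrightarrow>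
      gcounit A (gmult A 0 0 x y) = gcounit A x \<otimes>\<^bsub>K\<^esub> gcounit A y"
    and gcounit_one: "gcounit A (gunit A \<one>\<^bsub>K\<^esub>) = \<one>\<^bsub>K\<^esub>"

definition gbialg_mor ::
  "'k ring \<Rightarrow> ('k, 'v) gbialg \<Rightarrow> ('k, 'v) gbialg \<Rightarrow> (nat \<Rightarrow> 'v \<Rightarrow> 'v) \<Rightarrow> bool" where
  "gbialg_mor K A B h \<longleftrightarrow>
     (\<forall>n. h n \<in> mod_hom_ext K (piece A n) (piece B n)) \<and>
     (\<forall>i j. \<forall>x\<in>carrier (piece A i). \<forall>y\<in>carrier (piece A j).
        h (i + j) (gmult A i j x y) = gmult B i j (h i x) (h j y)) \<and>
     (\<forall>k\<in>carrier K. h 0 (gunit A k) = gunit B k) \<and>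
     (\<forall>i j. \<forall>x\<in>carrier (piece A (i + j)).
        tens_map K (piece A i) (piece A j) (piece B i) (piece B j) (h i) (h j) (gcomult A i j x) =
        gcomult B i j (h (i + j) x)) \<and>
     (\<forall>x\<in>carrier (piece A 0). gcounit B (h 0 x) = gcounit A x)"

definition gbialg_cat :: "'k ring \<Rightarrow> (('k, 'v) gbialg, nat \<Rightarrow> 'v \<Rightarrow> 'v) cat" where
  "gbialg_cat K = \<lparr>
     Obj = {A. connected_graded_bialgebra K A},
     Hom = (\<lambda>A B. {h. gbialg_mor K A B h}),
     Ident = (\<lambda>A n. \<lambda>x\<in>carrier (piece A n). x),
     Comp = (\<lambda>A B C g h n. compose (carrier (piece A n)) (g n) (h n))\<rparr>"


section \<open>The functor from symmetric monoidal partition functors to bialgebras\<close>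

definition sigma_alg :: "'k ring \<Rightarrow> ('k, 'v) smpf \<Rightarrow> ('k, 'v) gbialg" where
  "sigma_alg K R = \<lparr>
     piece = (\<lambda>m. val R (indiscrete m)),
     gmult = (\<lambda>i j x y.
       tr R (indiscrete i \<squnion>\<^sub>p indiscrete j) (indiscrete (i + j)) (pconcat i)
         (box K R (indiscrete i) (indiscrete j) x y)),
     gunit = kunit R,
     gcomult = (\<lambda>i j x.
       inv_into (carrier (tensor K (val R (indiscrete i)) (val R (indiscrete j))))
         (ext R (indiscrete i) (indiscrete j))
         (res R (indiscrete i \<squnion>\<^sub>p indiscrete j) (indiscrete (i + j)) (pconcat i) x)),
     gcounit = inv_into (carrier K) (kunit R)\<rparr>"

definition sigma_alg_map ::
  "('k, 'v) smpf \<Rightarrow> ('k, 'v) smpf \<Rightarrow> (part \<Rightarrow> 'v \<Rightarrow> 'v) \<Rightarrow> nat \<Rightarrow> 'v \<Rightarrow> 'v" where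
  "sigma_alg_map R S \<eta> = (\<lambda>m. \<eta> (indiscrete m))"

end

(* A value of R is spanned by external products of values on single blocks, and every
restriction and transfer between partitions of a set is assembled from those splitting or merging
two blocks, that is, from the comultiplication and the multiplication; so a morphism is the same
thing as a bialgebra map. The double coset formula for two two-block partitions is exactly the
compatibility of multiplication and comultiplication, double cosets being classified by the
matrices of cardinalities of block intersections.

Conversely, given A, let B be the coproduct of countably many copies of A as commutative algebras.
It is graded by finitely supported functions from the natural numbers to itself, and R(Lambda) is the
component of B whose degree on the copy labelled by a block is the size of the block. A span of finite sets of labels
induces an algebra endomorphism of B by comultiplying along one leg and multiplying along the
other; restrictions and transfers are of this form, and composition of spans gives
the double coset formula. *)
theory Submission imports Defs begin

text \<open>No inverse functor is written down on morphisms: an abstract criterion reduces the claim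
  to bijectivity on hom sets and one isomorphism for each bialgebra.

  Disjoint unions are associative only up to renaming. Computations in \<open>R\<close> therefore
  use partitions of disjoint sets of numbers, whose union \<open>pU\<close> is strictly associative
  and commutative; and since parallel morphisms into a single block are 2-isomorphic, the numbering
  of a block never matters.

  Conversely, a tensor product over the blocks of a varying partition would need an order of the
  factors and a type for each number of them. A coproduct with one copy for every number makes all
  values submodules of one module, with the least element of a block as its label. This coproduct
  must be coded in the type of elements of \<open>A\<close>, where infiniteness enters. Iterated
  comultiplications are likewise freed of any order: they become finite products in the commutative
  monoid of linear maps from \<open>A\<close> to \<open>B\<close> under convolution. A span spreads
  a multidegree over several others, so a restriction has to end with a projection.\<close>

notation psum (infixr "|+|" 65)

section \<open>Linear maps and finite sums\<close>

text \<open>Fubini for finite products. The additive form reorders the double sums in the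
  associativity of convolution; the multiplicative form composes two spans.\<close>

lemma (in comm_monoid) finprod_Sigma:
 assumes "finite A" "!!a. a : A ==> finite (B a)"
  "!!a b. a : A ==> b : B a ==> f a b : carrier G"
 shows "finprod G (%a. finprod G (f a) (B a)) A = finprod G (%(a, b). f a b) (Sigma A B)"
proof -
 have eq: "Sigma A B = (\<Union>a\<in>A. Pair a ` B a)" by auto
 have "finprod G (%(a, b). f a b) (Sigma A B) =
  finprod G (%a. finprod G (%(a, b). f a b) (Pair a ` B a)) A"
  unfolding eq
  by (rule finprod_UN_disjoint) (use assms in \<open>auto simp: pairwise_def disjnt_def\<close>)
 also have "... = finprod G (%a. finprod G (f a) (B a)) A"
 proof (rule finprod_cong')
  fix a assume a: "a : A"
  show "finprod G (%(a, b). f a b) (Pair a ` B a) = finprod G (f a) (B a)"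
  using assms a by (subst finprod_reindex) (auto simp: inj_on_def)
 qed (use assms in auto)
 finally show ?thesis by simp
qed

lemma (in comm_monoid) finprod_bij:
 assumes "bij_betw h A B" "!!b. b : B ==> f b : carrier G"
  "!!a. a : A ==> g a = f (h a)"
 shows "finprod G g A = finprod G f B"
proof -
 have "finprod G f (h ` A) = finprod G (%x. f (h x)) A"
  by (rule finprod_reindex) (use assms in \<open>auto simp: bij_betw_def\<close>)
 moreover have "finprod G g A = finprod G (%x. f (h x)) A"
  by (rule finprod_cong') (use assms in \<open>auto simp: bij_betw_def\<close>)
 ultimately show ?thesis using assms by (simp add: bij_betw_def)
qed

lemmas (in abelian_monoid) finsum_Sigma = add.finprod_Sigma
lemmas (in abelian_monoid) finsum_bij = add.finprod_bij
lemmas (in abelian_monoid) finsum_neutral_left = add.finprod_mono_neutral_cong_left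
lemmas (in abelian_monoid) finsum_neutral_right = add.finprod_mono_neutral_cong_right

lemma (in abelian_group) minus_eq_zero_iff:
 "x : carrier G ==> y : carrier G ==> x \<ominus> y = \<zero> \<longleftrightarrow> x = y"
 by (metis a_minus_def add.inv_solve_right l_zero r_neg zero_closed add.inv_closed)

lemma mod_homI:
 assumes "!!x. x : carrier M ==> f x : carrier N"
  and "!!x y. x : carrier M ==> y : carrier M ==> f (x \<oplus>\<^bsub>M\<^esub> y) = f x \<oplus>\<^bsub>N\<^esub> f y"
  and "!!k x. k : carrier K ==> x : carrier M ==> f (k \<odot>\<^bsub>M\<^esub> x) = k \<odot>\<^bsub>N\<^esub> f x"
 shows "f : mod_hom K M N"
 using assms by (auto simp: mod_hom_def)

lemma lin_closed: "f : mod_hom K M N ==> x : carrier M ==> f x : carrier N"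
 and lin_add: "f : mod_hom K M N ==> x : carrier M ==> y : carrier M ==>
  f (x \<oplus>\<^bsub>M\<^esub> y) = f x \<oplus>\<^bsub>N\<^esub> f y"
 and lin_smult: "f : mod_hom K M N ==> k : carrier K ==> x : carrier M ==>
  f (k \<odot>\<^bsub>M\<^esub> x) = k \<odot>\<^bsub>N\<^esub> f x"
 by (auto simp: mod_hom_def)

lemma mod_hom_ext_iff: "f : mod_hom_ext K M N \<longleftrightarrow> f : mod_hom K M N & f : extensional (carrier M)"
 by (auto simp: mod_hom_ext_def)

lemma lin_extD: "f : mod_hom_ext K M N ==> f : mod_hom K M N"
 by (simp add: mod_hom_ext_def)

lemma lin_zero:
 assumes "module K M" "module K N" "f : mod_hom K M N"
 shows "f \<zero>\<^bsub>M\<^esub> = \<zero>\<^bsub>N\<^esub>"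
proof -
 interpret M: module K M by fact
 interpret N: module K N by fact
 have "f (\<zero>\<^bsub>K\<^esub> \<odot>\<^bsub>M\<^esub> \<zero>\<^bsub>M\<^esub>) = \<zero>\<^bsub>K\<^esub> \<odot>\<^bsub>N\<^esub> f \<zero>\<^bsub>M\<^esub>"
  by (intro lin_smult[OF assms(3)]) auto
 then show ?thesis using lin_closed[OF assms(3), of "\<zero>\<^bsub>M\<^esub>"] by simp
qed

lemma lin_a_inv:
 assumes "module K M" "module K N" "f : mod_hom K M N" "x : carrier M"
 shows "f (\<ominus>\<^bsub>M\<^esub> x) = \<ominus>\<^bsub>N\<^esub> f x"
proof -
 interpret M: module K M by fact
 interpret N: module K N by fact
 have "f (\<ominus>\<^bsub>M\<^esub> x) \<oplus>\<^bsub>N\<^esub> f x = \<zero>\<^bsub>N\<^esub>"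
  using lin_add[OF assms(3), of "\<ominus>\<^bsub>M\<^esub> x" x] assms(4) lin_zero[OF assms(1-3)]
  by (simp add: M.l_neg)
 then show ?thesis
  using lin_closed[OF assms(3)] assms(4) by (simp add: N.add.inv_equality)
qed

lemma lin_minus:
 assumes "module K M" "module K N" "f : mod_hom K M N" "x : carrier M" "y : carrier M"
 shows "f (x \<ominus>\<^bsub>M\<^esub> y) = f x \<ominus>\<^bsub>N\<^esub> f y"
proof -
 interpret M: module K M by fact
 show ?thesis unfolding a_minus_def
  using assms by (simp add: lin_add[OF assms(3)] lin_a_inv[OF assms(1-3)])
qed

lemma lin_finsum:
 assumes "module K M" "module K N" "f : mod_hom K M N" "g : S \<rightarrow> carrier M"
 shows "f (finsum M g S) = finsum N (%s. f (g s)) S"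
proof -
 interpret M: module K M by fact
 interpret N: module K N by fact
 show ?thesis using assms(4)
 proof (induct S rule: infinite_finite_induct)
  case (insert x F)
  then have "g : F \<rightarrow> carrier M" "g x : carrier M" by auto
  with insert show ?case
  using lin_closed[OF assms(3)] by (simp add: lin_add[OF assms(3)] Pi_iff)
 qed (simp_all add: lin_zero[OF assms(1-3)])
qed

lemma lin_comp:
 assumes "f : mod_hom K M N" "g : mod_hom K N P"
 shows "(%x. g (f x)) : mod_hom K M P"
 using assms by (auto simp: mod_hom_def Pi_iff)

lemma lin_id: "(%x. x) : mod_hom K M M"
 by (auto simp: mod_hom_def)

lemma lin_id': "id : mod_hom K M M"
 by (auto simp: mod_hom_def)

lemma lin_const_zero:
 assumes "module K N" shows "(%x. \<zero>\<^bsub>N\<^esub>) : mod_hom K M N"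
proof -
 interpret N: module K N by fact
 show ?thesis by (rule mod_homI) auto
qed

lemma lin_cong:
 assumes "module K M" "f : mod_hom K M N" "!!x. x : carrier M ==> g x = f x"
 shows "g : mod_hom K M N"
proof -
 interpret M: module K M by fact
 show ?thesis using assms by (auto simp: mod_hom_def Pi_iff)
qed

lemma restrict_mod_hom_ext:
 assumes "module K M" "f : mod_hom K M N"
 shows "restrict f (carrier M) : mod_hom_ext K M N"
 using lin_cong[OF assms, of "restrict f (carrier M)"] by (simp add: mod_hom_ext_def)

lemma lin_plus:
 assumes "module K N" "f : mod_hom K M N" "g : mod_hom K M N"
 shows "(%x. f x \<oplus>\<^bsub>N\<^esub> g x) : mod_hom K M N"
proof -
 interpret N: module K N by fact
 show ?thesis
  by (rule mod_homI)
  (use lin_closed[OF assms(2)] lin_closed[OF assms(3)] in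
  \<open>auto simp: lin_add[OF assms(2)] lin_add[OF assms(3)]
  lin_smult[OF assms(2)] lin_smult[OF assms(3)] N.a_ac N.smult_r_distr\<close>)
qed

lemma lin_finsum_fun:
 assumes "module K N" "!!s. s : S ==> f s : mod_hom K M N"
 shows "(%x. finsum N (%s. f s x) S) : mod_hom K M N"
proof -
 interpret N: module K N by fact
 have c: "f s x : carrier N" if "s : S" "x : carrier M" for s x
  using assms(2)[OF that(1)] that(2) by (rule lin_closed)
 show ?thesis
 proof (rule mod_homI)
  fix x assume x: "x : carrier M"
  show "finsum N (%s. f s x) S : carrier N"
  using c x by (intro N.finsum_closed) (auto simp: Pi_iff)
  fix y assume y: "y : carrier M"
  have "finsum N (%s. f s (x \<oplus>\<^bsub>M\<^esub> y)) S = finsum N (%s. f s x \<oplus>\<^bsub>N\<^esub> f s y) S"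
  proof (rule N.finsum_cong'[OF refl])
  fix s assume "s : S"
  then show "f s (x \<oplus>\<^bsub>M\<^esub> y) = f s x \<oplus>\<^bsub>N\<^esub> f s y" using x y by (simp add: lin_add[OF assms(2)])
  qed (use c x y in \<open>auto simp: Pi_iff\<close>)
  also have "... = finsum N (%s. f s x) S \<oplus>\<^bsub>N\<^esub> finsum N (%s. f s y) S"
  using x y c by (intro N.finsum_addf) (auto simp: Pi_iff)
  finally show "finsum N (%s. f s (x \<oplus>\<^bsub>M\<^esub> y)) S =
  finsum N (%s. f s x) S \<oplus>\<^bsub>N\<^esub> finsum N (%s. f s y) S" .
 next
  fix k x assume k: "k : carrier K" and x: "x : carrier M"
  have "finsum N (%s. f s (k \<odot>\<^bsub>M\<^esub> x)) S = finsum N (%s. k \<odot>\<^bsub>N\<^esub> f s x) S"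
  proof (rule N.finsum_cong'[OF refl])
  fix s assume "s : S"
  then show "f s (k \<odot>\<^bsub>M\<^esub> x) = k \<odot>\<^bsub>N\<^esub> f s x" using x k by (simp add: lin_smult[OF assms(2)])
  qed (use c x k in \<open>auto simp: Pi_iff\<close>)
  also have "... = k \<odot>\<^bsub>N\<^esub> finsum N (%s. f s x) S"
  \<comment> \<open>An infinite index set gives zero on both sides, by the convention for
    \<open>finsum\<close>.\<close>
  proof (cases "finite S")
  case True
  then show ?thesis using c k x by (intro N.finsum_smult_ldistr[symmetric]) (auto simp: Pi_iff)
  qed (use k in \<open>simp add: N.finsum_infinite\<close>)
  finally show "finsum N (%s. f s (k \<odot>\<^bsub>M\<^esub> x)) S = k \<odot>\<^bsub>N\<^esub> finsum N (%s. f s x) S" .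
 qed
qed

lemma mod_isoD: 
 assumes "f : mod_iso K M N"
 shows "f : mod_hom K M N" "bij_betw f (carrier M) (carrier N)" "inj_on f (carrier M)"
  "f ` carrier M = carrier N"
 using assms by (auto simp: mod_iso_def bij_betw_def)

lemma mod_iso_inv_into:
 assumes "module K M" "f : mod_iso K M N"
 shows "inv_into (carrier M) f : mod_iso K N M"
proof -
 interpret M: module K M by fact
 note f = mod_isoD[OF assms(2)]
 let ?g = "inv_into (carrier M) f"
 have g: "?g y : carrier M" "f (?g y) = y" if "y : carrier N" for y
  using that f(4) by (auto intro: inv_into_into f_inv_into_f)
 have ff: "?g (f x) = x" if "x : carrier M" for x using that f(3) by simp
 have "?g : mod_hom K N M"
 proof (rule mod_homI)
  fix x y assume xy: "x : carrier N" "y : carrier N"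
  have "?g (x \<oplus>\<^bsub>N\<^esub> y) = ?g (f (?g x \<oplus>\<^bsub>M\<^esub> ?g y))"
  using xy g by (simp add: lin_add[OF f(1)])
  then show "?g (x \<oplus>\<^bsub>N\<^esub> y) = ?g x \<oplus>\<^bsub>M\<^esub> ?g y" using xy g ff by simp
 next
  fix k x assume kx: "k : carrier K" "x : carrier N"
  have "?g (k \<odot>\<^bsub>N\<^esub> x) = ?g (f (k \<odot>\<^bsub>M\<^esub> ?g x))"
  using kx g by (simp add: lin_smult[OF f(1)])
  then show "?g (k \<odot>\<^bsub>N\<^esub> x) = k \<odot>\<^bsub>M\<^esub> ?g x" using kx g ff by simp
 qed (use g in auto)
 then show ?thesis using bij_betw_inv_into[OF f(2)] by (simp add: mod_iso_def)
qed

lemma mod_isoI_inverse: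
 assumes "f : mod_hom K M N" "g : carrier N \<rightarrow> carrier M"
  "!!x. x : carrier M ==> g (f x) = x" "!!y. y : carrier N ==> f (g y) = y"
 shows "f : mod_iso K M N"
 using assms lin_closed[OF assms(1)]
 by (auto simp: mod_iso_def intro!: bij_betw_byWitness[where f' = g])

lemma mod_iso_comp:
 assumes "f : mod_iso K M N" "g : mod_iso K N P"
 shows "(%x. g (f x)) : mod_iso K M P"
 using assms lin_comp[of f K M N g P] bij_betw_trans[of f "carrier M" "carrier N" g]
 by (auto simp: mod_iso_def comp_def)

lemma lin_inv_into_eq:
 assumes "f : mod_iso K M N" "x : carrier M"
 shows "inv_into (carrier M) f (f x) = x"
 using assms mod_isoD(3)[OF assms(1)] by simp

lemma lin_f_inv_into:
 assumes "f : mod_iso K M N" "y : carrier N"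
 shows "f (inv_into (carrier M) f y) = y" "inv_into (carrier M) f y : carrier M"
 using assms mod_isoD(4)[OF assms(1)] by (auto intro: f_inv_into_f inv_into_into)

lemma bilinear_mapI:
 assumes "!!x y. x : carrier M ==> y : carrier N ==> f x y : carrier P"
  "!!x x' y. x : carrier M ==> x' : carrier M ==> y : carrier N ==> f (x \<oplus>\<^bsub>M\<^esub> x') y = f x y \<oplus>\<^bsub>P\<^esub> f x' y"
  "!!x y y'. x : carrier M ==> y : carrier N ==> y' : carrier N ==> f x (y \<oplus>\<^bsub>N\<^esub> y') = f x y \<oplus>\<^bsub>P\<^esub> f x y'"
  "!!k x y. k : carrier K ==> x : carrier M ==> y : carrier N ==> f (k \<odot>\<^bsub>M\<^esub> x) y = k \<odot>\<^bsub>P\<^esub> f x y"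
  "!!k x y. k : carrier K ==> x : carrier M ==> y : carrier N ==> f x (k \<odot>\<^bsub>N\<^esub> y) = k \<odot>\<^bsub>P\<^esub> f x y"
 shows "bilinear_map K M N P f"
 using assms by (auto simp: bilinear_map_def intro!: mod_homI)

lemma bilinear_mapI_hom:
 assumes "!!x. x : carrier M ==> f x : mod_hom K N P"
  "!!y. y : carrier N ==> (%x. f x y) : mod_hom K M P"
 shows "bilinear_map K M N P f"
 using assms by (auto simp: bilinear_map_def)

lemma bilinear_map_left: "bilinear_map K M N P f ==> y : carrier N ==> (%x. f x y) : mod_hom K M P"
 and bilinear_map_right: "bilinear_map K M N P f ==> x : carrier M ==> f x : mod_hom K N P"
 by (auto simp: bilinear_map_def)

lemma bilinear_map_closed:
 "bilinear_map K M N P f ==> x : carrier M ==> y : carrier N ==> f x y : carrier P"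
 using lin_closed[OF bilinear_map_left] by fastforce

lemma bilinear_map_comp:
 assumes "bilinear_map K M N P f" "g : mod_hom K M' M" "h : mod_hom K N' N" "p : mod_hom K P P'"
 shows "bilinear_map K M' N' P' (%x y. p (f (g x) (h y)))"
 using lin_closed[OF assms(2)] lin_closed[OF assms(3)]
 by (intro bilinear_mapI_hom lin_comp[OF _ assms(4)]
  lin_comp[OF assms(3) bilinear_map_right[OF assms(1)]]
  lin_comp[OF assms(2) bilinear_map_left[OF assms(1)]]) auto

section \<open>Modules given by generators and relations\<close>

lemma quot_mod_facts:
 assumes M: "module K M" and H: "submodule H K M"
 shows "module K (quot_mod M H)"
  and "(%x. H +>\<^bsub>M\<^esub> x) : mod_hom K M (quot_mod M H)"
  and "(%x. H +>\<^bsub>M\<^esub> x) ` carrier M = carrier (quot_mod M H)"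
  and "!!x. x : carrier M ==> H +>\<^bsub>M\<^esub> x = \<zero>\<^bsub>quot_mod M H\<^esub> \<longleftrightarrow> x : H"
proof -
 interpret M: module K M by fact
 interpret H: submodule H K M by fact
 interpret S: abelian_subgroup H M
  using H.subgroup_axioms M.abelian_group_axioms
  by (intro abelian_subgroupI3 additive_subgroupI)
 let ?Q = "quot_mod M H"
 have car: "carrier ?Q = (%x. H +>\<^bsub>M\<^esub> x) ` carrier M"
  by (auto simp: quot_mod_def A_RCOSETS_def')
 then show "(%x. H +>\<^bsub>M\<^esub> x) ` carrier M = carrier ?Q" by simp
 have zero: "\<zero>\<^bsub>?Q\<^esub> = H +>\<^bsub>M\<^esub> \<zero>\<^bsub>M\<^esub>"
  using S.a_subset by (simp add: quot_mod_def)
 have add: "(H +>\<^bsub>M\<^esub> x) \<oplus>\<^bsub>?Q\<^esub> (H +>\<^bsub>M\<^esub> y) = H +>\<^bsub>M\<^esub> (x \<oplus>\<^bsub>M\<^esub> y)"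
  if "x : carrier M" "y : carrier M" for x y
  using S.a_rcos_sum[OF that] by (simp add: quot_mod_def)
 have sm: "k \<odot>\<^bsub>?Q\<^esub> (H +>\<^bsub>M\<^esub> x) = H +>\<^bsub>M\<^esub> (k \<odot>\<^bsub>M\<^esub> x)" if k: "k : carrier K" and x: "x : carrier M" for k x
 proof -
  \<comment> \<open>Scalar multiplication in \<open>quot_mod\<close> is a union over
    representatives; it is a single coset because all members of the union coincide.\<close>
  have "H +>\<^bsub>M\<^esub> (k \<odot>\<^bsub>M\<^esub> z) = H +>\<^bsub>M\<^esub> (k \<odot>\<^bsub>M\<^esub> x)" if z: "z : H +>\<^bsub>M\<^esub> x" for z
  proof -
  have zc: "z : carrier M"
  using z M.a_r_coset_subset_G[OF S.a_subset x] by blast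
  have "z \<oplus>\<^bsub>M\<^esub> \<ominus>\<^bsub>M\<^esub> x : H" using S.a_rcos_module_imp[OF x z] .
  then have "k \<odot>\<^bsub>M\<^esub> (z \<oplus>\<^bsub>M\<^esub> \<ominus>\<^bsub>M\<^esub> x) : H" using k by blast
  then have "k \<odot>\<^bsub>M\<^esub> z \<oplus>\<^bsub>M\<^esub> \<ominus>\<^bsub>M\<^esub> (k \<odot>\<^bsub>M\<^esub> x) : H"
  using k x zc by (simp add: M.smult_r_distr M.smult_r_minus)
  then have "k \<odot>\<^bsub>M\<^esub> z : H +>\<^bsub>M\<^esub> (k \<odot>\<^bsub>M\<^esub> x)"
  using k x zc by (intro S.a_rcos_module_rev) auto
  then show ?thesis using S.a_repr_independence' k x by fastforce
  qed
  then have "(\<Union>z\<in>H +>\<^bsub>M\<^esub> x. H +>\<^bsub>M\<^esub> (k \<odot>\<^bsub>M\<^esub> z)) = (\<Union>z\<in>H +>\<^bsub>M\<^esub> x. H +>\<^bsub>M\<^esub> (k \<odot>\<^bsub>M\<^esub> x))"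
  by (intro SUP_cong refl)
  also have "... = H +>\<^bsub>M\<^esub> (k \<odot>\<^bsub>M\<^esub> x)" using S.a_rcos_self[OF x] by blast
  finally show ?thesis by (simp add: quot_mod_def)
 qed
 show "module K ?Q"
 proof (rule moduleI)
  show "cring K" ..
  show "abelian_group ?Q"
  proof (rule abelian_groupI)
  fix X assume "X : carrier ?Q"
  then obtain x where x: "x : carrier M" "X = H +>\<^bsub>M\<^esub> x" by (auto simp: car)
  show "EX Y:carrier ?Q. Y \<oplus>\<^bsub>?Q\<^esub> X = \<zero>\<^bsub>?Q\<^esub>"
  using x by (intro bexI[of _ "H +>\<^bsub>M\<^esub> (\<ominus>\<^bsub>M\<^esub> x)"]) (auto simp: car add zero M.l_neg)
  qed (auto simp: car add zero M.a_ac)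
 qed (auto simp: car add sm M.smult_l_distr M.smult_r_distr M.smult_assoc1)
 show "(%x. H +>\<^bsub>M\<^esub> x) : mod_hom K M ?Q"
  by (rule mod_homI) (auto simp: car add sm)
 show "H +>\<^bsub>M\<^esub> x = \<zero>\<^bsub>?Q\<^esub> \<longleftrightarrow> x : H" if x: "x : carrier M" for x
  using S.a_rcos_self[OF x] S.a_rcos_const[of x] by (auto simp: quot_mod_def)
qed

lemma free_mod_module:
 assumes "cring K"
 shows "module K (free_mod K S)"
proof -
 interpret K: cring K by fact
 let ?F = "free_mod K S"
 have fin: "finite {s. ph s \<oplus>\<^bsub>K\<^esub> psi s ~= \<zero>\<^bsub>K\<^esub>}" "{s. ph s \<oplus>\<^bsub>K\<^esub> psi s ~= \<zero>\<^bsub>K\<^esub>} <= S"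
  if "ph : carrier ?F" "psi : carrier ?F" for ph psi
 proof -
  have "{s. ph s \<oplus>\<^bsub>K\<^esub> psi s ~= \<zero>\<^bsub>K\<^esub>} <= {s. ph s ~= \<zero>\<^bsub>K\<^esub>} Un {s. psi s ~= \<zero>\<^bsub>K\<^esub>}" by auto
  then show "finite {s. ph s \<oplus>\<^bsub>K\<^esub> psi s ~= \<zero>\<^bsub>K\<^esub>}" "{s. ph s \<oplus>\<^bsub>K\<^esub> psi s ~= \<zero>\<^bsub>K\<^esub>} <= S"
  using that by (auto simp: free_mod_def elim!: finite_subset)
 qed
 have fin2: "finite {s. k \<otimes>\<^bsub>K\<^esub> ph s ~= \<zero>\<^bsub>K\<^esub>}" "{s. k \<otimes>\<^bsub>K\<^esub> ph s ~= \<zero>\<^bsub>K\<^esub>} <= S"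
  if "ph : carrier ?F" "k : carrier K" for ph k
 proof -
  have "{s. k \<otimes>\<^bsub>K\<^esub> ph s ~= \<zero>\<^bsub>K\<^esub>} <= {s. ph s ~= \<zero>\<^bsub>K\<^esub>}" using that by auto
  then show "finite {s. k \<otimes>\<^bsub>K\<^esub> ph s ~= \<zero>\<^bsub>K\<^esub>}" "{s. k \<otimes>\<^bsub>K\<^esub> ph s ~= \<zero>\<^bsub>K\<^esub>} <= S"
  using that by (auto simp: free_mod_def elim!: finite_subset)
 qed
 show ?thesis
 proof (rule moduleI)
  show "abelian_group ?F"
  proof (rule abelian_groupI)
  fix x assume x: "x : carrier ?F"
  have "(%s. \<ominus>\<^bsub>K\<^esub> x s) : carrier ?F"
  proof -
  have "{s. \<ominus>\<^bsub>K\<^esub> x s ~= \<zero>\<^bsub>K\<^esub>} <= {s. x s ~= \<zero>\<^bsub>K\<^esub>}" using x by (auto simp: free_mod_def)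
  then show ?thesis using x by (auto simp: free_mod_def elim!: finite_subset)
  qed
  then show "EX y:carrier ?F. y \<oplus>\<^bsub>?F\<^esub> x = \<zero>\<^bsub>?F\<^esub>"
  using x by (intro bexI[of _ "%s. \<ominus>\<^bsub>K\<^esub> x s"]) (auto simp: free_mod_def K.l_neg)
  next
  fix x y assume "x : carrier ?F" "y : carrier ?F"
  then show "x \<oplus>\<^bsub>?F\<^esub> y : carrier ?F" using fin[of x y] by (auto simp: free_mod_def)
  qed (auto simp: free_mod_def K.a_ac)
 next
  fix a x assume "a : carrier K" "x : carrier ?F"
  then show "a \<odot>\<^bsub>?F\<^esub> x : carrier ?F" using fin2[of x a] by (auto simp: free_mod_def)
 qed (auto simp: free_mod_def K.l_distr K.r_distr K.m_assoc K.is_cring)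
qed

lemma free_gen_closed:
 assumes "cring K" "s : S" shows "free_gen K s : carrier (free_mod K S)"
proof -
 interpret K: cring K by fact
 have "{t. free_gen K s t ~= \<zero>\<^bsub>K\<^esub>} <= {s}" by (auto simp: free_gen_def)
 then show ?thesis using assms(2) by (auto simp: free_mod_def free_gen_def intro: finite_subset)
qed

definition lin_ext :: "('k, 'r) ring_scheme => ('k, 'p) module => ('s => 'p) => ('s => 'k) => 'p" where
 "lin_ext K P f ph = (\<Oplus>\<^bsub>P\<^esub>s\<in>{s. ph s ~= \<zero>\<^bsub>K\<^esub>}. ph s \<odot>\<^bsub>P\<^esub> f s)"

lemma lin_ext_superset:
 assumes "module K P" "f : S \<rightarrow> carrier P" "ph : carrier (free_mod K S)"
  "finite T" "{s. ph s ~= \<zero>\<^bsub>K\<^esub>} <= T" "T <= S"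
 shows "lin_ext K P f ph = (\<Oplus>\<^bsub>P\<^esub>s\<in>T. ph s \<odot>\<^bsub>P\<^esub> f s)"
proof -
 interpret P: module K P by fact
 show ?thesis unfolding lin_ext_def
  by (rule P.finsum_neutral_left) (use assms in \<open>auto simp: free_mod_def Pi_iff subset_iff\<close>)
qed

lemma lin_ext_hom:
 assumes "module K P" "f : S \<rightarrow> carrier P"
 shows "lin_ext K P f : mod_hom K (free_mod K S) P"
  and "s : S ==> lin_ext K P f (free_gen K s) = f s"
proof -
 interpret P: module K P by fact
 let ?F = "free_mod K S"
 interpret F: module K ?F by (rule free_mod_module) (rule P.is_cring)
 have fin: "finite {s. ph s ~= \<zero>\<^bsub>K\<^esub>}" "{s. ph s ~= \<zero>\<^bsub>K\<^esub>} <= S" "!!s. ph s : carrier K"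
  if "ph : carrier ?F" for ph
  using that by (auto simp: free_mod_def)
 show "lin_ext K P f : mod_hom K ?F P"
 proof (rule mod_homI)
  fix ph assume ph: "ph : carrier ?F"
  show "lin_ext K P f ph : carrier P"
  unfolding lin_ext_def using fin[OF ph] assms(2) by (intro P.finsum_closed) (auto simp: Pi_iff subset_iff)
  fix psi assume psi: "psi : carrier ?F"
  let ?T = "{s. ph s ~= \<zero>\<^bsub>K\<^esub>} Un {s. psi s ~= \<zero>\<^bsub>K\<^esub>}"
  have T: "finite ?T" "?T <= S" using fin[OF ph] fin[OF psi] by auto
  have "lin_ext K P f (ph \<oplus>\<^bsub>?F\<^esub> psi) = (\<Oplus>\<^bsub>P\<^esub>s\<in>?T. (ph \<oplus>\<^bsub>?F\<^esub> psi) s \<odot>\<^bsub>P\<^esub> f s)"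
  using T ph psi F.a_closed[OF ph psi] by (intro lin_ext_superset[OF assms]) (auto simp: free_mod_def)
  also have "... = (\<Oplus>\<^bsub>P\<^esub>s\<in>?T. ph s \<odot>\<^bsub>P\<^esub> f s \<oplus>\<^bsub>P\<^esub> psi s \<odot>\<^bsub>P\<^esub> f s)"
  using T assms(2) fin[OF ph] fin[OF psi]
  by (intro P.finsum_cong') (auto simp: free_mod_def P.smult_l_distr Pi_iff subset_iff)
  also have "... = (\<Oplus>\<^bsub>P\<^esub>s\<in>?T. ph s \<odot>\<^bsub>P\<^esub> f s) \<oplus>\<^bsub>P\<^esub> (\<Oplus>\<^bsub>P\<^esub>s\<in>?T. psi s \<odot>\<^bsub>P\<^esub> f s)"
  using T assms(2) fin[OF ph] fin[OF psi]
  by (intro P.finsum_addf) (auto simp: Pi_iff subset_iff)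
  also have "... = lin_ext K P f ph \<oplus>\<^bsub>P\<^esub> lin_ext K P f psi"
  using T by (simp only: lin_ext_superset[OF assms ph T(1) Un_upper1 T(2)]
  lin_ext_superset[OF assms psi T(1) Un_upper2 T(2)])
  finally show "lin_ext K P f (ph \<oplus>\<^bsub>?F\<^esub> psi) = lin_ext K P f ph \<oplus>\<^bsub>P\<^esub> lin_ext K P f psi" .
 next
  fix k ph assume k: "k : carrier K" and ph: "ph : carrier ?F"
  let ?T = "{s. ph s ~= \<zero>\<^bsub>K\<^esub>}"
  have "lin_ext K P f (k \<odot>\<^bsub>?F\<^esub> ph) = (\<Oplus>\<^bsub>P\<^esub>s\<in>?T. (k \<odot>\<^bsub>?F\<^esub> ph) s \<odot>\<^bsub>P\<^esub> f s)"
  using fin[OF ph] ph k F.smult_closed by (intro lin_ext_superset[OF assms]) (auto simp: free_mod_def)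
  also have "... = (\<Oplus>\<^bsub>P\<^esub>s\<in>?T. k \<odot>\<^bsub>P\<^esub> (ph s \<odot>\<^bsub>P\<^esub> f s))"
  using assms(2) fin[OF ph] k
  by (intro P.finsum_cong') (auto simp: free_mod_def P.smult_assoc1 Pi_iff subset_iff)
  also have "... = k \<odot>\<^bsub>P\<^esub> lin_ext K P f ph"
  unfolding lin_ext_def using assms(2) fin[OF ph] k
  by (subst P.finsum_smult_ldistr) (auto simp: Pi_iff subset_iff)
  finally show "lin_ext K P f (k \<odot>\<^bsub>?F\<^esub> ph) = k \<odot>\<^bsub>P\<^esub> lin_ext K P f ph" .
 qed
 assume s: "s : S"
 have "lin_ext K P f (free_gen K s) = (\<Oplus>\<^bsub>P\<^esub>t\<in>{s}. free_gen K s t \<odot>\<^bsub>P\<^esub> f t)"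
  using s by (intro lin_ext_superset[OF assms] free_gen_closed P.is_cring) (auto simp: free_gen_def)
 then show "lin_ext K P f (free_gen K s) = f s"
  using s assms(2) by (auto simp: free_gen_def Pi_iff)
qed

text \<open>Induction on the size of the support: a nonzero coordinate is reset to zero and added
  back as a multiple of its generator.\<close>

lemma free_mod_induct:
 assumes "cring K" "ph : carrier (free_mod K S)" and z: "Q \<zero>\<^bsub>free_mod K S\<^esub>"
  and step: "!!k s psi. k : carrier K ==> s : S ==> psi : carrier (free_mod K S) ==> Q psi ==>
  Q (k \<odot>\<^bsub>free_mod K S\<^esub> free_gen K s \<oplus>\<^bsub>free_mod K S\<^esub> psi)"
 shows "Q ph"
 using assms(2)
proof (induct "card {s. ph s ~= \<zero>\<^bsub>K\<^esub>}" arbitrary: ph)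
 case 0
 then have "ph = \<zero>\<^bsub>free_mod K S\<^esub>" by (auto simp: free_mod_def)
 then show ?case using z by simp
next
 case (Suc n)
 interpret K: cring K by fact
 have fin: "finite {s. ph s ~= \<zero>\<^bsub>K\<^esub>}" "!!s. ph s ~= \<zero>\<^bsub>K\<^esub> ==> s : S" "!!s. ph s : carrier K"
  using Suc(3) by (auto simp: free_mod_def)
 obtain s where s: "ph s ~= \<zero>\<^bsub>K\<^esub>" using Suc(2) by force
 have e: "{t. (ph(s := \<zero>\<^bsub>K\<^esub>)) t ~= \<zero>\<^bsub>K\<^esub>} = {t. ph t ~= \<zero>\<^bsub>K\<^esub>} - {s}" by auto
 have p: "ph(s := \<zero>\<^bsub>K\<^esub>) : carrier (free_mod K S)" using fin by (auto simp: free_mod_def intro: finite_subset[OF _ fin(1)])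
 have "n = card {t. (ph(s := \<zero>\<^bsub>K\<^esub>)) t ~= \<zero>\<^bsub>K\<^esub>}" unfolding e using Suc(2) s fin(1) by simp
 note step[OF fin(3) fin(2)[OF s] p Suc(1)[OF this p], of s]
 also have "ph s \<odot>\<^bsub>free_mod K S\<^esub> free_gen K s \<oplus>\<^bsub>free_mod K S\<^esub> ph(s := \<zero>\<^bsub>K\<^esub>) = ph"
  using fin(3) by (auto simp: free_mod_def free_gen_def fun_eq_iff)
 finally show ?case .
qed

lemma gen_submod_submodule:
 assumes "module K M" "T <= carrier M"
 shows "submodule (gen_submod K M T) K M" "T <= gen_submod K M T"
  and "submodule H K M ==> T <= H ==> gen_submod K M T <= H"
proof -
 interpret M: module K M by fact
 note E = M.submoduleE
 show "submodule (gen_submod K M T) K M"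
 proof (rule M.submoduleI)
  show "gen_submod K M T <= carrier M"
  using M.carrier_is_submodule assms(2) by (auto simp: gen_submod_def)
  show "\<zero>\<^bsub>M\<^esub> : gen_submod K M T"
  by (auto simp: gen_submod_def dest!: submodule.axioms(1) subgroup.one_closed)
 qed (auto simp: gen_submod_def dest: E)
qed (auto simp: gen_submod_def)

text \<open>Modules by generators and relations. The tensor product and the coproduct of copies of
  \<open>A\<close> both have this form, so spanning and the universal property are proved once for
  both.\<close>

definition pres :: "('k, 'r) ring_scheme => 's set => ('s => 'k) set => ('k, ('s => 'k) set) module" where
 "pres K S T = quot_mod (free_mod K S) (gen_submod K (free_mod K S) T)"

definition pres_class :: "('k, 'r) ring_scheme => 's set => ('s => 'k) set => ('s => 'k) => ('s => 'k) set" where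
 "pres_class K S T ph = gen_submod K (free_mod K S) T +>\<^bsub>free_mod K S\<^esub> ph"

lemma pres_facts:
 assumes "cring K" "T <= carrier (free_mod K S)"
 shows pres_module: "module K (pres K S T)"
  and pres_class_hom: "pres_class K S T : mod_hom K (free_mod K S) (pres K S T)"
  and pres_class_surj: "pres_class K S T ` carrier (free_mod K S) = carrier (pres K S T)"
  and pres_class_rel: "ph : T ==> pres_class K S T ph = \<zero>\<^bsub>pres K S T\<^esub>"
proof -
 let ?F = "free_mod K S"
 have F: "module K ?F" by (rule free_mod_module) fact
 note G = gen_submod_submodule[OF F assms(2)]
 note Q = quot_mod_facts[OF F G(1)]
 show "module K (pres K S T)" "pres_class K S T : mod_hom K ?F (pres K S T)"
  "pres_class K S T ` carrier ?F = carrier (pres K S T)"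
  using Q(1-3) by (simp_all add: pres_def pres_class_def[abs_def])
 show "ph : T ==> pres_class K S T ph = \<zero>\<^bsub>pres K S T\<^esub>"
  using Q(4)[of ph] G(2) assms(2) by (auto simp: pres_def pres_class_def)
qed

lemma pres_induct:
 assumes "cring K" "T <= carrier (free_mod K S)" "u : carrier (pres K S T)"
  and z: "Q \<zero>\<^bsub>pres K S T\<^esub>"
  and g: "!!k s. k : carrier K ==> s : S ==> Q (k \<odot>\<^bsub>pres K S T\<^esub> pres_class K S T (free_gen K s))"
  and p: "!!u v. u : carrier (pres K S T) ==> v : carrier (pres K S T) ==> Q u ==> Q v ==> Q (u \<oplus>\<^bsub>pres K S T\<^esub> v)"
 shows "Q u"
proof -
 let ?F = "free_mod K S" and ?P = "pres K S T" and ?c = "pres_class K S T"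
 interpret F: module K ?F by (rule free_mod_module) fact
 interpret P: module K ?P by (rule pres_module) fact+
 note c = pres_class_hom[OF assms(1,2)]
 obtain ph where ph: "ph : carrier ?F" "u = ?c ph"
  using assms(3) unfolding pres_class_surj[OF assms(1,2), symmetric] by blast
 have "Q (?c ph)"
  using assms(1) ph(1)
 proof (rule free_mod_induct)
  show "Q (?c \<zero>\<^bsub>?F\<^esub>)" using z lin_zero[OF F.module_axioms P.module_axioms c] by simp
  fix k s psi assume k: "k : carrier K" and s: "s : S" and p': "psi : carrier ?F" "Q (?c psi)"
  note gc = free_gen_closed[OF assms(1) s]
  show "Q (?c (k \<odot>\<^bsub>?F\<^esub> free_gen K s \<oplus>\<^bsub>?F\<^esub> psi))"
  unfolding lin_add[OF c F.smult_closed[OF k gc] p'(1)] lin_smult[OF c k gc]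
  by (rule p[OF P.smult_closed[OF k lin_closed[OF c gc]] lin_closed[OF c p'(1)] g[OF k s] p'(2)])
 qed
 then show ?thesis by (simp add: ph(2))
qed

text \<open>The kernel of the linear extension of \<open>f\<close> is a submodule containing the
  relations, hence the submodule they generate. So the value depends only on the class, and
  evaluation at a chosen representative is linear.\<close>

lemma pres_lift:
 assumes "cring K" "T <= carrier (free_mod K S)" "module K P" "f : S \<rightarrow> carrier P"
  and T: "!!ph. ph : T ==> lin_ext K P f ph = \<zero>\<^bsub>P\<^esub>"
 shows "EX h : mod_hom K (pres K S T) P. ALL s:S. h (pres_class K S T (free_gen K s)) = f s"
proof -
 let ?F = "free_mod K S" and ?P = "pres K S T" and ?c = "pres_class K S T"
 interpret F: module K ?F by (rule free_mod_module) fact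
 interpret Q: module K ?P by (rule pres_module) fact+
 interpret P: module K P by fact
 note c = pres_class_hom[OF assms(1,2)]
 let ?L = "lin_ext K P f"
 note L = lin_ext_hom[OF assms(3,4)]
 let ?H = "{ph : carrier ?F. ?L ph = \<zero>\<^bsub>P\<^esub>}"
 have "submodule ?H K ?F"
  by (rule F.submoduleI)
  (auto simp: lin_zero[OF F.module_axioms assms(3) L(1)] lin_add[OF L(1)]
  lin_smult[OF L(1)] lin_a_inv[OF F.module_axioms assms(3) L(1)])
 then have sub: "gen_submod K ?F T <= ?H"
  using gen_submod_submodule(3)[OF F.module_axioms assms(2)] assms(2) T by blast
 have wd: "?L ph = ?L psi" if "ph : carrier ?F" "psi : carrier ?F" "?c ph = ?c psi" for ph psi
 proof -
  have "?c (ph \<ominus>\<^bsub>?F\<^esub> psi) = \<zero>\<^bsub>?P\<^esub>"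
  using that lin_closed[OF c] Q.minus_eq_zero_iff
  by (simp add: lin_minus[OF F.module_axioms Q.module_axioms c])
  then have "ph \<ominus>\<^bsub>?F\<^esub> psi : gen_submod K ?F T"
  using quot_mod_facts(4)[OF F.module_axioms gen_submod_submodule(1)[OF F.module_axioms assms(2)], of "ph \<ominus>\<^bsub>?F\<^esub> psi"] that
  by (auto simp: pres_def pres_class_def)
  then have "?L (ph \<ominus>\<^bsub>?F\<^esub> psi) = \<zero>\<^bsub>P\<^esub>" using sub by blast
  then show ?thesis using that lin_closed[OF L(1)] P.minus_eq_zero_iff
  by (simp add: lin_minus[OF F.module_axioms assms(3) L(1)])
 qed
 define r where "r u = (SOME ph. ph : carrier ?F & ?c ph = u)" for u
 have r: "r u : carrier ?F & ?c (r u) = u" if "u : carrier ?P" for u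
 proof -
  have "u : ?c ` carrier ?F" using that by (simp only: pres_class_surj[OF assms(1,2)])
  then show ?thesis unfolding r_def by (intro someI_ex[where P = "%ph. ph : carrier ?F & ?c ph = u"]) blast
 qed
 let ?h = "%u. ?L (r u)"
 have hc: "?h (?c ph) = ?L ph" if "ph : carrier ?F" for ph
  using wd[of "r (?c ph)" ph] r[of "?c ph"] lin_closed[OF c] that by auto
 have "?h : mod_hom K ?P P"
 proof (rule mod_homI)
  fix u v assume u: "u : carrier ?P" and v: "v : carrier ?P"
  have "?h (u \<oplus>\<^bsub>?P\<^esub> v) = ?h (?c (r u \<oplus>\<^bsub>?F\<^esub> r v))"
  using r[OF u] r[OF v] by (simp add: lin_add[OF c])
  then show "?h (u \<oplus>\<^bsub>?P\<^esub> v) = ?h u \<oplus>\<^bsub>P\<^esub> ?h v"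
  using r[OF u] r[OF v] hc by (simp add: lin_add[OF L(1)])
 next
  fix k u assume k: "k : carrier K" and u: "u : carrier ?P"
  have "?h (k \<odot>\<^bsub>?P\<^esub> u) = ?h (?c (k \<odot>\<^bsub>?F\<^esub> r u))"
  using r[OF u] k by (simp add: lin_smult[OF c])
  then show "?h (k \<odot>\<^bsub>?P\<^esub> u) = k \<odot>\<^bsub>P\<^esub> ?h u"
  using r[OF u] hc k by (simp add: lin_smult[OF L(1)])
 qed (use r lin_closed[OF L(1)] in auto)
 moreover have "ALL s:S. ?h (?c (free_gen K s)) = f s"
 proof
  fix s assume s: "s : S"
  show "?h (?c (free_gen K s)) = f s"
  using hc[OF free_gen_closed[OF assms(1) s]] L(2)[OF s] by simp
 qed
 ultimately show ?thesis by (intro bexI[of _ ?h])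
qed

section \<open>Tensor products\<close>

lemma tensor_pres: "tensor K M N = pres K (carrier M \<times> carrier N) (tensor_rels K M N)"
 and ptens_pres: "ptens K M N x y =
  pres_class K (carrier M \<times> carrier N) (tensor_rels K M N) (free_gen K (x, y))"
 by (auto simp: tensor_def pres_def ptens_def pres_class_def Let_def)

lemma tensor_relsI:
 fixes K M N
 defines "F \<equiv> free_mod K (carrier M \<times> carrier N)"
 shows "x : carrier M ==> x' : carrier M ==> y : carrier N ==>
  free_gen K (x \<oplus>\<^bsub>M\<^esub> x', y) \<ominus>\<^bsub>F\<^esub> (free_gen K (x, y) \<oplus>\<^bsub>F\<^esub> free_gen K (x', y)) : tensor_rels K M N"
  and "x : carrier M ==> y : carrier N ==> y' : carrier N ==>
  free_gen K (x, y \<oplus>\<^bsub>N\<^esub> y') \<ominus>\<^bsub>F\<^esub> (free_gen K (x, y) \<oplus>\<^bsub>F\<^esub> free_gen K (x, y')) : tensor_rels K M N"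
  and "k : carrier K ==> x : carrier M ==> y : carrier N ==>
  free_gen K (k \<odot>\<^bsub>M\<^esub> x, y) \<ominus>\<^bsub>F\<^esub> k \<odot>\<^bsub>F\<^esub> free_gen K (x, y) : tensor_rels K M N"
  and "k : carrier K ==> x : carrier M ==> y : carrier N ==>
  free_gen K (x, k \<odot>\<^bsub>N\<^esub> y) \<ominus>\<^bsub>F\<^esub> k \<odot>\<^bsub>F\<^esub> free_gen K (x, y) : tensor_rels K M N"
 unfolding tensor_rels_def Let_def F_def by blast+

lemma tensor_rels_closed:
 assumes "module K M" "module K N"
 shows "tensor_rels K M N <= carrier (free_mod K (carrier M \<times> carrier N))"
proof -
 interpret M: module K M by fact
 interpret N: module K N by fact
 interpret F: module K "free_mod K (carrier M \<times> carrier N)"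
  by (rule free_mod_module) (rule M.is_cring)
 have "free_gen K (x, y) : carrier (free_mod K (carrier M \<times> carrier N))"
  if "x : carrier M" "y : carrier N" for x y
  using that by (intro free_gen_closed M.is_cring) auto
 then show ?thesis unfolding tensor_rels_def Let_def
  by (intro Un_least subsetI; elim CollectE exE conjE) simp_all
qed

lemma tensor_module:
 assumes "module K M" "module K N"
 shows "module K (tensor K M N)"
 unfolding tensor_pres
 using assms(1) by (intro pres_module tensor_rels_closed assms) (simp add: module_def)

lemma ptens_bilinear:
 assumes "module K M" "module K N"
 shows "bilinear_map K M N (tensor K M N) (ptens K M N)"
proof -
 interpret M: module K M by fact
 interpret N: module K N by fact
 interpret T: module K "tensor K M N" by (rule tensor_module) fact+
 let ?S = "carrier M \<times> carrier N" and ?T = "tensor_rels K M N"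
 let ?F = "free_mod K ?S" and ?c = "pres_class K ?S ?T" and ?d = "free_gen K"
 interpret F: module K ?F by (rule free_mod_module) (rule M.is_cring)
 have d: "?d (x, y) : carrier ?F" if "x : carrier M" "y : carrier N" for x y
  using that by (intro free_gen_closed M.is_cring) auto
 have c: "?c : mod_hom K ?F (tensor K M N)" unfolding tensor_pres
  by (intro pres_class_hom M.is_cring tensor_rels_closed assms)
 have eq: "?c ph = ?c psi" if "ph \<ominus>\<^bsub>?F\<^esub> psi : ?T" "ph : carrier ?F" "psi : carrier ?F" for ph psi
 proof -
  have "?c (ph \<ominus>\<^bsub>?F\<^esub> psi) = \<zero>\<^bsub>tensor K M N\<^esub>" unfolding tensor_pres
  using that by (intro pres_class_rel M.is_cring tensor_rels_closed assms)
  then show ?thesis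
  using that lin_closed[OF c] T.minus_eq_zero_iff
  by (simp add: lin_minus[OF F.module_axioms T.module_axioms c])
 qed
 show ?thesis
 proof (rule bilinear_mapI)
  fix x y assume "x : carrier M" "y : carrier N"
  then show "ptens K M N x y : carrier (tensor K M N)"
  unfolding ptens_pres using lin_closed[OF c] d by auto
 next
  fix x x' y assume *: "x : carrier M" "x' : carrier M" "y : carrier N"
  have "?c (?d (x \<oplus>\<^bsub>M\<^esub> x', y)) = ?c (?d (x, y) \<oplus>\<^bsub>?F\<^esub> ?d (x', y))"
  using * d by (intro eq tensor_relsI) auto
  then show "ptens K M N (x \<oplus>\<^bsub>M\<^esub> x') y = ptens K M N x y \<oplus>\<^bsub>tensor K M N\<^esub> ptens K M N x' y"
  using * d by (simp add: ptens_pres lin_add[OF c])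
 next
  fix x y y' assume *: "x : carrier M" "y : carrier N" "y' : carrier N"
  have "?c (?d (x, y \<oplus>\<^bsub>N\<^esub> y')) = ?c (?d (x, y) \<oplus>\<^bsub>?F\<^esub> ?d (x, y'))"
  using * d by (intro eq tensor_relsI) auto
  then show "ptens K M N x (y \<oplus>\<^bsub>N\<^esub> y') = ptens K M N x y \<oplus>\<^bsub>tensor K M N\<^esub> ptens K M N x y'"
  using * d by (simp add: ptens_pres lin_add[OF c])
 next
  fix k x y assume *: "k : carrier K" "x : carrier M" "y : carrier N"
  have "?c (?d (k \<odot>\<^bsub>M\<^esub> x, y)) = ?c (k \<odot>\<^bsub>?F\<^esub> ?d (x, y))"
  using * d by (intro eq tensor_relsI) auto
  then show "ptens K M N (k \<odot>\<^bsub>M\<^esub> x) y = k \<odot>\<^bsub>tensor K M N\<^esub> ptens K M N x y"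
  using * d by (simp add: ptens_pres lin_smult[OF c])
  have "?c (?d (x, k \<odot>\<^bsub>N\<^esub> y)) = ?c (k \<odot>\<^bsub>?F\<^esub> ?d (x, y))"
  using * d by (intro eq tensor_relsI) auto
  then show "ptens K M N x (k \<odot>\<^bsub>N\<^esub> y) = k \<odot>\<^bsub>tensor K M N\<^esub> ptens K M N x y"
  using * d by (simp add: ptens_pres lin_smult[OF c])
 qed
qed

lemma ptens_closed:
 assumes "module K M" "module K N" "x : carrier M" "y : carrier N"
 shows "ptens K M N x y : carrier (tensor K M N)"
 by (rule bilinear_map_closed[OF ptens_bilinear[OF assms(1,2)] assms(3,4)])

text \<open>Scalars do not appear in the cases: a multiple of a pure tensor is pure again, the
  scalar being absorbed into the first factor.\<close>

lemma tensor_induct [consumes 3, case_names zero ptens add]: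
 assumes u: "u : carrier (tensor K M N)" and MN: "module K M" "module K N"
  and z: "Q \<zero>\<^bsub>tensor K M N\<^esub>"
  and g: "!!x y. x : carrier M ==> y : carrier N ==> Q (ptens K M N x y)"
  and p: "!!u v. u : carrier (tensor K M N) ==> v : carrier (tensor K M N) ==> Q u ==> Q v ==>
  Q (u \<oplus>\<^bsub>tensor K M N\<^esub> v)"
 shows "Q u"
proof -
 interpret M: module K M by fact
 note b = ptens_bilinear[OF MN]
 show ?thesis
 proof (rule pres_induct[OF M.is_cring tensor_rels_closed[OF MN] u[unfolded tensor_pres], where Q = Q])
  fix k s assume k: "k : carrier K" and "s : carrier M \<times> carrier N"
  then obtain x y where s: "s = (x, y)" "x : carrier M" "y : carrier N" by auto
  have "Q (ptens K M N (k \<odot>\<^bsub>M\<^esub> x) y)" using k s by (intro g) auto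
  then show "Q (k \<odot>\<^bsub>pres K (carrier M \<times> carrier N) (tensor_rels K M N)\<^esub>
  pres_class K (carrier M \<times> carrier N) (tensor_rels K M N) (free_gen K s))"
  using lin_smult[OF bilinear_map_left[OF b s(3)] k s(2)] s
  by (simp add: ptens_pres tensor_pres)
 qed (use z p in \<open>simp_all add: tensor_pres\<close>)
qed

lemma tensor_hom_eqI:
 assumes MN: "module K M" "module K N" "module K P"
  and f: "f : mod_hom K (tensor K M N) P" and g: "g : mod_hom K (tensor K M N) P"
  and eq: "!!x y. x : carrier M ==> y : carrier N ==> f (ptens K M N x y) = g (ptens K M N x y)"
  and u: "u : carrier (tensor K M N)"
 shows "f u = g u"
 using u MN(1,2)
proof (induct rule: tensor_induct)
 case zero show ?case
  using lin_zero[OF tensor_module[OF MN(1,2)] MN(3) f]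
  lin_zero[OF tensor_module[OF MN(1,2)] MN(3) g] by simp
next
 case (add u v) then show ?case by (simp add: lin_add[OF f] lin_add[OF g])
qed (rule eq)

text \<open>The description in \<open>tens_lift\<close> is definite: pure tensors span, which fixes
  a linear map on the carrier, and membership in \<open>mod_hom_ext\<close> fixes it
  outside.\<close>

lemma tens_lift:
 assumes MNP: "module K M" "module K N" "module K P" and f: "bilinear_map K M N P f"
 shows tens_lift_hom_ext: "tens_lift K M N P f : mod_hom_ext K (tensor K M N) P"
  and tens_lift_ptens: "!!x y. x : carrier M ==> y : carrier N ==>
  tens_lift K M N P f (ptens K M N x y) = f x y"
proof -
 interpret M: module K M by fact
 interpret N: module K N by fact
 interpret P: module K P by fact
 interpret T: module K "tensor K M N" by (rule tensor_module) fact+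
 let ?S = "carrier M \<times> carrier N" and ?T = "tensor_rels K M N"
 let ?F = "free_mod K ?S" and ?d = "free_gen K"
 let ?f = "%(x, y). f x y"
 interpret F: module K ?F by (rule free_mod_module) (rule M.is_cring)
 have fc: "?f : ?S \<rightarrow> carrier P" using bilinear_map_closed[OF f] by auto
 note L = lin_ext_hom[OF MNP(3) fc]
 have d: "?d (x, y) : carrier ?F" if "x : carrier M" "y : carrier N" for x y
  using that by (intro free_gen_closed M.is_cring) auto
 have Ld: "lin_ext K P ?f (?d (x, y)) = f x y" if "x : carrier M" "y : carrier N" for x y
  using L(2)[of "(x, y)"] that by auto
 note fl = bilinear_map_left[OF f] and fr = bilinear_map_right[OF f]
 note fs = lin_add[OF fl] lin_add[OF fr] lin_smult[OF fl] lin_smult[OF fr]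
 have T0: "lin_ext K P ?f ph = \<zero>\<^bsub>P\<^esub>" if "ph : ?T" for ph
  using that bilinear_map_closed[OF f] unfolding tensor_rels_def Let_def
  by (elim UnE CollectE exE conjE) (simp_all add: lin_minus[OF F.module_axioms MNP(3) L(1)] d Ld
  lin_add[OF L(1)] lin_smult[OF L(1)] P.minus_eq_zero_iff fs)
 obtain h where h: "h : mod_hom K (tensor K M N) P"
  "!!x y. x : carrier M ==> y : carrier N ==> h (ptens K M N x y) = f x y"
  using pres_lift[OF M.is_cring tensor_rels_closed[OF MNP(1,2)] MNP(3) fc T0]
  unfolding ptens_pres tensor_pres[symmetric] by auto
 let ?h = "restrict h (carrier (tensor K M N))"
 let ?Q = "%h. h : mod_hom_ext K (tensor K M N) P &
  (ALL x:carrier M. ALL y:carrier N. h (ptens K M N x y) = f x y)"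
 have h': "?Q ?h"
  using h restrict_mod_hom_ext[OF T.module_axioms h(1)] ptens_closed[OF MNP(1,2)] by auto
 have "EX! h. ?Q h"
 proof (rule ex1I, rule h')
  fix g assume g: "?Q g"
  show "g = ?h"
  proof (rule extensionalityI)
  fix u assume u: "u : carrier (tensor K M N)"
  show "g u = ?h u"
  proof (rule tensor_hom_eqI[OF MNP _ _ _ u])
  show "g : mod_hom K (tensor K M N) P" "?h : mod_hom K (tensor K M N) P"
  using g h' by (simp_all add: mod_hom_ext_iff)
  show "g (ptens K M N x y) = ?h (ptens K M N x y)" if "x : carrier M" "y : carrier N" for x y
  using g h' that by simp
  qed
  qed (use g in \<open>auto simp: mod_hom_ext_def\<close>)
 qed
 then have "?Q (tens_lift K M N P f)" unfolding tens_lift_def by (rule theI')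
 then show "tens_lift K M N P f : mod_hom_ext K (tensor K M N) P"
  "!!x y. x : carrier M ==> y : carrier N ==> tens_lift K M N P f (ptens K M N x y) = f x y"
  by auto
qed

lemmas tens_lift_hom = lin_extD[OF tens_lift_hom_ext]

lemma tens_map_bilinear:
 assumes "module K M'" "module K N'" "f : mod_hom K M M'" "g : mod_hom K N N'"
 shows "bilinear_map K M N (tensor K M' N') (%x y. ptens K M' N' (f x) (g y))"
 using bilinear_map_comp[OF ptens_bilinear[OF assms(1,2)] assms(3,4) lin_id] by simp

lemma tens_map:
 assumes MN: "module K M" "module K N" "module K M'" "module K N'"
  and fg: "f : mod_hom K M M'" "g : mod_hom K N N'"
 shows tens_map_hom_ext: "tens_map K M N M' N' f g : mod_hom_ext K (tensor K M N) (tensor K M' N')"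
  and tens_map_ptens: "!!x y. x : carrier M ==> y : carrier N ==>
  tens_map K M N M' N' f g (ptens K M N x y) = ptens K M' N' (f x) (g y)"
proof -
 note T = tensor_module[OF MN(3,4)] tens_map_bilinear[OF MN(3,4) fg]
 show "tens_map K M N M' N' f g : mod_hom_ext K (tensor K M N) (tensor K M' N')"
  unfolding tens_map_def by (rule tens_lift_hom_ext[OF MN(1,2) T])
 show "tens_map K M N M' N' f g (ptens K M N x y) = ptens K M' N' (f x) (g y)"
  if "x : carrier M" "y : carrier N" for x y
  unfolding tens_map_def using that by (rule tens_lift_ptens[OF MN(1,2) T])
qed

lemmas tens_map_hom = lin_extD[OF tens_map_hom_ext]

lemma tens_swap:
 assumes MN: "module K M" "module K N"
 shows tens_swap_hom: "tens_swap K M N : mod_hom K (tensor K M N) (tensor K N M)"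
  and tens_swap_ptens: "!!x y. x : carrier M ==> y : carrier N ==>
  tens_swap K M N (ptens K M N x y) = ptens K N M y x"
proof -
 have b: "bilinear_map K M N (tensor K N M) (%x y. ptens K N M y x)"
  using ptens_bilinear[OF MN(2,1)] by (simp add: bilinear_map_def)
 show "tens_swap K M N : mod_hom K (tensor K M N) (tensor K N M)"
  "!!x y. x : carrier M ==> y : carrier N ==> tens_swap K M N (ptens K M N x y) = ptens K N M y x"
  unfolding tens_swap_def
  using tens_lift_hom[OF MN tensor_module[OF MN(2,1)] b]
  tens_lift_ptens[OF MN tensor_module[OF MN(2,1)] b] by auto
qed

text \<open>Linear dependence of a lift on a parameter of its bilinear map. It justifies nested
  lifts, as in \<open>tens_assoc\<close> and \<open>tens_gmult\<close>. On a pure tensor it is the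
  assumption, and a sum of tensors gives a sum of linear maps.\<close>

lemma tens_lift_hom_param:
 assumes MNP: "module K M" "module K N" "module K P" "module K Q"
  and f: "!!z. z : carrier Q ==> bilinear_map K M N P (f z)"
  and l: "!!x y. x : carrier M ==> y : carrier N ==> (%z. f z x y) : mod_hom K Q P"
  and u: "u : carrier (tensor K M N)"
 shows "(%z. tens_lift K M N P (f z) u) : mod_hom K Q P"
proof -
 interpret P: module K P by fact
 interpret Q: module K Q by fact
 note h = tens_lift_hom[OF MNP(1-3) f]
 show ?thesis using u MNP(1,2)
 proof (induct rule: tensor_induct)
  case zero
  show ?case
  by (rule lin_cong[OF MNP(4) lin_const_zero[OF MNP(3)]])
  (rule lin_zero[OF tensor_module[OF MNP(1,2)] MNP(3) h])
 next
  case (ptens x y)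
  show ?case
  by (rule lin_cong[OF MNP(4) l[OF ptens]])
  (rule tens_lift_ptens[OF MNP(1-3) f ptens])
 next
  case (add u v)
  show ?case
  by (rule lin_cong[OF MNP(4) lin_plus[OF MNP(3) add(3,4)]])
  (rule lin_add[OF h add(1,2)])
 qed
qed

lemma tens_assoc:
 assumes MNP: "module K M" "module K N" "module K P"
 shows tens_assoc_hom: "tens_assoc K M N P :
  mod_hom K (tensor K (tensor K M N) P) (tensor K M (tensor K N P))"
  and tens_assoc_ptens: "!!x y z. x : carrier M ==> y : carrier N ==> z : carrier P ==>
  tens_assoc K M N P (ptens K (tensor K M N) P (ptens K M N x y) z) =
  ptens K M (tensor K N P) x (ptens K N P y z)"
proof -
 let ?MN = "tensor K M N" and ?NP = "tensor K N P"
 let ?T = "tensor K M ?NP"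
 have m: "module K ?MN" "module K ?NP" "module K ?T"
  by (intro tensor_module MNP)+
 let ?b = "%z x y. ptens K M ?NP x (ptens K N P y z)"
 have b1: "(%z. ptens K N P y z) : mod_hom K P ?NP" if "y : carrier N" for y
  using bilinear_map_right[OF ptens_bilinear[OF MNP(2,3)] that] .
 have b2: "(%y. ptens K N P y z) : mod_hom K N ?NP" if "z : carrier P" for z
  using bilinear_map_left[OF ptens_bilinear[OF MNP(2,3)] that] .
 note pb = ptens_bilinear[OF MNP(1) m(2)]
 have b: "bilinear_map K M N ?T (?b z)" if "z : carrier P" for z
  using bilinear_map_comp[OF pb lin_id b2[OF that] lin_id] .
 have l: "(%z. ?b z x y) : mod_hom K P ?T" if "x : carrier M" "y : carrier N" for x y
  using lin_comp[OF b1[OF that(2)] bilinear_map_right[OF pb that(1)]] .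
 let ?f = "%u z. tens_lift K M N ?T (?b z) u"
 have bf: "bilinear_map K ?MN P ?T ?f"
 proof (rule bilinear_mapI_hom)
  fix u assume "u : carrier ?MN"
  then show "?f u : mod_hom K P ?T"
  by (intro tens_lift_hom_param MNP m b l)
 next
  fix z assume "z : carrier P"
  then show "(%u. ?f u z) : mod_hom K ?MN ?T"
  by (intro tens_lift_hom MNP m b)
 qed
 show "tens_assoc K M N P : mod_hom K (tensor K ?MN P) ?T"
  unfolding tens_assoc_def by (intro tens_lift_hom m MNP bf)
 fix x y z assume *: "x : carrier M" "y : carrier N" "z : carrier P"
 have "tens_assoc K M N P (ptens K ?MN P (ptens K M N x y) z) = ?f (ptens K M N x y) z"
  unfolding tens_assoc_def
  by (rule tens_lift_ptens[OF m(1) MNP(3) m(3) bf ptens_closed[OF MNP(1,2) *(1,2)] *(3)])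
 also have "... = ptens K M ?NP x (ptens K N P y z)"
  by (rule tens_lift_ptens[OF MNP(1,2) m(3) b[OF *(3)] *(1,2)])
 finally show "tens_assoc K M N P (ptens K ?MN P (ptens K M N x y) z) =
  ptens K M ?NP x (ptens K N P y z)" .
qed

section \<open>Finite partitions\<close>

text \<open>Bijections chosen fibre by fibre glue together. The permutations with a prescribed
  effect on blocks are obtained from this.\<close>

lemma fiber_bij:
 fixes f :: "'a => 'i" and f' :: "'b => 'i"
 assumes "finite S" "finite S'" "!!i. card {s:S. f s = i} = card {s:S'. f' s = i}"
 shows "EX \<beta>. bij_betw \<beta> S S' & (ALL s:S. f' (\<beta> s) = f s)"
proof -
 have "EX b. bij_betw b {s:S. f s = i} {s:S'. f' s = i}" for i
  using assms by (intro finite_same_card_bij) auto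
 then have "ALL i. EX b. bij_betw b {s:S. f s = i} {s:S'. f' s = i}" by blast
 then obtain b where b: "!!i. bij_betw (b i) {s:S. f s = i} {s:S'. f' s = i}"
  using choice[of "%i b. bij_betw b {s:S. f s = i} {s:S'. f' s = i}"] by blast
 let ?\<beta> = "%s. b (f s) s"
 have im: "?\<beta> s : S' & f' (?\<beta> s) = f s" if "s : S" for s
  using bij_betwE[OF b[of "f s"]] that by auto
 have "inj_on ?\<beta> S"
 proof (rule inj_onI)
  fix s t assume st: "s : S" "t : S" "?\<beta> s = ?\<beta> t"
  then have "f s = f t" using im by metis
  then show "s = t"
  using st b[of "f t"] by (auto simp: bij_betw_def inj_on_def)
 qed
 moreover have "?\<beta> ` S = S'"
 proof
  show "?\<beta> ` S <= S'" using im by auto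
  show "S' <= ?\<beta> ` S"
  proof
  fix y assume y: "y : S'"
  then have "y : b (f' y) ` {s:S. f s = f' y}" using b[of "f' y"] by (auto simp: bij_betw_def)
  then obtain x where "x : S" "f x = f' y" "y = b (f' y) x" by blast
  then have "y = ?\<beta> x" "x : S" by simp_all
  then show "y : ?\<beta> ` S" by blast
  qed
 qed
 ultimately show ?thesis using im by (intro exI[of _ ?\<beta>]) (auto simp: bij_betw_def)
qed

lemma is_partD:
 assumes "is_part X"
 shows "finite (pts X)" "eqv X <= pts X \<times> pts X" "!!x. x : pts X ==> (x, x) : eqv X"
  "!!x y. (x, y) : eqv X ==> (y, x) : eqv X"
  "!!x y z. (x, y) : eqv X ==> (y, z) : eqv X ==> (x, z) : eqv X"
  "!!x y. (x, y) : eqv X ==> x : pts X" "!!x y. (x, y) : eqv X ==> y : pts X"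
proof -
 have e: "equiv (pts X) (eqv X)" "finite (pts X)" using assms by (auto simp: is_part_def)
 show "finite (pts X)" by fact
 show "eqv X <= pts X \<times> pts X" using e(1) by (auto simp: equiv_def refl_on_def)
 then show "!!x y. (x, y) : eqv X ==> x : pts X" "!!x y. (x, y) : eqv X ==> y : pts X" by auto
 show "!!x. x : pts X ==> (x, x) : eqv X" using e(1) by (auto simp: equiv_def refl_on_def)
 show "!!x y. (x, y) : eqv X ==> (y, x) : eqv X" using e(1) by (auto simp: equiv_def sym_def)
 show "!!x y z. (x, y) : eqv X ==> (y, z) : eqv X ==> (x, z) : eqv X"
  using e(1) unfolding equiv_def trans_def by blast
qed

lemma is_partI:
 assumes "finite (pts X)" "eqv X <= pts X \<times> pts X" "!!x. x : pts X ==> (x, x) : eqv X"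
  "!!x y. (x, y) : eqv X ==> (y, x) : eqv X"
  "!!x y z. (x, y) : eqv X ==> (y, z) : eqv X ==> (x, z) : eqv X"
 shows "is_part X"
 using assms unfolding is_part_def equiv_def refl_on_def sym_def trans_def by blast

text \<open>The least element of a block serves as the name of the block. Being a number, it can
  later select a copy of the algebra, and \<open>labs X\<close> has one element for each
  block.\<close>

definition lab :: "part => nat => nat" where
 "lab X s = Min (eqv X `` {s})"

definition labs :: "part => nat set" where
 "labs X = lab X ` pts X"

text \<open>For a partition this is the multidegree that will cut out the value at \<open>X\<close>:
  the block sizes as a finitely supported function of the label, zero at numbers that label no
  block.\<close>

definition pdeg :: "part => nat => nat" where
 "pdeg X t = card {s:pts X. lab X s = t}"

lemma lab:
 assumes "is_part X"
 shows lab_eqv: "s : pts X ==> (s, lab X s) : eqv X"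
  and lab_pts: "s : pts X ==> lab X s : pts X"
  and lab_eq_iff: "s : pts X ==> s' : pts X ==> lab X s = lab X s' \<longleftrightarrow> (s, s') : eqv X"
  and lab_lab: "s : pts X ==> lab X (lab X s) = lab X s"
  and finite_labs: "finite (labs X)" and labs_pts: "labs X <= pts X"
  and lab_labs: "t : labs X ==> lab X t = t"
proof -
 note P = is_partD[OF assms]
 have le: "(s, lab X s) : eqv X" if "s : pts X" for s
 proof -
  have "finite (eqv X `` {s})" "eqv X `` {s} ~= {}"
  using P(1,2) P(3)[OF that] by (auto intro: finite_subset[of _ "pts X"])
  then have "Min (eqv X `` {s}) : eqv X `` {s}" by (rule Min_in)
  then show ?thesis by (simp add: lab_def)
 qed
 then show "s : pts X ==> (s, lab X s) : eqv X" .
 show lp: "s : pts X ==> lab X s : pts X" for s using le P(7) by blast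
 have cong: "lab X s = lab X s'" if "(s, s') : eqv X" for s s'
 proof -
  have "eqv X `` {s} = eqv X `` {s'}" using that P(4,5) by blast
  then show ?thesis by (simp add: lab_def)
 qed
 show "s : pts X ==> s' : pts X ==> lab X s = lab X s' \<longleftrightarrow> (s, s') : eqv X"
  using cong le P(4,5) by metis
 show ll: "lab X (lab X s) = lab X s" if "s : pts X" for s using cong[OF le[OF that]] by simp
 show "finite (labs X)" "labs X <= pts X" "t : labs X ==> lab X t = t"
  using P(1) lp ll by (auto simp: labs_def)
qed

lemma pdeg_pos_iff:
 assumes "is_part X" shows "pdeg X t ~= 0 \<longleftrightarrow> t : labs X"
 using is_partD(1)[OF assms] by (auto simp: pdeg_def labs_def card_eq_0_iff)

lemma prefines_iff:
 "prefines X Y \<longleftrightarrow> is_part X & is_part Y & pts X = pts Y & eqv X <= eqv Y"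
 by (auto simp: prefines_def pmor_def)

lemma pmorD:
 assumes "pmor X Y f"
 shows "is_part X" "is_part Y" "bij_betw f (pts X) (pts Y)" "inj_on f (pts X)" "f ` pts X = pts Y"
  "!!x. x : pts X ==> f x : pts Y" "!!x y. (x, y) : eqv X ==> (f x, f y) : eqv Y"
 using assms by (auto simp: pmor_def bij_betw_def)

text \<open>A morphism maps each block into one block, so replacing a point by the label of its
  block does not change the label of the image. Hence morphisms compose on labels.\<close>

lemma pmor_lab:
 assumes "pmor X Y f" "s : pts X"
 shows "lab Y (f (lab X s)) = lab Y (f s)"
proof -
 note f = pmorD[OF assms(1)]
 have "(f s, f (lab X s)) : eqv Y" using f(7) lab_eqv[OF f(1) assms(2)] by blast
 then show ?thesis
  using lab_eq_iff[OF f(2), of "f s" "f (lab X s)"] f(6) lab_pts[OF f(1) assms(2)] assms(2) by simp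
qed

lemma pmor_labs: "pmor X Y f ==> p : labs X ==> lab Y (f p) : labs Y"
 using pmorD[of X Y f] labs_pts[of X] by (auto simp: labs_def)

lemma card_fibers:
 assumes "finite S" "finite L" "!!s. s : S ==> g s : L"
 shows "card S = (\<Sum>p\<in>L. card {s:S. g s = p})"
proof -
 have "S = (\<Union>p\<in>L. {s:S. g s = p})" using assms by auto
 also have "card ... = (\<Sum>p\<in>L. card {s:S. g s = p})"
  using assms by (intro card_UN_disjoint) auto
 finally show ?thesis .
qed

text \<open>A block of \<open>Y\<close> is the disjoint union of the images of those blocks of
  \<open>X\<close> that are sent into it, because \<open>f\<close> is bijective on points.\<close>

lemma pdeg_push:
 assumes f: "pmor X Y f"
 shows "pdeg Y t = (\<Sum>p\<in>{p:labs X. lab Y (f p) = t}. pdeg X p)"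
proof -
 note F = pmorD[OF f]
 have "{s:pts Y. lab Y s = t} = f ` {s:pts X. lab Y (f s) = t}" using F(5) by auto
 then have "pdeg Y t = card {s:pts X. lab Y (f s) = t}"
  unfolding pdeg_def using F(4) by (simp add: card_image inj_on_def)
 also have "... = (\<Sum>p\<in>{p:labs X. lab Y (f p) = t}. card {s:{s:pts X. lab Y (f s) = t}. lab X s = p})"
  using is_partD(1)[OF F(1)] finite_labs[OF F(1)]
  by (intro card_fibers) (auto simp: labs_def pmor_lab[OF f])
 also have "... = (\<Sum>p\<in>{p:labs X. lab Y (f p) = t}. pdeg X p)"
 proof (intro sum.cong refl)
  fix p assume "p : {p:labs X. lab Y (f p) = t}"
  then have "{s:{s:pts X. lab Y (f s) = t}. lab X s = p} = {s:pts X. lab X s = p}"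
  using pmor_lab[OF f] by force
  then show "card {s:{s:pts X. lab Y (f s) = t}. lab X s = p} = pdeg X p" by (simp add: pdeg_def)
 qed
 finally show ?thesis .
qed

section \<open>Morphisms, unions of disjoint partitions, and induction on blocks\<close>

lemma pmor_id: "is_part X ==> pmor X X id"
 by (auto simp: pmor_def)

lemma pmor_comp: "pmor X Y f ==> pmor Y Z g ==> pmor X Z (g o f)"
 using bij_betw_trans[of f "pts X" "pts Y" g "pts Z"] unfolding pmor_def by auto

lemma pmor_cong:
 assumes "pmor X Y f" "!!x. x : pts X ==> g x = f x"
 shows "pmor X Y g"
proof -
 note F = pmorD[OF assms(1)]
 have "bij_betw g (pts X) (pts Y)" using F(3) assms(2) by (simp cong: bij_betw_cong)
 then show ?thesis using F assms(2) is_partD(6,7)[OF F(1)] unfolding pmor_def by auto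
qed

lemma two_iso_cong: "pmor X Y f ==> (!!x. x : pts X ==> g x = f x) ==> two_iso X Y f g"
 using is_partD(3)[of Y] by (auto simp: two_iso_def dest: pmorD)

lemma piso_iff:
 "piso X Y f \<longleftrightarrow> pmor X Y f & (ALL x:pts X. ALL y:pts X. (f x, f y) : eqv Y --> (x, y) : eqv X)"
proof
 assume f: "piso X Y f"
 then have F: "pmor X Y f" "pmor Y X (inv_into (pts X) f)" by (auto simp: piso_def)
 then show "pmor X Y f & (ALL x:pts X. ALL y:pts X. (f x, f y) : eqv Y --> (x, y) : eqv X)"
  using pmorD(7)[OF F(2)] pmorD(4)[OF F(1)] by (metis inv_into_f_f)
next
 assume f: "pmor X Y f & (ALL x:pts X. ALL y:pts X. (f x, f y) : eqv Y --> (x, y) : eqv X)"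
 then have m: "pmor X Y f" by simp
 note F = pmorD[OF m]
 have "(inv_into (pts X) f x, inv_into (pts X) f y) : eqv X" if "(x, y) : eqv Y" for x y
 proof -
  have "x : f ` pts X" "y : f ` pts X" using F(5) is_partD(6,7)[OF F(2) that] by auto
  then show ?thesis using f that by (simp add: f_inv_into_f inv_into_into)
 qed
 then have "pmor Y X (inv_into (pts X) f)"
  using F bij_betw_inv_into[OF F(3)] by (auto simp: pmor_def)
 then show "piso X Y f" using m by (simp add: piso_def)
qed

lemma piso_inv:
 assumes "piso X Y f"
 shows "pmor Y X (inv_into (pts X) f)" "!!x. x : pts X ==> inv_into (pts X) f (f x) = x"
  "!!y. y : pts Y ==> f (inv_into (pts X) f y) = y"
proof -
 have F: "pmor X Y f" "pmor Y X (inv_into (pts X) f)" using assms by (auto simp: piso_def)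
 then show "pmor Y X (inv_into (pts X) f)" "!!x. x : pts X ==> inv_into (pts X) f (f x) = x"
  "!!y. y : pts Y ==> f (inv_into (pts X) f y) = y"
  using pmorD(4,5)[OF F(1)] by (auto simp: f_inv_into_f)
qed

text \<open>The union for partitions of disjoint sets of numbers. Unlike the disjoint union
  \<open>|+|\<close> it is associative, commutative and unital as an equality, which spares all
  coherence maps.\<close>

definition pU :: "part => part => part" where
 "pU X Y = \<lparr>pts = pts X Un pts Y, eqv = eqv X Un eqv Y\<rparr>"

text \<open>Keeps the actual points of a block, where \<open>indiscrete\<close> would renumber them.
  For empty \<open>b\<close> there is no block at all, and \<open>J {}\<close> is the empty
  partition.\<close>

definition J :: "nat set => part" where
 "J b = \<lparr>pts = b, eqv = b \<times> b\<rparr>"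

abbreviation pempty :: part where "pempty \<equiv> indiscrete 0"

lemma pts_simps [simp]: "pts (pU X Y) = pts X Un pts Y" "pts (J b) = b"
 "pts (X |+| Y) = inl ` pts X Un inr ` pts Y" "pts (ptransport f X) = f ` pts X"
 "pts (pmeet X Y) = pts X" "eqv (pmeet X Y) = eqv X Int eqv Y"
 "eqv (pU X Y) = eqv X Un eqv Y" "eqv (J b) = b \<times> b" "eqv (ptransport f X) = map_prod f f ` eqv X"
 by (auto simp: pU_def J_def psum_def ptransport_def pmeet_def)

lemma indiscrete_J: "indiscrete n = J {1..n}"
 by (simp add: indiscrete_def J_def)

lemma pts_indiscrete [simp]: "pts (indiscrete n) = {1..n}"
 by (simp add: indiscrete_J)

lemma psum_pU: "X |+| Y = pU (ptransport inl X) (ptransport inr Y)"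
 by (simp add: psum_def pU_def)

lemma pU_comm: "pU X Y = pU Y X" and pU_assoc: "pU (pU X Y) Z = pU X (pU Y Z)"
 by (auto simp: pU_def)

lemma pU_lcomm: "pU X (pU Y Z) = pU Y (pU X Z)"
 by (auto simp: pU_def)

lemma pU_empty [simp]: "pU pempty X = X" "pU X pempty = X" "J {} = pempty"
 by (auto simp: pU_def indiscrete_J J_def)

lemma is_part_J [simp]: "is_part (J b) \<longleftrightarrow> finite b"
 by (auto intro: is_partI dest: is_partD(1))

lemma is_part_indiscrete [simp]: "is_part (indiscrete n)"
 by (simp add: indiscrete_J)

lemma is_part_pU:
 assumes "is_part X" "is_part Y" "pts X Int pts Y = {}"
 shows "is_part (pU X Y)"
proof -
 note L = is_partD[OF assms(1)] and O = is_partD[OF assms(2)]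
 show ?thesis
 proof (rule is_partI)
  fix x y z assume "(x, y) : eqv (pU X Y)" "(y, z) : eqv (pU X Y)"
  then show "(x, z) : eqv (pU X Y)"
  using L(5-7) O(5-7) assms(3) by simp blast
 qed (use L(1-4,6,7) O(1-4,6,7) in auto)
qed

lemma is_part_ptransport:
 assumes "is_part X" "inj_on f (pts X)"
 shows "is_part (ptransport f X)"
proof -
 note L = is_partD[OF assms(1)]
 show ?thesis
 proof (rule is_partI)
  fix x y z assume "(x, y) : eqv (ptransport f X)" "(y, z) : eqv (ptransport f X)"
  then obtain a b b' c where "(a, b) : eqv X" "(b', c) : eqv X" "x = f a" "y = f b" "f b = f b'" "z = f c"
  by auto
  moreover from this have "b = b'" using assms(2) L(6,7) by (meson inj_onD)
  ultimately have "(a, c) : eqv X" "x = f a" "z = f c" using L(5) by blast+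
  then show "(x, z) : eqv (ptransport f X)" by force
 qed (use L(1-4,6,7) in \<open>auto simp: image_iff\<close>, force+)
qed

lemma piso_ptransport:
 assumes "is_part X" "inj_on f (pts X)"
 shows "piso X (ptransport f X) f"
 unfolding piso_iff
proof (intro conjI ballI impI)
 show "pmor X (ptransport f X) f"
  using is_part_ptransport[OF assms] assms by (auto simp: pmor_def bij_betw_def)
 fix x y assume "x : pts X" "y : pts X" "(f x, f y) : eqv (ptransport f X)"
 then obtain a b where ab: "(a, b) : eqv X" "f x = f a" "f y = f b" by auto
 then have "x = a" "y = b"
  using \<open>x : pts X\<close> \<open>y : pts X\<close> assms(2) is_partD(6,7)[OF assms(1) ab(1)] by (auto dest: inj_onD)
 then show "(x, y) : eqv X" using ab by simp
qed

lemma pmor_ptransport_to: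
 assumes "pmor X Y f" shows "pmor (ptransport f X) Y id"
proof -
 note F = pmorD[OF assms]
 show ?thesis
  using is_part_ptransport[OF F(1,4)] F by (auto simp: pmor_def)
qed

lemma pmor_pU:
 assumes "pmor X X' f" "pmor Y Y' f" "pts X Int pts Y = {}" "pts X' Int pts Y' = {}"
 shows "pmor (pU X Y) (pU X' Y') f"
proof -
 note F = pmorD[OF assms(1)] and G = pmorD[OF assms(2)]
 have "bij_betw f (pts X Un pts Y) (pts X' Un pts Y')"
  by (rule bij_betw_combine[OF F(3) G(3) assms(4)])
 then show ?thesis
  using is_part_pU[OF F(1) G(1) assms(3)] is_part_pU[OF F(2) G(2) assms(4)] F(7) G(7)
  by (auto simp: pmor_def)
qed

lemma piso_pU:
 assumes "piso X X' f" "piso Y Y' f" "pts X Int pts Y = {}" "pts X' Int pts Y' = {}"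
 shows "piso (pU X Y) (pU X' Y') f"
 unfolding piso_iff
proof (intro conjI ballI impI)
 have F: "pmor X X' f" "pmor Y Y' f" using assms(1,2) by (auto simp: piso_def)
 then show "pmor (pU X Y) (pU X' Y') f" using assms(3,4) by (rule pmor_pU)
 note F1 = pmorD[OF F(1)] and F2 = pmorD[OF F(2)]
 fix x y assume x: "x : pts (pU X Y)" and y: "y : pts (pU X Y)" and e: "(f x, f y) : eqv (pU X' Y')"
 from e have "(f x, f y) : eqv X' | (f x, f y) : eqv Y'" by simp
 then show "(x, y) : eqv (pU X Y)"
 proof
  assume l: "(f x, f y) : eqv X'"
  then have "f x : pts X'" "f y : pts X'" using is_partD(6,7)[OF F1(2)] by blast+
  then have "x : pts X" "y : pts X" using x y F2(6) assms(4) by auto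
  then show ?thesis using l assms(1) by (simp add: piso_iff)
 next
  assume l: "(f x, f y) : eqv Y'"
  then have "f x : pts Y'" "f y : pts Y'" using is_partD(6,7)[OF F2(2)] by blast+
  then have "x : pts Y" "y : pts Y" using x y F1(6) assms(4) by auto
  then show ?thesis using l assms(2) by (simp add: piso_iff)
 qed
qed

lemma pmor_to_J:
 "is_part X ==> bij_betw f (pts X) b ==> pmor X (J b) f"
 using is_partD(1,6,7)[of X] bij_betw_finite[of f "pts X" b] by (auto simp: pmor_def bij_betw_def)

lemma piso_J: "finite b ==> bij_betw f b c ==> piso (J b) (J c) f"
 by (simp add: piso_iff pmor_to_J)

lemma part_split:
 assumes "is_part X" "p : pts X"
 defines "b \<equiv> eqv X `` {p}"
 shows "EX X'. is_part X' & b Int pts X' = {} & X = pU (J b) X'" "p : b" "finite b"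
proof -
 note P = is_partD[OF assms(1)]
 let ?L = "\<lparr>pts = pts X - b, eqv = eqv X Int (pts X - b) \<times> (pts X - b)\<rparr>"
 show "p : b" using P(3)[OF assms(2)] by (simp add: b_def)
 have bp: "b <= pts X" using P(2) by (auto simp: b_def)
 then show "finite b" using P(1) finite_subset by blast
 have "is_part ?L"
 proof (rule is_partI)
  fix x y z assume "(x, y) : eqv ?L" "(y, z) : eqv ?L"
  then show "(x, z) : eqv ?L" using P(5)[of x y z] by simp
 qed (use P(1,3,4) in auto)
 moreover have "X = pU (J b) ?L"
 proof -
  have "eqv X = b \<times> b Un eqv X Int (pts X - b) \<times> (pts X - b)"
  proof (intro equalityI subrelI)
  fix x y assume xy: "(x, y) : eqv X"
  show "(x, y) : b \<times> b Un eqv X Int (pts X - b) \<times> (pts X - b)"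
  proof (cases "x : b")
  case True then show ?thesis using P(5)[of p x y] xy by (simp add: b_def)
  next
  case False
  then have "y ~: b" using P(5)[of p y x] P(4)[OF xy] by (auto simp: b_def)
  then show ?thesis using False xy P(6,7)[OF xy] by simp
  qed
  next
  fix x y assume "(x, y) : b \<times> b Un eqv X Int (pts X - b) \<times> (pts X - b)"
  then show "(x, y) : eqv X" using P(5)[of x p y] P(4)[of p x] by (auto simp: b_def)
  qed
  moreover have "pts X = b Un (pts X - b)" using bp by blast
  ultimately show ?thesis by (cases X) (simp add: pU_def J_def)
 qed
 ultimately show "EX X'. is_part X' & b Int pts X' = {} & X = pU (J b) X'"
  by (intro exI[of _ ?L]) auto
qed

lemma part_induct [consumes 1, case_names empty block]:
 assumes "is_part X" and e: "P pempty"
  and b: "!!b X. b ~= {} ==> finite b ==> is_part X ==> b Int pts X = {} ==> P X ==> P (pU (J b) X)"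
 shows "P X"
 using assms(1)
proof (induct "card (pts X)" arbitrary: X rule: less_induct)
 case less
 show ?case
 proof (cases "pts X = {}")
  case True
  then have "X = pempty" using is_partD(2)[OF less(2)] by (cases X) (simp add: indiscrete_def)
  then show ?thesis using e by simp
 next
  case False
  then obtain p where p: "p : pts X" by blast
  let ?b = "eqv X `` {p}"
  obtain X' where L: "is_part X'" "?b Int pts X' = {}" "X = pU (J ?b) X'"
  and bb: "p : ?b" "finite ?b"
  using part_split[OF less(2) p] by blast
  have "pts X = ?b Un pts X'" using arg_cong[OF L(3), of pts] by simp
  then have "card (pts X) = card ?b + card (pts X')"
  using card_Un_disjoint[OF bb(2) is_partD(1)[OF L(1)] L(2)] by simp
  moreover have "card ?b > 0" using bb by (auto simp: card_gt_0_iff)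
  ultimately have "card (pts X') < card (pts X)" by simp
  then have "P (pU (J ?b) X')" using b[OF _ bb(2) L(1,2)] less(1) L(1) bb(1) by blast
  then show ?thesis using L(3) by simp
 qed
qed

text \<open>Two points related in \<open>Y\<close> but not in \<open>X\<close> lie in different
  blocks \<open>b\<close> and \<open>c\<close> of \<open>X\<close>, and the partition with these two
  merged still refines \<open>Y\<close>. Every refinement is thus a chain of mergings of two
  blocks.\<close>

lemma pmor_merge:
 assumes r: "pmor X Y id" and ne: "X ~= Y"
 shows "EX b c X'. b ~= {} & c ~= {} & finite b & finite c & b Int c = {} & is_part X' & (b Un c) Int pts X' = {} &
  X = pU (J b) (pU (J c) X') & pmor (pU (J (b Un c)) X') Y id"
proof -
 have ref: "is_part X" "is_part Y" "pts X = pts Y" "eqv X <= eqv Y"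
  using r by (auto simp: pmor_def bij_betw_def)
 note L = is_partD[OF ref(1)] and O = is_partD[OF ref(2)]
 have "eqv X ~= eqv Y" using ne ref(3) by (metis part.equality unit.exhaust)
 then obtain x y where xy: "(x, y) : eqv Y" "(x, y) ~: eqv X" using ref(4) by auto
 have xp: "x : pts X" "y : pts X" using O(6,7) xy ref(3) by auto
 let ?b = "eqv X `` {x}" and ?c = "eqv X `` {y}"
 obtain X1 where L1: "is_part X1" "?b Int pts X1 = {}" "X = pU (J ?b) X1" "x : ?b" "finite ?b"
  using part_split[OF ref(1) xp(1)] by blast
 have disj: "?b Int ?c = {}" using xy L(4,5) by blast
 have y1: "y : pts X1" using L1(3) xp(2) xy(2) L(3)[OF xp(1)]
  by (metis Image_singleton_iff Un_iff pts_simps(1,2))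
 have c1: "eqv X1 `` {y} = ?c"
 proof -
  have "eqv X = ?b \<times> ?b Un eqv X1" using arg_cong[OF L1(3), of eqv] by simp
  moreover have "y ~: ?b" using xy by simp
  ultimately show ?thesis by blast
 qed
 obtain X2 where L2: "is_part X2" "?c Int pts X2 = {}" "X1 = pU (J ?c) X2" "y : ?c" "finite ?c"
  using part_split[OF L1(1) y1] c1 by metis
 have ptsL: "pts X = ?b Un (?c Un pts X2)" "pts X1 = ?c Un pts X2"
  using arg_cong[OF L1(3), of pts] arg_cong[OF L2(3), of pts] by simp_all
 have eqvL: "eqv X = ?b \<times> ?b Un (?c \<times> ?c Un eqv X2)"
  using arg_cong[OF L1(3), of eqv] arg_cong[OF L2(3), of eqv] by simp
 have d: "(?b Un ?c) Int pts X2 = {}" using L1(2) L2(2) ptsL(2) by blast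
 have "is_part (pU (J (?b Un ?c)) X2)"
  using L1(5) L2(1,5) d by (intro is_part_pU) auto
 moreover have "(?b Un ?c) \<times> (?b Un ?c) <= eqv Y"
 proof -
  have "(x, z) : eqv Y" if "z : ?b Un ?c" for z using that ref(4) xy(1) O(5) by blast
  then show ?thesis using O(4,5) by blast
 qed
 ultimately have "pmor (pU (J (?b Un ?c)) X2) Y id"
  using ref eqvL ptsL(1) unfolding pmor_def by (auto simp: Un_assoc bij_betw_def)
 then show ?thesis
  using L1(3-5) L2 disj d by (intro exI[of _ ?b] exI[of _ ?c] exI[of _ X2]) auto
qed

section \<open>Double cosets of block permutations\<close>

text \<open>The contingency matrix of \<open>si\<close>, with rows for the blocks of
  \<open>X\<close> and columns for those of \<open>Z\<close>. It is going to be a complete invariant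
  of the double coset of \<open>si\<close>.\<close>

definition dmat :: "part => part => (nat => nat) => nat => nat => nat" where
 "dmat Z X si x z = card {s:pts X. lab X s = x & lab Z (si s) = z}"

text \<open>The contingency matrices with the block sizes as margins. The last condition reflects
  that a block permutation of \<open>Y\<close> moves points only within blocks of
  \<open>Y\<close>.\<close>

definition dmats :: "part => part => part => (nat => nat => nat) set" where
 "dmats Z Y X = {m. (ALL x. (\<Sum>z\<in>labs Z. m x z) = pdeg X x) & (ALL z. (\<Sum>x\<in>labs X. m x z) = pdeg Z z) &
  (ALL x z. m x z ~= 0 --> x : labs X & z : labs Z & lab Y x = lab Y z)}"

lemma block_permsD:
 assumes "si : block_perms Y"
 shows "si permutes pts Y" "!!s. s : pts Y ==> (s, si s) : eqv Y"
  "bij_betw si (pts Y) (pts Y)" "!!s. si s : pts Y \<longleftrightarrow> s : pts Y"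
  "bij si" "!!s. s ~: pts Y ==> si s = s"
proof -
 show p: "si permutes pts Y" using assms by (simp add: block_perms_def)
 show "!!s. s : pts Y ==> (s, si s) : eqv Y" using assms by (simp add: block_perms_def)
 show "bij_betw si (pts Y) (pts Y)" "!!s. si s : pts Y \<longleftrightarrow> s : pts Y" "bij si" "!!s. s ~: pts Y ==> si s = s"
  using permutes_imp_bij[OF p] permutes_in_image[OF p] permutes_bij[OF p] permutes_not_in[OF p] by auto
qed

lemma block_perms_lab:
 assumes "is_part Y" "si : block_perms Y" "s : pts Y"
 shows "lab Y (si s) = lab Y s"
 using block_permsD[OF assms(2)] assms lab_eq_iff[OF assms(1), of s "si s"] by simp

lemma block_permsI:
 assumes "is_part Y" "bij_betw si (pts Y) (pts Y)" "!!s. s : pts Y ==> lab Y (si s) = lab Y s"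
 shows "(%s. if s : pts Y then si s else s) : block_perms Y"
proof -
 have c: "si s : pts Y" if "s : pts Y" for s using assms(2) that by (auto simp: bij_betw_def)
 have "(%s. if s : pts Y then si s else s) permutes pts Y"
  using assms(2) by (intro bij_imp_permutes) (auto cong: bij_betw_cong)
 moreover have "(s, si s) : eqv Y" if "s : pts Y" for s
  using assms(3)[OF that] lab_eq_iff[OF assms(1) that c[OF that]] by simp
 ultimately show ?thesis by (auto simp: block_perms_def)
qed

context
 fixes Z Y X
 assumes G: "prefines Z Y" and L: "prefines X Y"
begin

lemma dc_parts: "is_part Z" "is_part Y" "is_part X" "pts Z = pts Y" "pts X = pts Y"
 using G L by (auto simp: prefines_iff)

lemma dc_lab: "s : pts Y ==> lab Y (lab Z s) = lab Y s" "s : pts Y ==> lab Y (lab X s) = lab Y s"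
proof -
 have m: "pmor Z Y id" "pmor X Y id" using G L by (auto simp: prefines_def)
 show "s : pts Y ==> lab Y (lab Z s) = lab Y s" "s : pts Y ==> lab Y (lab X s) = lab Y s"
  using pmor_lab[OF m(1), of s] pmor_lab[OF m(2), of s] dc_parts by auto
qed

lemma dmat_invariant:
 assumes "si : block_perms Y" "\<gamma> : block_perms Z" "\<delta> : block_perms X"
 shows "dmat Z X (\<gamma> o si o \<delta>) = dmat Z X si"
proof (intro ext)
 fix x z
 note s = block_permsD[OF assms(1)] and g = block_permsD[OF assms(2)] and d = block_permsD[OF assms(3)]
 have l: "lab X (\<delta> s) = lab X s" if "s : pts X" for s
  using block_perms_lab[OF dc_parts(3) assms(3) that] .
 have l': "lab Z (\<gamma> s) = lab Z s" if "s : pts Y" for s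
  using block_perms_lab[OF dc_parts(1) assms(2), of s] that dc_parts(4) by simp
 let ?A = "{s:pts X. lab X s = x & lab Z ((\<gamma> o si o \<delta>) s) = z}"
 let ?B = "{s:pts X. lab X s = x & lab Z (si s) = z}"
 have "\<delta> ` ?A = ?B"
 proof
  show "\<delta> ` ?A <= ?B" using l l' d(4) s(4) dc_parts by auto
  show "?B <= \<delta> ` ?A"
  proof
  fix t assume t: "t : ?B"
  then obtain u where u: "t = \<delta> u" "u : pts X" using d(3) by (auto simp: bij_betw_def)
  then have "u : ?A" using t l l' s(4) d(4) dc_parts by auto
  then show "t : \<delta> ` ?A" using u by blast
  qed
 qed
 moreover have "inj_on \<delta> ?A" using d(5) by (meson bij_is_inj inj_on_subset subset_UNIV)
 then have "card (\<delta> ` ?A) = card ?A" by (rule card_image)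
 ultimately show "dmat Z X (\<gamma> o si o \<delta>) x z = dmat Z X si x z"
  unfolding dmat_def by (simp only:)
qed

text \<open>Equal matrices say that the pairs \<open>(lab X s, lab Z (tau s))\<close> and
  \<open>(lab X s, lab Z (si s))\<close> have fibres of equal size. A bijection matching the fibres
  preserves the blocks of \<open>X\<close>, which gives \<open>\<delta>\<close>; then
  \<open>\<gamma>\<close> is forced by the equation and preserves the blocks of
  \<open>Z\<close>.\<close>

lemma dmat_eq_imp:
 assumes s: "si : block_perms Y" and t: "tau : block_perms Y" and eq: "dmat Z X si = dmat Z X tau"
 shows "EX \<gamma>:block_perms Z. EX \<delta>:block_perms X. tau = \<gamma> o si o \<delta>"
proof -
 note S = block_permsD[OF s] and T = block_permsD[OF t]
 have fin: "finite (pts Y)" using is_partD(1)[OF dc_parts(2)] .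
 have "EX \<beta>. bij_betw \<beta> (pts Y) (pts Y) &
  (ALL s:pts Y. (lab X (\<beta> s), lab Z (si (\<beta> s))) = (lab X s, lab Z (tau s)))"
 proof (rule fiber_bij[OF fin fin])
  fix i :: "nat \<times> nat"
  have "card {s:pts X. lab X s = fst i & lab Z (tau s) = snd i} =
  card {s:pts X. lab X s = fst i & lab Z (si s) = snd i}"
  using fun_cong[OF fun_cong[OF eq, of "fst i"], of "snd i"] by (simp add: dmat_def)
  then show "card {s:pts Y. (lab X s, lab Z (tau s)) = i} = card {s:pts Y. (lab X s, lab Z (si s)) = i}"
  using dc_parts(5) by (cases i) simp
 qed
 then obtain \<beta> where b: "bij_betw \<beta> (pts Y) (pts Y)" "!!s. s : pts Y ==> lab X (\<beta> s) = lab X s"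
  "!!s. s : pts Y ==> lab Z (si (\<beta> s)) = lab Z (tau s)" by auto
 define \<delta> where "\<delta> = (%s. if s : pts Y then \<beta> s else s)"
 have d: "\<delta> : block_perms X"
  using block_permsI[OF dc_parts(3), of \<beta>] b dc_parts(5) by (simp add: \<delta>_def)
 note D = block_permsD[OF d]
 let ?c = "si o \<delta>"
 have pc: "?c permutes pts Y" using S(1) D(1) dc_parts(5) by (simp add: permutes_compose)
 define \<gamma> where "\<gamma> = tau o inv_into UNIV ?c"
 have pg: "\<gamma> permutes pts Y" unfolding \<gamma>_def by (intro permutes_compose permutes_inv pc T(1))
 have e: "\<gamma> o si o \<delta> = tau"
  using permutes_inv_o(2)[OF pc] by (simp add: \<gamma>_def comp_assoc)
 have "\<gamma> : block_perms Z"
 proof -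
  have "lab Z (\<gamma> u) = lab Z u" if u: "u : pts Y" for u
  proof -
  obtain s where s': "s : pts Y" "u = ?c s" using u permutes_image[OF pc] by blast
  have "\<gamma> u = tau s" using fun_cong[OF e, of s] s' by simp
  moreover have "lab Z u = lab Z (tau s)" using b(3) s' by (simp add: \<delta>_def)
  ultimately show ?thesis by simp
  qed
  then have "(u, \<gamma> u) : eqv Z" if "u : pts Z" for u
  using lab_eq_iff[OF dc_parts(1), of u "\<gamma> u"] that dc_parts(4) permutes_in_image[OF pg] by auto
  then show ?thesis using pg dc_parts(4) by (simp add: block_perms_def)
 qed
 then show ?thesis using d e by metis
qed

lemma dmat_dmats:
 assumes s: "si : block_perms Y" shows "dmat Z X si : dmats Z Y X"
proof -
 note S = block_permsD[OF s]
 have fin: "finite (pts X)" using is_partD(1)[OF dc_parts(3)] .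
 have sl: "lab Z (si s) : labs Z" if "s : pts X" for s
  using that S(4) dc_parts by (auto simp: labs_def)
 have "(\<Sum>z\<in>labs Z. dmat Z X si x z) = pdeg X x" for x
 proof -
  have "pdeg X x = (\<Sum>z\<in>labs Z. card {s:{s:pts X. lab X s = x}. lab Z (si s) = z})"
  unfolding pdeg_def using fin finite_labs[OF dc_parts(1)] sl by (intro card_fibers) auto
  then show ?thesis by (simp add: dmat_def conj_assoc)
 qed
 moreover have "(\<Sum>x\<in>labs X. dmat Z X si x z) = pdeg Z z" for z
 proof -
  have "{s:pts Z. lab Z s = z} = si ` {s:pts X. lab Z (si s) = z}"
  proof
  show "{s:pts Z. lab Z s = z} <= si ` {s:pts X. lab Z (si s) = z}"
  proof
  fix u assume u: "u : {s:pts Z. lab Z s = z}"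
  then have "u : si ` pts Y" using permutes_image[OF S(1)] dc_parts by simp
  then obtain v where "v : pts Y" "u = si v" by blast
  then show "u : si ` {s:pts X. lab Z (si s) = z}" using u dc_parts by auto
  qed
  qed (use S(4) dc_parts in auto)
  then have "pdeg Z z = card {s:pts X. lab Z (si s) = z}"
  unfolding pdeg_def using inj_on_subset[OF bij_is_inj[OF S(5)] subset_UNIV] by (simp add: card_image)
  also have "... = (\<Sum>x\<in>labs X. card {s:{s:pts X. lab Z (si s) = z}. lab X s = x})"
  using fin finite_labs[OF dc_parts(3)] by (intro card_fibers) (auto simp: labs_def)
  also have "... = (\<Sum>x\<in>labs X. dmat Z X si x z)"
  by (intro sum.cong refl) (auto simp: dmat_def intro!: arg_cong[where f = card])
  finally show ?thesis by simp
 qed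
 moreover have "x : labs X & z : labs Z & lab Y x = lab Y z" if nz: "dmat Z X si x z ~= 0" for x z
 proof -
  obtain s where s': "s : pts X" "lab X s = x" "lab Z (si s) = z"
  proof -
  have "{s:pts X. lab X s = x & lab Z (si s) = z} ~= {}"
  using nz unfolding dmat_def by (metis card.empty)
  then show thesis using that by blast
  qed
  have "lab Y (si s) = lab Y s" using block_perms_lab[OF dc_parts(2) s] s' dc_parts by simp
  then have "lab Y x = lab Y z" using dc_lab s' S(4) dc_parts by metis
  then show ?thesis using s' sl by (auto simp: labs_def)
 qed
 ultimately show ?thesis by (simp add: dmats_def)
qed

text \<open>The auxiliary set \<open>?S\<close> has over each cell as many elements as the entry
  says. The row sums allow the points of \<open>X\<close> to be matched with \<open>?S\<close> along
  the rows. The column \<open>c s\<close> thereby assigned to a point \<open>s\<close> occurs as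
  often as the column sum says, so that a permutation can realise it.\<close>

lemma dmat_surj:
 assumes m: "m : dmats Z Y X" shows "EX si:block_perms Y. dmat Z X si = m"
proof -
 have M: "!!x. (\<Sum>z\<in>labs Z. m x z) = pdeg X x" "!!z. (\<Sum>x\<in>labs X. m x z) = pdeg Z z"
  "!!x z. m x z ~= 0 ==> x : labs X & z : labs Z & lab Y x = lab Y z"
  using m by (auto simp: dmats_def)
 have fin: "finite (pts X)" "finite (labs X)" "finite (labs Z)"
  using is_partD(1)[OF dc_parts(3)] finite_labs dc_parts by auto
 let ?S = "SIGMA x:labs X. SIGMA z:labs Z. {..<m x z}"
 have finS: "finite ?S" using fin by auto
 have "EX \<beta>. bij_betw \<beta> (pts X) ?S & (ALL s:pts X. fst (\<beta> s) = lab X s)"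
 proof (rule fiber_bij[OF fin(1) finS])
  fix x
  show "card {s:pts X. lab X s = x} = card {u:?S. fst u = x}"
  proof (cases "x : labs X")
  case True
  then have "{u:?S. fst u = x} = Pair x ` (SIGMA z:labs Z. {..<m x z})" by auto
  then have "card {u:?S. fst u = x} = (\<Sum>z\<in>labs Z. m x z)"
  using fin by (simp add: card_image inj_on_def)
  then show ?thesis using M(1) by (simp add: pdeg_def)
  next
  case False
  then have "{u:?S. fst u = x} = {}" by auto
  moreover have "{s:pts X. lab X s = x} = {}" using False by (auto simp: labs_def)
  ultimately show ?thesis by (simp only: card.empty)
  qed
 qed
 then obtain \<beta> where b: "bij_betw \<beta> (pts X) ?S" "!!s. s : pts X ==> fst (\<beta> s) = lab X s" by blast
 define c where "c s = fst (snd (\<beta> s))" for s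
 have bin: "\<beta> s : ?S" if "s : pts X" for s using b(1) that by (auto simp: bij_betw_def)
 have fib: "card {s:pts X. Q (\<beta> s)} = card {u:?S. Q u}" for Q
 proof -
  have "{u:?S. Q u} = \<beta> ` {s:pts X. Q (\<beta> s)}"
  unfolding bij_betw_imp_surj_on[OF b(1), symmetric] by blast
  moreover have "inj_on \<beta> {s:pts X. Q (\<beta> s)}"
  using b(1) by (auto simp: bij_betw_def inj_on_def)
  ultimately show ?thesis by (simp add: card_image)
 qed
 have cm: "card {s:pts X. lab X s = x & c s = z} = m x z" for x z
 proof -
  have "{s:pts X. lab X s = x & c s = z} = {s:pts X. fst (\<beta> s) = x & fst (snd (\<beta> s)) = z}"
  using b(2) by (auto simp: c_def)
  also have "card ... = card {u:?S. fst u = x & fst (snd u) = z}" by (rule fib)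
  also have "{u:?S. fst u = x & fst (snd u) = z} = (%i. (x, z, i)) ` {..<m x z}"
  using M(3)[of x z] by force
  also have "card ... = m x z" by (simp add: card_image inj_on_def)
  finally show ?thesis .
 qed
 have cz: "card {s:pts X. c s = z} = pdeg Z z" for z
 proof -
  have "card {s:pts X. c s = z} = (\<Sum>x\<in>labs X. card {s:{s:pts X. c s = z}. lab X s = x})"
  using fin by (intro card_fibers) (auto simp: labs_def)
  also have "... = (\<Sum>x\<in>labs X. m x z)"
  by (intro sum.cong refl) (auto simp: cm[symmetric] intro!: arg_cong[where f = card])
  finally show ?thesis using M(2) by simp
 qed
 have "EX si. bij_betw si (pts X) (pts Z) & (ALL s:pts X. lab Z (si s) = c s)"
  using fin(1) is_partD(1)[OF dc_parts(1)] cz by (intro fiber_bij) (auto simp: pdeg_def)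
 then obtain si where s: "bij_betw si (pts Y) (pts Y)" "!!s. s : pts Y ==> lab Z (si s) = c s"
  using dc_parts by auto
 have "lab Y (si s) = lab Y s" if sp: "s : pts Y" for s
 proof -
  have "s : {t:pts X. lab X t = lab X s & c t = c s}" using sp dc_parts by simp
  then have "m (lab X s) (c s) ~= 0" using cm[of "lab X s" "c s"] fin(1)
  by (metis (no_types, lifting) card_0_eq empty_iff finite_subset mem_Collect_eq subsetI)
  then have "lab Y (lab X s) = lab Y (c s)" using M(3) by blast
  moreover have "si s : pts Y" using s(1) sp by (auto simp: bij_betw_def)
  ultimately show ?thesis using dc_lab sp s(2) by metis
 qed
 then have bp: "(%s. if s : pts Y then si s else s) : block_perms Y"
  by (rule block_permsI[OF dc_parts(2) s(1)])
 moreover have "dmat Z X (%s. if s : pts Y then si s else s) = m"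
 proof (intro ext)
  fix x z
  have "{t:pts X. lab X t = x & lab Z (if t : pts Y then si t else t) = z} =
  {t:pts X. lab X t = x & c t = z}" using s(2) dc_parts by auto
  then show "dmat Z X (%s. if s : pts Y then si s else s) x z = m x z"
  using cm by (simp add: dmat_def)
 qed
 ultimately show ?thesis by blast
qed

lemma dmat_eq_iff:
 assumes "si : block_perms Y" "tau : block_perms Y"
 shows "(EX \<gamma>:block_perms Z. EX \<delta>:block_perms X. tau = \<gamma> o si o \<delta>) \<longleftrightarrow> dmat Z X tau = dmat Z X si"
 using dmat_invariant[OF assms(1)] dmat_eq_imp[OF assms] by metis

text \<open>A sum over an arbitrary transversal thus becomes a sum over matrices.\<close>

lemma dcoset_reps_bij:
 assumes "dcoset_reps Z Y X T"
 shows "bij_betw (dmat Z X) T (dmats Z Y X)"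
proof -
 have T: "T <= block_perms Y" and ex: "!!si. si : block_perms Y ==> EX! tau. tau : T & dmat Z X tau = dmat Z X si"
 proof -
  show T: "T <= block_perms Y" using assms by (simp add: dcoset_reps_def)
  fix si assume s: "si : block_perms Y"
  have "EX! tau. tau : T & (EX \<gamma>:block_perms Z. EX \<delta>:block_perms X. tau = \<gamma> o si o \<delta>)"
  using assms s by (simp add: dcoset_reps_def)
  moreover have "(tau : T & (EX \<gamma>:block_perms Z. EX \<delta>:block_perms X. tau = \<gamma> o si o \<delta>)) \<longleftrightarrow>
  (tau : T & dmat Z X tau = dmat Z X si)" for tau
  using dmat_eq_iff[OF s, of tau] T by blast
  ultimately show "EX! tau. tau : T & dmat Z X tau = dmat Z X si" by simp
 qed
 have "inj_on (dmat Z X) T"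
 proof (rule inj_onI)
  fix a b assume ab: "a : T" "b : T" "dmat Z X a = dmat Z X b"
  then have "a : block_perms Y" using T by blast
  note e = ex[OF this]
  show "a = b"
  using the1_equality[OF e, of a] the1_equality[OF e, of b] ab by simp
 qed
 moreover have "dmat Z X ` T = dmats Z Y X"
 proof
  show "dmat Z X ` T <= dmats Z Y X" using dmat_dmats T by blast
  show "dmats Z Y X <= dmat Z X ` T"
  proof
  fix m assume "m : dmats Z Y X"
  then obtain si where s: "si : block_perms Y" "dmat Z X si = m" using dmat_surj by blast
  then obtain tau where "tau : T" "dmat Z X tau = dmat Z X si" using ex1_implies_ex[OF ex[OF s(1)]] by blast
  then have "m = dmat Z X tau" "tau : T" using s(2) by simp_all
  then show "m : dmat Z X ` T" by (rule image_eqI)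
  qed
 qed
 ultimately show ?thesis by (simp add: bij_betw_def)
qed

end

lemma finite_block_perms: "is_part Y ==> finite (block_perms Y)"
 using finite_permutations[of "pts Y"] is_partD(1)[of Y]
 by (auto simp: block_perms_def intro: finite_subset[of _ "{p. p permutes pts Y}"])

section \<open>Fully faithful and essentially surjective functors\<close>

text \<open>The quasi-inverse chooses for each object \<open>Y\<close> an object \<open>G Y\<close>
  with an isomorphism \<open>e Y\<close> from its image, conjugates arrows by these isomorphisms and
  takes preimages under the bijection of hom sets. Faithfulness reduces each equation in
  \<open>C\<close> to one in \<open>D\<close>.\<close>

lemma equivalence_from_ff_es:
 assumes C: "is_category C" and D: "is_category D" and F: "is_functor C D Fo Fa"
  and ff: "!!X Y. X : Obj C ==> Y : Obj C ==> bij_betw (Fa X Y) (Hom C X Y) (Hom D (Fo X) (Fo Y))"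
  and es: "!!Y. Y : Obj D ==> EX X:Obj C. EX f. is_iso D (Fo X) Y f"
 shows "is_equivalence C D Fo Fa"
proof -
 have Ci: "!!X. X : Obj C ==> Ident C X : Hom C X X"
  and Cc: "!!X Y Z f g. X : Obj C ==> Y : Obj C ==> Z : Obj C ==> f : Hom C X Y ==> g : Hom C Y Z ==>
  Comp C X Y Z g f : Hom C X Z"
  using C unfolding is_category_def by blast+
 have Di: "!!X. X : Obj D ==> Ident D X : Hom D X X"
  and Dc: "!!X Y Z f g. X : Obj D ==> Y : Obj D ==> Z : Obj D ==> f : Hom D X Y ==> g : Hom D Y Z ==>
  Comp D X Y Z g f : Hom D X Z"
  and Dl: "!!X Y f. X : Obj D ==> Y : Obj D ==> f : Hom D X Y ==> Comp D X X Y f (Ident D X) = f"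
  and Dr: "!!X Y f. X : Obj D ==> Y : Obj D ==> f : Hom D X Y ==> Comp D X Y Y (Ident D Y) f = f"
  and Da: "!!W X Y Z f g h. W : Obj D ==> X : Obj D ==> Y : Obj D ==> Z : Obj D ==>
  f : Hom D W X ==> g : Hom D X Y ==> h : Hom D Y Z ==>
  Comp D W X Z (Comp D X Y Z h g) f = Comp D W Y Z h (Comp D W X Y g f)"
  using D unfolding is_category_def by (blast, blast, blast, blast, metis)
 have Fo: "!!X. X : Obj C ==> Fo X : Obj D"
  and Fh: "!!X Y f. X : Obj C ==> Y : Obj C ==> f : Hom C X Y ==> Fa X Y f : Hom D (Fo X) (Fo Y)"
  and Fi: "!!X. X : Obj C ==> Fa X X (Ident C X) = Ident D (Fo X)"
  and Fc: "!!X Y Z f g. X : Obj C ==> Y : Obj C ==> Z : Obj C ==> f : Hom C X Y ==> g : Hom C Y Z ==>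
  Fa X Z (Comp C X Y Z g f) = Comp D (Fo X) (Fo Y) (Fo Z) (Fa Y Z g) (Fa X Y f)"
  using F unfolding is_functor_def by blast+
 have inj: "f = g" if "X : Obj C" "Y : Obj C" "f : Hom C X Y" "g : Hom C X Y" "Fa X Y f = Fa X Y g"
  for X Y f g
  using ff[OF that(1,2)] that(3-) unfolding bij_betw_def by (auto dest: inj_onD)
 define L where "L X Y h = inv_into (Hom C X Y) (Fa X Y) h" for X Y h
 have L: "L X Y h : Hom C X Y" "Fa X Y (L X Y h) = h"
  if "X : Obj C" "Y : Obj C" "h : Hom D (Fo X) (Fo Y)" for X Y h
 proof -
  have "h : Fa X Y ` Hom C X Y" using ff[OF that(1,2)] that(3) by (simp add: bij_betw_def)
  then show "L X Y h : Hom C X Y" "Fa X Y (L X Y h) = h"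
  unfolding L_def by (auto intro: inv_into_into f_inv_into_f)
 qed
 have "ALL Y:Obj D. EX X f g. X : Obj C & f : Hom D (Fo X) Y & g : Hom D Y (Fo X) &
  Comp D (Fo X) Y (Fo X) g f = Ident D (Fo X) & Comp D Y (Fo X) Y f g = Ident D Y"
 proof
  fix Y assume "Y : Obj D"
  then obtain X f where "X : Obj C" "is_iso D (Fo X) Y f" using es by blast
  then show "EX X f g. X : Obj C & f : Hom D (Fo X) Y & g : Hom D Y (Fo X) &
  Comp D (Fo X) Y (Fo X) g f = Ident D (Fo X) & Comp D Y (Fo X) Y f g = Ident D Y"
  unfolding is_iso_def by blast
 qed
 then obtain G e e' where G: "!!Y. Y : Obj D ==> G Y : Obj C"
  and e: "!!Y. Y : Obj D ==> e Y : Hom D (Fo (G Y)) Y"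
  and e': "!!Y. Y : Obj D ==> e' Y : Hom D Y (Fo (G Y))"
  and e'e: "!!Y. Y : Obj D ==> Comp D (Fo (G Y)) Y (Fo (G Y)) (e' Y) (e Y) = Ident D (Fo (G Y))"
  and ee': "!!Y. Y : Obj D ==> Comp D Y (Fo (G Y)) Y (e Y) (e' Y) = Ident D Y"
  unfolding bchoice_iff by blast
 let ?FG = "%Y. Fo (G Y)"
 have FG: "!!Y. Y : Obj D ==> ?FG Y : Obj D" using G Fo by blast
 define Ga where "Ga Y Z g = L (G Y) (G Z) (Comp D (?FG Y) Z (?FG Z) (e' Z) (Comp D (?FG Y) Y Z g (e Y)))"
  for Y Z g
 have m: "Comp D (?FG Y) Y Z g (e Y) : Hom D (?FG Y) Z"
  "Comp D (?FG Y) Z (?FG Z) (e' Z) (Comp D (?FG Y) Y Z g (e Y)) : Hom D (?FG Y) (?FG Z)"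
  if "Y : Obj D" "Z : Obj D" "g : Hom D Y Z" for Y Z g
  using that e e' FG Dc by auto
 have Ga: "Ga Y Z g : Hom C (G Y) (G Z)"
  "Fa (G Y) (G Z) (Ga Y Z g) = Comp D (?FG Y) Z (?FG Z) (e' Z) (Comp D (?FG Y) Y Z g (e Y))"
  if "Y : Obj D" "Z : Obj D" "g : Hom D Y Z" for Y Z g
  unfolding Ga_def using L[OF G G m(2)] that by auto
 have nat: "Comp D (?FG Y) (?FG Z) Z (e Z) (Fa (G Y) (G Z) (Ga Y Z g)) = Comp D (?FG Y) Y Z g (e Y)"
  if "Y : Obj D" "Z : Obj D" "g : Hom D Y Z" for Y Z g
 proof -
  have "Comp D (?FG Y) (?FG Z) Z (e Z) (Fa (G Y) (G Z) (Ga Y Z g)) =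
  Comp D (?FG Y) Z Z (Comp D Z (?FG Z) Z (e Z) (e' Z)) (Comp D (?FG Y) Y Z g (e Y))"
  unfolding Ga(2)[OF that]
  by (rule Da[symmetric]) (use that FG e e' m in auto)
  then show ?thesis using ee' Dr m FG that by simp
 qed
 \<comment> \<open>\<open>e Y\<close> has the left inverse \<open>e' Y\<close> and can be cancelled,
   so functoriality of \<open>G\<close> is checked after composition with \<open>e\<close>.\<close>
 have cancel: "u = v" if "Y : Obj D" "X : Obj D" "u : Hom D X (?FG Y)" "v : Hom D X (?FG Y)"
  "Comp D X (?FG Y) Y (e Y) u = Comp D X (?FG Y) Y (e Y) v" for X Y u v
 proof -
  have "w = Comp D X Y (?FG Y) (e' Y) (Comp D X (?FG Y) Y (e Y) w)" if "w : Hom D X (?FG Y)" for w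
  using Da[of X "?FG Y" Y "?FG Y" w "e Y" "e' Y"] e'e Dr[of X "?FG Y" w] e e' FG
  \<open>Y : Obj D\<close> \<open>X : Obj D\<close> that by simp
  then show ?thesis using that(3-) by metis
 qed
 have Gfun: "is_functor D C G Ga"
  unfolding is_functor_def
 proof (intro conjI ballI)
  fix X assume X: "X : Obj D"
  show "G X : Obj C" using G X .
  show "Ga X X (Ident D X) = Ident C (G X)"
  proof (rule inj[OF G[OF X] G[OF X] Ga(1)[OF X X Di[OF X]] Ci[OF G[OF X]]])
  show "Fa (G X) (G X) (Ga X X (Ident D X)) = Fa (G X) (G X) (Ident C (G X))"
  using Ga(2)[OF X X Di[OF X]] Fi[OF G[OF X]] Dr[OF FG[OF X] X e[OF X]] e'e[OF X] by simp
  qed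
  fix Y assume Y: "Y : Obj D"
  show "Ga X Y f : Hom C (G X) (G Y)" if "f : Hom D X Y" for f using Ga(1)[OF X Y that] .
  fix Z f g assume Z: "Z : Obj D" and f: "f : Hom D X Y" and g: "g : Hom D Y Z"
  note gf = Dc[OF X Y Z f g]
  show "Ga X Z (Comp D X Y Z g f) = Comp C (G X) (G Y) (G Z) (Ga Y Z g) (Ga X Y f)"
  proof (rule inj[OF G[OF X] G[OF Z] Ga(1)[OF X Z gf] Cc[OF G[OF X] G[OF Y] G[OF Z] Ga(1)[OF X Y f] Ga(1)[OF Y Z g]]])
  let ?a = "Fa (G X) (G Y) (Ga X Y f)" and ?b = "Fa (G Y) (G Z) (Ga Y Z g)"
  have a: "?a : Hom D (?FG X) (?FG Y)" and b: "?b : Hom D (?FG Y) (?FG Z)"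
  using Fh G Ga(1) X Y Z f g by auto
  have ba: "Comp D (?FG X) (?FG Y) (?FG Z) ?b ?a : Hom D (?FG X) (?FG Z)"
  using Dc[OF FG[OF X] FG[OF Y] FG[OF Z] a b] .
  have "Fa (G X) (G Z) (Ga X Z (Comp D X Y Z g f)) = Comp D (?FG X) (?FG Y) (?FG Z) ?b ?a"
  proof (rule cancel[OF Z FG[OF X] _ ba])
  show "Fa (G X) (G Z) (Ga X Z (Comp D X Y Z g f)) : Hom D (?FG X) (?FG Z)"
  using Fh[OF G[OF X] G[OF Z] Ga(1)[OF X Z gf]] .
  have "Comp D (?FG X) (?FG Z) Z (e Z) (Comp D (?FG X) (?FG Y) (?FG Z) ?b ?a) =
  Comp D (?FG X) (?FG Y) Z (Comp D (?FG Y) (?FG Z) Z (e Z) ?b) ?a"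
  using Da[OF FG[OF X] FG[OF Y] FG[OF Z] Z a b e[OF Z]] by simp
  also have "... = Comp D (?FG X) (?FG Y) Z (Comp D (?FG Y) Y Z g (e Y)) ?a"
  using nat[OF Y Z g] by simp
  also have "... = Comp D (?FG X) Y Z g (Comp D (?FG X) (?FG Y) Y (e Y) ?a)"
  using Da[OF FG[OF X] FG[OF Y] Y Z a e[OF Y] g] .
  also have "... = Comp D (?FG X) Y Z g (Comp D (?FG X) X Y f (e X))"
  using nat[OF X Y f] by simp
  also have "... = Comp D (?FG X) X Z (Comp D X Y Z g f) (e X)"
  using Da[OF FG[OF X] X Y Z e[OF X] f g] by simp
  finally show "Comp D (?FG X) (?FG Z) Z (e Z) (Fa (G X) (G Z) (Ga X Z (Comp D X Y Z g f))) =
  Comp D (?FG X) (?FG Z) Z (e Z) (Comp D (?FG X) (?FG Y) (?FG Z) ?b ?a)"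
  using nat[OF X Z gf] by simp
  qed
  then show "Fa (G X) (G Z) (Ga X Z (Comp D X Y Z g f)) =
  Fa (G X) (G Z) (Comp C (G X) (G Y) (G Z) (Ga Y Z g) (Ga X Y f))"
  using Fc[OF G[OF X] G[OF Y] G[OF Z] Ga(1)[OF X Y f] Ga(1)[OF Y Z g]] by simp
  qed
 qed
 have beta: "is_natural_iso D D (%X. Fo (G X)) (%X Y f. Fa (G X) (G Y) (Ga X Y f)) (%X. X) (%X Y f. f) e"
  unfolding is_natural_iso_def is_iso_def
 proof (intro conjI ballI)
  fix X assume X: "X : Obj D"
  show "e X : Hom D (Fo (G X)) X" using e[OF X] .
  show "EX g:Hom D X (Fo (G X)). Comp D (Fo (G X)) X (Fo (G X)) g (e X) = Ident D (Fo (G X)) &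
  Comp D X (Fo (G X)) X (e X) g = Ident D X"
  using e'[OF X] e'e[OF X] ee'[OF X] by blast
 qed (rule nat)
 \<comment> \<open>The unit goes from \<open>X\<close> to \<open>G (Fo X)\<close>, so it is the
   preimage of the inverse \<open>e'\<close>, not of \<open>e\<close>.\<close>
 define al where "al X = L X (G (Fo X)) (e' (Fo X))" for X
 define al' where "al' X = L (G (Fo X)) X (e (Fo X))" for X
 have al: "al X : Hom C X (G (Fo X))" "Fa X (G (Fo X)) (al X) = e' (Fo X)"
  "al' X : Hom C (G (Fo X)) X" "Fa (G (Fo X)) X (al' X) = e (Fo X)" if X: "X : Obj C" for X
  unfolding al_def al'_def
  using L[OF X G[OF Fo[OF X]] e'[OF Fo[OF X]]] L[OF G[OF Fo[OF X]] X e[OF Fo[OF X]]] by auto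
 have alpha: "is_natural_iso C C (%X. X) (%X Y f. f)
  (%X. G (Fo X)) (%X Y f. Ga (Fo X) (Fo Y) (Fa X Y f)) al"
  unfolding is_natural_iso_def is_iso_def
 proof (intro conjI ballI)
  fix X assume X: "X : Obj C"
  note GX = G[OF Fo[OF X]]
  show "al X : Hom C X (G (Fo X))" using al(1)[OF X] .
  show "EX g:Hom C (G (Fo X)) X. Comp C X (G (Fo X)) X g (al X) = Ident C X &
  Comp C (G (Fo X)) X (G (Fo X)) (al X) g = Ident C (G (Fo X))"
  proof (intro bexI[OF _ al(3)[OF X]] conjI)
  show "Comp C X (G (Fo X)) X (al' X) (al X) = Ident C X"
  by (rule inj[OF X X Cc[OF X GX X al(1)[OF X] al(3)[OF X]] Ci[OF X]])
  (simp add: Fc[OF X GX X al(1)[OF X] al(3)[OF X]] al[OF X] Fi[OF X] ee' Fo[OF X])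
  show "Comp C (G (Fo X)) X (G (Fo X)) (al X) (al' X) = Ident C (G (Fo X))"
  by (rule inj[OF GX GX Cc[OF GX X GX al(3)[OF X] al(1)[OF X]] Ci[OF GX]])
  (simp add: Fc[OF GX X GX al(3)[OF X] al(1)[OF X]] al[OF X] Fi[OF GX] e'e Fo[OF X])
  qed
  fix Y f assume Y: "Y : Obj C" and f: "f : Hom C X Y"
  note GY = G[OF Fo[OF Y]] and Ff = Fh[OF X Y f] and FX = Fo[OF X] and FY = Fo[OF Y]
  note Gf = Ga(1)[OF FX FY Ff]
  show "Comp C X Y (G (Fo Y)) (al Y) f = Comp C X (G (Fo X)) (G (Fo Y)) (Ga (Fo X) (Fo Y) (Fa X Y f)) (al X)"
  proof (rule inj[OF X GY Cc[OF X Y GY f al(1)[OF Y]] Cc[OF X GX GY al(1)[OF X] Gf]])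
  let ?E = "Comp D (?FG (Fo X)) (Fo X) (Fo Y) (Fa X Y f) (e (Fo X))"
  have E: "?E : Hom D (?FG (Fo X)) (Fo Y)" using m(1)[OF FX FY Ff] .
  have "Fa X (G (Fo Y)) (Comp C X (G (Fo X)) (G (Fo Y)) (Ga (Fo X) (Fo Y) (Fa X Y f)) (al X)) =
  Comp D (Fo X) (?FG (Fo X)) (?FG (Fo Y)) (Comp D (?FG (Fo X)) (Fo Y) (?FG (Fo Y)) (e' (Fo Y)) ?E) (e' (Fo X))"
  using Fc[OF X GX GY al(1)[OF X] Gf] al(2)[OF X] Ga(2)[OF FX FY Ff] by simp
  also have "... = Comp D (Fo X) (Fo Y) (?FG (Fo Y)) (e' (Fo Y)) (Comp D (Fo X) (?FG (Fo X)) (Fo Y) ?E (e' (Fo X)))"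
  using Da[OF FX FG[OF FX] FY FG[OF FY] e'[OF FX] E e'[OF FY]] .
  also have "Comp D (Fo X) (?FG (Fo X)) (Fo Y) ?E (e' (Fo X)) =
  Comp D (Fo X) (Fo X) (Fo Y) (Fa X Y f) (Comp D (Fo X) (?FG (Fo X)) (Fo X) (e (Fo X)) (e' (Fo X)))"
  using Da[OF FX FG[OF FX] FX FY e'[OF FX] e[OF FX] Ff] .
  also have "... = Fa X Y f" using ee'[OF FX] Dl[OF FX FY Ff] by simp
  finally show "Fa X (G (Fo Y)) (Comp C X Y (G (Fo Y)) (al Y) f) =
  Fa X (G (Fo Y)) (Comp C X (G (Fo X)) (G (Fo Y)) (Ga (Fo X) (Fo Y) (Fa X Y f)) (al X))"
  using Fc[OF X Y GY f al(1)[OF Y]] al(2)[OF Y] by simp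
  qed
 qed
 show ?thesis
  unfolding is_equivalence_def using C D F Gfun alpha beta by blast
qed

section \<open>Internal products in a symmetric monoidal partition functor\<close>

lemma copair_simps [simp]: "copair f g (inl x) = f x" "copair f g (inr y) = g y"
 by (simp_all add: copair_def)

lemma psum_map_simps [simp]: "psum_map f g (inl x) = inl (f x)" "psum_map f g (inr y) = inr (g y)"
 by (simp_all add: psum_map_def)

lemma pcodiag_simps [simp]: "pcodiag (inl x) = x" "pcodiag (inr x) = x"
 by (simp_all add: pcodiag_def)

lemma pconcat_simps [simp]: "pconcat i (inl x) = x" "pconcat i (inr x) = i + x"
 by (simp_all add: pconcat_def)

lemma pswap_simps [simp]: "pswap (inl x) = inr x" "pswap (inr x) = inl x"
 by (simp_all add: pswap_def)

lemma passoc_simps [simp]: "passoc (inl (inl x)) = inl x" "passoc (inl (inr y)) = inr (inl y)"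
 "passoc (inr z) = inr (inr z)"
 by (simp_all add: passoc_def)

lemma inl_inr [simp]: "inl x ~= inr y" "inr y ~= inl x" "inl x = inl x' \<longleftrightarrow> x = x'" "inr x = inr x' \<longleftrightarrow> x = x'"
 by (simp_all add: sum_encode_eq)

lemma inj_inl: "inj_on inl S" and inj_inr: "inj_on inr S"
 by (simp_all add: inj_on_def)

lemma piso_inl: "is_part X ==> piso X (ptransport inl X) inl"
 and piso_inr: "is_part X ==> piso X (ptransport inr X) inr"
 by (simp_all add: piso_ptransport inj_inl inj_inr)

lemma piso_ptransport_back:
 assumes "is_part X" "inj_on f (pts X)" "!!x. x : pts X ==> g (f x) = x"
 shows "piso (ptransport f X) X g"
proof -
 note P = is_partD[OF assms(1)]
 have "bij_betw g (f ` pts X) (pts X)"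
  using assms(3) by (intro bij_betw_byWitness[where f' = f]) auto
 then show ?thesis
  using assms(1,3) is_part_ptransport[OF assms(1,2)] P(6,7)
  by (fastforce simp: piso_iff pmor_def)
qed

lemma is_part_psum: "is_part X ==> is_part Y ==> is_part (X |+| Y)"
 unfolding psum_pU by (intro is_part_pU is_part_ptransport inj_inl inj_inr) auto

lemma eqv_psum: "eqv (X |+| Y) = map_prod inl inl ` eqv X Un map_prod inr inr ` eqv Y"
 by (simp add: psum_def)

lemma eqv_psum_iff [simp]: "(inl x, inl y) : eqv (X |+| Y) \<longleftrightarrow> (x, y) : eqv X"
 "(inr x', inr y') : eqv (X |+| Y) \<longleftrightarrow> (x', y') : eqv Y"
 "(inl x, inr y') ~: eqv (X |+| Y)" "(inr x', inl y) ~: eqv (X |+| Y)"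
 by (auto simp: eqv_psum)

lemma psum_eqvE:
 assumes "(u, v) : eqv (X |+| Y)"
 obtains (left) x y where "u = inl x" "v = inl y" "(x, y) : eqv X"
  | (right) x y where "u = inr x" "v = inr y" "(x, y) : eqv Y"
 using assms by (auto simp: eqv_psum)

lemma pmor_psum_map:
 assumes "pmor X X' f" "pmor Y Y' g"
 shows "pmor (X |+| Y) (X' |+| Y') (psum_map f g)"
proof -
 note F = pmorD[OF assms(1)] and G = pmorD[OF assms(2)]
 have l: "bij_betw (psum_map f g) (inl ` pts X) (inl ` pts X')"
  using F(4) by (auto simp: bij_betw_def inj_on_def image_image F(5)[symmetric])
 have r: "bij_betw (psum_map f g) (inr ` pts Y) (inr ` pts Y')"
  using G(4) by (auto simp: bij_betw_def inj_on_def image_image G(5)[symmetric])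
 have "bij_betw (psum_map f g) (pts (X |+| Y)) (pts (X' |+| Y'))"
  unfolding pts_simps by (rule bij_betw_combine[OF l r]) auto
 moreover have "(psum_map f g u, psum_map f g v) : eqv (X' |+| Y')" if "(u, v) : eqv (X |+| Y)" for u v
  using that by (cases rule: psum_eqvE) (simp_all add: F(7) G(7))
 ultimately show ?thesis
  using is_part_psum[OF F(1) G(1)] is_part_psum[OF F(2) G(2)] unfolding pmor_def by blast
qed

lemma piso_psum_map:
 assumes "piso X X' f" "piso Y Y' g"
 shows "piso (X |+| Y) (X' |+| Y') (psum_map f g)"
 unfolding piso_iff
proof (intro conjI ballI impI)
 show "pmor (X |+| Y) (X' |+| Y') (psum_map f g)"
  using assms by (intro pmor_psum_map) (auto simp: piso_iff)
 fix u v assume "u : pts (X |+| Y)" "v : pts (X |+| Y)"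
  "(psum_map f g u, psum_map f g v) : eqv (X' |+| Y')"
 then show "(u, v) : eqv (X |+| Y)" using assms by (auto simp: piso_iff)
qed

lemma piso_pcodiag:
 assumes "is_part X" "is_part Y" "pts X Int pts Y = {}"
 shows "piso (X |+| Y) (pU X Y) pcodiag"
 unfolding psum_pU
 by (intro piso_pU piso_ptransport_back assms inj_inl inj_inr) (use assms in auto)

lemma piso_pmor: "piso X Y f ==> pmor X Y f"
 by (simp add: piso_def)

lemma piso_comp: "piso X Y f ==> piso Y Z g ==> piso X Z (g o f)"
 unfolding piso_iff using pmor_comp[of X Y f Z g] pmorD(6)[of X Y f] by auto

lemma pmor_pconcat: "pmor (indiscrete i |+| indiscrete j) (indiscrete (i + j)) (pconcat i)"
proof -
 have "bij_betw (pconcat i) (inl ` {1..i} Un inr ` {1..j}) {1..i + j}"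
 proof -
  have "{1..i + j} = {1..i} Un (%y. i + y) ` {1..j}"
  by (auto simp: image_iff)
  then show ?thesis by (auto simp: bij_betw_def inj_on_def image_Un image_image)
 qed
 then show ?thesis
  using pmor_to_J[of "indiscrete i |+| indiscrete j" "pconcat i" "{1..i + j}"]
  by (simp add: indiscrete_J is_part_psum)
qed

text \<open>The external product moved along the codiagonal onto the union. It is meant for disjoint
  point sets, where the codiagonal is an isomorphism; associativity and symmetry then hold as plain
  equations.\<close>

definition ib :: "'k ring => ('k, 'v) smpf => part => part => 'v => 'v => 'v" where
 "ib K R X Y x y = tr R (X |+| Y) (pU X Y) pcodiag (box K R X Y x y)"

definition ibT :: "('k, 'v) smpf => part => part => ('k, 'v, 'v) tens => 'v" where
 "ibT R X Y u = tr R (X |+| Y) (pU X Y) pcodiag (ext R X Y u)"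

text \<open>Identifies the value at \<open>indiscrete (card b)\<close> with the value at
  \<open>J b\<close>. Two bijections onto one block are 2-isomorphic, so the result does not depend
  on the numbering that is chosen.\<close>

definition put :: "('k, 'v) smpf => nat set => 'v => 'v" where
 "put R b = tr R (indiscrete (card b)) (J b) (SOME e. bij_betw e {1..card b} b)"

section \<open>Calculus of transfers, restrictions and internal products\<close>

context symmetric_monoidal_partition_functor
begin

abbreviation V where "V X \<equiv> carrier (val R X)"

lemma tr_closed: "pmor X Y f ==> x : V X ==> tr R X Y f x : V Y"
 using lin_closed[OF tr_hom] .

lemma res_closed: "pmor X Y f ==> x : V Y ==> res R X Y f x : V X"
 using lin_closed[OF res_hom] .

lemma tr_cong:
 assumes "pmor X Y f" "x : V X" "!!s. s : pts X ==> g s = f s"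
 shows "tr R X Y g x = tr R X Y f x"
 using tr_two_iso[OF assms(1) pmor_cong[OF assms(1,3)] two_iso_cong[OF assms(1,3)] assms(2)] by simp

lemma res_cong:
 assumes "pmor X Y f" "x : V Y" "!!s. s : pts X ==> g s = f s"
 shows "res R X Y g x = res R X Y f x"
 using res_two_iso[OF assms(1) pmor_cong[OF assms(1,3)] two_iso_cong[OF assms(1,3)] assms(2)] by simp

lemma tr_tr:
 assumes "pmor X Y f" "pmor Y Z g" "x : V X"
 shows "tr R Y Z g (tr R X Y f x) = tr R X Z (g o f) x"
 using tr_comp[OF assms] by simp

lemma res_res:
 assumes "pmor X Y f" "pmor Y Z g" "x : V Z"
 shows "res R X Y f (res R Y Z g x) = res R X Z (g o f) x"
 using res_comp[OF assms] by simp

text \<open>All morphisms from \<open>X\<close> into a single block are 2-isomorphic. In particular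
  a permutation of the points of one block acts as the identity.\<close>

lemma tr_to_J:
 assumes "pmor X (J b) f" "pmor X (J b) g" "x : V X"
 shows "tr R X (J b) f x = tr R X (J b) g x"
 using assms pmorD(6)[OF assms(1)] pmorD(6)[OF assms(2)]
 by (intro tr_two_iso) (auto simp: two_iso_def)

lemma res_to_J:
 assumes "pmor X (J b) f" "pmor X (J b) g" "x : V (J b)"
 shows "res R X (J b) f x = res R X (J b) g x"
 using assms pmorD(6)[OF assms(1)] pmorD(6)[OF assms(2)]
 by (intro res_two_iso) (auto simp: two_iso_def)

lemma tr_res_inverse:
 assumes "piso X Y f"
 shows "x : V Y ==> tr R X Y f (res R X Y f x) = x" "y : V X ==> res R X Y f (tr R X Y f y) = y"
proof -
 note i = piso_inv[OF assms] and m = piso_pmor[OF assms]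
 note P = pmorD(1,2)[OF m]
 let ?g = "inv_into (pts X) f"
 show "tr R X Y f (res R X Y f x) = x" if x: "x : V Y"
 proof -
  have "tr R X Y f (res R X Y f x) = res R Y X ?g (res R X Y f x)"
  by (rule tr_iso[OF assms res_closed[OF m x]])
  also have "... = res R Y Y (f o ?g) x" by (rule res_res[OF i(1) m x])
  also have "... = res R Y Y id x" by (rule res_cong[OF pmor_id[OF P(2)] x]) (simp add: i(3))
  finally show ?thesis using res_id[OF P(2) x] by simp
 qed
 show "res R X Y f (tr R X Y f y) = y" if y: "y : V X"
 proof -
  have "res R X Y f (tr R X Y f y) = res R X Y f (res R Y X ?g y)"
  by (simp only: tr_iso[OF assms y])
  also have "... = res R X X (?g o f) y" by (rule res_res[OF m i(1) y])
  also have "... = res R X X id y" by (rule res_cong[OF pmor_id[OF P(1)] y]) (simp add: i(2))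
  finally show ?thesis using res_id[OF P(1) y] by simp
 qed
qed

lemma tr_mod_iso:
 assumes "piso X Y f" shows "tr R X Y f : mod_iso K (val R X) (val R Y)"
 by (rule mod_isoI_inverse[OF tr_hom[OF piso_pmor[OF assms]] _ tr_res_inverse(2,1)[OF assms]])
  (auto intro: res_closed piso_pmor assms)

lemma ext_ptens: "ext R X Y (ptens K (val R X) (val R Y) x y) = box K R X Y x y"
 by (simp add: box_def)

lemma box_closed:
 assumes "is_part X" "is_part Y" "x : V X" "y : V Y"
 shows "box K R X Y x y : V (X |+| Y)"
 unfolding box_def
 by (rule lin_closed[OF mod_isoD(1)[OF ext_iso[OF assms(1,2)]]
  ptens_closed[OF val_module[OF assms(1)] val_module[OF assms(2)] assms(3,4)]])

lemma ibT_ptens: "ibT R X Y (ptens K (val R X) (val R Y) x y) = ib K R X Y x y"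
 by (simp add: ib_def ibT_def box_def)

lemma ibT_iso:
 assumes "is_part X" "is_part Y" "pts X Int pts Y = {}"
 shows "ibT R X Y : mod_iso K (tensor K (val R X) (val R Y)) (val R (pU X Y))"
 unfolding ibT_def[abs_def]
 by (rule mod_iso_comp[OF ext_iso[OF assms(1,2)] tr_mod_iso[OF piso_pcodiag[OF assms]]])

lemma ib_bilinear:
 assumes "is_part X" "is_part Y" "pts X Int pts Y = {}"
 shows "bilinear_map K (val R X) (val R Y) (val R (pU X Y)) (ib K R X Y)"
 using bilinear_map_comp[OF ptens_bilinear[OF val_module[OF assms(1)] val_module[OF assms(2)]]
  lin_id lin_id mod_isoD(1)[OF ibT_iso[OF assms]]]
 by (simp add: ibT_ptens)

lemma ib_closed:
 assumes "is_part X" "is_part Y" "pts X Int pts Y = {}" "x : V X" "y : V Y"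
 shows "ib K R X Y x y : V (pU X Y)"
 by (rule bilinear_map_closed[OF ib_bilinear[OF assms(1-3)] assms(4,5)])

lemma ib_induct [consumes 4, case_names zero ib add]:
 assumes w: "w : V (pU X Y)" and P: "is_part X" "is_part Y" "pts X Int pts Y = {}"
  and z: "Q \<zero>\<^bsub>val R (pU X Y)\<^esub>"
  and g: "!!x y. x : V X ==> y : V Y ==> Q (ib K R X Y x y)"
  and p: "!!u v. u : V (pU X Y) ==> v : V (pU X Y) ==> Q u ==> Q v ==> Q (u \<oplus>\<^bsub>val R (pU X Y)\<^esub> v)"
 shows "Q w"
proof -
 note m = val_module[OF P(1)] val_module[OF P(2)]
 note T = ibT_iso[OF P]
 have "w : ibT R X Y ` carrier (tensor K (val R X) (val R Y))"
  using w mod_isoD(4)[OF T] by simp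
 then obtain u where u: "u : carrier (tensor K (val R X) (val R Y))" "w = ibT R X Y u" by blast
 have "Q (ibT R X Y u)"
  using u(1) m
 proof (induct rule: tensor_induct)
  case zero
  show ?case
  using lin_zero[OF tensor_module[OF m] val_module[OF is_part_pU[OF P]] mod_isoD(1)[OF T]] z by simp
 next
  case (ptens x y) then show ?case using g by (simp add: ibT_ptens)
 next
  case (add u v)
  then show ?case
  using lin_closed[OF mod_isoD(1)[OF T]] p by (simp add: lin_add[OF mod_isoD(1)[OF T]])
 qed
 then show ?thesis using u(2) by simp
qed

lemma ib_hom_eqI:
 assumes w: "w : V (pU X Y)" and P: "is_part X" "is_part Y" "pts X Int pts Y = {}"
  and f: "f : mod_hom K (val R (pU X Y)) N" and g: "g : mod_hom K (val R (pU X Y)) N"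
  and N: "module K N"
  and eq: "!!x y. x : V X ==> y : V Y ==> f (ib K R X Y x y) = g (ib K R X Y x y)"
 shows "f w = g w"
 using w P
proof (induct rule: ib_induct)
 case zero
 show ?case
  using lin_zero[OF val_module[OF is_part_pU[OF P]] N f]
  lin_zero[OF val_module[OF is_part_pU[OF P]] N g] by simp
next
 case (add u v) then show ?case by (simp add: lin_add[OF f] lin_add[OF g])
qed (rule eq)

lemma ib_comm:
 assumes P: "is_part X" "is_part Y" "pts X Int pts Y = {}" and x: "x : V X" and y: "y : V Y"
 shows "ib K R Y X y x = ib K R X Y x y"
proof -
 have d: "pts Y Int pts X = {}" using P(3) by blast
 note c = piso_pmor[OF piso_pcodiag[OF P(2,1) d]] and c' = piso_pmor[OF piso_pcodiag[OF P]]
 note b = box_closed[OF P(1,2) x y]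
 have sw: "pmor (X |+| Y) (Y |+| X) pswap"
 proof -
  have "bij_betw pswap (inl ` pts X Un inr ` pts Y) (inl ` pts Y Un inr ` pts X)"
  by (rule bij_betw_byWitness[where f' = pswap]) auto
  then show ?thesis using is_part_psum[OF P(1,2)] is_part_psum[OF P(2,1)]
  by (auto simp: pmor_def psum_pU)
 qed
 have "ib K R Y X y x = tr R (Y |+| X) (pU Y X) pcodiag (tr R (X |+| Y) (Y |+| X) pswap (box K R X Y x y))"
  unfolding ib_def by (simp only: box_sym[OF P(1,2) x y])
 also have "... = tr R (X |+| Y) (pU Y X) (pcodiag o pswap) (box K R X Y x y)"
  by (rule tr_tr[OF sw c b])
 also have "... = tr R (X |+| Y) (pU X Y) pcodiag (box K R X Y x y)"
  unfolding pU_comm[of Y X] by (rule tr_cong[OF c' b]) auto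
 finally show ?thesis by (simp add: ib_def)
qed

lemma ib_box_tr:
 assumes f: "pmor X X' f" "pmor Y Y' g" "pts X' Int pts Y' = {}" and x: "x : V X" and y: "y : V Y"
 shows "ib K R X' Y' (tr R X X' f x) (tr R Y Y' g y) =
  tr R (X |+| Y) (pU X' Y') (pcodiag o psum_map f g) (box K R X Y x y)"
 unfolding ib_def box_tr[OF f(1,2) x y, symmetric]
 by (rule tr_tr[OF pmor_psum_map[OF f(1,2)] piso_pmor[OF piso_pcodiag[OF pmorD(2)[OF f(1)] pmorD(2)[OF f(2)] f(3)]]
  box_closed[OF pmorD(1)[OF f(1)] pmorD(1)[OF f(2)] x y]])

text \<open>Both sides are transfers of triple external products, which \<open>passoc\<close>
  exchanges; the functions into the union agree pointwise, since each of them just forgets the tags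
  \<open>inl\<close> and \<open>inr\<close>.\<close>

lemma ib_assoc:
 assumes P: "is_part X" "is_part Y" "is_part Z"
  and d: "pts X Int pts Y = {}" "pts X Int pts Z = {}" "pts Y Int pts Z = {}"
  and x: "x : V X" and y: "y : V Y" and z: "z : V Z"
 shows "ib K R (pU X Y) Z (ib K R X Y x y) z = ib K R X (pU Y Z) x (ib K R Y Z y z)"
proof -
 let ?U = "pU X (pU Y Z)"
 have d1: "pts (pU X Y) Int pts Z = {}" and d2: "pts X Int pts (pU Y Z) = {}" using d by auto
 note b1 = box_closed[OF P(1,2) x y] and b2 = box_closed[OF P(2,3) y z]
 note c1 = piso_pmor[OF piso_pcodiag[OF P(1,2) d(1)]] and c2 = piso_pmor[OF piso_pcodiag[OF P(2,3) d(3)]]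
 note s1 = is_part_psum[OF P(1,2)] and s2 = is_part_psum[OF P(2,3)]
 note bb1 = box_closed[OF s1 P(3) b1 z] and bb2 = box_closed[OF P(1) s2 x b2]
 have as: "pmor ((X |+| Y) |+| Z) (X |+| (Y |+| Z)) passoc"
 proof -
  let ?q = "copair (%x. inl (inl x)) (copair (%y. inl (inr y)) inr)"
  have "bij_betw passoc (inl ` (inl ` pts X Un inr ` pts Y) Un inr ` pts Z)
  (inl ` pts X Un inr ` (inl ` pts Y Un inr ` pts Z))"
  by (rule bij_betw_byWitness[where f' = ?q]) auto
  moreover have "(passoc u, passoc v) : eqv (X |+| (Y |+| Z))" if "(u, v) : eqv ((X |+| Y) |+| Z)" for u v
  using that by (cases rule: psum_eqvE) (auto elim: psum_eqvE)
  ultimately show ?thesis using is_part_psum[OF s1 P(3)] is_part_psum[OF P(1) s2]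
  unfolding pmor_def by auto
 qed
 have m1: "pmor ((X |+| Y) |+| Z) ?U (pcodiag o psum_map pcodiag id)"
  using pmor_comp[OF pmor_psum_map[OF c1 pmor_id[OF P(3)]]
  piso_pmor[OF piso_pcodiag[OF is_part_pU[OF P(1,2) d(1)] P(3) d1]]]
  by (simp only: pU_assoc)
 have m2: "pmor (X |+| (Y |+| Z)) ?U (pcodiag o psum_map id pcodiag)"
  using pmor_comp[OF pmor_psum_map[OF pmor_id[OF P(1)] c2]
  piso_pmor[OF piso_pcodiag[OF P(1) is_part_pU[OF P(2,3) d(3)] d2]]] .
 have "ib K R (pU X Y) Z (ib K R X Y x y) z =
  ib K R (pU X Y) Z (tr R (X |+| Y) (pU X Y) pcodiag (box K R X Y x y)) (tr R Z Z id z)"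
  by (simp only: ib_def[of K R X Y] tr_id[OF P(3) z])
 also have "... = tr R ((X |+| Y) |+| Z) ?U (pcodiag o psum_map pcodiag id)
  (box K R (X |+| Y) Z (box K R X Y x y) z)"
  using ib_box_tr[OF c1 pmor_id[OF P(3)] d1 b1 z] by (simp only: pU_assoc)
 also have "... = tr R ((X |+| Y) |+| Z) ?U ((pcodiag o psum_map id pcodiag) o passoc)
  (box K R (X |+| Y) Z (box K R X Y x y) z)"
  by (rule tr_cong[OF pmor_comp[OF as m2] bb1]) auto
 also have "... = tr R (X |+| (Y |+| Z)) ?U (pcodiag o psum_map id pcodiag)
  (box K R X (Y |+| Z) x (box K R Y Z y z))"
  unfolding box_assoc[OF P x y z, symmetric] by (rule tr_tr[OF as m2 bb1, symmetric])
 also have "... = ib K R X (pU Y Z) (tr R X X id x) (tr R (Y |+| Z) (pU Y Z) pcodiag (box K R Y Z y z))"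
  using ib_box_tr[OF pmor_id[OF P(1)] c2 d2 x b2] by simp
 finally show ?thesis by (simp only: ib_def[of K R Y Z] tr_id[OF P(1) x])
qed

lemma ib_unit:
 assumes "is_part X" "k : carrier K" "x : V X"
 shows "ib K R pempty X (kunit R k) x = k \<odot>\<^bsub>val R X\<^esub> x"
 using box_unit_left[OF assms] by (simp add: ib_def)

lemma ib_tr:
 assumes f: "pmor X X' f" "pmor Y Y' f" and d: "pts X Int pts Y = {}" "pts X' Int pts Y' = {}"
  and x: "x : V X" and y: "y : V Y"
 shows "tr R (pU X Y) (pU X' Y') f (ib K R X Y x y) = ib K R X' Y' (tr R X X' f x) (tr R Y Y' f y)"
proof -
 note P = pmorD(1)[OF f(1)] pmorD(1)[OF f(2)] and P' = pmorD(2)[OF f(1)] pmorD(2)[OF f(2)]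
 note b = box_closed[OF P x y]
 note c = piso_pmor[OF piso_pcodiag[OF P d(1)]] and c' = piso_pmor[OF piso_pcodiag[OF P' d(2)]]
 have "tr R (pU X Y) (pU X' Y') f (ib K R X Y x y) =
  tr R (X |+| Y) (pU X' Y') (f o pcodiag) (box K R X Y x y)"
  unfolding ib_def by (rule tr_tr[OF c pmor_pU[OF f d] b])
 also have "... = tr R (X |+| Y) (pU X' Y') (pcodiag o psum_map f f) (box K R X Y x y)"
  by (rule tr_cong[OF pmor_comp[OF pmor_psum_map[OF f] c'] b]) auto
 also have "... = ib K R X' Y' (tr R X X' f x) (tr R Y Y' f y)"
  by (rule ib_box_tr[OF f d(2) x y, symmetric])
 finally show ?thesis .
qed

text \<open>\<open>ib\<close> ends with a transfer, which does not meet a restriction directly.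
  Restriction along the codiagonal inverts that transfer and reduces the claim to naturality of the
  external product.\<close>

lemma ib_res:
 assumes f: "pmor X X' f" "pmor Y Y' f" and d: "pts X Int pts Y = {}" "pts X' Int pts Y' = {}"
  and x: "x : V X'" and y: "y : V Y'"
 shows "res R (pU X Y) (pU X' Y') f (ib K R X' Y' x y) = ib K R X Y (res R X X' f x) (res R Y Y' f y)"
proof -
 note P = pmorD(1)[OF f(1)] pmorD(1)[OF f(2)] and P' = pmorD(2)[OF f(1)] pmorD(2)[OF f(2)]
 note b = box_closed[OF P' x y]
 note c = piso_pcodiag[OF P d(1)] and c' = piso_pcodiag[OF P' d(2)]
 note fU = pmor_pU[OF f d]
 let ?v = "ib K R X' Y' x y"
 have v: "?v : V (pU X' Y')" by (rule ib_closed[OF P' d(2) x y])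
 have "res R (pU X Y) (pU X' Y') f ?v =
  tr R (X |+| Y) (pU X Y) pcodiag (res R (X |+| Y) (pU X Y) pcodiag (res R (pU X Y) (pU X' Y') f ?v))"
  by (rule tr_res_inverse(1)[OF c res_closed[OF fU v], symmetric])
 also have "res R (X |+| Y) (pU X Y) pcodiag (res R (pU X Y) (pU X' Y') f ?v) =
  res R (X |+| Y) (pU X' Y') (f o pcodiag) ?v"
  by (rule res_res[OF piso_pmor[OF c] fU v])
 also have "... = res R (X |+| Y) (pU X' Y') (pcodiag o psum_map f f) ?v"
  by (rule res_cong[OF pmor_comp[OF pmor_psum_map[OF f] piso_pmor[OF c']] v]) auto
 also have "... = res R (X |+| Y) (X' |+| Y') (psum_map f f) (res R (X' |+| Y') (pU X' Y') pcodiag ?v)"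
  by (rule res_res[OF pmor_psum_map[OF f] piso_pmor[OF c'] v, symmetric])
 also have "res R (X' |+| Y') (pU X' Y') pcodiag ?v = box K R X' Y' x y"
  unfolding ib_def by (rule tr_res_inverse(2)[OF c' b])
 also have "res R (X |+| Y) (X' |+| Y') (psum_map f f) (box K R X' Y' x y) =
  box K R X Y (res R X X' f x) (res R Y Y' f y)"
  by (rule box_res[OF f x y])
 finally show ?thesis by (simp add: ib_def)
qed

text \<open>Recovers the external product from the internal one: a map that respects
  \<open>ib\<close> and the transfers along \<open>inl\<close> and \<open>inr\<close> also respects
  \<open>box\<close>.\<close>

lemma box_ib:
 assumes P: "is_part X" "is_part Y" and x: "x : V X" and y: "y : V Y"
 shows "box K R X Y x y = ib K R (ptransport inl X) (ptransport inr Y)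
  (tr R X (ptransport inl X) inl x) (tr R Y (ptransport inr Y) inr y)"
proof -
 note i = piso_pmor[OF piso_inl[OF P(1)]] piso_pmor[OF piso_inr[OF P(2)]]
 note b = box_closed[OF P x y]
 have disj: "pts (ptransport inl X) Int pts (ptransport inr Y) = {}" by auto
 have "tr R (X |+| Y) (X |+| Y) (pcodiag o psum_map inl inr) (box K R X Y x y) =
  tr R (X |+| Y) (X |+| Y) id (box K R X Y x y)"
  by (rule tr_cong[OF pmor_id[OF is_part_psum[OF P]] b]) auto
 then show ?thesis
  using ib_box_tr[OF i disj x y] tr_id[OF is_part_psum[OF P] b]
  by (simp add: psum_pU[symmetric])
qed

lemma put_bij:
 assumes "finite b"
 shows "piso (indiscrete (card b)) (J b) (SOME e. bij_betw e {1..card b} b)"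
proof -
 have "EX e. bij_betw e {1..card b} b" using assms by (intro finite_same_card_bij) auto
 then have "bij_betw (SOME e. bij_betw e {1..card b} b) {1..card b} b" by (rule someI_ex)
 then show ?thesis by (simp add: indiscrete_J piso_J)
qed

lemma put_iso: "finite b ==> put R b : mod_iso K (val R (indiscrete (card b))) (val R (J b))"
 unfolding put_def by (rule tr_mod_iso[OF put_bij])

lemmas put_hom = mod_isoD(1)[OF put_iso]

lemma put_closed: "finite b ==> x : V (indiscrete (card b)) ==> put R b x : V (J b)"
 by (rule lin_closed[OF put_hom])

lemma put_eq_tr:
 assumes "pmor (indiscrete (card b)) (J b) f" "x : V (indiscrete (card b))"
 shows "put R b x = tr R (indiscrete (card b)) (J b) f x"
 unfolding put_def using pmorD(2)[OF assms(1)] assms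
 by (intro tr_to_J piso_pmor[OF put_bij]) auto

lemma put_indiscrete:
 assumes "x : V (indiscrete n)" shows "put R {1..n} x = x"
 using put_eq_tr[of "{1..n}" id x] assms pmor_id[OF is_part_indiscrete[of n]] tr_id[OF is_part_indiscrete[of n]]
 by (simp add: indiscrete_J)

lemma tr_put:
 assumes f: "bij_betw f b c" "finite b" and x: "x : V (indiscrete (card b))"
 shows "tr R (J b) (J c) f (put R b x) = put R c x"
proof -
 have m: "pmor (J b) (J c) f" using piso_pmor[OF piso_J[OF f(2,1)]] .
 have cc: "card c = card b" using bij_betw_same_card[OF f(1)] by simp
 note e = piso_pmor[OF put_bij[OF f(2)]]
 show ?thesis
  unfolding put_def[of R b]
  using tr_tr[OF e m x] put_eq_tr[of c, unfolded cc, OF pmor_comp[OF e m] x] by simp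
qed

lemma res_put:
 assumes f: "bij_betw f b c" "finite b" and x: "x : V (indiscrete (card b))"
 shows "res R (J b) (J c) f (put R c x) = put R b x"
 using tr_res_inverse(2)[OF piso_J[OF f(2,1)] put_closed[OF f(2) x]] tr_put[OF f x] by simp

abbreviation gm where "gm \<equiv> gmult (sigma_alg K R)"
abbreviation gc where "gc \<equiv> gcomult (sigma_alg K R)"

lemma gm_def: "gm i j x y = tr R (indiscrete i |+| indiscrete j) (indiscrete (i + j)) (pconcat i)
  (box K R (indiscrete i) (indiscrete j) x y)"
 by (simp add: sigma_alg_def)

lemma gm_bilinear:
 "bilinear_map K (val R (indiscrete i)) (val R (indiscrete j)) (val R (indiscrete (i + j))) (gm i j)"
 unfolding gm_def[abs_def] box_def
 by (rule bilinear_map_comp[OF ptens_bilinear[OF val_module val_module] lin_id lin_id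
  lin_comp[OF mod_isoD(1)[OF ext_iso] tr_hom[OF pmor_pconcat]]]) simp_all

lemma gc_hom: "gc i j : mod_hom K (val R (indiscrete (i + j))) (tensor K (val R (indiscrete i)) (val R (indiscrete j)))"
 unfolding sigma_alg_def gbialg.simps
 by (rule lin_comp[OF res_hom[OF pmor_pconcat]
  mod_isoD(1)[OF mod_iso_inv_into[OF tensor_module[OF val_module val_module] ext_iso]]]) simp_all

lemma ext_gc:
 assumes "x : V (indiscrete (i + j))"
 shows "ext R (indiscrete i) (indiscrete j) (gc i j x) =
  res R (indiscrete i |+| indiscrete j) (indiscrete (i + j)) (pconcat i) x"
 unfolding sigma_alg_def gbialg.simps
 by (rule lin_f_inv_into(1)[OF ext_iso res_closed[OF pmor_pconcat assms]]) simp_all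

text \<open>The multiplication in terms of actual blocks. The two composites into the single block
  \<open>b Un c\<close> give the same transfer by \<open>tr_to_J\<close>, however the points are
  numbered.\<close>

lemma tr_merge:
 assumes b: "finite b" "finite c" "b Int c = {}"
  and x: "x : V (indiscrete (card b))" and y: "y : V (indiscrete (card c))"
 shows "tr R (pU (J b) (J c)) (J (b Un c)) id (ib K R (J b) (J c) (put R b x) (put R c y)) =
  put R (b Un c) (gm (card b) (card c) x y)"
proof -
 let ?i = "card b" and ?j = "card c"
 have cc: "card (b Un c) = ?i + ?j" using b by (simp add: card_Un_disjoint)
 note e = piso_pmor[OF put_bij[OF b(1)]] and e2 = piso_pmor[OF put_bij[OF b(2)]]
 have e3: "pmor (indiscrete (?i + ?j)) (J (b Un c)) (SOME e. bij_betw e {1..?i + ?j} (b Un c))"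
  using piso_pmor[OF put_bij[of "b Un c"]] b by (simp add: cc)
 have d: "pts (J b) Int pts (J c) = {}" using b by simp
 have p: "is_part (J b)" "is_part (J c)" "is_part (indiscrete ?i)" "is_part (indiscrete ?j)" using b by auto
 note bx = box_closed[OF p(3,4) x y]
 note m = pmor_comp[OF pmor_psum_map[OF e e2] piso_pmor[OF piso_pcodiag[OF p(1,2) d]]]
 have m2: "pmor (pU (J b) (J c)) (J (b Un c)) id"
  using is_part_pU[OF p(1,2) d] by (intro pmor_to_J) auto
 have "tr R (pU (J b) (J c)) (J (b Un c)) id (ib K R (J b) (J c) (put R b x) (put R c y)) =
  tr R (indiscrete ?i |+| indiscrete ?j) (J (b Un c)) (id o (pcodiag o
  psum_map (SOME e. bij_betw e {1..?i} b) (SOME e. bij_betw e {1..?j} c)))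
  (box K R (indiscrete ?i) (indiscrete ?j) x y)"
  unfolding put_def ib_box_tr[OF e e2 d x y] by (rule tr_tr[OF m m2 bx])
 also have "... = tr R (indiscrete ?i |+| indiscrete ?j) (J (b Un c))
  ((SOME e. bij_betw e {1..?i + ?j} (b Un c)) o pconcat ?i) (box K R (indiscrete ?i) (indiscrete ?j) x y)"
  by (rule tr_to_J[OF pmor_comp[OF m m2] pmor_comp[OF pmor_pconcat e3] bx])
 also have "... = put R (b Un c) (gm ?i ?j x y)"
  unfolding put_def gm_def cc by (rule tr_tr[OF pmor_pconcat e3 bx, symmetric])
 finally show ?thesis .
qed

text \<open>The linear extension of the internal product of two \<open>put\<close> elements. A
  comultiplication yields sums of pure tensors, which \<open>ib\<close> does not accept.\<close>

definition IB where
 "IB b c u = ibT R (J b) (J c) (tens_map K (val R (indiscrete (card b))) (val R (indiscrete (card c)))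
  (val R (J b)) (val R (J c)) (put R b) (put R c) u)"

lemma IB:
 assumes b: "finite b" "finite c" "b Int c = {}"
 shows IB_hom: "IB b c : mod_hom K (tensor K (val R (indiscrete (card b))) (val R (indiscrete (card c))))
  (val R (pU (J b) (J c)))"
  and IB_ptens: "!!x y. x : V (indiscrete (card b)) ==> y : V (indiscrete (card c)) ==>
  IB b c (ptens K (val R (indiscrete (card b))) (val R (indiscrete (card c))) x y) =
  ib K R (J b) (J c) (put R b x) (put R c y)"
proof -
 have p: "is_part (J b)" "is_part (J c)" "is_part (indiscrete (card b))" "is_part (indiscrete (card c))"
  "pts (J b) Int pts (J c) = {}" using b by auto
 note m = val_module[OF p(3)] val_module[OF p(4)] val_module[OF p(1)] val_module[OF p(2)]
 note t = tens_map_hom[OF m put_hom[OF b(1)] put_hom[OF b(2)]]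
  tens_map_ptens[OF m put_hom[OF b(1)] put_hom[OF b(2)]]
 show "IB b c : mod_hom K (tensor K (val R (indiscrete (card b))) (val R (indiscrete (card c))))
  (val R (pU (J b) (J c)))"
  unfolding IB_def[abs_def] by (rule lin_comp[OF t(1) mod_isoD(1)[OF ibT_iso[OF p(1,2,5)]]])
 show "IB b c (ptens K (val R (indiscrete (card b))) (val R (indiscrete (card c))) x y) =
  ib K R (J b) (J c) (put R b x) (put R c y)"
  if "x : V (indiscrete (card b))" "y : V (indiscrete (card c))" for x y
  unfolding IB_def using that by (simp add: t(2) ibT_ptens)
qed

text \<open>The dual of \<open>tr_merge\<close>: after pulling back along the isomorphism from the
  standard disjoint union, two composites into a single block agree by
  \<open>res_to_J\<close>.\<close>

lemma res_split:
 assumes b: "finite b" "finite c" "b Int c = {}" and x: "x : V (indiscrete (card b + card c))"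
 shows "res R (pU (J b) (J c)) (J (b Un c)) id (put R (b Un c) x) = IB b c (gc (card b) (card c) x)"
proof -
 let ?i = "card b" and ?j = "card c"
 let ?Ii = "indiscrete ?i" and ?Ij = "indiscrete ?j"
 have cc: "card (b Un c) = ?i + ?j" using b by (simp add: card_Un_disjoint)
 note e = put_bij[OF b(1)] and e2 = put_bij[OF b(2)]
 let ?e = "SOME e. bij_betw e {1..?i} b" and ?e2 = "SOME e. bij_betw e {1..?j} c"
 let ?e3 = "SOME e. bij_betw e {1..?i + ?j} (b Un c)"
 have e3: "piso (indiscrete (?i + ?j)) (J (b Un c)) ?e3"
  using put_bij[of "b Un c"] b by (simp add: cc)
 have p: "is_part (J b)" "is_part (J c)" "is_part ?Ii" "is_part ?Ij"
  "pts (J b) Int pts (J c) = {}" using b by auto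
 let ?ph = "pcodiag o psum_map ?e ?e2"
 have ps: "piso (?Ii |+| ?Ij) (J b |+| J c) (psum_map ?e ?e2)"
  by (rule piso_psum_map[OF e e2])
 have ph: "piso (?Ii |+| ?Ij) (pU (J b) (J c)) ?ph"
  by (rule piso_comp[OF ps piso_pcodiag[OF p(1,2,5)]])
 have m2: "pmor (pU (J b) (J c)) (J (b Un c)) id"
  using is_part_pU[OF p(1,2,5)] by (intro pmor_to_J) auto
 let ?T = "tensor K (val R ?Ii) (val R ?Ij)"
 \<comment> \<open>Numbering the two blocks separately and multiplying is the same as transferring
   the external product along the joint numbering \<open>?ph\<close>; it is enough to see this on
   pure tensors.\<close>
 have key: "IB b c u = tr R (?Ii |+| ?Ij) (pU (J b) (J c)) ?ph (ext R ?Ii ?Ij u)" if u: "u : carrier ?T" for u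
 proof (rule tensor_hom_eqI[OF val_module[OF p(3)] val_module[OF p(4)] val_module[OF is_part_pU[OF p(1,2,5)]]
  IB_hom[OF b] _ _ u])
  show "(%u. tr R (?Ii |+| ?Ij) (pU (J b) (J c)) ?ph (ext R ?Ii ?Ij u)) : mod_hom K ?T (val R (pU (J b) (J c)))"
  by (rule lin_comp[OF mod_isoD(1)[OF ext_iso[OF p(3,4)]] tr_hom[OF piso_pmor[OF ph]]])
  fix x y assume xy: "x : V ?Ii" "y : V ?Ij"
  show "IB b c (ptens K (val R ?Ii) (val R ?Ij) x y) =
  tr R (?Ii |+| ?Ij) (pU (J b) (J c)) ?ph (ext R ?Ii ?Ij (ptens K (val R ?Ii) (val R ?Ij) x y))"
  unfolding IB_ptens[OF b xy] ext_ptens put_def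
  by (rule ib_box_tr[OF piso_pmor[OF e] piso_pmor[OF e2] p(5) xy])
 qed
 let ?w = "put R (b Un c) x"
 have w: "?w : V (J (b Un c))" using put_closed[of "b Un c"] b x by (simp add: cc)
 have wx: "?w = tr R (indiscrete (?i + ?j)) (J (b Un c)) ?e3 x" by (simp add: put_def cc)
 have x': "x = res R (indiscrete (?i + ?j)) (J (b Un c)) ?e3 ?w"
  unfolding wx by (rule tr_res_inverse(2)[OF e3 x, symmetric])
 have "res R (pU (J b) (J c)) (J (b Un c)) id ?w =
  tr R (?Ii |+| ?Ij) (pU (J b) (J c)) ?ph (res R (?Ii |+| ?Ij) (pU (J b) (J c)) ?ph
  (res R (pU (J b) (J c)) (J (b Un c)) id ?w))"
  by (rule tr_res_inverse(1)[OF ph res_closed[OF m2 w], symmetric])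
 also have "res R (?Ii |+| ?Ij) (pU (J b) (J c)) ?ph (res R (pU (J b) (J c)) (J (b Un c)) id ?w) =
  res R (?Ii |+| ?Ij) (J (b Un c)) (id o ?ph) ?w"
  by (rule res_res[OF piso_pmor[OF ph] m2 w])
 also have "... = res R (?Ii |+| ?Ij) (J (b Un c)) (?e3 o pconcat ?i) ?w"
  by (rule res_to_J[OF pmor_comp[OF piso_pmor[OF ph] m2] pmor_comp[OF pmor_pconcat piso_pmor[OF e3]] w])
 also have "... = res R (?Ii |+| ?Ij) (indiscrete (?i + ?j)) (pconcat ?i)
  (res R (indiscrete (?i + ?j)) (J (b Un c)) ?e3 ?w)"
  by (rule res_res[OF pmor_pconcat piso_pmor[OF e3] w, symmetric])
 also have "... = ext R ?Ii ?Ij (gc ?i ?j x)" unfolding x'[symmetric] by (rule ext_gc[OF x, symmetric])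
 also have "tr R (?Ii |+| ?Ij) (pU (J b) (J c)) ?ph (ext R ?Ii ?Ij (gc ?i ?j x)) = IB b c (gc ?i ?j x)"
  by (rule key[OF lin_closed[OF gc_hom x], symmetric])
 finally show ?thesis .
qed

end

section \<open>The bialgebra of a symmetric monoidal partition functor\<close>

lemma cring_self_mod:
 assumes "cring K" shows "module K (self_mod K)"
proof -
 interpret K: cring K by fact
 show ?thesis
  unfolding self_mod_def
  by (intro moduleI abelian_groupI)
  (auto simp: K.a_ac K.l_distr K.r_distr K.m_assoc assms intro: K.l_neg)
qed

lemma tens_map_comp:
 assumes M: "module K M" "module K N" "module K M'" "module K N'" "module K M''" "module K N''"
  and f: "f : mod_hom K M M'" "g : mod_hom K N N'" "f' : mod_hom K M' M''" "g' : mod_hom K N' N''"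
  and e: "!!x. x : carrier M ==> f'' x = f' (f x)" "!!y. y : carrier N ==> g'' y = g' (g y)"
  and u: "u : carrier (tensor K M N)"
 shows "tens_map K M' N' M'' N'' f' g' (tens_map K M N M' N' f g u) = tens_map K M N M'' N'' f'' g'' u"
proof -
 have f'': "f'' : mod_hom K M M''" "g'' : mod_hom K N N''"
  using lin_cong[OF M(1) lin_comp[OF f(1,3)] e(1)] lin_cong[OF M(2) lin_comp[OF f(2,4)] e(2)] by auto
 show ?thesis
 proof (rule tensor_hom_eqI[OF M(1,2) tensor_module[OF M(5,6)]
  lin_comp[OF tens_map_hom[OF M(1-4) f(1,2)] tens_map_hom[OF M(3-6) f(3,4)]] tens_map_hom[OF M(1,2,5,6) f''] _ u])
  fix x y assume x: "x : carrier M" "y : carrier N"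
  note fx = lin_closed[OF f(1) x(1)] lin_closed[OF f(2) x(2)]
  show "tens_map K M' N' M'' N'' f' g' (tens_map K M N M' N' f g (ptens K M N x y)) = tens_map K M N M'' N'' f'' g'' (ptens K M N x y)"
  unfolding tens_map_ptens[OF M(1-4) f(1,2) x] tens_map_ptens[OF M(3-6) f(3,4) fx] tens_map_ptens[OF M(1,2,5,6) f'' x] e(1)[OF x(1)] e(2)[OF x(2)] ..
 qed
qed

lemma tens_map_ident:
 assumes M: "module K M" "module K N" and e: "!!x. x : carrier M ==> f x = x" "!!y. y : carrier N ==> g y = y"
  and u: "u : carrier (tensor K M N)"
 shows "tens_map K M N M N f g u = u"
proof -
 have f: "f : mod_hom K M M" "g : mod_hom K N N"
  using lin_cong[OF M(1) lin_id e(1)] lin_cong[OF M(2) lin_id e(2)] by auto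
 show ?thesis
  by (rule tensor_hom_eqI[OF M tensor_module[OF M] tens_map_hom[OF M M f] lin_id _ u])
  (simp add: tens_map_ptens[OF M M f] e)
qed

lemma tens_map_iso:
 assumes MN: "module K M" "module K N" "module K M'" "module K N'"
  and f: "f : mod_iso K M M'" and g: "g : mod_iso K N N'"
 shows "tens_map K M N M' N' f g : mod_iso K (tensor K M N) (tensor K M' N')"
proof -
 note h = mod_isoD(1)[OF f] mod_isoD(1)[OF g]
 note h' = mod_isoD(1)[OF mod_iso_inv_into[OF MN(1) f]] mod_isoD(1)[OF mod_iso_inv_into[OF MN(2) g]]
 note i = tens_map_ident[where f = "%x. x" and g = "%x. x"]
 show ?thesis
  by (rule mod_isoI_inverse[OF tens_map_hom[OF MN h]])
  (use lin_closed[OF tens_map_hom[OF MN(3,4,1,2) h']] in \<open>auto simp: tens_map_comp[OF MN MN(1,2) h h', where f'' = "%x. x" and g'' = "%x. x"]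
  tens_map_comp[OF MN(3,4) MN h' h, where f'' = "%x. x" and g'' = "%x. x"] i[OF MN(1,2)] i[OF MN(3,4)]
  lin_inv_into_eq[OF f] lin_inv_into_eq[OF g] lin_f_inv_into[OF f] lin_f_inv_into[OF g]\<close>)
qed

text \<open>The definition nests one lift inside another, so the inner lift must be shown bilinear
  in \<open>x1\<close> and \<open>x2\<close> before the outer one makes sense; linearity in
  \<open>v\<close> is then linearity in a parameter.\<close>

lemma tens_gmult_facts:
 fixes K :: "'k ring" and A :: "('k, 'v) gbialg"
 assumes m: "!!n. module K (piece A n)"
  and g: "!!i j. bilinear_map K (piece A i) (piece A j) (piece A (i + j)) (gmult A i j)"
 shows tens_gmult_bilinear: "bilinear_map K (piece_tensor K A a b) (piece_tensor K A c d)
  (piece_tensor K A (a + c) (b + d)) (tens_gmult K A a b c d)"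
  and tens_gmult_ptens: "x1 : carrier (piece A a) ==> x2 : carrier (piece A b) ==>
  y1 : carrier (piece A c) ==> y2 : carrier (piece A d) ==>
  tens_gmult K A a b c d (ptens K (piece A a) (piece A b) x1 x2) (ptens K (piece A c) (piece A d) y1 y2) =
  ptens K (piece A (a + c)) (piece A (b + d)) (gmult A a c x1 y1) (gmult A b d x2 y2)"
proof -
 let ?P = "piece_tensor K A (a + c) (b + d)"
 let ?f = "%x1 x2 y1 y2. ptens K (piece A (a + c)) (piece A (b + d)) (gmult A a c x1 y1) (gmult A b d x2 y2)"
 let ?F = "%x1 x2. tens_lift K (piece A c) (piece A d) ?P (?f x1 x2)"
 note P = tensor_module[OF m m, of "a + c" "b + d"]
 note pb = ptens_bilinear[OF m m, of "a + c" "b + d"]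
 have f: "bilinear_map K (piece A c) (piece A d) ?P (?f x1 x2)"
  if "x1 : carrier (piece A a)" "x2 : carrier (piece A b)" for x1 x2
  using bilinear_map_comp[OF pb bilinear_map_right[OF g that(1)] bilinear_map_right[OF g that(2)] lin_id] .
 have f': "bilinear_map K (piece A a) (piece A b) ?P (%x1 x2. ?f x1 x2 y1 y2)"
  if "y1 : carrier (piece A c)" "y2 : carrier (piece A d)" for y1 y2
  using bilinear_map_comp[OF pb bilinear_map_left[OF g that(1)] bilinear_map_left[OF g that(2)] lin_id] .
 have F: "bilinear_map K (piece A a) (piece A b) ?P (%x1 x2. ?F x1 x2 v)"
  if v: "v : carrier (piece_tensor K A c d)" for v
 proof (rule bilinear_mapI_hom)
  fix x1 assume x1: "x1 : carrier (piece A a)"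
  show "(%x2. ?F x1 x2 v) : mod_hom K (piece A b) ?P"
  by (rule tens_lift_hom_param[OF m m P m f[OF x1] _ v])
  (simp_all add: bilinear_map_right[OF f' x1])
 next
  fix x2 assume x2: "x2 : carrier (piece A b)"
  show "(%x1. ?F x1 x2 v) : mod_hom K (piece A a) ?P"
  by (rule tens_lift_hom_param[OF m m P m f[OF _ x2] _ v])
  (simp_all add: bilinear_map_left[OF f' x2])
 qed
 show "bilinear_map K (piece_tensor K A a b) (piece_tensor K A c d) ?P (tens_gmult K A a b c d)"
  unfolding tens_gmult_def[abs_def]
 proof (rule bilinear_mapI_hom)
  fix u assume u: "u : carrier (piece_tensor K A a b)"
  show "(%v. tens_lift K (piece A a) (piece A b) ?P (%x1 x2. ?F x1 x2 v) u) :
  mod_hom K (piece_tensor K A c d) ?P"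
  by (rule tens_lift_hom_param[OF m m P tensor_module[OF m m] F _ u])
  (assumption | rule tens_lift_hom[OF m m P f])+
 next
  fix v assume v: "v : carrier (piece_tensor K A c d)"
  show "(%u. tens_lift K (piece A a) (piece A b) ?P (%x1 x2. ?F x1 x2 v) u) :
  mod_hom K (piece_tensor K A a b) ?P"
  by (rule tens_lift_hom[OF m m P F[OF v]])
 qed
 assume x: "x1 : carrier (piece A a)" "x2 : carrier (piece A b)"
  and y: "y1 : carrier (piece A c)" "y2 : carrier (piece A d)"
 show "tens_gmult K A a b c d (ptens K (piece A a) (piece A b) x1 x2) (ptens K (piece A c) (piece A d) y1 y2) =
  ?f x1 x2 y1 y2"
  unfolding tens_gmult_def tens_lift_ptens[OF m m P F[OF ptens_closed[OF m m y]] x]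
  by (rule tens_lift_ptens[OF m m P f[OF x] y])
qed

text \<open>Identities in degrees \<open>i\<close>, \<open>j\<close>, \<open>l\<close> are proved at
  partitions with disjoint blocks of these sizes and pulled back along injective maps such as
  \<open>put\<close> and \<open>IB\<close>.\<close>

lemma disjoint_sets_exist:
 fixes i j l :: nat
 obtains b c d :: "nat set" where "finite b" "finite c" "finite d" "card b = i" "card c = j" "card d = l"
  "b Int c = {}" "b Int d = {}" "c Int d = {}"
proof
 show "finite {0..<i}" "finite {i..<i + j}" "finite {i + j..<i + j + l}" "card {0..<i} = i"
  "card {i..<i + j} = j" "card {i + j..<i + j + l} = l" "{0..<i} Int {i..<i + j} = {}"
  "{0..<i} Int {i + j..<i + j + l} = {}" "{i..<i + j} Int {i + j..<i + j + l} = {}" by auto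
qed

text \<open>A number that labels no block has the empty class. An empty \<open>b\<close> or
  \<open>c\<close> has no label, so it is never the class of a point.\<close>

lemma two_block_class:
 assumes "finite b" "finite c" "b Int c = {}"
 shows "{s:b Un c. lab (pU (J b) (J c)) s = x} : {{}, b, c}"
  and "s : b ==> {t:b Un c. lab (pU (J b) (J c)) t = lab (pU (J b) (J c)) s} = b"
  and "s : c ==> {t:b Un c. lab (pU (J b) (J c)) t = lab (pU (J b) (J c)) s} = c"
proof -
 have P: "is_part (pU (J b) (J c))" using assms by (intro is_part_pU) auto
 have l: "lab (pU (J b) (J c)) t = lab (pU (J b) (J c)) s \<longleftrightarrow> (t : b & s : b | t : c & s : c)"
  if "t : b Un c" "s : b Un c" for s t
  using lab_eq_iff[OF P, of t s] that by simp
 show B: "{t:b Un c. lab (pU (J b) (J c)) t = lab (pU (J b) (J c)) s} = b" if "s : b" for s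
  using l[of _ s] that assms(3) by blast
 show C: "{t:b Un c. lab (pU (J b) (J c)) t = lab (pU (J b) (J c)) s} = c" if "s : c" for s
  using l[of _ s] that assms(3) by blast
 show "{s:b Un c. lab (pU (J b) (J c)) s = x} : {{}, b, c}"
 proof (cases "EX s:b Un c. lab (pU (J b) (J c)) s = x")
  case True
  then obtain s where s: "s : b Un c" "x = lab (pU (J b) (J c)) s" by blast
  then consider "s : b" | "s : c" by blast
  then show ?thesis
  proof cases
  case 1 then show ?thesis unfolding s(2) B[OF 1] by simp
  next
  case 2 then show ?thesis unfolding s(2) C[OF 2] by simp
  qed
 next
  case False then show ?thesis by auto
 qed
qed

section \<open>The algebra and coalgebra axioms\<close>

context symmetric_monoidal_partition_functor
begin

lemma put_inj:
 assumes "finite b" "x : V (indiscrete (card b))" "y : V (indiscrete (card b))" "put R b x = put R b y"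
 shows "x = y"
 using mod_isoD(3)[OF put_iso[OF assms(1)]] assms(2-) by (simp add: inj_on_def)

lemma IB_iso:
 assumes b: "finite b" "finite c" "b Int c = {}"
 shows "IB b c : mod_iso K (tensor K (val R (indiscrete (card b))) (val R (indiscrete (card c))))
  (val R (pU (J b) (J c)))"
 unfolding IB_def[abs_def]
 by (rule mod_iso_comp[OF tens_map_iso[OF _ _ _ _ put_iso[OF b(1)] put_iso[OF b(2)]] ibT_iso])
  (use b in \<open>auto intro: val_module\<close>)

lemma J_disjoint_parts:
 assumes "finite b" "finite c" "b Int c = {}"
 shows "is_part (pU (J b) (J c))" "pts (J b) Int pts (J c) = {}"
  "pmor (pU (J b) (J c)) (J (b Un c)) id"
proof -
 show p: "is_part (pU (J b) (J c))" "pts (J b) Int pts (J c) = {}"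
  using assms by (auto intro!: is_part_pU)
 show "pmor (pU (J b) (J c)) (J (b Un c)) id" using p by (intro pmor_to_J) auto
qed

lemma gm_closed: "x : V (indiscrete i) ==> y : V (indiscrete j) ==> gm i j x y : V (indiscrete (i + j))"
 by (rule bilinear_map_closed[OF gm_bilinear])

text \<open>Merging three blocks pairwise, in either order, is one transfer into a single block,
  applied to a triple product that \<open>ib_assoc\<close> makes independent of the
  brackets.\<close>

lemma gm_assoc:
 assumes x: "x : V (indiscrete i)" and y: "y : V (indiscrete j)" and z: "z : V (indiscrete l)"
 shows "gm (i + j) l (gm i j x y) z = gm i (j + l) x (gm j l y z)"
proof -
 obtain b c d :: "nat set" where b: "finite b" "finite c" "finite d" and ca: "card b = i" "card c = j" "card d = l"
  and ds: "b Int c = {}" "b Int d = {}" "c Int d = {}" by (rule disjoint_sets_exist)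
 have cbc: "card (b Un c) = i + j" and ccd: "card (c Un d) = j + l" and cbcd: "card (b Un (c Un d)) = i + (j + l)"
  using b ca ds by (simp_all add: card_Un_disjoint Int_Un_distrib)
 have d1: "(b Un c) Int d = {}" and d2: "b Int (c Un d) = {}" using ds by auto
 have fbc: "finite (b Un c)" "finite (c Un d)" using b by auto
 have p: "is_part (J b)" "is_part (J c)" "is_part (J d)" using b by auto
 note q1 = J_disjoint_parts[OF b(1,2) ds(1)] and q2 = J_disjoint_parts[OF b(2,3) ds(3)]
 note r1 = J_disjoint_parts[OF fbc(1) b(3) d1] and r2 = J_disjoint_parts[OF b(1) fbc(2) d2]
 let ?x = "put R b x" and ?y = "put R c y" and ?z = "put R d z"
 have X: "?x : V (J b)" "?y : V (J c)" "?z : V (J d)"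
  using put_closed[OF b(1)] put_closed[OF b(2)] put_closed[OF b(3)] x y z ca by auto
 let ?U = "J (b Un (c Un d))"
 note xy = ib_closed[OF p(1,2) q1(2) X(1,2)] and yz = ib_closed[OF p(2,3) q2(2) X(2,3)]
 have dd1: "pts (pU (J b) (J c)) Int pts (J d) = {}" and dd2: "pts (J b) Int pts (pU (J c) (J d)) = {}"
  "pts (J (b Un c)) Int pts (J d) = {}" "pts (J b) Int pts (J (c Un d)) = {}" using ds by auto
 have "put R (b Un (c Un d)) (gm (i + j) l (gm i j x y) z) =
  tr R (pU (J (b Un c)) (J d)) ?U id (ib K R (J (b Un c)) (J d) (put R (b Un c) (gm i j x y)) ?z)"
  using tr_merge[OF fbc(1) b(3) d1, of "gm i j x y" z] gm_closed[OF x y] z ca cbc by (simp add: Un_assoc)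
 also have "put R (b Un c) (gm i j x y) = tr R (pU (J b) (J c)) (J (b Un c)) id (ib K R (J b) (J c) ?x ?y)"
  using tr_merge[OF b(1,2) ds(1), of x y] x y ca by simp
 also have "ib K R (J (b Un c)) (J d) ... ?z =
  ib K R (J (b Un c)) (J d) (tr R (pU (J b) (J c)) (J (b Un c)) id (ib K R (J b) (J c) ?x ?y)) (tr R (J d) (J d) id ?z)"
  by (simp only: tr_id[OF p(3) X(3)])
 also have "... = tr R (pU (pU (J b) (J c)) (J d)) (pU (J (b Un c)) (J d)) id
  (ib K R (pU (J b) (J c)) (J d) (ib K R (J b) (J c) ?x ?y) ?z)"
  by (rule ib_tr[OF q1(3) pmor_id[OF p(3)] dd1 dd2(2) xy X(3), symmetric])
 also have "tr R (pU (J (b Un c)) (J d)) ?U id ... = tr R (pU (pU (J b) (J c)) (J d)) ?U (id o id)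
  (ib K R (pU (J b) (J c)) (J d) (ib K R (J b) (J c) ?x ?y) ?z)"
  by (rule tr_tr[OF pmor_pU[OF q1(3) pmor_id[OF p(3)] dd1 dd2(2)] r1(3)[unfolded Un_assoc]
  ib_closed[OF q1(1) p(3) dd1 xy X(3)]])
 also have "... = tr R (pU (J b) (pU (J c) (J d))) ?U (id o id)
  (ib K R (J b) (pU (J c) (J d)) ?x (ib K R (J c) (J d) ?y ?z))"
  unfolding pU_assoc using ib_assoc[OF p _ _ _ X] ds by simp
 also have "... = tr R (pU (J b) (J (c Un d))) ?U id (tr R (pU (J b) (pU (J c) (J d))) (pU (J b) (J (c Un d))) id
  (ib K R (J b) (pU (J c) (J d)) ?x (ib K R (J c) (J d) ?y ?z)))"
  by (rule tr_tr[OF pmor_pU[OF pmor_id[OF p(1)] q2(3) dd2(1,3)] r2(3)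
  ib_closed[OF p(1) q2(1) dd2(1) X(1) yz], symmetric])
 also have "tr R (pU (J b) (pU (J c) (J d))) (pU (J b) (J (c Un d))) id
  (ib K R (J b) (pU (J c) (J d)) ?x (ib K R (J c) (J d) ?y ?z)) =
  ib K R (J b) (J (c Un d)) (tr R (J b) (J b) id ?x) (tr R (pU (J c) (J d)) (J (c Un d)) id (ib K R (J c) (J d) ?y ?z))"
  by (rule ib_tr[OF pmor_id[OF p(1)] q2(3) dd2(1,3) X(1) yz])
 also have "... = ib K R (J b) (J (c Un d)) ?x (put R (c Un d) (gm j l y z))"
  using tr_merge[OF b(2,3) ds(3), of y z] y z ca by (simp add: tr_id[OF p(1) X(1)])
 also have "tr R (pU (J b) (J (c Un d))) ?U id ... = put R (b Un (c Un d)) (gm i (j + l) x (gm j l y z))"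
  using tr_merge[OF b(1) fbc(2) d2, of x "gm j l y z"] gm_closed[OF y z] x ca ccd by simp
 finally show ?thesis
  using put_inj[of "b Un (c Un d)"] b gm_closed[OF gm_closed[OF x y] z] gm_closed[OF x gm_closed[OF y z]]
  by (simp add: cbcd add.assoc)
qed

lemma gm_comm:
 assumes x: "x : V (indiscrete i)" and y: "y : V (indiscrete j)"
 shows "gm i j x y = gm j i y x"
proof -
 obtain b c d :: "nat set" where b: "finite b" "finite c" and ca: "card b = i" "card c = j"
  and ds: "b Int c = {}" by (rule disjoint_sets_exist[of i j 0]) blast
 have ds': "c Int b = {}" using ds by auto
 have X: "put R b x : V (J b)" "put R c y : V (J c)"
  using put_closed[OF b(1)] put_closed[OF b(2)] x y ca by auto
 have "put R (b Un c) (gm i j x y) = put R (b Un c) (gm j i y x)"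
  using tr_merge[OF b ds, of x y] tr_merge[OF b(2,1) ds', of y x] x y ca ds b
  ib_comm[OF _ _ _ X] pU_comm[of "J b"] by (simp add: Un_commute)
 then show ?thesis
  using put_inj[of "b Un c"] b gm_closed[OF x y] gm_closed[OF y x] ca ds
  by (simp add: card_Un_disjoint add.commute)
qed

lemma kunit_closed: "k : carrier K ==> kunit R k : V pempty"
 using lin_closed[OF mod_isoD(1)[OF kunit_iso]] by (simp add: self_mod_def)

lemma put_empty: "x : V pempty ==> put R {} x = x"
 using put_indiscrete[of x 0] by simp

lemma gm_unit:
 assumes k: "k : carrier K" and x: "x : V (indiscrete n)"
 shows "gm 0 n (kunit R k) x = k \<odot>\<^bsub>val R (indiscrete n)\<^esub> x"
proof -
 interpret A: module K "val R (indiscrete n)" by (rule val_module) simp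
 obtain b c d :: "nat set" where c: "finite c" "card c = n" by (rule disjoint_sets_exist[of n 0 0])
 have p: "is_part (J c)" using c by simp
 have xc: "put R c x : V (J c)" using put_closed[OF c(1)] x c(2) by simp
 interpret C: module K "val R (J c)" by (rule val_module[OF p])
 have ph: "put R c : mod_hom K (val R (indiscrete n)) (val R (J c))" using put_hom[OF c(1)] c(2) by simp
 have "tr R (J c) (J c) id (ib K R pempty (J c) (kunit R k) (put R c x)) = put R c (gm 0 n (kunit R k) x)"
  using tr_merge[of "{}" c "kunit R k" x] k x c kunit_closed[OF k] put_empty[OF kunit_closed[OF k]] by simp
 moreover have "tr R (J c) (J c) id (ib K R pempty (J c) (kunit R k) (put R c x)) = k \<odot>\<^bsub>val R (J c)\<^esub> put R c x"
  unfolding ib_unit[OF p k xc] by (rule tr_id[OF p C.smult_closed[OF k xc]])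
 ultimately have "put R c (gm 0 n (kunit R k) x) = put R c (k \<odot>\<^bsub>val R (indiscrete n)\<^esub> x)"
  by (simp add: lin_smult[OF ph k x])
 then show ?thesis
  using put_inj[OF c(1)] gm_closed[OF kunit_closed[OF k] x] k x c(2) by simp
qed

lemma gc_closed: "x : V (indiscrete (i + j)) ==>
  gc i j x : carrier (tensor K (val R (indiscrete i)) (val R (indiscrete j)))"
 by (rule lin_closed[OF gc_hom])

text \<open>Splitting a block into three parts in two stages is one restriction, whichever part is
  split off first. Both iterated comultiplications are compared with it inside the value at the
  three-block partition.\<close>

lemma gc_coassoc:
 assumes x: "x : V (indiscrete (i + j + l))"
 defines "A \<equiv> %n. val R (indiscrete n)"
 shows "tens_assoc K (A i) (A j) (A l)
  (tens_map K (A (i + j)) (A l) (tensor K (A i) (A j)) (A l) (gc i j) id (gc (i + j) l x)) =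
  tens_map K (A i) (A (j + l)) (A i) (tensor K (A j) (A l)) id (gc j l) (gc i (j + l) x)"
proof -
 obtain b c d :: "nat set" where b: "finite b" "finite c" "finite d" and ca: "card b = i" "card c = j" "card d = l"
  and ds: "b Int c = {}" "b Int d = {}" "c Int d = {}" by (rule disjoint_sets_exist)
 have cbc: "card (b Un c) = i + j" and ccd: "card (c Un d) = j + l" and cbcd: "card (b Un (c Un d)) = i + j + l"
  using b ca ds by (simp_all add: card_Un_disjoint Int_Un_distrib)
 have d1: "(b Un c) Int d = {}" and d2: "b Int (c Un d) = {}" using ds by auto
 have fbc: "finite (b Un c)" "finite (c Un d)" using b by auto
 have p: "is_part (J b)" "is_part (J c)" "is_part (J d)" "is_part (J (b Un c))" "is_part (J (c Un d))" using b by auto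
 note q1 = J_disjoint_parts[OF b(1,2) ds(1)] and q2 = J_disjoint_parts[OF b(2,3) ds(3)]
 note r1 = J_disjoint_parts[OF fbc(1) b(3) d1] and r2 = J_disjoint_parts[OF b(1) fbc(2) d2]
 have dd: "pts (pU (J b) (J c)) Int pts (J d) = {}" "pts (J b) Int pts (pU (J c) (J d)) = {}"
  "pts (J (b Un c)) Int pts (J d) = {}" "pts (J b) Int pts (J (c Un d)) = {}" using ds by auto
 have mA: "module K (A n)" for n unfolding A_def by (rule val_module) simp
 have pc: "put R b x : V (J b)" if "x : carrier (A i)" for x using put_closed[OF b(1)] that ca by (simp add: A_def)
 have pd: "put R d x : V (J d)" if "x : carrier (A l)" for x using put_closed[OF b(3)] that ca by (simp add: A_def)
 have pcc: "put R c x : V (J c)" if "x : carrier (A j)" for x using put_closed[OF b(2)] that ca by (simp add: A_def)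
 note mT = tensor_module[OF mA mA]
 let ?U = "pU (J b) (pU (J c) (J d))" and ?W = "J (b Un (c Un d))"
 have U: "is_part ?U" by (rule is_part_pU[OF p(1) q2(1) dd(2)])
 note mU = val_module[OF U]
 have IBbc: "IB b c : mod_hom K (tensor K (A i) (A j)) (val R (pU (J b) (J c)))"
  "!!x y. x : carrier (A i) ==> y : carrier (A j) ==>
  IB b c (ptens K (A i) (A j) x y) = ib K R (J b) (J c) (put R b x) (put R c y)"
  using IB_hom[OF b(1,2) ds(1)] IB_ptens[OF b(1,2) ds(1)] by (simp_all add: A_def ca)
 have IBcd: "IB c d : mod_iso K (tensor K (A j) (A l)) (val R (pU (J c) (J d)))"
  "!!x y. x : carrier (A j) ==> y : carrier (A l) ==>
  IB c d (ptens K (A j) (A l) x y) = ib K R (J c) (J d) (put R c x) (put R d y)"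
  using IB_iso[OF b(2,3) ds(3)] IB_ptens[OF b(2,3) ds(3)] by (simp_all add: A_def ca)
 have IB1: "IB (b Un c) d : mod_hom K (tensor K (A (i + j)) (A l)) (val R (pU (J (b Un c)) (J d)))"
  "!!x y. x : carrier (A (i + j)) ==> y : carrier (A l) ==>
  IB (b Un c) d (ptens K (A (i + j)) (A l) x y) = ib K R (J (b Un c)) (J d) (put R (b Un c) x) (put R d y)"
  using IB_hom[OF fbc(1) b(3) d1] IB_ptens[OF fbc(1) b(3) d1] by (simp_all add: A_def ca cbc)
 have IB2: "IB b (c Un d) : mod_hom K (tensor K (A i) (A (j + l))) (val R (pU (J b) (J (c Un d))))"
  "!!x y. x : carrier (A i) ==> y : carrier (A (j + l)) ==>
  IB b (c Un d) (ptens K (A i) (A (j + l)) x y) = ib K R (J b) (J (c Un d)) (put R b x) (put R (c Un d) y)"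
  using IB_hom[OF b(1) fbc(2) d2] IB_ptens[OF b(1) fbc(2) d2] by (simp_all add: A_def ca ccd)
 have gch: "gc i j : mod_hom K (A (i + j)) (tensor K (A i) (A j))" for i j
  using gc_hom by (simp add: A_def)
 have putb: "put R b : mod_iso K (A i) (val R (J b))" using put_iso[OF b(1)] by (simp add: A_def ca)
 let ?tm = "tens_map K (A i) (tensor K (A j) (A l)) (val R (J b)) (val R (pU (J c) (J d))) (put R b) (IB c d)"
 \<comment> \<open>The triple internal product as an injective map out of the right-bracketed tensor
   product. Preceded by the associator it is the left-bracketed triple product, by
   \<open>ib_assoc\<close>.\<close>
 define \<Theta> where "\<Theta> u = ibT R (J b) (pU (J c) (J d)) (?tm u)" for u
 note tmi = tens_map_iso[OF mA mT val_module[OF p(1)] val_module[OF q2(1)] putb IBcd(1)]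
 have \<Theta>: "\<Theta> : mod_iso K (tensor K (A i) (tensor K (A j) (A l))) (val R ?U)"
  unfolding \<Theta>_def[abs_def] by (rule mod_iso_comp[OF tmi ibT_iso[OF p(1) q2(1) dd(2)]])
 have \<Theta>p: "\<Theta> (ptens K (A i) (tensor K (A j) (A l)) x v) = ib K R (J b) (pU (J c) (J d)) (put R b x) (IB c d v)"
  if "x : carrier (A i)" "v : carrier (tensor K (A j) (A l))" for x v
  unfolding \<Theta>_def
  using tens_map_ptens[OF mA mT val_module[OF p(1)] val_module[OF q2(1)] mod_isoD(1)[OF putb] mod_isoD(1)[OF IBcd(1)] that]
  by (simp add: ibT_ptens)
 note as = tens_assoc_hom[OF mA mA mA, of i j l] and asp = tens_assoc_ptens[OF mA mA mA, of _ i _ j _ l]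
 have \<Theta>as: "\<Theta> (tens_assoc K (A i) (A j) (A l) (ptens K (tensor K (A i) (A j)) (A l) v z)) =
  ib K R (pU (J b) (J c)) (J d) (IB b c v) (put R d z)"
  if v: "v : carrier (tensor K (A i) (A j))" and z: "z : carrier (A l)" for v z
 proof (rule tensor_hom_eqI[OF mA mA mU _ _ _ v])
  show "(%v. \<Theta> (tens_assoc K (A i) (A j) (A l) (ptens K (tensor K (A i) (A j)) (A l) v z))) :
  mod_hom K (tensor K (A i) (A j)) (val R ?U)"
  by (rule lin_comp[OF lin_comp[OF bilinear_map_left[OF ptens_bilinear[OF mT mA] z] as] mod_isoD(1)[OF \<Theta>]])
  show "(%v. ib K R (pU (J b) (J c)) (J d) (IB b c v) (put R d z)) : mod_hom K (tensor K (A i) (A j)) (val R ?U)"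
  using lin_comp[OF IBbc(1) bilinear_map_left[OF ib_bilinear[OF q1(1) p(3) dd(1)] pd[OF z]]]
  by (simp only: pU_assoc)
  fix x y assume x: "x : carrier (A i)" and y: "y : carrier (A j)"
  show "\<Theta> (tens_assoc K (A i) (A j) (A l) (ptens K (tensor K (A i) (A j)) (A l) (ptens K (A i) (A j) x y) z)) =
  ib K R (pU (J b) (J c)) (J d) (IB b c (ptens K (A i) (A j) x y)) (put R d z)"
  unfolding asp[OF x y z] \<Theta>p[OF x ptens_closed[OF mA mA y z]] IBcd(2)[OF y z] IBbc(2)[OF x y]
  by (rule ib_assoc[OF p(1-3) _ _ _ pc[OF x] pcc[OF y] pd[OF z], symmetric]) (use ds in auto)
 qed
 note tL = tens_map_hom[OF mA mA mT mA gch lin_id', of i j l] and tLp = tens_map_ptens[OF mA mA mT mA gch lin_id', of _ i j _ l]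
 note tR = tens_map_hom[OF mA mA mA mT lin_id' gch, of i j l] and tRp = tens_map_ptens[OF mA mA mA mT lin_id' gch, of _ i _ j l]
 have L: "\<Theta> (tens_assoc K (A i) (A j) (A l) (tens_map K (A (i + j)) (A l) (tensor K (A i) (A j)) (A l) (gc i j) id u)) =
  res R ?U (pU (J (b Un c)) (J d)) id (IB (b Un c) d u)"
  if u: "u : carrier (tensor K (A (i + j)) (A l))" for u
 proof (rule tensor_hom_eqI[OF mA mA mU _ _ _ u])
  note pm = pmor_pU[OF q1(3) pmor_id[OF p(3)] dd(1,3), unfolded pU_assoc]
  show "(%u. \<Theta> (tens_assoc K (A i) (A j) (A l) (tens_map K (A (i + j)) (A l) (tensor K (A i) (A j)) (A l) (gc i j) id u))) :
  mod_hom K (tensor K (A (i + j)) (A l)) (val R ?U)"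
  by (rule lin_comp[OF lin_comp[OF tL as] mod_isoD(1)[OF \<Theta>]])
  show "(%u. res R ?U (pU (J (b Un c)) (J d)) id (IB (b Un c) d u)) : mod_hom K (tensor K (A (i + j)) (A l)) (val R ?U)"
  by (rule lin_comp[OF IB1(1) res_hom[OF pm]])
  fix w z assume w: "w : carrier (A (i + j))" and z: "z : carrier (A l)"
  have pw: "put R (b Un c) w : V (J (b Un c))" using put_closed[OF fbc(1)] w cbc by (simp add: A_def)
  have gw: "gc i j w : carrier (tensor K (A i) (A j))" by (rule lin_closed[OF gch w])
  have s: "IB b c (gc i j w) = res R (pU (J b) (J c)) (J (b Un c)) id (put R (b Un c) w)"
  using res_split[OF b(1,2) ds(1), of w] w ca by (simp add: A_def)
  have "res R (pU (pU (J b) (J c)) (J d)) (pU (J (b Un c)) (J d)) id (ib K R (J (b Un c)) (J d) (put R (b Un c) w) (put R d z)) =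
  ib K R (pU (J b) (J c)) (J d) (IB b c (gc i j w)) (res R (J d) (J d) id (put R d z))"
  unfolding s by (rule ib_res[OF q1(3) pmor_id[OF p(3)] dd(1,3) pw pd[OF z]])
  then show "\<Theta> (tens_assoc K (A i) (A j) (A l) (tens_map K (A (i + j)) (A l) (tensor K (A i) (A j)) (A l) (gc i j) id
  (ptens K (A (i + j)) (A l) w z))) =
  res R ?U (pU (J (b Un c)) (J d)) id (IB (b Un c) d (ptens K (A (i + j)) (A l) w z))"
  unfolding tLp[OF w z] id_apply[of z] \<Theta>as[OF gw z] IB1(2)[OF w z] pU_assoc by (simp only: res_id[OF p(3) pd[OF z]])
 qed
 have Rr: "\<Theta> (tens_map K (A i) (A (j + l)) (A i) (tensor K (A j) (A l)) id (gc j l) u) =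
  res R ?U (pU (J b) (J (c Un d))) id (IB b (c Un d) u)"
  if u: "u : carrier (tensor K (A i) (A (j + l)))" for u
 proof (rule tensor_hom_eqI[OF mA mA mU _ _ _ u])
  note pm = pmor_pU[OF pmor_id[OF p(1)] q2(3) dd(2,4)]
  show "(%u. \<Theta> (tens_map K (A i) (A (j + l)) (A i) (tensor K (A j) (A l)) id (gc j l) u)) :
  mod_hom K (tensor K (A i) (A (j + l))) (val R ?U)"
  by (rule lin_comp[OF tR mod_isoD(1)[OF \<Theta>]])
  show "(%u. res R ?U (pU (J b) (J (c Un d))) id (IB b (c Un d) u)) : mod_hom K (tensor K (A i) (A (j + l))) (val R ?U)"
  by (rule lin_comp[OF IB2(1) res_hom[OF pm]])
  fix x w assume x: "x : carrier (A i)" and w: "w : carrier (A (j + l))"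
  have pw: "put R (c Un d) w : V (J (c Un d))" using put_closed[OF fbc(2)] w ccd by (simp add: A_def)
  have gw: "gc j l w : carrier (tensor K (A j) (A l))" by (rule lin_closed[OF gch w])
  have s: "IB c d (gc j l w) = res R (pU (J c) (J d)) (J (c Un d)) id (put R (c Un d) w)"
  using res_split[OF b(2,3) ds(3), of w] w ca by (simp add: A_def)
  have "res R ?U (pU (J b) (J (c Un d))) id (ib K R (J b) (J (c Un d)) (put R b x) (put R (c Un d) w)) =
  ib K R (J b) (pU (J c) (J d)) (res R (J b) (J b) id (put R b x)) (IB c d (gc j l w))"
  unfolding s by (rule ib_res[OF pmor_id[OF p(1)] q2(3) dd(2,4) pc[OF x] pw])
  then show "\<Theta> (tens_map K (A i) (A (j + l)) (A i) (tensor K (A j) (A l)) id (gc j l) (ptens K (A i) (A (j + l)) x w)) =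
  res R ?U (pU (J b) (J (c Un d))) id (IB b (c Un d) (ptens K (A i) (A (j + l)) x w))"
  unfolding tRp[OF x w] id_apply[of x] \<Theta>p[OF x gw] IB2(2)[OF x w] by (simp only: res_id[OF p(1) pc[OF x]])
 qed
 have x1: "x : carrier (A (i + j + l))" "x : carrier (A (i + (j + l)))" using x by (simp_all add: A_def add.assoc)
 note g1 = lin_closed[OF gch x1(1)] and g2 = lin_closed[OF gch x1(2)]
 have pw: "put R (b Un (c Un d)) x : V ?W" using put_closed[of "b Un (c Un d)"] b x cbcd by simp
 have s1: "IB (b Un c) d (gc (i + j) l x) = res R (pU (J (b Un c)) (J d)) ?W id (put R (b Un (c Un d)) x)"
  using res_split[OF fbc(1) b(3) d1, of x] x by (simp add: cbc ca Un_assoc)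
 have s2: "IB b (c Un d) (gc i (j + l) x) = res R (pU (J b) (J (c Un d))) ?W id (put R (b Un (c Un d)) x)"
  using res_split[OF b(1) fbc(2) d2, of x] x by (simp add: ccd ca add.assoc)
 have "\<Theta> (tens_assoc K (A i) (A j) (A l)
  (tens_map K (A (i + j)) (A l) (tensor K (A i) (A j)) (A l) (gc i j) id (gc (i + j) l x))) =
  res R ?U ?W (id o id) (put R (b Un (c Un d)) x)"
  unfolding L[OF g1] s1
  by (rule res_res[OF pmor_pU[OF q1(3) pmor_id[OF p(3)] dd(1,3), unfolded pU_assoc] r1(3)[unfolded Un_assoc] pw])
 also have "... = \<Theta> (tens_map K (A i) (A (j + l)) (A i) (tensor K (A j) (A l)) id (gc j l) (gc i (j + l) x))"
  unfolding Rr[OF g2] s2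
  by (rule res_res[OF pmor_pU[OF pmor_id[OF p(1)] q2(3) dd(2,4)] r2(3) pw, symmetric])
 finally show ?thesis
  by (rule inj_onD[OF mod_isoD(3)[OF \<Theta>]]) (rule lin_closed[OF as lin_closed[OF tL g1]] lin_closed[OF tR g2])+
qed

lemma gc_cocomm:
 assumes x: "x : V (indiscrete (i + j))"
 shows "tens_swap K (val R (indiscrete i)) (val R (indiscrete j)) (gc i j x) = gc j i x"
proof -
 let ?A = "%n. val R (indiscrete n)"
 have mA: "module K (?A n)" for n by (rule val_module) simp
 obtain b c d :: "nat set" where b: "finite b" "finite c" and ca: "card b = i" "card c = j"
  and ds: "b Int c = {}" by (rule disjoint_sets_exist[of i j 0]) blast
 have ds': "c Int b = {}" using ds by auto
 have p: "is_part (J b)" "is_part (J c)" using b by auto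
 note q = J_disjoint_parts[OF b ds]
 have IBbc: "IB b c : mod_hom K (tensor K (?A i) (?A j)) (val R (pU (J b) (J c)))"
  "!!x y. x : carrier (?A i) ==> y : carrier (?A j) ==>
  IB b c (ptens K (?A i) (?A j) x y) = ib K R (J b) (J c) (put R b x) (put R c y)"
  using IB_hom[OF b ds] IB_ptens[OF b ds] by (simp_all add: ca)
 have IBcb: "IB c b : mod_iso K (tensor K (?A j) (?A i)) (val R (pU (J b) (J c)))"
  "!!x y. x : carrier (?A j) ==> y : carrier (?A i) ==>
  IB c b (ptens K (?A j) (?A i) x y) = ib K R (J c) (J b) (put R c x) (put R b y)"
  using IB_iso[OF b(2,1) ds'] IB_ptens[OF b(2,1) ds'] by (simp_all add: ca pU_comm[of "J c"])
 note sw = tens_swap_hom[OF mA mA, of i j] and swp = tens_swap_ptens[OF mA mA, of _ i _ j]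
 have key: "IB c b (tens_swap K (?A i) (?A j) u) = IB b c u" if u: "u : carrier (tensor K (?A i) (?A j))" for u
 proof (rule tensor_hom_eqI[OF mA mA val_module[OF q(1)] lin_comp[OF sw mod_isoD(1)[OF IBcb(1)]] IBbc(1) _ u])
  fix x y assume x: "x : V (indiscrete i)" and y: "y : V (indiscrete j)"
  have X: "put R b x : V (J b)" "put R c y : V (J c)"
  using put_closed[OF b(1)] put_closed[OF b(2)] x y ca by auto
  show "IB c b (tens_swap K (?A i) (?A j) (ptens K (?A i) (?A j) x y)) = IB b c (ptens K (?A i) (?A j) x y)"
  unfolding swp[OF x y] IBcb(2)[OF y x] IBbc(2)[OF x y] by (rule ib_comm[OF p q(2) X])
 qed
 have x': "x : V (indiscrete (j + i))" using x by (simp add: add.commute)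
 have "IB b c (gc i j x) = IB c b (gc j i x)"
  using res_split[OF b ds, of x] res_split[OF b(2,1) ds', of x] x x'
  by (simp add: ca Un_commute pU_comm[of "J c"])
 then have "IB c b (tens_swap K (?A i) (?A j) (gc i j x)) = IB c b (gc j i x)" using key[OF gc_closed[OF x]] by simp
 then show ?thesis
  by (rule inj_onD[OF mod_isoD(3)[OF IBcb(1)]]) (rule lin_closed[OF sw gc_closed[OF x]] gc_closed[OF x'])+
qed

abbreviation ku where "ku \<equiv> inv_into (carrier K) (kunit R)"

lemma self_mod_simps: "carrier (self_mod K) = carrier K" "zero (self_mod K) = \<zero>\<^bsub>K\<^esub>" "add (self_mod K) = add K"
 "smult (self_mod K) = monoid.mult K"
 by (simp_all add: self_mod_def)

lemma ku: "k : carrier K ==> ku (kunit R k) = k" "x : V pempty ==> kunit R (ku x) = x" "x : V pempty ==> ku x : carrier K"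
 "ku : mod_hom K (val R pempty) (self_mod K)"
 using lin_inv_into_eq[OF kunit_iso] lin_f_inv_into[OF kunit_iso]
  mod_isoD(1)[OF mod_iso_inv_into[OF cring_self_mod[OF is_cring] kunit_iso]]
 by (simp_all add: self_mod_simps)

text \<open>Realised with the empty set as first block: the restriction is then along an identity,
  and \<open>ib_unit\<close> turns the factor at the empty partition into a scalar.\<close>

lemma gc_counit:
 assumes x: "x : V (indiscrete n)"
 shows "tens_lift K (val R pempty) (val R (indiscrete n)) (val R (indiscrete n))
  (%a b. ku a \<odot>\<^bsub>val R (indiscrete n)\<^esub> b) (gc 0 n x) = x"
proof -
 let ?A = "%n. val R (indiscrete n)"
 have mA: "module K (?A n)" for n by (rule val_module) simp
 interpret A: module K "?A n" by (rule mA)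
 note kh = ku(4)
 have bl: "bilinear_map K (?A 0) (?A n) (?A n) (%a b. ku a \<odot>\<^bsub>?A n\<^esub> b)"
  by (rule bilinear_mapI)
  (auto simp: ku(3) lin_add[OF kh] lin_smult[OF kh] self_mod_simps A.smult_l_distr A.smult_r_distr
  A.smult_assoc1[symmetric] m_comm)
 obtain b c d :: "nat set" where c: "finite c" "card c = n" by (rule disjoint_sets_exist[of n 0 0])
 have fc: "finite {}" "finite c" "{} Int c = {}" using c by auto
 have IB: "IB {} c : mod_hom K (tensor K (?A 0) (?A n)) (val R (J c))"
  "!!x y. x : carrier (?A 0) ==> y : carrier (?A n) ==>
  IB {} c (ptens K (?A 0) (?A n) x y) = ib K R pempty (J c) x (put R c y)"
  using IB_hom[OF fc] IB_ptens[OF fc] by (simp_all add: c put_empty)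
 have pc: "is_part (J c)" using c by simp
 have puth: "put R c : mod_hom K (?A n) (val R (J c))" using put_hom[OF c(1)] by (simp add: c)
 note tl = tens_lift_hom[OF mA mA mA bl] and tlp = tens_lift_ptens[OF mA mA mA bl]
 have key: "put R c (tens_lift K (?A 0) (?A n) (?A n) (%a b. ku a \<odot>\<^bsub>?A n\<^esub> b) u) = IB {} c u"
  if u: "u : carrier (tensor K (?A 0) (?A n))" for u
 proof (rule tensor_hom_eqI[OF mA mA val_module[OF pc] lin_comp[OF tl puth] IB(1) _ u])
  fix a x assume a: "a : carrier (?A 0)" and x: "x : carrier (?A n)"
  show "put R c (tens_lift K (?A 0) (?A n) (?A n) (%a b. ku a \<odot>\<^bsub>?A n\<^esub> b) (ptens K (?A 0) (?A n) a x)) =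
  IB {} c (ptens K (?A 0) (?A n) a x)"
  unfolding tlp[OF a x] IB(2)[OF a x] lin_smult[OF puth ku(3)[OF a] x]
  using ib_unit[OF pc ku(3)[OF a] lin_closed[OF puth x]] by (simp add: ku(2)[OF a])
 qed
 have g: "gc 0 n x : carrier (tensor K (?A 0) (?A n))" using gc_closed[of x 0 n] x by simp
 have "IB {} c (gc 0 n x) = put R c x"
  using res_split[OF fc, of x] x res_id[OF pc lin_closed[OF puth x]] by (simp add: c)
 then have "put R c (tens_lift K (?A 0) (?A n) (?A n) (%a b. ku a \<odot>\<^bsub>?A n\<^esub> b) (gc 0 n x)) = put R c x"
  using key[OF g] by simp
 then show ?thesis
  using put_inj[OF c(1)] lin_closed[OF tl g] x by (simp add: c)
qed

lemma gc_one: "gc 0 0 (kunit R \<one>\<^bsub>K\<^esub>) = ptens K (val R pempty) (val R pempty) (kunit R \<one>\<^bsub>K\<^esub>) (kunit R \<one>\<^bsub>K\<^esub>)"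
proof -
 let ?u = "kunit R \<one>\<^bsub>K\<^esub>"
 have u: "?u : V pempty" by (rule kunit_closed) simp
 interpret A: module K "val R pempty" by (rule val_module) simp
 have f: "finite ({} :: nat set)" "{} Int {} = ({} :: nat set)" by auto
 have i: "inj_on (IB {} {}) (carrier (tensor K (val R pempty) (val R pempty)))"
  using mod_isoD(3)[OF IB_iso[OF f(1,1,2)]] by simp
 have "IB {} {} (gc 0 0 ?u) = ?u"
  using res_split[OF f(1,1,2), of ?u] u res_id[OF is_part_indiscrete u] by (simp add: put_empty)
 moreover have "IB {} {} (ptens K (val R pempty) (val R pempty) ?u ?u) = ?u"
  using IB_ptens[OF f(1,1,2), of ?u ?u] u ib_unit[OF is_part_indiscrete _ u, of "\<one>\<^bsub>K\<^esub>"] by (simp add: put_empty)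
 ultimately show ?thesis
  by (intro inj_onD[OF i]) (use u gc_closed[of ?u 0 0] in \<open>auto intro!: ptens_closed val_module\<close>)
qed

lemma gm_ku:
 assumes "x : V pempty" "y : V pempty"
 shows "ku (gm 0 0 x y) = ku x \<otimes>\<^bsub>K\<^esub> ku y"
proof -
 interpret A: module K "val R pempty" by (rule val_module) simp
 have "gm 0 0 x y = ku x \<odot>\<^bsub>val R pempty\<^esub> y"
  using gm_unit[OF ku(3)[OF assms(1)] assms(2)] by (simp add: ku(2)[OF assms(1)])
 then show ?thesis using lin_smult[OF ku(4) ku(3)[OF assms(1)] assms(2)] by (simp add: self_mod_simps)
qed

text \<open>Four blocks arise when two two-block partitions are intersected; this regroups the
  factors from source blocks to target blocks.\<close>

lemma ib_interchange:
 assumes P: "is_part P1" "is_part P2" "is_part P3" "is_part P4"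
  and d: "pts P1 Int pts P2 = {}" "pts P1 Int pts P3 = {}" "pts P1 Int pts P4 = {}"
  "pts P2 Int pts P3 = {}" "pts P2 Int pts P4 = {}" "pts P3 Int pts P4 = {}"
  and x: "x1 : V P1" "x2 : V P2" "x3 : V P3" "x4 : V P4"
 shows "ib K R (pU P1 P2) (pU P3 P4) (ib K R P1 P2 x1 x2) (ib K R P3 P4 x3 x4) =
  ib K R (pU P1 P3) (pU P2 P4) (ib K R P1 P3 x1 x3) (ib K R P2 P4 x2 x4)"
proof -
 have d': "pts P3 Int pts P2 = {}" using d(4) by auto
 note c34 = ib_closed[OF P(3,4) d(6) x(3,4)] and c24 = ib_closed[OF P(2,4) d(5) x(2,4)]
 have p: "is_part (pU P3 P4)" "is_part (pU P2 P4)" using P d by (auto intro: is_part_pU)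
 have "ib K R (pU P1 P2) (pU P3 P4) (ib K R P1 P2 x1 x2) (ib K R P3 P4 x3 x4) =
  ib K R P1 (pU P2 (pU P3 P4)) x1 (ib K R P2 (pU P3 P4) x2 (ib K R P3 P4 x3 x4))"
  by (rule ib_assoc[OF P(1,2) p(1) _ _ _ x(1,2) c34]) (use d in auto)
 also have "ib K R P2 (pU P3 P4) x2 (ib K R P3 P4 x3 x4) = ib K R (pU P2 P3) P4 (ib K R P2 P3 x2 x3) x4"
  by (rule ib_assoc[OF P(2-4) d(4-6) x(2-4), symmetric])
 also have "... = ib K R (pU P3 P2) P4 (ib K R P3 P2 x3 x2) x4"
  unfolding ib_comm[OF P(3,2) d' x(3,2)] pU_comm[of P2] ..
 also have "... = ib K R P3 (pU P2 P4) x3 (ib K R P2 P4 x2 x4)"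
  by (rule ib_assoc[OF P(3,2,4) d' d(6,5) x(3,2,4)])
 also have "ib K R P1 (pU P2 (pU P3 P4)) x1 ... =
  ib K R (pU P1 P3) (pU P2 P4) (ib K R P1 P3 x1 x3) (ib K R P2 P4 x2 x4)"
  unfolding pU_lcomm[of P2 P3] by (rule ib_assoc[OF P(1,3) p(2) _ _ _ x(1,3) c24, symmetric]) (use d in auto)
 finally show ?thesis .
qed

end

section \<open>Compatibility of multiplication and comultiplication\<close>

lemma bilinear_eqI_tensor:
 assumes m: "module K M" "module K N" "module K M'" "module K N'" "module K P"
  and f: "bilinear_map K (tensor K M N) (tensor K M' N') P f"
  and g: "bilinear_map K (tensor K M N) (tensor K M' N') P g"
  and eq: "!!x y x' y'. x : carrier M ==> y : carrier N ==> x' : carrier M' ==> y' : carrier N' ==>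
  f (ptens K M N x y) (ptens K M' N' x' y') = g (ptens K M N x y) (ptens K M' N' x' y')"
  and u: "u : carrier (tensor K M N)" and v: "v : carrier (tensor K M' N')"
 shows "f u v = g u v"
proof (rule tensor_hom_eqI[OF m(1,2,5) bilinear_map_left[OF f v] bilinear_map_left[OF g v] _ u])
 fix x y assume xy: "x : carrier M" "y : carrier N"
 note p = ptens_closed[OF m(1,2) xy]
 show "f (ptens K M N x y) v = g (ptens K M N x y) v"
  by (rule tensor_hom_eqI[OF m(3,4,5) bilinear_map_right[OF f p] bilinear_map_right[OF g p] _ v])
  (rule eq[OF xy])
qed

context symmetric_monoidal_partition_functor
begin

text \<open>One summand of the double coset formula. \<open>c11\<close> and \<open>c12\<close> come
  from the first source block, \<open>c21\<close> and \<open>c22\<close> from the second; the last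
  index tells whether \<open>si\<close> sends them to \<open>b1\<close> or \<open>b2\<close>. After
  regrouping by target the two target blocks are merged separately, which is the product of the
  tensor square.\<close>

lemma tr_split_product:
 assumes fin: "finite c11" "finite c12" "finite c21" "finite c22"
  and d: "c11 Int c12 = {}" "c11 Int c21 = {}" "c11 Int c22 = {}" "c12 Int c21 = {}" "c12 Int c22 = {}" "c21 Int c22 = {}"
  and s: "bij_betw si (c11 Un c21) b1" "bij_betw si (c12 Un c22) b2" "b1 Int b2 = {}"
  and u: "u : carrier (tensor K (val R (indiscrete (card c11))) (val R (indiscrete (card c12))))"
  and v: "v : carrier (tensor K (val R (indiscrete (card c21))) (val R (indiscrete (card c22))))"
 shows "tr R (pU (pU (J c11) (J c12)) (pU (J c21) (J c22))) (pU (J b1) (J b2)) si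
  (ib K R (pU (J c11) (J c12)) (pU (J c21) (J c22)) (IB c11 c12 u) (IB c21 c22 v)) =
  IB b1 b2 (tens_gmult K (sigma_alg K R) (card c11) (card c12) (card c21) (card c22) u v)"
proof -
 let ?A = "%n. val R (indiscrete n)" and ?S = "sigma_alg K R"
 have mA: "module K (?A n)" for n by (rule val_module) simp
 have mS: "module K (piece ?S n)" for n using mA by (simp add: sigma_alg_def)
 have gS: "bilinear_map K (piece ?S i) (piece ?S j) (piece ?S (i + j)) (gm i j)" for i j
  using gm_bilinear by (simp add: sigma_alg_def)
 have pS: "piece ?S n = ?A n" for n by (simp add: sigma_alg_def)
 let ?a = "card c11" and ?b = "card c12" and ?c = "card c21" and ?d = "card c22"
 have cb: "card b1 = ?a + ?c" "card b2 = ?b + ?d"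
  using bij_betw_same_card[OF s(1)] bij_betw_same_card[OF s(2)] fin d by (simp_all add: card_Un_disjoint)
 have fb: "finite b1" "finite b2" using bij_betw_finite[OF s(1)] bij_betw_finite[OF s(2)] fin by auto
 have p: "is_part (J c11)" "is_part (J c12)" "is_part (J c21)" "is_part (J c22)" using fin by auto
 note q1 = J_disjoint_parts[OF fin(1,2) d(1)] and q2 = J_disjoint_parts[OF fin(3,4) d(6)]
 note r1 = J_disjoint_parts[OF fin(1,3) d(2)] and r2 = J_disjoint_parts[OF fin(2,4) d(5)]
 note qb = J_disjoint_parts[OF fb s(3)]
 have dq: "pts (pU (J c11) (J c12)) Int pts (pU (J c21) (J c22)) = {}"
  and dr: "pts (pU (J c11) (J c21)) Int pts (pU (J c12) (J c22)) = {}" using d by auto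
 let ?P = "pU (pU (J c11) (J c12)) (pU (J c21) (J c22))"
 have Peq: "?P = pU (pU (J c11) (J c21)) (pU (J c12) (J c22))" by (auto simp: pU_def)
 have m1: "pmor (pU (J c11) (J c21)) (J b1) si" and m2: "pmor (pU (J c12) (J c22)) (J b2) si"
  using r1(1) r2(1) s by (auto intro: pmor_to_J)
 have m: "pmor ?P (pU (J b1) (J b2)) si" unfolding Peq by (rule pmor_pU[OF m1 m2 dr qb(2)])
 note i1 = IB_hom[OF fin(1,2) d(1)] and i2 = IB_hom[OF fin(3,4) d(6)] and ib' = IB_hom[OF fb s(3), unfolded cb]
 note bb = ib_bilinear[OF q1(1) q2(1) dq]
 show ?thesis
 proof (rule bilinear_eqI_tensor[OF mA mA mA mA val_module[OF qb(1)] _ _ _ u v])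
  show "bilinear_map K (tensor K (?A ?a) (?A ?b)) (tensor K (?A ?c) (?A ?d)) (val R (pU (J b1) (J b2)))
  (%u v. tr R ?P (pU (J b1) (J b2)) si (ib K R (pU (J c11) (J c12)) (pU (J c21) (J c22)) (IB c11 c12 u) (IB c21 c22 v)))"
  by (rule bilinear_map_comp[OF bb i1 i2 tr_hom[OF m]])
  show "bilinear_map K (tensor K (?A ?a) (?A ?b)) (tensor K (?A ?c) (?A ?d)) (val R (pU (J b1) (J b2)))
  (%u v. IB b1 b2 (tens_gmult K ?S ?a ?b ?c ?d u v))"
  by (rule bilinear_map_comp[OF tens_gmult_bilinear[OF mS gS, where a = ?a and b = ?b and c = ?c and d = ?d, unfolded pS]
  lin_id lin_id ib'])
  fix x1 x2 y1 y2 assume x: "x1 : V (indiscrete ?a)" "x2 : V (indiscrete ?b)"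
  and y: "y1 : V (indiscrete ?c)" "y2 : V (indiscrete ?d)"
  note X = put_closed[OF fin(1) x(1)] put_closed[OF fin(2) x(2)] put_closed[OF fin(3) y(1)] put_closed[OF fin(4) y(2)]
  note g = gm_closed[OF x(1) y(1)] gm_closed[OF x(2) y(2)]
  have t1: "tr R (pU (J c) (J c')) (J b) si (ib K R (J c) (J c') (put R c x) (put R c' y)) = put R b (gm (card c) (card c') x y)"
  if c: "finite c" "finite c'" "c Int c' = {}" and s: "bij_betw si (c Un c') b" and xy: "x : V (indiscrete (card c))" "y : V (indiscrete (card c'))"
  for c c' b x y
  proof -
  note q = J_disjoint_parts[OF c]
  have cc: "card (c Un c') = card c + card c'" using c by (simp add: card_Un_disjoint)
  have fU: "finite (c Un c')" using c by simp
  have xp: "ib K R (J c) (J c') (put R c x) (put R c' y) : V (pU (J c) (J c'))"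
  by (rule ib_closed[OF _ _ q(2) put_closed[OF c(1) xy(1)] put_closed[OF c(2) xy(2)]]) (use c in auto)
  have "tr R (pU (J c) (J c')) (J b) (si o id) (ib K R (J c) (J c') (put R c x) (put R c' y)) =
  tr R (J (c Un c')) (J b) si (tr R (pU (J c) (J c')) (J (c Un c')) id (ib K R (J c) (J c') (put R c x) (put R c' y)))"
  by (rule tr_tr[OF q(3) piso_pmor[OF piso_J[OF fU s]] xp, symmetric])
  also have "... = put R b (gm (card c) (card c') x y)"
  unfolding tr_merge[OF c xy] using tr_put[OF s fU] gm_closed[OF xy] by (simp add: cc)
  finally show ?thesis by simp
  qed
  have "tr R ?P (pU (J b1) (J b2)) si (ib K R (pU (J c11) (J c12)) (pU (J c21) (J c22))
  (ib K R (J c11) (J c12) (put R c11 x1) (put R c12 x2)) (ib K R (J c21) (J c22) (put R c21 y1) (put R c22 y2))) =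
  tr R (pU (pU (J c11) (J c21)) (pU (J c12) (J c22))) (pU (J b1) (J b2)) si (ib K R (pU (J c11) (J c21)) (pU (J c12) (J c22))
  (ib K R (J c11) (J c21) (put R c11 x1) (put R c21 y1)) (ib K R (J c12) (J c22) (put R c12 x2) (put R c22 y2)))"
  unfolding Peq by (subst ib_interchange[OF p _ _ _ _ _ _ X]) (use d in auto)
  also have "... = ib K R (J b1) (J b2)
  (tr R (pU (J c11) (J c21)) (J b1) si (ib K R (J c11) (J c21) (put R c11 x1) (put R c21 y1)))
  (tr R (pU (J c12) (J c22)) (J b2) si (ib K R (J c12) (J c22) (put R c12 x2) (put R c22 y2)))"
  by (rule ib_tr[OF m1 m2 dr qb(2) ib_closed[OF p(1,3) r1(2) X(1,3)] ib_closed[OF p(2,4) r2(2) X(2,4)]])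
  also have "... = ib K R (J b1) (J b2) (put R b1 (gm ?a ?c x1 y1)) (put R b2 (gm ?b ?d x2 y2))"
  unfolding t1[OF fin(1,3) d(2) s(1) x(1) y(1)] t1[OF fin(2,4) d(5) s(2) x(2) y(2)] ..
  finally show "tr R ?P (pU (J b1) (J b2)) si (ib K R (pU (J c11) (J c12)) (pU (J c21) (J c22))
  (IB c11 c12 (ptens K (?A ?a) (?A ?b) x1 x2)) (IB c21 c22 (ptens K (?A ?c) (?A ?d) y1 y2))) =
  IB b1 b2 (tens_gmult K ?S ?a ?b ?c ?d (ptens K (?A ?a) (?A ?b) x1 x2) (ptens K (?A ?c) (?A ?d) y1 y2))"
  unfolding IB_ptens[OF fin(1,2) d(1) x] IB_ptens[OF fin(3,4) d(6) y]
  using tens_gmult_ptens[OF mS gS, where a = ?a and b = ?b and c = ?c and d = ?d] x y IB_ptens[OF fb s(3), unfolded cb, OF g]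
  by (simp add: pS)
 qed
qed

end

text \<open>It suffices to choose the points that go to \<open>b1\<close>: \<open>q1\<close> of the
  first block and \<open>q3\<close> of the second, \<open>card b1\<close> in total. The entries for
  \<open>b2\<close> follow from the row sums.\<close>

lemma two_block_permutation:
 fixes c1 c2 b1 b2 :: "nat set"
 assumes c: "finite c1" "finite c2" "c1 Int c2 = {}" and b: "b1 Un b2 = c1 Un c2" "b1 Int b2 = {}"
  and q: "q1 + q2 = card c1" "q3 + q4 = card c2" "q1 + q3 = card b1" "q2 + q4 = card b2"
 shows "EX si:block_perms (J (c1 Un c2)). card {s:c1. si s : b1} = q1 & card {s:c1. si s : b2} = q2 &
  card {s:c2. si s : b1} = q3 & card {s:c2. si s : b2} = q4"
proof -
 let ?U = "c1 Un c2"
 have fin: "finite ?U" "finite b1" "finite b2" using c b(1) by (auto intro: finite_subset[of _ "c1 Un c2"])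
 obtain e1 where e1: "e1 <= c1" "card e1 = q1" using obtain_subset_with_card_n[of q1 c1] q(1) by (metis le_add1)
 obtain e2 where e2: "e2 <= c2" "card e2 = q3" using obtain_subset_with_card_n[of q3 c2] q(2) by (metis le_add1)
 have fe: "finite e1" "finite e2" using e1 e2 c finite_subset by blast+
 have ce: "card (e1 Un e2) = card b1" using e1 e2 c(3) q(3) fe by (subst card_Un_disjoint) auto
 have cU: "card ?U = card b1 + card b2" unfolding b(1)[symmetric] using fin b(2) by (simp add: card_Un_disjoint)
 have "EX si. bij_betw si ?U ?U & (ALL s:?U. (si s : b1) = (s : e1 Un e2))"
 proof (rule fiber_bij[OF fin(1) fin(1)])
  fix i
  show "card {s:?U. (s : e1 Un e2) = i} = card {s:?U. (s : b1) = i}"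
  proof (cases i)
  case True
  have "{s:?U. (s : e1 Un e2) = i} = e1 Un e2" "{s:?U. (s : b1) = i} = b1" using True e1 e2 b by auto
  then show ?thesis using ce by simp
  next
  case False
  have "{s:?U. (s : e1 Un e2) = i} = ?U - (e1 Un e2)" "{s:?U. (s : b1) = i} = ?U - b1" using False e1 e2 b by auto
  moreover have "card (?U - (e1 Un e2)) = card ?U - card (e1 Un e2)" using fe e1 e2 by (intro card_Diff_subset) auto
  moreover have "card (?U - b1) = card ?U - card b1" using fin b by (intro card_Diff_subset) auto
  ultimately show ?thesis using ce by simp
  qed
 qed
 then obtain \<beta> where be: "bij_betw \<beta> ?U ?U" "!!s. s : ?U ==> \<beta> s : b1 \<longleftrightarrow> s : e1 Un e2" by blast
 define si where "si = (%s. if s : ?U then \<beta> s else s)"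
 have bm: "\<beta> s : ?U" if "s : ?U" for s using be(1) that by (auto simp: bij_betw_def)
 have "bij_betw si ?U ?U" using bij_betw_cong[of ?U \<beta> si ?U] be(1) by (simp add: si_def)
 then have "si permutes ?U" by (rule bij_imp_permutes) (simp add: si_def)
 then have bp: "si : block_perms (J ?U)" using bm by (auto simp: block_perms_def si_def)
 have b1: "si s : b1 \<longleftrightarrow> s : e1 Un e2" "si s : b2 \<longleftrightarrow> s ~: e1 Un e2" if "s : ?U" for s
  using be(2)[OF that] bm[OF that] b that by (auto simp: si_def)
 have "{s:c1. si s : b1} = e1" "{s:c1. si s : b2} = c1 - e1" "{s:c2. si s : b1} = e2" "{s:c2. si s : b2} = c2 - e2"
  using b1 e1 e2 c(3) by auto
 moreover have "card (c1 - e1) = q2" "card (c2 - e2) = q4" using e1 e2 fe q by (simp_all add: card_Diff_subset)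
 ultimately show ?thesis using bp e1(2) e2(2) by (intro bexI[of _ si]) simp_all
qed

context
 fixes Z Y X si
 assumes G: "prefines Z Y" and L: "prefines X Y" and s: "si : block_perms Y"
begin

text \<open>With the inverse of \<open>si\<close> rewritten away, the blocks of the first meet are
  visibly the nonempty cells counted by \<open>dmat\<close>.\<close>

lemma dc_meet:
 defines "Mt \<equiv> pmeet (ptransport (inv_into UNIV si) Z) X" and "Mt' \<equiv> pmeet Z (ptransport si X)"
 shows dc_meet_pts: "pts Mt = pts Y"
  and dc_meet_eqv: "(a, b) : eqv Mt \<longleftrightarrow> (si a, si b) : eqv Z & (a, b) : eqv X"
  and dc_meet_pmor: "pmor Mt X id" "pmor Mt Mt' si" "pmor Mt' Z id"
proof -
 note P = dc_parts[OF G L] and S = block_permsD[OF s]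
 note PG = is_partD[OF P(1)] and PL = is_partD[OF P(3)]
 let ?i = "inv_into UNIV si"
 have i: "?i (si a) = a" "si (?i a) = a" for a
  using S(5) by (simp_all add: bij_is_inj bij_is_surj surj_f_inv_f)
 have ip: "?i a : pts Y \<longleftrightarrow> a : pts Y" for a using S(4)[of "?i a"] i by simp
 have ii: "?i ` pts Y = pts Y"
 proof
  show "?i ` pts Y <= pts Y" using ip by auto
  show "pts Y <= ?i ` pts Y" using S(4) i(1) by (metis image_eqI subsetI)
 qed
 have sU: "si ` pts Y = pts Y" using S(3) by (simp add: bij_betw_def)
 show pts: "pts Mt = pts Y" by (simp add: Mt_def P(4) ii)
 have pts': "pts Mt' = pts Y" by (simp add: Mt'_def P(4))
 have t1: "(a, b) : map_prod ?i ?i ` eqv Z \<longleftrightarrow> (si a, si b) : eqv Z" for a b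
 proof
  assume "(a, b) : map_prod ?i ?i ` eqv Z" then show "(si a, si b) : eqv Z" using i by auto
 next
  assume "(si a, si b) : eqv Z"
  then have "map_prod ?i ?i (si a, si b) : map_prod ?i ?i ` eqv Z" by (rule imageI)
  then show "(a, b) : map_prod ?i ?i ` eqv Z" using i by simp
 qed
 have t2: "(a, b) : map_prod si si ` eqv X \<longleftrightarrow> (?i a, ?i b) : eqv X" for a b
 proof
  assume "(a, b) : map_prod si si ` eqv X" then show "(?i a, ?i b) : eqv X" using i by auto
 next
  assume "(?i a, ?i b) : eqv X"
  then have "map_prod si si (?i a, ?i b) : map_prod si si ` eqv X" by (rule imageI)
  then show "(a, b) : map_prod si si ` eqv X" using i by simp
 qed
 show e: "(a, b) : eqv Mt \<longleftrightarrow> (si a, si b) : eqv Z & (a, b) : eqv X" for a b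
  by (simp add: Mt_def t1)
 have e': "(a, b) : eqv Mt' \<longleftrightarrow> (a, b) : eqv Z & (?i a, ?i b) : eqv X" for a b
  by (simp add: Mt'_def t2)
 have part: "is_part Mt"
 proof (rule is_partI)
  show "finite (pts Mt)" using pts is_partD(1)[OF P(2)] by simp
  show "eqv Mt <= pts Mt \<times> pts Mt" using e PL(6,7) P(5) pts by auto
  show "!!x. x : pts Mt ==> (x, x) : eqv Mt" using e PL(3) PG(3) P pts S(4) by simp
  show "!!x y. (x, y) : eqv Mt ==> (y, x) : eqv Mt" using e PL(4) PG(4) by simp
  show "!!x y z. (x, y) : eqv Mt ==> (y, z) : eqv Mt ==> (x, z) : eqv Mt" using e PL(5) PG(5) by blast
 qed
 have part': "is_part Mt'"
 proof (rule is_partI)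
  show "finite (pts Mt')" using pts' is_partD(1)[OF P(2)] by simp
  show "eqv Mt' <= pts Mt' \<times> pts Mt'" using e' PG(6,7) P(4) pts' by auto
  show "!!x. x : pts Mt' ==> (x, x) : eqv Mt'" using e' PL(3) PG(3) P pts' ip by simp
  show "!!x y. (x, y) : eqv Mt' ==> (y, x) : eqv Mt'" using e' PL(4) PG(4) by simp
  show "!!x y z. (x, y) : eqv Mt' ==> (y, z) : eqv Mt' ==> (x, z) : eqv Mt'" using e' PL(5) PG(5) by blast
 qed
 show "pmor Mt X id" using part P pts e by (auto simp: pmor_def)
 show "pmor Mt' Z id" using part' P pts' e' by (auto simp: pmor_def)
 show "pmor Mt Mt' si" using part part' pts pts' S(3) e e' i by (auto simp: pmor_def)
qed

end

context symmetric_monoidal_partition_functor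
begin

text \<open>In each summand the last two transfers compose to a single transfer along
  \<open>si\<close>.\<close>

lemma double_coset':
 assumes G: "prefines Z Y" and L: "prefines X Y" and T: "dcoset_reps Z Y X T" and x: "x : V X"
 shows "res R Z Y id (tr R X Y id x) =
  (\<Oplus>\<^bsub>val R Z\<^esub>si\<in>T. tr R (pmeet (ptransport (inv_into UNIV si) Z) X) Z si
  (res R (pmeet (ptransport (inv_into UNIV si) Z) X) X id x))"
proof -
 interpret A: module K "val R Z" using dc_parts[OF G L] by (intro val_module)
 have sT: "si : block_perms Y" if "si : T" for si using T that by (auto simp: dcoset_reps_def)
 show ?thesis
  unfolding double_coset[OF G L T x]
 proof (rule A.finsum_cong'[OF refl])
  fix si assume "si : T"
  note m = dc_meet_pmor[OF G L sT[OF this]]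
  show "tr R (pmeet Z (ptransport si X)) Z id
  (tr R (pmeet (ptransport (inv_into UNIV si) Z) X) (pmeet Z (ptransport si X)) si
  (res R (pmeet (ptransport (inv_into UNIV si) Z) X) X id x)) =
  tr R (pmeet (ptransport (inv_into UNIV si) Z) X) Z si
  (res R (pmeet (ptransport (inv_into UNIV si) Z) X) X id x)"
  using tr_tr[OF m(2,3) res_closed[OF m(1) x]] by simp
 next
  show "(%si. tr R (pmeet (ptransport (inv_into UNIV si) Z) X) Z si
  (res R (pmeet (ptransport (inv_into UNIV si) Z) X) X id x)) : T \<rightarrow> V Z"
  proof
  fix si assume "si : T"
  note m = dc_meet_pmor[OF G L sT[OF this]]
  show "tr R (pmeet (ptransport (inv_into UNIV si) Z) X) Z si
  (res R (pmeet (ptransport (inv_into UNIV si) Z) X) X id x) : V Z"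
  using tr_closed[OF pmor_comp[OF m(2,3)] res_closed[OF m(1) x]] by simp
  qed
 qed
qed

end

lemma card_fiber_split:
 assumes "finite c" "!!s. s : c ==> s : A | s : B" "!!s. s : c ==> ~ (s : A & s : B)"
 shows "card {s:c. s : A} + card {s:c. s : B} = card c"
proof -
 have "c = {s:c. s : A} Un {s:c. s : B}" using assms by blast
 also have "card ... = card {s:c. s : A} + card {s:c. s : B}"
  using assms by (intro card_Un_disjoint) auto
 finally show ?thesis by simp
qed

context
 fixes c1 c2 b1 b2 :: "nat set"
 assumes c: "finite c1" "finite c2" "c1 Int c2 = {}" and b: "b1 Un b2 = c1 Un c2" "b1 Int b2 = {}"
begin

text \<open>The contingency matrix for two two-block partitions, indexed by the blocks themselves
  and not by labels, so that an empty block, which has no label, still has its entries 0.\<close>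

definition quad where
 "quad si = (card {s:c1. si s : b1}, card {s:c1. si s : b2}, card {s:c2. si s : b1}, card {s:c2. si s : b2})"

lemma two_block_prefines:
 "prefines (pU (J b1) (J b2)) (J (c1 Un c2))" "prefines (pU (J c1) (J c2)) (J (c1 Un c2))"
proof -
 have fb: "finite b1" "finite b2" using c b(1) by (auto intro: finite_subset[of _ "c1 Un c2"])
 have "b1 <= c1 Un c2" "b2 <= c1 Un c2" using b by auto
 then show "prefines (pU (J b1) (J b2)) (J (c1 Un c2))" "prefines (pU (J c1) (J c2)) (J (c1 Un c2))"
  using c b fb by (auto simp: prefines_iff intro!: is_part_pU)
qed

text \<open>The class of a label is one of the two blocks or empty, so the labelled matrix consists
  of entries of \<open>quad\<close> and zeros. Conversely, an entry of \<open>quad\<close> absent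
  from it belongs to an empty block and is zero.\<close>

lemma quad_dmat:
 assumes s: "si : block_perms (J (c1 Un c2))" and t: "tau : block_perms (J (c1 Un c2))"
 shows "quad si = quad tau \<longleftrightarrow> dmat (pU (J b1) (J b2)) (pU (J c1) (J c2)) si = dmat (pU (J b1) (J b2)) (pU (J c1) (J c2)) tau"
  (is "_ \<longleftrightarrow> dmat ?G ?L _ = _")
proof -
 let ?U = "c1 Un c2"
 have fb: "finite b1" "finite b2" using c b(1) by (auto intro: finite_subset[of _ "c1 Un c2"])
 have mem: "si s : ?U" "tau s : ?U" if "s : ?U" for s
  using block_permsD(4)[OF s, of s] block_permsD(4)[OF t, of s] that by simp_all
 have d: "dmat ?G ?L \<rho> x z = card {s:{s:?U. lab ?L s = x}. \<rho> s : {u:b1 Un b2. lab ?G u = z}}"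
  if "!!s. s : ?U ==> \<rho> s : ?U" for \<rho> x z
  using that b(1) by (auto simp: dmat_def intro!: arg_cong[where f = card])
 have ds: "dmat ?G ?L si x z = card {s:{s:?U. lab ?L s = x}. si s : {u:b1 Un b2. lab ?G u = z}}" for x z
  by (rule d) (rule mem(1))
 have dt: "dmat ?G ?L tau x z = card {s:{s:?U. lab ?L s = x}. tau s : {u:b1 Un b2. lab ?G u = z}}" for x z
  by (rule d) (rule mem(2))
 note Lc = two_block_class[OF c] and Gc = two_block_class[OF fb b(2)]
 show ?thesis
 proof
  assume q: "quad si = quad tau"
  show "dmat ?G ?L si = dmat ?G ?L tau"
  proof (intro ext)
  fix x z
  have "card {s:X. si s : Z} = card {s:X. tau s : Z}" if "X : {{}, c1, c2}" "Z : {{}, b1, b2}" for X Z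
  using that q by (auto simp: quad_def)
  from this[OF Lc(1)[of x] Gc(1)[of z]]
  show "dmat ?G ?L si x z = dmat ?G ?L tau x z" unfolding ds dt .
  qed
 next
  assume q: "dmat ?G ?L si = dmat ?G ?L tau"
  have "card {s:X. si s : Z} = card {s:X. tau s : Z}" if X: "X : {c1, c2}" and Z: "Z : {b1, b2}" for X Z
  proof (cases "X = {} | Z = {}")
  case False
  then obtain s u where su: "s : X" "u : Z" by blast
  have Xe: "{t:?U. lab ?L t = lab ?L s} = X" using X su Lc(2,3) by auto
  have Ze: "{t:b1 Un b2. lab ?G t = lab ?G u} = Z" using Z su Gc(2,3) by auto
  show ?thesis
  using fun_cong[OF fun_cong[OF q, of "lab ?L s"], of "lab ?G u"]
  unfolding ds dt Xe Ze .
  qed auto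
  then show "quad si = quad tau" by (simp add: quad_def)
 qed
qed

lemma quad_sums:
 assumes s: "si : block_perms (J (c1 Un c2))" and q: "quad si = (q1, q2, q3, q4)"
 shows "q1 + q2 = card c1" "q3 + q4 = card c2" "q1 + q3 = card b1" "q2 + q4 = card b2"
proof -
 let ?U = "c1 Un c2"
 note S = block_permsD[OF s, simplified]
 have q': "q1 = card {s:c1. si s : b1}" "q2 = card {s:c1. si s : b2}" "q3 = card {s:c2. si s : b1}" "q4 = card {s:c2. si s : b2}"
  using q by (simp_all add: quad_def)
 have m: "si s : b1 Un b2" if "s : ?U" for s using S(4)[of s] that b(1) by simp
 have "card {s:c. s : si -` b1} + card {s:c. s : si -` b2} = card c" if "c <= ?U" "finite c" for c
  using that m b(2) by (intro card_fiber_split) auto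
 then show "q1 + q2 = card c1" "q3 + q4 = card c2" using c q' by simp_all
 have "card {s:c1. si s : X} + card {s:c2. si s : X} = card X" if X: "X <= ?U" for X
 proof -
  have "X <= si ` ?U" using X S(3) by (simp add: bij_betw_def)
  then have Xe: "X = si ` ({s:c1. si s : X} Un {s:c2. si s : X})" using X by auto
  have "inj_on si ({s:c1. si s : X} Un {s:c2. si s : X})"
  using S(3) by (auto simp: bij_betw_def intro: inj_on_subset)
  note arg_cong[OF Xe, of card]
  also have "card (si ` ({s:c1. si s : X} Un {s:c2. si s : X})) = card ({s:c1. si s : X} Un {s:c2. si s : X})"
  by (rule card_image) fact
  also have "... = card {s:c1. si s : X} + card {s:c2. si s : X}" using c by (intro card_Un_disjoint) auto
  finally show ?thesis by simp
 qed
 then show "q1 + q3 = card b1" "q2 + q4 = card b2" using b q' by blast+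
qed

text \<open>The transversal is indexed by exactly those quadruples over which the bialgebra axiom
  for the comultiplication of a product sums.\<close>

lemma two_block_reps:
 defines "Q \<equiv> {(q1, q2, q3, q4). q1 + q2 = card c1 & q3 + q4 = card c2 & q1 + q3 = card b1 & q2 + q4 = card b2}"
 shows "EX sg. (ALL q:Q. sg q : block_perms (J (c1 Un c2)) & quad (sg q) = q) &
  dcoset_reps (pU (J b1) (J b2)) (J (c1 Un c2)) (pU (J c1) (J c2)) (sg ` Q)"
proof -
 have "ALL q:Q. EX si. si : block_perms (J (c1 Un c2)) & quad si = q"
 proof
  fix q assume "q : Q"
  then obtain q1 q2 q3 q4 where q: "q = (q1, q2, q3, q4)" "q1 + q2 = card c1" "q3 + q4 = card c2"
  "q1 + q3 = card b1" "q2 + q4 = card b2" by (auto simp: Q_def)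
  from two_block_permutation[OF c b q(2-5)]
  show "EX si. si : block_perms (J (c1 Un c2)) & quad si = q" by (auto simp: quad_def q(1))
 qed
 then obtain sg where sg: "!!q. q : Q ==> sg q : block_perms (J (c1 Un c2)) & quad (sg q) = q"
  unfolding bchoice_iff by blast
 note G = two_block_prefines(1) and L = two_block_prefines(2)
 have "dcoset_reps (pU (J b1) (J b2)) (J (c1 Un c2)) (pU (J c1) (J c2)) (sg ` Q)"
  unfolding dcoset_reps_def
 proof (intro conjI ballI)
  show "sg ` Q <= block_perms (J (c1 Un c2))" using sg by auto
  fix si assume s: "si : block_perms (J (c1 Un c2))"
  have qQ: "quad si : Q"
  proof -
  obtain q1 q2 q3 q4 where q: "quad si = (q1, q2, q3, q4)" by (metis prod.exhaust)
  show ?thesis using quad_sums[OF s q] q by (simp add: Q_def)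
  qed
  have iff: "(EX \<gamma>:block_perms (pU (J b1) (J b2)). EX \<delta>:block_perms (pU (J c1) (J c2)). tau = \<gamma> o si o \<delta>) \<longleftrightarrow> quad tau = quad si"
  if "tau : sg ` Q" for tau
  using dmat_eq_iff[OF G L s, of tau] quad_dmat[OF _ s, of tau] sg that by auto
  show "EX! tau. tau : sg ` Q & (EX \<gamma>:block_perms (pU (J b1) (J b2)). EX \<delta>:block_perms (pU (J c1) (J c2)). tau = \<gamma> o si o \<delta>)"
  proof (rule ex1I[of _ "sg (quad si)"])
  have m: "sg (quad si) : sg ` Q" using qQ by blast
  show "sg (quad si) : sg ` Q & (EX \<gamma>:block_perms (pU (J b1) (J b2)). EX \<delta>:block_perms (pU (J c1) (J c2)). sg (quad si) = \<gamma> o si o \<delta>)"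
  using iff[OF m] m sg[OF qQ] by simp
  fix tau assume t: "tau : sg ` Q & (EX \<gamma>:block_perms (pU (J b1) (J b2)). EX \<delta>:block_perms (pU (J c1) (J c2)). tau = \<gamma> o si o \<delta>)"
  then have "quad tau = quad si" using iff[OF conjunct1[OF t]] by simp
  moreover obtain q where "q : Q" "tau = sg q" using t by blast
  ultimately show "tau = sg (quad si)" using sg[of q] by simp
  qed
 qed
 then show ?thesis using sg by blast
qed

lemma two_block_meet:
 assumes s: "si : block_perms (J (c1 Un c2))"
 shows "pmeet (ptransport (inv_into UNIV si) (pU (J b1) (J b2))) (pU (J c1) (J c2)) =
  pU (pU (J {s:c1. si s : b1}) (J {s:c1. si s : b2})) (pU (J {s:c2. si s : b1}) (J {s:c2. si s : b2}))"
  (is "?P = ?Q")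
proof -
 note m = dc_meet_pts[OF two_block_prefines s] dc_meet_eqv[OF two_block_prefines s]
 have mem: "si s : b1 Un b2" if "s : c1 Un c2" for s
  using block_permsD(4)[OF s, of s] that b(1) by simp
 have p: "pts ?P = pts ?Q" unfolding m(1) using mem by auto
 have e: "eqv ?P = eqv ?Q"
 proof (intro equalityI subrelI)
  fix x y assume "(x, y) : eqv ?P"
  then have "(si x, si y) : eqv (pU (J b1) (J b2))" "(x, y) : eqv (pU (J c1) (J c2))"
  unfolding m(2) by auto
  then show "(x, y) : eqv ?Q" by auto
 next
  fix x y assume "(x, y) : eqv ?Q"
  then show "(x, y) : eqv ?P" unfolding m(2) by auto
 qed
 show ?thesis by (rule part.equality[OF p e]) simp
qed

end

context symmetric_monoidal_partition_functor
begin

text \<open>The double coset formula for one set, cut into \<open>c1\<close>, \<open>c2\<close> of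
  sizes \<open>i\<close>, \<open>j\<close> and also into \<open>b1\<close>, \<open>b2\<close> of
  sizes \<open>m\<close>, \<open>n\<close>. Its left side is the comultiplication of the product; a
  summand on the right restricts both factors and then applies
  \<open>tr_split_product\<close>.\<close>

lemma gc_gm:
 assumes x: "x : V (indiscrete i)" and y: "y : V (indiscrete j)" and mn: "m + n = i + j"
 shows "gc m n (gm i j x y) =
  (\<Oplus>\<^bsub>tensor K (val R (indiscrete m)) (val R (indiscrete n))\<^esub>
  q\<in>{(a, b, c, d). a + b = i & c + d = j & a + c = m & b + d = n}.
  case q of (a, b, c, d) => tens_gmult K (sigma_alg K R) a b c d (gc a b x) (gc c d y))"
proof -
 let ?A = "%n. val R (indiscrete n)" and ?S = "sigma_alg K R"
 have mA: "module K (?A n)" for n by (rule val_module) simp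
 obtain c1 c2 e :: "nat set" where c: "finite c1" "finite c2" "c1 Int c2 = {}" and ca: "card c1 = i" "card c2 = j"
  by (rule disjoint_sets_exist[of i j 0])
 let ?U = "c1 Un c2"
 have cU: "card ?U = m + n" "finite ?U" using c ca mn by (simp_all add: card_Un_disjoint)
 obtain b1 where b1: "b1 <= ?U" "card b1 = m" using obtain_subset_with_card_n[of m ?U] cU by (metis le_add1)
 define b2 where "b2 = ?U - b1"
 have fb: "finite b1" "finite b2" and b: "b1 Un b2 = c1 Un c2" "b1 Int b2 = {}"
  using b1 cU(2) finite_subset by (auto simp: b2_def)
 have b2: "card b2 = n" using b1 cU fb by (simp add: b2_def card_Diff_subset)
 let ?G = "pU (J b1) (J b2)" and ?L = "pU (J c1) (J c2)" and ?O = "J ?U"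
 define Q where "Q = {(q1, q2, q3, q4). q1 + q2 = i & q3 + q4 = j & q1 + q3 = m & q2 + q4 = n}"
 obtain sg where sg: "!!q. q : Q ==> sg q : block_perms ?O" "!!q. q : Q ==> quad c1 c2 b1 b2 (sg q) = q"
  and T: "dcoset_reps ?G ?O ?L (sg ` Q)"
  using two_block_reps[OF c b] unfolding ca b1(2) b2 Q_def[symmetric] by blast
 note pG = two_block_prefines(1)[OF c b] and pL = two_block_prefines(2)[OF c b]
 note qc = J_disjoint_parts[OF c] and qb = J_disjoint_parts[OF fb b(2)]
 note X = put_closed[OF c(1), unfolded ca, OF x] put_closed[OF c(2), unfolded ca, OF y]
 have pc: "is_part (J c1)" "is_part (J c2)" using c by auto
 note w = ib_closed[OF pc qc(2) X]
 let ?w = "ib K R (J c1) (J c2) (put R c1 x) (put R c2 y)"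
 interpret G: module K "val R ?G" by (rule val_module[OF qb(1)])
 interpret T: module K "tensor K (?A m) (?A n)" by (rule tensor_module[OF mA mA])
 note IBh = IB_hom[OF fb b(2), unfolded b1(2) b2]
 have mS: "module K (piece ?S n)" for n using mA by (simp add: sigma_alg_def)
 have gS: "bilinear_map K (piece ?S i) (piece ?S j) (piece ?S (i + j)) (gm i j)" for i j
  using gm_bilinear by (simp add: sigma_alg_def)
 have pS: "piece ?S n = ?A n" for n by (simp add: sigma_alg_def)
 let ?t = "%q. case q of (q1, q2, q3, q4) => tens_gmult K ?S q1 q2 q3 q4 (gc q1 q2 x) (gc q3 q4 y)"
 have tc: "?t q : carrier (tensor K (?A m) (?A n))" if "q : Q" for q
 proof -
  obtain q1 q2 q3 q4 where q: "q = (q1, q2, q3, q4)" "q1 + q2 = i" "q3 + q4 = j" "q1 + q3 = m" "q2 + q4 = n"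
  using \<open>q : Q\<close> by (auto simp: Q_def)
  show ?thesis
  using bilinear_map_closed[OF tens_gmult_bilinear[OF mS gS, where a = q1 and b = q2 and c = q3 and d = q4, unfolded pS]
  gc_closed gc_closed, of x y] x y q by simp
 qed
 let ?P = "%si. pmeet (ptransport (inv_into UNIV si) ?G) ?L"
 have trm: "tr R (?P (sg q)) ?G (sg q) (res R (?P (sg q)) ?L id ?w) = IB b1 b2 (?t q)" if qQ: "q : Q" for q
 proof -
  obtain q1 q2 q3 q4 where q: "q = (q1, q2, q3, q4)" "q1 + q2 = i" "q3 + q4 = j" "q1 + q3 = m" "q2 + q4 = n"
  using \<open>q : Q\<close> by (auto simp: Q_def)
  let ?s = "sg q"
  note s = sg(1)[OF qQ]
  let ?c11 = "{s:c1. ?s s : b1}" and ?c12 = "{s:c1. ?s s : b2}" and ?c21 = "{s:c2. ?s s : b1}" and ?c22 = "{s:c2. ?s s : b2}"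
  have cc: "card ?c11 = q1" "card ?c12 = q2" "card ?c21 = q3" "card ?c22 = q4"
  using sg(2)[OF qQ] q(1) by (simp_all add: quad_def[OF c b])
  have fin: "finite ?c11" "finite ?c12" "finite ?c21" "finite ?c22" using c by auto
  have d: "?c11 Int ?c12 = {}" "?c11 Int ?c21 = {}" "?c11 Int ?c22 = {}" "?c12 Int ?c21 = {}" "?c12 Int ?c22 = {}" "?c21 Int ?c22 = {}"
  using c b(2) by auto
  have mem: "?s s : b1 Un b2" if "s : c1 Un c2" for s
  using block_permsD(4)[OF s, of s] that b(1) by simp
  have u: "?c11 Un ?c12 = c1" "?c21 Un ?c22 = c2" using mem by auto
  have bij: "bij_betw ?s ?U ?U" using block_permsD(3)[OF s] by simp
  have bb: "bij_betw ?s (?c11 Un ?c21) b1" "bij_betw ?s (?c12 Un ?c22) b2"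
  proof -
  have *: "bij_betw ?s ({s:c1. ?s s : Z} Un {s:c2. ?s s : Z}) Z" if "Z <= ?U" for Z
  proof -
  have "Z <= ?s ` ?U" using that bij by (simp add: bij_betw_def)
  then have "?s ` ({s:c1. ?s s : Z} Un {s:c2. ?s s : Z}) = Z" by auto
  then show ?thesis using bij by (auto simp: bij_betw_def intro: inj_on_subset)
  qed
  show "bij_betw ?s (?c11 Un ?c21) b1" "bij_betw ?s (?c12 Un ?c22) b2" using *[of b1] *[of b2] b by auto
  qed
  note P = two_block_meet[OF c b s]
  note q1' = J_disjoint_parts[OF fin(1,2) d(1), unfolded u] and q2' = J_disjoint_parts[OF fin(3,4) d(6), unfolded u]
  have dq: "pts (pU (J ?c11) (J ?c12)) Int pts (pU (J ?c21) (J ?c22)) = {}" using d by auto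
  have "res R (?P ?s) ?L id ?w = ib K R (pU (J ?c11) (J ?c12)) (pU (J ?c21) (J ?c22))
  (res R (pU (J ?c11) (J ?c12)) (J c1) id (put R c1 x)) (res R (pU (J ?c21) (J ?c22)) (J c2) id (put R c2 y))"
  unfolding P by (rule ib_res[OF q1'(3) q2'(3) dq qc(2) X])
  also have "res R (pU (J ?c11) (J ?c12)) (J c1) id (put R c1 x) = IB ?c11 ?c12 (gc q1 q2 x)"
  by (rule res_split[OF fin(1,2) d(1), unfolded u cc q(2), OF x])
  also have "res R (pU (J ?c21) (J ?c22)) (J c2) id (put R c2 y) = IB ?c21 ?c22 (gc q3 q4 y)"
  by (rule res_split[OF fin(3,4) d(6), unfolded u cc q(3), OF y])
  finally have e: "res R (?P ?s) ?L id ?w = ib K R (pU (J ?c11) (J ?c12)) (pU (J ?c21) (J ?c22))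
  (IB ?c11 ?c12 (gc q1 q2 x)) (IB ?c21 ?c22 (gc q3 q4 y))" .
  have g: "gc q1 q2 x : carrier (tensor K (?A q1) (?A q2))" "gc q3 q4 y : carrier (tensor K (?A q3) (?A q4))"
  using gc_closed[of x q1 q2] gc_closed[of y q3 q4] x y q by simp_all
  have tq: "?t q = tens_gmult K ?S q1 q2 q3 q4 (gc q1 q2 x) (gc q3 q4 y)" by (simp add: q(1))
  show ?thesis
  unfolding e tq unfolding P by (rule tr_split_product[OF fin d bb b(2), unfolded cc, OF g])
 qed
 have inj: "inj_on sg Q" by (rule inj_on_inverseI[where g = "quad c1 c2 b1 b2"]) (rule sg(2))
 have gmc: "gm i j x y : V (indiscrete (m + n))" using gm_closed[OF x y] mn by simp
 have "IB b1 b2 (gc m n (gm i j x y)) = res R ?G ?O id (put R ?U (gm i j x y))"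
  using res_split[OF fb b(2), of "gm i j x y"] gmc unfolding b(1) by (simp add: b1 b2)
 also have "put R ?U (gm i j x y) = tr R ?L ?O id ?w"
  using tr_merge[OF c, unfolded ca, OF x y] by simp
 also have "res R ?G ?O id (tr R ?L ?O id ?w) =
  (\<Oplus>\<^bsub>val R ?G\<^esub>si\<in>sg ` Q. tr R (?P si) ?G si (res R (?P si) ?L id ?w))"
  by (rule double_coset'[OF pG pL T w])
 also have "... = (\<Oplus>\<^bsub>val R ?G\<^esub>q\<in>Q. tr R (?P (sg q)) ?G (sg q) (res R (?P (sg q)) ?L id ?w))"
  by (rule G.finsum_reindex[OF _ inj]) (use trm tc lin_closed[OF IBh] in \<open>auto simp del: pts_simps\<close>)
 also have "... = (\<Oplus>\<^bsub>val R ?G\<^esub>q\<in>Q. IB b1 b2 (?t q))"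
  by (rule G.finsum_cong'[OF refl]) (use trm tc lin_closed[OF IBh] in auto)
 also have "... = IB b1 b2 (\<Oplus>\<^bsub>tensor K (?A m) (?A n)\<^esub>q\<in>Q. ?t q)"
  by (rule lin_finsum[OF T.module_axioms G.module_axioms IBh, symmetric]) (use tc in auto)
 finally have eq: "IB b1 b2 (gc m n (gm i j x y)) = IB b1 b2 (\<Oplus>\<^bsub>tensor K (?A m) (?A n)\<^esub>q\<in>Q. ?t q)" .
 have inj': "inj_on (IB b1 b2) (carrier (tensor K (?A m) (?A n)))"
  using mod_isoD(3)[OF IB_iso[OF fb b(2)]] by (simp add: b1 b2)
 have c1: "gc m n (gm i j x y) : carrier (tensor K (?A m) (?A n))" by (rule gc_closed[OF gmc])
 have c2: "(\<Oplus>\<^bsub>tensor K (?A m) (?A n)\<^esub>q\<in>Q. ?t q) : carrier (tensor K (?A m) (?A n))"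
  using tc by (intro T.finsum_closed) auto
 show ?thesis unfolding Q_def[symmetric] by (rule inj_onD[OF inj' eq c1 c2])
qed

lemma sigma_alg_simps:
 "piece (sigma_alg K R) n = val R (indiscrete n)" "gunit (sigma_alg K R) = kunit R" "gcounit (sigma_alg K R) = ku"
 by (simp_all add: sigma_alg_def)

lemma sigma_alg_bialgebra: "connected_graded_bialgebra K (sigma_alg K R)"
 unfolding connected_graded_bialgebra_def connected_graded_bialgebra_axioms_def sigma_alg_simps
 using is_cring gm_bilinear gc_hom ku(4) kunit_iso gm_assoc gm_comm gm_unit gc_coassoc gc_cocomm gc_counit gc_gm gc_one gm_ku
  ku(1)[OF one_closed]
 by (intro conjI allI impI) (auto intro: val_module)

end

lemma smpf_morD:
 assumes "smpf_mor K R S eta"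
 shows "eta : extensional (Collect is_part)" "is_part X ==> eta X : mod_hom_ext K (val R X) (val S X)"
  "is_part X ==> eta X : mod_hom K (val R X) (val S X)" "is_part X ==> x : carrier (val R X) ==> eta X x : carrier (val S X)"
  "pmor X Y f ==> y : carrier (val R Y) ==> eta X (res R X Y f y) = res S X Y f (eta Y y)"
  "pmor X Y f ==> z : carrier (val R X) ==> eta Y (tr R X Y f z) = tr S X Y f (eta X z)"
  "k : carrier K ==> eta pempty (kunit R k) = kunit S k"
  "is_part X ==> is_part Y ==> x : carrier (val R X) ==> y : carrier (val R Y) ==>
  eta (X |+| Y) (box K R X Y x y) = box K S X Y (eta X x) (eta Y y)"
proof -
 show "eta : extensional (Collect is_part)" using assms by (auto simp: smpf_mor_def PiE_def)
 show *: "eta X : mod_hom_ext K (val R X) (val S X)" if "is_part X" using assms that by (auto simp: smpf_mor_def)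
 show "is_part X ==> eta X : mod_hom K (val R X) (val S X)" by (rule lin_extD[OF *])
 show "is_part X ==> x : carrier (val R X) ==> eta X x : carrier (val S X)" by (rule lin_closed[OF lin_extD[OF *]])
qed (use assms in \<open>simp_all add: smpf_mor_def\<close>)

lemma sigma_alg_map_mor:
 assumes R: "symmetric_monoidal_partition_functor K R" and S: "symmetric_monoidal_partition_functor K S"
  and e: "smpf_mor K R S eta"
 shows "gbialg_mor K (sigma_alg K R) (sigma_alg K S) (sigma_alg_map R S eta)"
proof -
 interpret R: symmetric_monoidal_partition_functor K R by fact
 interpret S: symmetric_monoidal_partition_functor K S by fact
 let ?I = indiscrete
 note h = smpf_morD(3,2)[OF e] and res = smpf_morD(5)[OF e] and tr = smpf_morD(6)[OF e] and ku = smpf_morD(7)[OF e]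
  and bx = smpf_morD(8)[OF e]
 note hI = h(1)[OF is_part_indiscrete]
 have mR: "module K (val R (?I n))" and mS: "module K (val S (?I n))" for n
  by (auto intro: R.val_module S.val_module)
 have mult: "eta (?I (i + j)) (gmult (sigma_alg K R) i j x y) = gmult (sigma_alg K S) i j (eta (?I i) x) (eta (?I j) y)"
  if x: "x : carrier (val R (?I i))" and y: "y : carrier (val R (?I j))" for i j x y
  unfolding R.gm_def S.gm_def
  using tr[OF pmor_pconcat R.box_closed[OF _ _ x y]] bx[OF _ _ x y] by simp
 have comult: "tens_map K (val R (?I i)) (val R (?I j)) (val S (?I i)) (val S (?I j)) (eta (?I i)) (eta (?I j)) (gcomult (sigma_alg K R) i j x) =
  gcomult (sigma_alg K S) i j (eta (?I (i + j)) x)"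
  if x: "x : carrier (val R (?I (i + j)))" for i j x
 proof -
  let ?T = "tens_map K (val R (?I i)) (val R (?I j)) (val S (?I i)) (val S (?I j)) (eta (?I i)) (eta (?I j))"
  note t = tens_map_hom[OF mR mR mS mS hI hI, of i j] and tp = tens_map_ptens[OF mR mR mS mS hI hI, of _ i _ j]
  have p: "is_part (?I i |+| ?I j)" by (intro is_part_psum is_part_indiscrete)
  \<comment> \<open>The comultiplication is defined through an inverse of \<open>ext\<close>, so the
    two sides are compared after applying \<open>ext S\<close>, where \<open>eta\<close> is known to
    respect external products.\<close>
  have key: "ext S (?I i) (?I j) (?T u) = eta (?I i |+| ?I j) (ext R (?I i) (?I j) u)"
  if u: "u : carrier (tensor K (val R (?I i)) (val R (?I j)))" for u
  proof (rule tensor_hom_eqI[OF mR mR S.val_module[OF p] _ _ _ u])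
  show "(%u. ext S (?I i) (?I j) (?T u)) : mod_hom K (tensor K (val R (?I i)) (val R (?I j))) (val S (?I i |+| ?I j))"
  by (rule lin_comp[OF t mod_isoD(1)[OF S.ext_iso[OF is_part_indiscrete is_part_indiscrete]]])
  show "(%u. eta (?I i |+| ?I j) (ext R (?I i) (?I j) u)) : mod_hom K (tensor K (val R (?I i)) (val R (?I j))) (val S (?I i |+| ?I j))"
  by (rule lin_comp[OF mod_isoD(1)[OF R.ext_iso[OF is_part_indiscrete is_part_indiscrete]] h(1)[OF p]])
  fix x y assume xy: "x : carrier (val R (?I i))" "y : carrier (val R (?I j))"
  show "ext S (?I i) (?I j) (?T (ptens K (val R (?I i)) (val R (?I j)) x y)) =
  eta (?I i |+| ?I j) (ext R (?I i) (?I j) (ptens K (val R (?I i)) (val R (?I j)) x y))"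
  unfolding tp[OF xy] R.ext_ptens S.ext_ptens using bx[OF _ _ xy] by simp
  qed
  note hx = lin_closed[OF hI x]
  have "ext S (?I i) (?I j) (?T (gcomult (sigma_alg K R) i j x)) = ext S (?I i) (?I j) (gcomult (sigma_alg K S) i j (eta (?I (i + j)) x))"
  unfolding key[OF R.gc_closed[OF x]] R.ext_gc[OF x] S.ext_gc[OF hx] res[OF pmor_pconcat x] ..
  then show ?thesis
  by (rule inj_onD[OF mod_isoD(3)[OF S.ext_iso[OF is_part_indiscrete is_part_indiscrete]]])
  (rule lin_closed[OF t R.gc_closed[OF x]] S.gc_closed[OF hx])+
 qed
 have counit: "S.ku (eta pempty x) = R.ku x" if x: "x : carrier (val R pempty)" for x
  using ku[OF R.ku(3)[OF x]] S.ku(1)[OF R.ku(3)[OF x]] by (simp add: R.ku(2)[OF x])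
 show ?thesis
  unfolding gbialg_mor_def R.sigma_alg_simps S.sigma_alg_simps sigma_alg_map_def
  using h(2)[OF is_part_indiscrete] mult ku comult counit by blast
qed

section \<open>Morphisms of partition functors from morphisms of bialgebras\<close>

lemma pU_block_cancel:
 assumes "pU (J b) X = pU (J b) Y" "b Int pts X = {}" "b Int pts Y = {}" "is_part X" "is_part Y"
 shows "X = Y"
proof -
 have e: "b Un pts X = b Un pts Y" "b \<times> b Un eqv X = b \<times> b Un eqv Y"
  using arg_cong[OF assms(1), of pts] arg_cong[OF assms(1), of eqv] by simp_all
 have X: "eqv X <= pts X \<times> pts X" and Y: "eqv Y <= pts Y \<times> pts Y"
  using is_partD(2) assms(4,5) by auto
 show ?thesis
 proof (rule part.equality)
  show "pts X = pts Y" using e(1) assms(2,3) by blast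
  show "eqv X = eqv Y"
  proof (intro equalityI subrelI)
  fix x y assume "(x, y) : eqv X"
  moreover from this have "x ~: b" using X assms(2) by blast
  ultimately show "(x, y) : eqv Y" using e(2) by blast
  next
  fix x y assume "(x, y) : eqv Y"
  moreover from this have "x ~: b" using Y assms(3) by blast
  ultimately show "(x, y) : eqv X" using e(2) by blast
  qed
 qed simp
qed

text \<open>Two blocks of one partition are equal or disjoint; in the second case each is a block of
  what the other leaves over.\<close>

lemma pU_block_exchange:
 assumes e: "pU (J c) X = pU (J b) Y" and ne: "b ~= {}" "c ~= {}"
  and d: "c Int pts X = {}" "b Int pts Y = {}" and p: "is_part X" "is_part Y" "finite b" "finite c"
 shows "b = c & X = Y | (b Int c = {} & (EX Z. is_part Z & (b Un c) Int pts Z = {} & X = pU (J b) Z & Y = pU (J c) Z))"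
proof -
 have bc: "eqv (pU (J b) Y) `` {q} = b" if "q : b" for q
  using that d(2) is_partD(2)[OF p(2)] by auto
 have cc: "eqv (pU (J c) X) `` {q} = c" if "q : c" for q
  using that d(1) is_partD(2)[OF p(1)] by auto
 show ?thesis
 proof (cases "b Int c = {}")
  case False
  then obtain q where "q : b" "q : c" by blast
  then have "b = c" using bc[of q] cc[of q] e by simp
  moreover from this have "X = Y" using pU_block_cancel[of c X Y] e d p by simp
  ultimately show ?thesis by blast
 next
  case True
  obtain q where q: "q : b" using ne by blast
  have "pts (pU (J c) X) = pts (pU (J b) Y)" using e by simp
  then have qX: "q : pts X" using q True by auto
  have "eqv X `` {q} = eqv (pU (J c) X) `` {q}" using q True by auto
  then have "eqv X `` {q} = b" using bc[OF q] e by simp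
  then obtain Z where Z: "is_part Z" "b Int pts Z = {}" "X = pU (J b) Z"
  using part_split(1)[OF p(1) qX] by metis
  have cZ: "c Int pts Z = {}" using d(1) Z(3) by auto
  have "pU (J b) (pU (J c) Z) = pU (J b) Y" using e Z(3) pU_lcomm[of "J b" "J c" Z] by simp
  moreover have "is_part (pU (J c) Z)" using Z p cZ by (intro is_part_pU) auto
  ultimately have "pU (J c) Z = Y" using pU_block_cancel[of b "pU (J c) Z" Y] True Z(2) d(2) p(2) by auto
  then show ?thesis using True Z cZ by blast
 qed
qed

context symmetric_monoidal_partition_functor
begin

lemma ib_lcomm:
 assumes P: "is_part P1" "is_part P2" "is_part P3"
  and d: "pts P1 Int pts P2 = {}" "pts P1 Int pts P3 = {}" "pts P2 Int pts P3 = {}"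
  and x: "x1 : V P1" "x2 : V P2" "x3 : V P3"
 shows "ib K R P1 (pU P2 P3) x1 (ib K R P2 P3 x2 x3) = ib K R P2 (pU P1 P3) x2 (ib K R P1 P3 x1 x3)"
proof -
 have d': "pts P2 Int pts P1 = {}" using d(1) by blast
 show ?thesis
  using ib_assoc[OF P d x] ib_assoc[OF P(2,1,3) d' d(3,2) x(2,1,3)] ib_comm[OF P(1,2) d(1) x(1,2)]
  by (simp add: pU_comm[of P2 P1])
qed

lemma ib_one:
 assumes "is_part X" "x : V X"
 shows "ib K R pempty X (kunit R \<one>\<^bsub>K\<^esub>) x = x" "ib K R X pempty x (kunit R \<one>\<^bsub>K\<^esub>) = x"
proof -
 interpret A: module K "val R X" by (rule val_module) fact
 show 1: "ib K R pempty X (kunit R \<one>\<^bsub>K\<^esub>) x = x" using ib_unit[OF assms(1) one_closed assms(2)] assms(2) by simp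
 show "ib K R X pempty x (kunit R \<one>\<^bsub>K\<^esub>) = x"
  using ib_comm[OF is_part_indiscrete[of 0] assms(1) _ kunit_closed[OF one_closed] assms(2)] 1 by simp
qed

lemma kunit_scale: "k : carrier K ==> kunit R k = k \<odot>\<^bsub>val R pempty\<^esub> kunit R \<one>\<^bsub>K\<^esub>"
 using lin_smult[OF mod_isoD(1)[OF kunit_iso], of k "\<one>\<^bsub>K\<^esub>"] by (simp add: self_mod_simps)

end

text \<open>Pairs that belong to the graph of any morphism extending \<open>h\<close>: products of
  \<open>put\<close> elements with the products of their images. A relation is used because an
  element can be such a product in many ways, and at this stage nothing shows that its image is well
  defined.\<close>

inductive gp :: "'k ring => ('k, 'v) smpf => ('k, 'v) smpf => (nat => 'v => 'v) => part => 'v => 'v => bool"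
 for K R S h where
 gp_empty: "gp K R S h pempty (kunit R \<one>\<^bsub>K\<^esub>) (kunit S \<one>\<^bsub>K\<^esub>)"
| gp_block: "gp K R S h X u v ==> b ~= {} ==> finite b ==> is_part X ==> b Int pts X = {} ==>
  x : carrier (val R (indiscrete (card b))) ==>
  gp K R S h (pU (J b) X) (ib K R (J b) X (put R b x) u) (ib K S (J b) X (put S b (h (card b) x)) v)"

locale smpf_pair = R: symmetric_monoidal_partition_functor K R + S: symmetric_monoidal_partition_functor K S
 for K :: "'k ring" and R S :: "('k, 'v) smpf" +
 fixes h :: "nat => 'v => 'v"
 assumes h_hom: "h n : mod_hom K (val R (indiscrete n)) (val S (indiscrete n))"
begin

abbreviation "GP \<equiv> gp K R S h"

lemma h_closed: "x : R.V (indiscrete n) ==> h n x : S.V (indiscrete n)"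
 by (rule lin_closed[OF h_hom])

lemma gp_closed: "GP X u v ==> is_part X & u : R.V X & v : S.V X"
proof (induct rule: gp.induct)
 case gp_empty
 then show ?case using R.kunit_closed S.kunit_closed R.one_closed by simp
next
 case (gp_block X u v b x)
 then have p: "is_part (J b)" "pts (J b) Int pts X = {}" by auto
 show ?case
  using gp_block p is_part_pU[OF p(1) _ p(2)]
  R.ib_closed[OF p(1) _ p(2) R.put_closed[OF gp_block(4,7)]]
  S.ib_closed[OF p(1) _ p(2) S.put_closed[OF gp_block(4) h_closed[OF gp_block(7)]]] by simp
qed

text \<open>The first components of \<open>gp\<close> span, because the internal product is an
  isomorphism from the tensor product and \<open>put\<close> is onto the value at a block.\<close>

lemma gp_hom_eqI:
 assumes "is_part X" "module K N" "f : mod_hom K (val R X) N" "g : mod_hom K (val R X) N"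
  "!!u v. GP X u v ==> f u = g u" "w : R.V X"
 shows "f w = g w"
 using assms
proof (induct X arbitrary: f g w rule: part_induct)
 case empty
 note k = R.ku(2)[OF empty(5)] R.ku(3)[OF empty(5)]
 have "w = R.ku w \<odot>\<^bsub>val R pempty\<^esub> kunit R \<one>\<^bsub>K\<^esub>" using R.kunit_scale[OF k(2)] k(1) by simp
 moreover have "f (kunit R \<one>\<^bsub>K\<^esub>) = g (kunit R \<one>\<^bsub>K\<^esub>)" using empty(4)[OF gp_empty] .
 ultimately show ?case
  using lin_smult[OF empty(2) k(2) R.kunit_closed[OF R.one_closed]]
  lin_smult[OF empty(3) k(2) R.kunit_closed[OF R.one_closed]] by metis
next
 case (block b X)
 have p: "is_part (J b)" "pts (J b) Int pts X = {}" using block by auto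
 show ?case
 proof (rule R.ib_hom_eqI[OF block(10) p(1) block(3) p(2) block(7,8,6)])
  fix y z assume y: "y : R.V (J b)" and z: "z : R.V X"
  obtain x where x: "x : R.V (indiscrete (card b))" "y = put R b x"
  using y mod_isoD(4)[OF R.put_iso[OF block(2)]] by blast
  note r = bilinear_map_right[OF R.ib_bilinear[OF p(1) block(3) p(2)] y]
  show "f (ib K R (J b) X y z) = g (ib K R (J b) X y z)"
  proof (rule block(5)[OF block(6) lin_comp[OF r block(7)] lin_comp[OF r block(8)] _ z])
  fix u v assume "GP X u v"
  from gp_block[OF this block(1-4) x(1)]
  show "f (ib K R (J b) X y u) = g (ib K R (J b) X y u)" unfolding x(2) by (rule block(9))
  qed
 qed
qed

text \<open>The inductive definition adds the blocks in some order. Since factors can be exchanged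
  in an internal product, any chosen block can be taken as the one added last.\<close>

lemma gp_split:
 assumes "GP X u v" "X = pU (J b) X'" "b ~= {}" "finite b" "is_part X'" "b Int pts X' = {}"
 shows "EX x u' v'. x : R.V (indiscrete (card b)) & GP X' u' v' &
  u = ib K R (J b) X' (put R b x) u' & v = ib K S (J b) X' (put S b (h (card b) x)) v'"
 using assms
proof (induct arbitrary: X' rule: gp.induct)
 case gp_empty
 have "pts pempty = pts (pU (J b) X')" using gp_empty(1) by simp
 then show ?case using gp_empty(2) by simp
next
 case (gp_block X1 u1 v1 c y)
 note ex = pU_block_exchange[OF gp_block(8) gp_block(9) gp_block(3) gp_block(6,12) gp_block(5,11,10,4)]
 show ?case
 proof (cases "b = c & X1 = X'")
  case True
  then show ?thesis using gp_block(1,7) by blast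
 next
  case False
  then obtain Z where bc: "b Int c = {}" and Z: "is_part Z" "(b Un c) Int pts Z = {}" "X1 = pU (J b) Z" "X' = pU (J c) Z"
  using ex by blast
  have bZ: "b Int pts Z = {}" and cZ: "c Int pts Z = {}" using Z(2) by auto
  obtain x u2 v2 where x: "x : R.V (indiscrete (card b))" and g: "GP Z u2 v2"
  and u1: "u1 = ib K R (J b) Z (put R b x) u2" and v1: "v1 = ib K S (J b) Z (put S b (h (card b) x)) v2"
  using gp_block(2)[OF Z(3) gp_block(9,10) Z(1) bZ] by blast
  have cl: "u2 : R.V Z" "v2 : S.V Z" using gp_closed[OF g] by auto
  have p: "is_part (J c)" "is_part (J b)" using gp_block(4,10) by auto
  have d: "pts (J c) Int pts (J b) = {}" "pts (J c) Int pts Z = {}" "pts (J b) Int pts Z = {}" using bc bZ cZ by auto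
  note pc = R.put_closed[OF gp_block(4,7)] R.put_closed[OF gp_block(10) x]
  note pc' = S.put_closed[OF gp_block(4) h_closed[OF gp_block(7)]] S.put_closed[OF gp_block(10) h_closed[OF x]]
  show ?thesis
  proof (intro exI conjI)
  show "GP X' (ib K R (J c) Z (put R c y) u2) (ib K S (J c) Z (put S c (h (card c) y)) v2)"
  unfolding Z(4) by (rule gp.gp_block[OF g gp_block(3,4) Z(1) cZ gp_block(7)])
  show "ib K R (J c) X1 (put R c y) u1 = ib K R (J b) X' (put R b x) (ib K R (J c) Z (put R c y) u2)"
  unfolding u1 Z(3,4) by (rule R.ib_lcomm[OF p Z(1) d pc cl(1)])
  show "ib K S (J c) X1 (put S c (h (card c) y)) v1 =
  ib K S (J b) X' (put S b (h (card b) x)) (ib K S (J c) Z (put S c (h (card c) y)) v2)"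
  unfolding v1 Z(3,4) by (rule S.ib_lcomm[OF p Z(1) d pc' cl(2)])
  qed (rule x)
 qed
qed

lemma gp_empty_unique:
 assumes "GP pempty u v" shows "u = kunit R \<one>\<^bsub>K\<^esub> & v = kunit S \<one>\<^bsub>K\<^esub>"
 using assms
proof (cases rule: gp.cases)
 case (gp_block X u' v' b x)
 have "pts pempty = pts (pU (J b) X)" by (simp only: gp_block(1))
 then show ?thesis using gp_block(5) by simp
qed auto

text \<open>By induction on the blocks: \<open>h\<close> on one block is tensored with the map for
  the rest and carried over by \<open>ibT\<close>. By \<open>gp_split\<close> the result has the
  right value on every pair, also on pairs that were built with another block last.\<close>

lemma eta_exists:
 assumes "is_part X"
 shows "EX f:mod_hom K (val R X) (val S X). ALL u v. GP X u v --> f u = v"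
 using assms
proof (induct X rule: part_induct)
 case empty
 have f: "(%x. kunit S (R.ku x)) : mod_hom K (val R pempty) (val S pempty)"
  by (rule lin_comp[OF R.ku(4) mod_isoD(1)[OF S.kunit_iso]])
 show ?case
  by (rule bexI[OF _ f]) (auto dest!: gp_empty_unique simp: R.ku(1))
next
 case (block b X)
 have p: "is_part (J b)" "pts (J b) Int pts X = {}" using block by auto
 obtain f where f: "f : mod_hom K (val R X) (val S X)" "!!u v. GP X u v ==> f u = v" using block(5) by blast
 note m = R.val_module[OF p(1)] R.val_module[OF block(3)] S.val_module[OF p(1)] S.val_module[OF block(3)]
 let ?V = "R.V (indiscrete (card b))"
 let ?g = "%y. put S b (h (card b) (inv_into ?V (put R b) y))"
 note pi = R.put_iso[OF block(2)]
 have g: "?g : mod_hom K (val R (J b)) (val S (J b))"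
  by (rule lin_comp[OF lin_comp[OF mod_isoD(1)[OF mod_iso_inv_into[OF R.val_module[OF is_part_indiscrete] pi]] h_hom]
  S.put_hom[OF block(2)]])
 let ?t = "tens_map K (val R (J b)) (val R X) (val S (J b)) (val S X) ?g f"
 let ?T = "carrier (tensor K (val R (J b)) (val R X))"
 note iR = R.ibT_iso[OF p(1) block(3) p(2)] and iS = S.ibT_iso[OF p(1) block(3) p(2)]
 let ?F = "%w. ibT S (J b) X (?t (inv_into ?T (ibT R (J b) X) w))"
 have F: "?F : mod_hom K (val R (pU (J b) X)) (val S (pU (J b) X))"
  by (rule lin_comp[OF lin_comp[OF mod_isoD(1)[OF mod_iso_inv_into[OF tensor_module[OF m(1,2)] iR]]
  tens_map_hom[OF m g f(1)]] mod_isoD(1)[OF iS]])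
 show ?case
 proof (rule bexI[OF _ F], intro allI impI)
  fix u v assume uv: "GP (pU (J b) X) u v"
  obtain x u' v' where x: "x : ?V" and g': "GP X u' v'"
  and u: "u = ib K R (J b) X (put R b x) u'" and v: "v = ib K S (J b) X (put S b (h (card b) x)) v'"
  using gp_split[OF uv refl block(1-4)] by blast
  have cl: "u' : R.V X" using gp_closed[OF g'] by simp
  note px = R.put_closed[OF block(2) x]
  have "inv_into ?T (ibT R (J b) X) u = ptens K (val R (J b)) (val R X) (put R b x) u'"
  unfolding u R.ibT_ptens[symmetric] by (rule lin_inv_into_eq[OF iR ptens_closed[OF m(1,2) px cl]])
  then show "?F u = v"
  using tens_map_ptens[OF m g f(1) px cl] f(2)[OF g'] lin_inv_into_eq[OF pi x]
  by (simp add: S.ibT_ptens v)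
 qed
qed

text \<open>The choice is unique on the carrier, because the first components of \<open>gp\<close>
  span.\<close>

definition eta where
 "eta X = restrict (SOME f. f : mod_hom K (val R X) (val S X) & (ALL u v. GP X u v --> f u = v)) (R.V X)"

lemma eta:
 assumes "is_part X"
 shows eta_hom_ext: "eta X : mod_hom_ext K (val R X) (val S X)"
  and eta_gp: "GP X u v ==> eta X u = v"
proof -
 let ?P = "%f. f : mod_hom K (val R X) (val S X) & (ALL u v. GP X u v --> f u = v)"
 have "EX f. ?P f" using eta_exists[OF assms] by blast
 then have P: "?P (SOME f. ?P f)" by (rule someI_ex)
 then show "eta X : mod_hom_ext K (val R X) (val S X)"
  unfolding eta_def by (intro restrict_mod_hom_ext R.val_module assms) blast
 assume g: "GP X u v"
 then show "eta X u = v" using P gp_closed[OF g] by (simp add: eta_def)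
qed

lemmas eta_hom = lin_extD[OF eta_hom_ext]

lemma gp_union:
 assumes "GP X u v" "GP Y u' v'" "pts X Int pts Y = {}"
 shows "GP (pU X Y) (ib K R X Y u u') (ib K S X Y v v')"
 using assms
proof (induct rule: gp.induct)
 case gp_empty
 then show ?case using gp_closed[OF gp_empty(1)] R.ib_one(1) S.ib_one(1) by simp
next
 case (gp_block X u v b x)
 have d: "b Int pts Y = {}" "pts X Int pts Y = {}" using gp_block(9) by auto
 note c = gp_closed[OF gp_block(1)] gp_closed[OF gp_block(8)]
 have P: "is_part (J b)" "is_part X" "is_part Y" using gp_block(4) c by auto
 have dd: "pts (J b) Int pts X = {}" "pts (J b) Int pts Y = {}" "pts X Int pts Y = {}" using d gp_block(6) by auto
 have "GP (pU (J b) (pU X Y)) (ib K R (J b) (pU X Y) (put R b x) (ib K R X Y u u'))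
  (ib K S (J b) (pU X Y) (put S b (h (card b) x)) (ib K S X Y v v'))"
  using gp_block(2)[OF gp_block(8) d(2)] gp_block(3,4,6,7) d is_part_pU[OF P(2,3) d(2)]
  by (intro gp.gp_block) auto
 then show ?case
  unfolding pU_assoc
  using R.ib_assoc[OF P dd R.put_closed[OF gp_block(4,7)]] S.ib_assoc[OF P dd S.put_closed[OF gp_block(4) h_closed[OF gp_block(7)]]] c
  by simp
qed

lemma eta_ib:
 assumes P: "is_part X" "is_part Y" "pts X Int pts Y = {}" and x: "x : R.V X" and y: "y : R.V Y"
 shows "eta (pU X Y) (ib K R X Y x y) = ib K S X Y (eta X x) (eta Y y)"
proof -
 note U = is_part_pU[OF P]
 note bR = R.ib_bilinear[OF P] and bS = S.ib_bilinear[OF P]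
 note e = eta_hom[OF U] eta_hom[OF P(1)] eta_hom[OF P(2)]
 have 1: "eta (pU X Y) (ib K R X Y u y) = ib K S X Y (eta X u) (eta Y y)" if g: "GP X u v" for u v
 proof -
  have c: "u : R.V X" "v : S.V X" using gp_closed[OF g] by auto
  show ?thesis
  unfolding eta_gp[OF P(1) g]
  proof (rule gp_hom_eqI[OF P(2) S.val_module[OF U] lin_comp[OF bilinear_map_right[OF bR c(1)] e(1)]
  lin_comp[OF e(3) bilinear_map_right[OF bS c(2)]] _ y])
  fix u' v' assume g': "GP Y u' v'"
  show "eta (pU X Y) (ib K R X Y u u') = ib K S X Y v (eta Y u')"
  using eta_gp[OF U gp_union[OF g g' P(3)]] eta_gp[OF P(2) g'] by simp
  qed
 qed
 show ?thesis
  by (rule gp_hom_eqI[OF P(1) S.val_module[OF U] lin_comp[OF bilinear_map_left[OF bR y] e(1)]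
  lin_comp[OF e(2) bilinear_map_left[OF bS lin_closed[OF e(3) y]]] 1 x])
qed

end

lemma gbialg_morD:
 assumes "gbialg_mor K A B h"
 shows "h n : mod_hom_ext K (piece A n) (piece B n)" "h n : mod_hom K (piece A n) (piece B n)"
  "a : carrier (piece A n) ==> h n a : carrier (piece B n)"
  "x : carrier (piece A i) ==> y : carrier (piece A j) ==> h (i + j) (gmult A i j x y) = gmult B i j (h i x) (h j y)"
  "k : carrier K ==> h 0 (gunit A k) = gunit B k"
  "z : carrier (piece A (i + j)) ==>
  tens_map K (piece A i) (piece A j) (piece B i) (piece B j) (h i) (h j) (gcomult A i j z) = gcomult B i j (h (i + j) z)"
  "w : carrier (piece A 0) ==> gcounit B (h 0 w) = gcounit A w"
proof -
 show *: "h n : mod_hom_ext K (piece A n) (piece B n)" for n using assms by (simp add: gbialg_mor_def)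
 show "h n : mod_hom K (piece A n) (piece B n)" by (rule lin_extD[OF *])
 show "a : carrier (piece A n) ==> h n a : carrier (piece B n)" by (rule lin_closed[OF lin_extD[OF *]])
 show "x : carrier (piece A i) ==> y : carrier (piece A j) ==> h (i + j) (gmult A i j x y) = gmult B i j (h i x) (h j y)"
  "k : carrier K ==> h 0 (gunit A k) = gunit B k"
  "z : carrier (piece A (i + j)) ==>
  tens_map K (piece A i) (piece A j) (piece B i) (piece B j) (h i) (h j) (gcomult A i j z) = gcomult B i j (h (i + j) z)"
  "w : carrier (piece A 0) ==> gcounit B (h 0 w) = gcounit A w"
  using assms unfolding gbialg_mor_def by blast+
qed

section \<open>Naturality of the map induced by a bialgebra morphism\<close>

locale smpf_pair_bialg = smpf_pair +
 assumes h_mor: "gbialg_mor K (sigma_alg K R) (sigma_alg K S) h"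
begin

lemmas h_mult = gbialg_morD(4)[OF h_mor, unfolded R.sigma_alg_simps S.sigma_alg_simps]
lemmas h_unit = gbialg_morD(5)[OF h_mor, unfolded R.sigma_alg_simps S.sigma_alg_simps]
lemmas h_comult = gbialg_morD(6)[OF h_mor, unfolded R.sigma_alg_simps S.sigma_alg_simps]

text \<open>For nonempty \<open>b\<close> the pair lies in \<open>gp\<close> by one step from the
  empty partition. An empty \<open>b\<close> is no block; there the element is a scalar multiple of
  the unit, and compatibility of \<open>h\<close> with the units decides.\<close>

lemma eta_put:
 assumes b: "finite b" and x: "x : R.V (indiscrete (card b))"
 shows "eta (J b) (put R b x) = put S b (h (card b) x)"
proof (cases "b = {}")
 case True
 have x0: "x : R.V pempty" using x True by simp
 note k = R.ku(3)[OF x0]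
 have x': "x = R.ku x \<odot>\<^bsub>val R pempty\<^esub> kunit R \<one>\<^bsub>K\<^esub>" using R.kunit_scale[OF k] R.ku(2)[OF x0] by simp
 have "eta pempty x = R.ku x \<odot>\<^bsub>val S pempty\<^esub> eta pempty (kunit R \<one>\<^bsub>K\<^esub>)"
  using lin_smult[OF eta_hom[OF is_part_indiscrete] k R.kunit_closed[OF R.one_closed]] x' by simp
 also have "... = kunit S (R.ku x)" using eta_gp[OF is_part_indiscrete gp_empty] S.kunit_scale[OF k] by simp
 also have "... = h 0 x" using h_unit[OF k] R.ku(2)[OF x0] by simp
 finally show ?thesis using True x0 R.put_empty[OF x0] S.put_empty[OF h_closed[OF x0]] by simp
next
 case False
 have "GP (pU (J b) pempty) (ib K R (J b) pempty (put R b x) (kunit R \<one>\<^bsub>K\<^esub>))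
  (ib K S (J b) pempty (put S b (h (card b) x)) (kunit S \<one>\<^bsub>K\<^esub>))"
  using False b x by (intro gp_block gp_empty) auto
 then have "GP (J b) (put R b x) (put S b (h (card b) x))"
  using R.ib_one(2)[OF _ R.put_closed[OF b x]] S.ib_one(2)[OF _ S.put_closed[OF b h_closed[OF x]]] b by simp
 then show ?thesis using eta_gp b by simp
qed

text \<open>Naturality at one morphism, in both variances. As a property of \<open>f\<close> it is
  closed under composition and union, which reduces it to bijections between blocks and to the
  merging of two blocks.\<close>

definition nat where
 "nat X Y f \<longleftrightarrow> pmor X Y f & (ALL x:R.V X. eta Y (tr R X Y f x) = tr S X Y f (eta X x)) &
  (ALL x:R.V Y. eta X (res R X Y f x) = res S X Y f (eta Y x))"

lemma eta_closed: "is_part X ==> x : R.V X ==> eta X x : S.V X"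
 by (rule lin_closed[OF eta_hom])

lemma nat_comp:
 assumes f: "nat X Y f" and g: "nat Y Z g"
 shows "nat X Z (g o f)"
proof -
 have m: "pmor X Y f" "pmor Y Z g" using f g by (auto simp: nat_def)
 note p = pmorD(1)[OF m(1)] pmorD(2)[OF m(2)]
 have "eta Z (tr R X Z (g o f) x) = tr S X Z (g o f) (eta X x)" if x: "x : R.V X" for x
  using f g R.tr_closed[OF m(1) x] R.tr_comp[OF m x] S.tr_comp[OF m eta_closed[OF p(1) x]] x
  by (simp add: nat_def)
 moreover have "eta X (res R X Z (g o f) x) = res S X Z (g o f) (eta Z x)" if x: "x : R.V Z" for x
  using f g R.res_closed[OF m(2) x] R.res_comp[OF m x] S.res_comp[OF m eta_closed[OF p(2) x]] x
  by (simp add: nat_def)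
 ultimately show ?thesis using pmor_comp[OF m] by (simp add: nat_def)
qed

lemma nat_id: "is_part X ==> nat X X id"
 using R.tr_id S.tr_id R.res_id S.res_id eta_closed by (simp add: nat_def pmor_id)

lemma nat_cong:
 assumes f: "nat X Y f" and g: "!!x. x : pts X ==> g x = f x"
 shows "nat X Y g"
proof -
 have m: "pmor X Y f" using f by (simp add: nat_def)
 note p = pmorD(1,2)[OF m]
 show ?thesis
  using f pmor_cong[OF m g] R.tr_cong[OF m _ g] S.tr_cong[OF m _ g] R.res_cong[OF m _ g] S.res_cong[OF m _ g]
  eta_closed[OF p(1)] eta_closed[OF p(2)] by (simp add: nat_def)
qed

lemma nat_pU:
 assumes f: "nat X X' f" "nat Y Y' f" and d: "pts X Int pts Y = {}" "pts X' Int pts Y' = {}"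
 shows "nat (pU X Y) (pU X' Y') f"
proof -
 have m: "pmor X X' f" "pmor Y Y' f" using f by (auto simp: nat_def)
 note P = pmorD(1)[OF m(1)] pmorD(1)[OF m(2)] and P' = pmorD(2)[OF m(1)] pmorD(2)[OF m(2)]
 note M = pmor_pU[OF m d]
 note U = is_part_pU[OF P d(1)] and U' = is_part_pU[OF P' d(2)]
 have "eta (pU X' Y') (tr R (pU X Y) (pU X' Y') f w) = tr S (pU X Y) (pU X' Y') f (eta (pU X Y) w)"
  if w: "w : R.V (pU X Y)" for w
 proof (rule R.ib_hom_eqI[OF w P d(1) lin_comp[OF R.tr_hom[OF M] eta_hom[OF U']] lin_comp[OF eta_hom[OF U] S.tr_hom[OF M]] S.val_module[OF U']])
  fix x y assume x: "x : R.V X" and y: "y : R.V Y"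
  show "eta (pU X' Y') (tr R (pU X Y) (pU X' Y') f (ib K R X Y x y)) =
  tr S (pU X Y) (pU X' Y') f (eta (pU X Y) (ib K R X Y x y))"
  unfolding R.ib_tr[OF m d x y] eta_ib[OF P d(1) x y] eta_ib[OF P' d(2) R.tr_closed[OF m(1) x] R.tr_closed[OF m(2) y]]
  S.ib_tr[OF m d eta_closed[OF P(1) x] eta_closed[OF P(2) y]]
  using f x y by (simp add: nat_def)
 qed
 moreover have "eta (pU X Y) (res R (pU X Y) (pU X' Y') f w) = res S (pU X Y) (pU X' Y') f (eta (pU X' Y') w)"
  if w: "w : R.V (pU X' Y')" for w
 proof (rule R.ib_hom_eqI[OF w P' d(2) lin_comp[OF R.res_hom[OF M] eta_hom[OF U]] lin_comp[OF eta_hom[OF U'] S.res_hom[OF M]] S.val_module[OF U]])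
  fix x y assume x: "x : R.V X'" and y: "y : R.V Y'"
  show "eta (pU X Y) (res R (pU X Y) (pU X' Y') f (ib K R X' Y' x y)) =
  res S (pU X Y) (pU X' Y') f (eta (pU X' Y') (ib K R X' Y' x y))"
  unfolding R.ib_res[OF m d x y] eta_ib[OF P' d(2) x y] eta_ib[OF P d(1) R.res_closed[OF m(1) x] R.res_closed[OF m(2) y]]
  S.ib_res[OF m d eta_closed[OF P'(1) x] eta_closed[OF P'(2) y]]
  using f x y by (simp add: nat_def)
 qed
 ultimately show ?thesis using M by (simp add: nat_def)
qed

lemma nat_J:
 assumes f: "bij_betw f b c" "finite b"
 shows "nat (J b) (J c) f"
proof -
 have m: "pmor (J b) (J c) f" using piso_pmor[OF piso_J[OF f(2,1)]] .
 have fc: "finite c" using f bij_betw_finite by blast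
 have cc: "card c = card b" using bij_betw_same_card[OF f(1)] by simp
 have "eta (J c) (tr R (J b) (J c) f y) = tr S (J b) (J c) f (eta (J b) y)" if y: "y : R.V (J b)" for y
 proof -
  obtain x where x: "x : R.V (indiscrete (card b))" "y = put R b x"
  using y mod_isoD(4)[OF R.put_iso[OF f(2)]] by blast
  show ?thesis
  unfolding x(2) R.tr_put[OF f x(1)] eta_put[OF f(2) x(1)] S.tr_put[OF f h_closed[OF x(1)]]
  using eta_put[OF fc, unfolded cc, OF x(1)] .
 qed
 moreover have "eta (J b) (res R (J b) (J c) f y) = res S (J b) (J c) f (eta (J c) y)" if y: "y : R.V (J c)" for y
 proof -
  obtain x where x: "x : R.V (indiscrete (card b))" "y = put R c x"
  using y mod_isoD(4)[OF R.put_iso[OF fc]] cc by auto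
  show ?thesis
  unfolding x(2) R.res_put[OF f x(1)] eta_put[OF f(2) x(1)] eta_put[OF fc, unfolded cc, OF x(1)]
  using S.res_put[OF f h_closed[OF x(1)]] by simp
 qed
 ultimately show ?thesis using m by (simp add: nat_def)
qed

text \<open>Multiplicativity of \<open>h\<close> gives the transfers through
  \<open>tr_merge\<close>, and its compatibility with the comultiplication gives the restrictions
  through \<open>res_split\<close>.\<close>

lemma nat_merge:
 assumes b: "finite b" "finite c" "b Int c = {}"
 shows "nat (pU (J b) (J c)) (J (b Un c)) id"
proof -
 let ?i = "card b" and ?j = "card c"
 have P: "is_part (J b)" "is_part (J c)" using b by auto
 note R = R.J_disjoint_parts[OF b]
 have fU: "finite (b Un c)" "is_part (J (b Un c))" using b by auto
 have cU: "card (b Un c) = ?i + ?j" using b by (simp add: card_Un_disjoint)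
 have "eta (J (b Un c)) (tr R (pU (J b) (J c)) (J (b Un c)) id w) =
  tr S (pU (J b) (J c)) (J (b Un c)) id (eta (pU (J b) (J c)) w)"
  if w: "w : R.V (pU (J b) (J c))" for w
 proof (rule R.ib_hom_eqI[OF w P R(2) lin_comp[OF R.tr_hom[OF R(3)] eta_hom[OF fU(2)]]
  lin_comp[OF eta_hom[OF R(1)] S.tr_hom[OF R(3)]] S.val_module[OF fU(2)]])
  fix y z assume y: "y : R.V (J b)" and z: "z : R.V (J c)"
  obtain x where x: "x : R.V (indiscrete ?i)" "y = put R b x" using y mod_isoD(4)[OF R.put_iso[OF b(1)]] by blast
  obtain x' where x': "x' : R.V (indiscrete ?j)" "z = put R c x'" using z mod_isoD(4)[OF R.put_iso[OF b(2)]] by blast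
  show "eta (J (b Un c)) (tr R (pU (J b) (J c)) (J (b Un c)) id (ib K R (J b) (J c) y z)) =
  tr S (pU (J b) (J c)) (J (b Un c)) id (eta (pU (J b) (J c)) (ib K R (J b) (J c) y z))"
  unfolding eta_ib[OF P R(2) y z] unfolding x(2) x'(2) R.tr_merge[OF b x(1) x'(1)] eta_put[OF b(1) x(1)] eta_put[OF b(2) x'(1)]
  S.tr_merge[OF b h_closed[OF x(1)] h_closed[OF x'(1)]]
  using eta_put[OF fU(1), unfolded cU, OF R.gm_closed[OF x(1) x'(1)]] h_mult[OF x(1) x'(1)] by simp
 qed
 moreover have "eta (pU (J b) (J c)) (res R (pU (J b) (J c)) (J (b Un c)) id y) =
  res S (pU (J b) (J c)) (J (b Un c)) id (eta (J (b Un c)) y)" if y: "y : R.V (J (b Un c))" for y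
 proof -
  obtain x where x: "x : R.V (indiscrete (?i + ?j))" "y = put R (b Un c) x"
  using y mod_isoD(4)[OF R.put_iso[OF fU(1)]] cU by auto
  let ?A = "%n. val R (indiscrete n)" and ?B = "%n. val S (indiscrete n)"
  have mA: "module K (?A n)" "module K (?B n)" for n by (auto intro: R.val_module S.val_module)
  let ?t = "tens_map K (?A ?i) (?A ?j) (?B ?i) (?B ?j) (h ?i) (h ?j)"
  note t = tens_map_hom[OF mA(1,1,2,2) h_hom h_hom, of ?i ?j] tens_map_ptens[OF mA(1,1,2,2) h_hom h_hom, of _ ?i _ ?j]
  have key: "eta (pU (J b) (J c)) (R.IB b c u) = S.IB b c (?t u)" if u: "u : carrier (tensor K (?A ?i) (?A ?j))" for u
  proof (rule tensor_hom_eqI[OF mA(1,1) S.val_module[OF R(1)] lin_comp[OF R.IB_hom[OF b] eta_hom[OF R(1)]]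
  lin_comp[OF t(1) S.IB_hom[OF b]] _ u])
  fix x x' assume x: "x : R.V (indiscrete ?i)" "x' : R.V (indiscrete ?j)"
  show "eta (pU (J b) (J c)) (R.IB b c (ptens K (?A ?i) (?A ?j) x x')) = S.IB b c (?t (ptens K (?A ?i) (?A ?j) x x'))"
  unfolding R.IB_ptens[OF b x] t(2)[OF x] S.IB_ptens[OF b h_closed[OF x(1)] h_closed[OF x(2)]]
  eta_ib[OF P R(2) R.put_closed[OF b(1) x(1)] R.put_closed[OF b(2) x(2)]] eta_put[OF b(1) x(1)] eta_put[OF b(2) x(2)] ..
  qed
  show ?thesis
  unfolding x(2) R.res_split[OF b x(1)] key[OF R.gc_closed[OF x(1)]] h_comult[OF x(1)]
  eta_put[OF fU(1), unfolded cU, OF x(1)] S.res_split[OF b h_closed[OF x(1)]] ..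
 qed
 ultimately show ?thesis using R(3) by (simp add: nat_def)
qed

text \<open>A renaming of points acts block by block, and on a single block it is absorbed by
  \<open>put\<close>.\<close>

lemma nat_transport:
 assumes "is_part X" "inj_on f (pts X)"
 shows "nat X (ptransport f X) f"
 using assms
proof (induct X rule: part_induct)
 case empty
 have "ptransport f pempty = pempty" by (simp add: ptransport_def indiscrete_def)
 then show ?case using nat_cong[OF nat_id[OF is_part_indiscrete[of 0]], of f] by simp
next
 case (block b X)
 have i: "inj_on f b" "inj_on f (pts X)" using block(6) by (auto simp: inj_on_Un)
 have e: "ptransport f (pU (J b) X) = pU (J (f ` b)) (ptransport f X)"
 proof -
  have "map_prod f f ` (b \<times> b Un eqv X) = f ` b \<times> f ` b Un map_prod f f ` eqv X" by (auto simp: image_iff)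
  then show ?thesis by (simp add: ptransport_def pU_def J_def image_Un)
 qed
 have "f ` b Int f ` pts X = {}" using block(4,6) by (auto simp: inj_on_def)
 then show ?case
  unfolding e using block(2,4) i block(5)[OF i(2)]
  by (intro nat_pU nat_J) (auto simp: bij_betw_def)
qed

text \<open>Induction on the number of pairs equivalent in \<open>Y\<close> but not in
  \<open>X\<close>; merging two blocks lowers it.\<close>

lemma nat_refine:
 assumes "pmor X Y id" shows "nat X Y id"
 using assms
proof (induct "card (eqv Y - eqv X)" arbitrary: X rule: less_induct)
 case less
 show ?case
 proof (cases "X = Y")
  case True then show ?thesis using nat_id pmorD(1)[OF less(2)] by simp
 next
  case False
  obtain b c X' where b: "b ~= {}" "c ~= {}" "finite b" "finite c" "b Int c = {}" "is_part X'" "(b Un c) Int pts X' = {}"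
  and L: "X = pU (J b) (pU (J c) X')" and m: "pmor (pU (J (b Un c)) X') Y id"
  using pmor_merge[OF less(2) False] by blast
  let ?L = "pU (J (b Un c)) X'"
  have 1: "nat X ?L id"
  unfolding L pU_assoc[symmetric]
  by (rule nat_pU[OF nat_merge[OF b(3-5)] nat_id[OF b(6)]]) (use b(7) in auto)
  have fin: "finite (eqv Y)"
  using is_partD(1,2)[OF pmorD(2)[OF m]] by (meson finite_SigmaI finite_subset)
  have "eqv Y - eqv ?L \<subset> eqv Y - eqv X"
  proof
  show "eqv Y - eqv ?L <= eqv Y - eqv X" by (auto simp: L)
  obtain x y where xy: "x : b" "y : c" using b by blast
  have "(x, y) : eqv ?L" using xy by simp
  then have "(x, y) : eqv Y" using pmorD(7)[OF m] by fastforce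
  moreover have "(x, y) ~: eqv X"
  using xy b(5,7) is_partD(2)[OF b(6)] by (auto simp: L)
  ultimately show "eqv Y - eqv ?L ~= eqv Y - eqv X" using \<open>(x, y) : eqv ?L\<close> by blast
  qed
  then have "card (eqv Y - eqv ?L) < card (eqv Y - eqv X)" using fin by (intro psubset_card_mono) auto
  from nat_comp[OF 1 less(1)[OF this m]] show ?thesis by simp
 qed
qed

text \<open>Every morphism is a renaming of points followed by a refinement.\<close>

lemma nat_all:
 assumes f: "pmor X Y f" shows "nat X Y f"
 using nat_comp[OF nat_transport[OF pmorD(1,4)[OF f]] nat_refine[OF pmor_ptransport_to[OF f]]] by simp

lemma eta_mor: "smpf_mor K R S (restrict eta (Collect is_part))"
proof -
 have bx: "eta (X |+| Y) (box K R X Y x y) = box K S X Y (eta X x) (eta Y y)"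
  if P: "is_part X" "is_part Y" and x: "x : R.V X" and y: "y : R.V Y" for X Y x y
 proof -
  note i = piso_pmor[OF piso_inl[OF P(1)]] piso_pmor[OF piso_inr[OF P(2)]]
  have d: "pts (ptransport inl X) Int pts (ptransport inr Y) = {}" by auto
  have n: "eta (ptransport inl X) (tr R X (ptransport inl X) inl x) = tr S X (ptransport inl X) inl (eta X x)"
  "eta (ptransport inr Y) (tr R Y (ptransport inr Y) inr y) = tr S Y (ptransport inr Y) inr (eta Y y)"
  using nat_all[OF i(1)] nat_all[OF i(2)] x y by (auto simp: nat_def)
  show ?thesis
  unfolding R.box_ib[OF P x y] psum_pU eta_ib[OF pmorD(2)[OF i(1)] pmorD(2)[OF i(2)] d R.tr_closed[OF i(1) x] R.tr_closed[OF i(2) y]]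
  S.box_ib[OF P eta_closed[OF P(1) x] eta_closed[OF P(2) y]] n ..
 qed
 have ku: "eta pempty (kunit R k) = kunit S k" if k: "k : carrier K" for k
  using eta_put[of "{}" "kunit R k"] R.kunit_closed[OF k] h_unit[OF k] S.kunit_closed[OF k]
  by (simp add: R.put_empty S.put_empty)
 have n: "eta X (res R X Y f x) = res S X Y f (eta Y x)" if "pmor X Y f" "x : R.V Y" for X Y f x
  using nat_all[OF that(1)] that(2) by (simp add: nat_def)
 have n': "eta Y (tr R X Y f x) = tr S X Y f (eta X x)" if "pmor X Y f" "x : R.V X" for X Y f x
  using nat_all[OF that(1)] that(2) by (simp add: nat_def)
 show ?thesis
  unfolding smpf_mor_def
  using eta_hom_ext bx ku n n' pmorD(1,2) is_part_psum by auto
qed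

lemma eta_indiscrete:
 assumes "x : R.V (indiscrete n)" shows "eta (indiscrete n) x = h n x"
 using eta_put[of "{1..n}" x] assms R.put_indiscrete[OF assms] S.put_indiscrete[OF h_closed[OF assms]]
 by (simp add: indiscrete_J[symmetric] del: One_nat_def)

end

context
 fixes K :: "'k ring" and R S :: "('k, 'v) smpf" and eta
 assumes R: "symmetric_monoidal_partition_functor K R" and S: "symmetric_monoidal_partition_functor K S"
  and e: "smpf_mor K R S eta"
begin

lemma smpf_mor_pair: "smpf_pair K R S (%n. eta (indiscrete n))"
proof -
 have "eta (indiscrete n) : mod_hom K (val R (indiscrete n)) (val S (indiscrete n))" for n
  using e is_part_indiscrete[of n] by (auto simp: smpf_mor_def mod_hom_ext_def)
 then show ?thesis using R S by (simp add: smpf_pair_def smpf_pair_axioms_def)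
qed

text \<open>Gives uniqueness: two morphisms with the same components on one-block partitions have
  the same \<open>gp\<close>, and its first components span.\<close>

lemma smpf_mor_gp:
 assumes "gp K R S (%n. eta (indiscrete n)) X u v" shows "eta X u = v"
proof -
 interpret smpf_pair K R S "%n. eta (indiscrete n)" by (rule smpf_mor_pair)
 note tr = smpf_morD(6)[OF e] and ku = smpf_morD(7)[OF e] and bx = smpf_morD(8)[OF e]
 show ?thesis
  using assms
 proof (induct rule: gp.induct)
  case gp_empty show ?case by (rule ku[OF R.one_closed])
 next
  case (gp_block X u v b x)
  have p: "is_part (J b)" "pts (J b) Int pts X = {}" using gp_block by auto
  have u: "u : R.V X" using gp_closed[OF gp_block(1)] by simp
  note px = R.put_closed[OF gp_block(4,7)]
  have "eta (J b) (put R b x) = put S b (eta (indiscrete (card b)) x)"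
  unfolding put_def by (rule tr[OF piso_pmor[OF R.put_bij[OF gp_block(4)]] gp_block(7)])
  then show ?case
  unfolding ib_def
  using tr[OF piso_pmor[OF piso_pcodiag[OF p(1) gp_block(5) p(2)]] R.box_closed[OF p(1) gp_block(5) px u]]
  bx[OF p(1) gp_block(5) px u] gp_block(2) by simp
 qed
qed

end

text \<open>Full faithfulness: a morphism is determined through \<open>gp\<close> by its components
  on single blocks, and every bialgebra morphism extends, by \<open>eta\<close>.\<close>

lemma sigma_alg_map_bij:
 assumes R: "symmetric_monoidal_partition_functor K R" and S: "symmetric_monoidal_partition_functor K S"
 shows "bij_betw (sigma_alg_map R S) {eta. smpf_mor K R S eta} {h. gbialg_mor K (sigma_alg K R) (sigma_alg K S) h}"
 unfolding bij_betw_def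
proof (intro conjI equalityI subsetI)
 interpret R: symmetric_monoidal_partition_functor K R by fact
 interpret S: symmetric_monoidal_partition_functor K S by fact
 show "inj_on (sigma_alg_map R S) {eta. smpf_mor K R S eta}"
 proof (rule inj_onI)
  fix eta \<theta> assume e: "eta : {eta. smpf_mor K R S eta}" and t: "\<theta> : {eta. smpf_mor K R S eta}"
  and eq: "sigma_alg_map R S eta = sigma_alg_map R S \<theta>"
  then have e': "smpf_mor K R S eta" and t': "smpf_mor K R S \<theta>" by auto
  interpret smpf_pair K R S "%n. eta (indiscrete n)" by (rule smpf_mor_pair[OF R S e'])
  have eq': "(%n. \<theta> (indiscrete n)) = (%n. eta (indiscrete n))" using eq by (simp add: sigma_alg_map_def)
  have h: "eta X : mod_hom_ext K (val R X) (val S X)" "\<theta> X : mod_hom_ext K (val R X) (val S X)" if "is_part X" for X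
  using e' t' that by (auto simp: smpf_mor_def)
  show "eta = \<theta>"
  proof (rule ext)
  fix X
  show "eta X = \<theta> X"
  proof (cases "is_part X")
  case True
  show ?thesis
  proof (rule extensionalityI)
  fix w assume w: "w : R.V X"
  show "eta X w = \<theta> X w"
  by (rule gp_hom_eqI[OF True S.val_module[OF True] lin_extD[OF h(1)[OF True]] lin_extD[OF h(2)[OF True]] _ w])
  (simp add: smpf_mor_gp[OF R S e'] smpf_mor_gp[OF R S t', unfolded eq'])
  qed (use h[OF True] in \<open>auto simp: mod_hom_ext_def\<close>)
  next
  case False
  then show ?thesis using smpf_morD(1)[OF e'] smpf_morD(1)[OF t'] by (simp add: extensional_def)
  qed
  qed
 qed
 show "h : {h. gbialg_mor K (sigma_alg K R) (sigma_alg K S) h}"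
  if "h : sigma_alg_map R S ` {eta. smpf_mor K R S eta}" for h
  using that sigma_alg_map_mor[OF R S] by auto
 fix h assume "h : {h. gbialg_mor K (sigma_alg K R) (sigma_alg K S) h}"
 then have h: "gbialg_mor K (sigma_alg K R) (sigma_alg K S) h" by simp
 have hh: "h n : mod_hom_ext K (val R (indiscrete n)) (val S (indiscrete n))" for n
  using h by (simp add: gbialg_mor_def R.sigma_alg_simps S.sigma_alg_simps)
 interpret smpf_pair_bialg K R S h
  by unfold_locales (rule lin_extD[OF hh], rule h)
 have eqh: "sigma_alg_map R S (restrict eta (Collect is_part)) = h"
 proof (rule ext)
  fix n
  show "sigma_alg_map R S (restrict eta (Collect is_part)) n = h n"
  unfolding sigma_alg_map_def
  proof (rule extensionalityI)
  show "restrict eta (Collect is_part) (indiscrete n) : extensional (R.V (indiscrete n))"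
  using eta_hom_ext[OF is_part_indiscrete, of n] by (simp add: mod_hom_ext_def)
  show "h n : extensional (R.V (indiscrete n))" using hh[of n] by (simp add: mod_hom_ext_def)
  qed (simp add: eta_indiscrete)
 qed
 show "h : sigma_alg_map R S ` {eta. smpf_mor K R S eta}"
  by (rule image_eqI[where f = "sigma_alg_map R S" and x = "restrict eta (Collect is_part)"])
  (simp_all only: eqh mem_Collect_eq eta_mor)
qed

section \<open>The coproduct of countably many copies of a bialgebra\<close>

text \<open>An infinite type is in bijection with its square and with itself minus a point. Lists
  are coded by iterated pairing, shifted so as to miss \<open>undefined\<close>, the code of the
  empty list.\<close>

lemma infinite_list_inj:
 assumes "infinite (UNIV :: 'v set)"
 shows "EX c :: 'v list => 'v. inj c"
proof -
 obtain p :: "'v \<times> 'v => 'v" where p: "bij p"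
  using card_of_Times_same_infinite[OF assms] unfolding card_of_ordIso[symmetric] by auto
 obtain s :: "'v => 'v" where s: "inj s" "range s <= UNIV - {undefined}"
  using infinite_imp_bij_betw[OF assms, of undefined] unfolding bij_betw_def by blast
 define c where "c = rec_list undefined (%x _ r. s (p (x, r)))"
 have c: "c [] = undefined" "c (x # xs) = s (p (x, c xs))" for x xs by (simp_all add: c_def)
 have "xs = ys" if "c xs = c ys" for xs ys
  using that
 proof (induct xs arbitrary: ys)
  case Nil
  show ?case
  proof (cases ys)
  case (Cons y zs)
  then have "undefined = s (p (y, c zs))" using Nil by (simp add: c)
  then show ?thesis using s(2) by (metis DiffE insertI1 rangeI subsetD)
  qed simp
 next
  case (Cons x xs)
  show ?case
  proof (cases ys)
  case Nil
  then have "undefined = s (p (x, c xs))" using Cons(2) by (simp add: c)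
  then show ?thesis using s(2) by (metis DiffE insertI1 rangeI subsetD)
  next
  case (Cons y zs)
  then have "s (p (x, c xs)) = s (p (y, c zs))" using Cons.prems by (simp add: c)
  then have "(x, c xs) = (y, c zs)" using s(1) p by (meson bij_is_inj injD)
  then show ?thesis using Cons.hyps Cons by simp
  qed
 qed
 then show ?thesis by (auto simp: inj_def)
qed

lemma transport_module:
 assumes M: "module K M" and e: "inj_on e (carrier M)"
 shows "EX N :: ('k, 'v) module. module K N & e : mod_iso K M N"
proof -
 interpret M: module K M by fact
 let ?d = "inv_into (carrier M) e"
 let ?N = "\<lparr>carrier = e ` carrier M, monoid.mult = undefined, one = undefined, zero = e \<zero>\<^bsub>M\<^esub>,
  add = (%u v. e (?d u \<oplus>\<^bsub>M\<^esub> ?d v)), smult = (%k u. e (k \<odot>\<^bsub>M\<^esub> ?d u))\<rparr> :: ('k, 'v) module"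
 have d: "?d (e x) = x" if "x : carrier M" for x using e that by simp
 have "module K ?N"
 proof (rule moduleI)
  show "abelian_group ?N"
  proof (rule abelian_groupI)
  fix u assume "u : carrier ?N"
  then obtain x where x: "x : carrier M" "u = e x" by auto
  show "EX v:carrier ?N. v \<oplus>\<^bsub>?N\<^esub> u = \<zero>\<^bsub>?N\<^esub>"
  using x by (intro bexI[of _ "e (\<ominus>\<^bsub>M\<^esub> x)"]) (auto simp: d M.l_neg)
  qed (auto simp: d M.a_ac)
 qed (auto simp: d M.smult_l_distr M.smult_r_distr M.smult_assoc1 M.is_cring)
 moreover have "e : mod_iso K M ?N"
  using e by (auto simp: mod_iso_def bij_betw_def d intro!: mod_homI)
 ultimately show ?thesis by blast
qed

locale big_bialgebra = connected_graded_bialgebra K A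
 for K :: "'k ring" and A :: "('k, 'v) gbialg" +
 assumes infinite_carrier: "infinite (UNIV :: 'v set)"
begin

abbreviation P where "P n \<equiv> carrier (piece A n)"

definition hone :: "nat \<times> 'v" where "hone = (0, gunit A \<one>\<^bsub>K\<^esub>)"

definition hm :: "nat \<times> 'v => nat \<times> 'v => nat \<times> 'v" where
 "hm p q = (fst p + fst q, gmult A (fst p) (fst q) (snd p) (snd q))"

text \<open>Homogeneous elements carry their degree along, because the pieces of \<open>A\<close>
  may overlap as subsets of the type.\<close>

definition Hs :: "(nat \<times> 'v) set" where "Hs = {p. snd p : P (fst p)}"

lemma gunit_closed: "k : carrier K ==> gunit A k : P 0"
 using lin_closed[OF mod_isoD(1)[OF connected]] by (simp add: self_mod_def)

lemma gmult_closed: "x : P i ==> y : P j ==> gmult A i j x y : P (i + j)"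
 by (rule bilinear_map_closed[OF gmult_bilinear])

lemma hm: "p : Hs ==> q : Hs ==> hm p q : Hs" "hone : Hs"
 "p : Hs ==> q : Hs ==> hm p q = hm q p"
 "p : Hs ==> q : Hs ==> r : Hs ==> hm (hm p q) r = hm p (hm q r)"
 "p : Hs ==> hm hone p = p" "p : Hs ==> hm p hone = p"
 "fst (hm p q) = fst p + fst q" "fst hone = 0"
proof -
 show c: "hm p q = hm q p" if "p : Hs" "q : Hs" for p q
  using that gmult_comm by (simp add: hm_def Hs_def add.commute)
 show o: "hone : Hs" using gunit_closed by (simp add: hone_def Hs_def)
 show l: "hm hone p = p" if "p : Hs" for p
 proof -
  interpret M: module K "piece A (fst p)" by (rule piece_module)
  show ?thesis using that gmult_unit[OF one_closed, of "snd p" "fst p"] M.smult_one by (cases p) (simp add: hm_def hone_def Hs_def)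
 qed
 show "hm p hone = p" if "p : Hs" for p using c[OF that o] l[OF that] by simp
 show "p : Hs ==> q : Hs ==> hm p q : Hs" using gmult_closed by (simp add: hm_def Hs_def)
 show "p : Hs ==> q : Hs ==> r : Hs ==> hm (hm p q) r = hm p (hm q r)"
  using gmult_assoc by (simp add: hm_def Hs_def add.assoc)
qed (simp_all add: hm_def hone_def)

text \<open>These index the pure tensors, with homogeneous factors, of the infinite tensor product
  of copies of \<open>A\<close>, in which almost all factors are the unit.\<close>

definition Mon :: "(nat => nat \<times> 'v) set" where
 "Mon = {x. (ALL s. x s : Hs) & finite {s. x s ~= hone}}"

definition xm :: "(nat => nat \<times> 'v) => (nat => nat \<times> 'v) => (nat => nat \<times> 'v)" where
 "xm x y = (%s. hm (x s) (y s))"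

definition xone :: "nat => nat \<times> 'v" where "xone = (%_. hone)"

lemma MonD: "x : Mon ==> x s : Hs" "x : Mon ==> finite {s. x s ~= hone}"
 "x : Mon ==> snd (x s) : P (fst (x s))"
 by (auto simp: Mon_def Hs_def)

lemma Mon_upd: "x : Mon ==> a : P n ==> x(s := (n, a)) : Mon"
proof -
 assume x: "x : Mon" "a : P n"
 have "{t. (x(s := (n, a))) t ~= hone} <= insert s {t. x t ~= hone}" by auto
 then have "finite {t. (x(s := (n, a))) t ~= hone}"
  by (rule finite_subset) (use x in \<open>simp add: Mon_def\<close>)
 then show ?thesis using x by (simp add: Mon_def Hs_def)
qed

lemma xone_Mon: "xone : Mon" using hm(2) by (simp add: Mon_def xone_def)

lemma xm_Mon: "x : Mon ==> y : Mon ==> xm x y : Mon"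
proof -
 assume x: "x : Mon" "y : Mon"
 have "{t. xm x y t ~= hone} <= {t. x t ~= hone} Un {t. y t ~= hone}" using hm(5)[OF hm(2)] by (auto simp: xm_def)
 then have "finite {t. xm x y t ~= hone}"
  by (rule finite_subset) (use x in \<open>simp add: Mon_def\<close>)
 then show ?thesis using x hm(1) by (simp add: Mon_def xm_def)
qed

lemma xm: "x : Mon ==> y : Mon ==> xm x y = xm y x"
 "x : Mon ==> y : Mon ==> z : Mon ==> xm (xm x y) z = xm x (xm y z)"
 "x : Mon ==> xm xone x = x"
 using hm MonD(1) by (auto simp: xm_def xone_def)

text \<open>Updating one coordinate of an arbitrary monomial expresses multilinearity without
  reference to the varying finite set of nontrivial coordinates.\<close>

definition mlin :: "('k, 'p) module => ((nat => nat \<times> 'v) => 'p) => bool" where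
 "mlin Q f \<longleftrightarrow> (ALL x:Mon. f x : carrier Q) &
  (ALL x:Mon. ALL s n. ALL a:P n. ALL b:P n.
  f (x(s := (n, a \<oplus>\<^bsub>piece A n\<^esub> b))) = f (x(s := (n, a))) \<oplus>\<^bsub>Q\<^esub> f (x(s := (n, b)))) &
  (ALL x:Mon. ALL s n. ALL k:carrier K. ALL a:P n. f (x(s := (n, k \<odot>\<^bsub>piece A n\<^esub> a))) = k \<odot>\<^bsub>Q\<^esub> f (x(s := (n, a))))"

lemma mlinI:
 assumes "!!x. x : Mon ==> f x : carrier Q"
  "!!x s n a b. x : Mon ==> a : P n ==> b : P n ==>
  f (x(s := (n, a \<oplus>\<^bsub>piece A n\<^esub> b))) = f (x(s := (n, a))) \<oplus>\<^bsub>Q\<^esub> f (x(s := (n, b)))"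
  "!!x s n k a. x : Mon ==> k : carrier K ==> a : P n ==>
  f (x(s := (n, k \<odot>\<^bsub>piece A n\<^esub> a))) = k \<odot>\<^bsub>Q\<^esub> f (x(s := (n, a)))"
 shows "mlin Q f"
 using assms by (simp add: mlin_def)

lemma mlinD:
 assumes "mlin Q f"
 shows "!!x. x : Mon ==> f x : carrier Q"
  "!!x s n a b. x : Mon ==> a : P n ==> b : P n ==>
  f (x(s := (n, a \<oplus>\<^bsub>piece A n\<^esub> b))) = f (x(s := (n, a))) \<oplus>\<^bsub>Q\<^esub> f (x(s := (n, b)))"
  "!!x s n k a. x : Mon ==> k : carrier K ==> a : P n ==>
  f (x(s := (n, k \<odot>\<^bsub>piece A n\<^esub> a))) = k \<odot>\<^bsub>Q\<^esub> f (x(s := (n, a)))"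
 using assms by (simp_all add: mlin_def)

lemma mlinI_hom:
 assumes "!!x. x : Mon ==> f x : carrier Q"
  "!!x s n. x : Mon ==> (%a. f (x(s := (n, a)))) : mod_hom K (piece A n) Q"
 shows "mlin Q f"
 using assms(1) lin_add[OF assms(2)] lin_smult[OF assms(2)] by (intro mlinI) auto

lemma mlin_hom: "mlin Q f ==> x : Mon ==> (%a. f (x(s := (n, a)))) : mod_hom K (piece A n) Q"
 using mlinD[of Q f] Mon_upd by (intro mod_homI) auto

lemma mlin_comp: "mlin Q f ==> g : mod_hom K Q Q' ==> mlin Q' (%x. g (f x))"
 using mlinD[of Q f] lin_closed[of g K Q Q'] lin_comp[OF mlin_hom]
 by (intro mlinI_hom) auto

definition rels :: "((nat => nat \<times> 'v) => 'k) set" where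
 "rels = (let F = free_mod K Mon; d = free_gen K in
  {d (x(s := (n, a \<oplus>\<^bsub>piece A n\<^esub> b))) \<ominus>\<^bsub>F\<^esub> (d (x(s := (n, a))) \<oplus>\<^bsub>F\<^esub> d (x(s := (n, b)))) | x s n a b.
  x : Mon & a : P n & b : P n} Un
  {d (x(s := (n, k \<odot>\<^bsub>piece A n\<^esub> a))) \<ominus>\<^bsub>F\<^esub> k \<odot>\<^bsub>F\<^esub> d (x(s := (n, a))) | x s n k a.
  x : Mon & k : carrier K & a : P n})"

lemma relsI:
 defines "F \<equiv> free_mod K Mon"
 shows "x : Mon ==> a : P n ==> b : P n ==>
  free_gen K (x(s := (n, a \<oplus>\<^bsub>piece A n\<^esub> b))) \<ominus>\<^bsub>F\<^esub> (free_gen K (x(s := (n, a))) \<oplus>\<^bsub>F\<^esub> free_gen K (x(s := (n, b)))) : rels"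
  and "x : Mon ==> k : carrier K ==> a : P n ==>
  free_gen K (x(s := (n, k \<odot>\<^bsub>piece A n\<^esub> a))) \<ominus>\<^bsub>F\<^esub> k \<odot>\<^bsub>F\<^esub> free_gen K (x(s := (n, a))) : rels"
 unfolding rels_def Let_def F_def by blast+

lemma piece_closed: "a : P n ==> b : P n ==> a \<oplus>\<^bsub>piece A n\<^esub> b : P n" "k : carrier K ==> a : P n ==> k \<odot>\<^bsub>piece A n\<^esub> a : P n"
proof -
 interpret M: module K "piece A n" by (rule piece_module)
 show "a : P n ==> b : P n ==> a \<oplus>\<^bsub>piece A n\<^esub> b : P n" "k : carrier K ==> a : P n ==> k \<odot>\<^bsub>piece A n\<^esub> a : P n" by auto
qed

lemma free_gen_Mon: "x : Mon ==> free_gen K x : carrier (free_mod K Mon)"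
 by (rule free_gen_closed[OF is_cring])

lemma rels_closed: "rels <= carrier (free_mod K Mon)"
proof -
 interpret F: module K "free_mod K Mon" by (rule free_mod_module[OF is_cring])
 show ?thesis
  unfolding rels_def Let_def
  by (intro Un_least subsetI; elim CollectE exE conjE) (simp_all add: free_gen_Mon Mon_upd piece_closed)
qed

text \<open>The coproduct of copies of \<open>A\<close> indexed by the natural numbers, as a module.
  Its elements are sets of functions; the algebra structure is put on a copy \<open>Bm\<close>
  inside the given type.\<close>

definition B0 where "B0 = pres K Mon rels"
definition g0 where "g0 x = pres_class K Mon rels (free_gen K x)"

lemma B0_module: "module K B0"
 unfolding B0_def by (rule pres_module[OF is_cring rels_closed])

lemma g0_mlin: "mlin B0 g0"
proof -
 interpret F: module K "free_mod K Mon" by (rule free_mod_module[OF is_cring])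
 interpret B: module K B0 by (rule B0_module)
 let ?c = "pres_class K Mon rels"
 have c: "?c : mod_hom K (free_mod K Mon) B0"
  unfolding B0_def by (rule pres_class_hom[OF is_cring rels_closed])
 have eq: "?c ph = ?c psi" if "ph \<ominus>\<^bsub>free_mod K Mon\<^esub> psi : rels" "ph : carrier (free_mod K Mon)" "psi : carrier (free_mod K Mon)" for ph psi
 proof -
  have "?c (ph \<ominus>\<^bsub>free_mod K Mon\<^esub> psi) = \<zero>\<^bsub>B0\<^esub>" unfolding B0_def
  by (rule pres_class_rel[OF is_cring rels_closed that(1)])
  then show ?thesis
  using that lin_closed[OF c] B.minus_eq_zero_iff
  by (simp add: lin_minus[OF F.module_axioms B.module_axioms c])
 qed
 show ?thesis
 proof (rule mlinI)
  fix x assume "x : Mon" then show "g0 x : carrier B0"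
  unfolding g0_def by (rule lin_closed[OF c free_gen_Mon])
 next
  fix x s n a b assume *: "x : Mon" "a : P n" "b : P n"
  note f = free_gen_Mon[OF Mon_upd[OF *(1,2)]] free_gen_Mon[OF Mon_upd[OF *(1,3)]] free_gen_Mon[OF Mon_upd[OF *(1) piece_closed(1)[OF *(2,3)]]]
  show "g0 (x(s := (n, a \<oplus>\<^bsub>piece A n\<^esub> b))) = g0 (x(s := (n, a))) \<oplus>\<^bsub>B0\<^esub> g0 (x(s := (n, b)))"
  unfolding g0_def lin_add[OF c f(1,2), symmetric] by (rule eq[OF relsI(1)[OF *] f(3) F.a_closed[OF f(1,2)]])
 next
  fix x s n k a assume *: "x : Mon" "k : carrier K" "a : P n"
  note f = free_gen_Mon[OF Mon_upd[OF *(1,3)]] free_gen_Mon[OF Mon_upd[OF *(1) piece_closed(2)[OF *(2,3)]]]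
  show "g0 (x(s := (n, k \<odot>\<^bsub>piece A n\<^esub> a))) = k \<odot>\<^bsub>B0\<^esub> g0 (x(s := (n, a)))"
  unfolding g0_def lin_smult[OF c *(2) f(1), symmetric] by (rule eq[OF relsI(2)[OF *] f(2) F.smult_closed[OF *(2) f(1)]])
 qed
qed

text \<open>A scalar can be absorbed into a coordinate, by choice the one at 0. Hence sums of
  monomials without coefficients exhaust \<open>B0\<close>, on which its coding relies.\<close>

lemma mlin_scale_mon: "mlin Q f ==> x : Mon ==> k : carrier K ==>
  k \<odot>\<^bsub>Q\<^esub> f x = f (x(0 := (fst (x 0), k \<odot>\<^bsub>piece A (fst (x 0))\<^esub> snd (x 0))))"
 using mlinD(3)[of Q f x k "snd (x 0)" "fst (x 0)" 0] MonD(3)[of x 0] by simp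

lemma Mon_scale: "x : Mon ==> k : carrier K ==> x(0 := (fst (x 0), k \<odot>\<^bsub>piece A (fst (x 0))\<^esub> snd (x 0))) : Mon"
 using Mon_upd piece_closed(2) MonD(3) by blast

lemma B0_induct:
 assumes "u : carrier B0" "Q \<zero>\<^bsub>B0\<^esub>" "!!x. x : Mon ==> Q (g0 x)"
  "!!u v. u : carrier B0 ==> v : carrier B0 ==> Q u ==> Q v ==> Q (u \<oplus>\<^bsub>B0\<^esub> v)"
 shows "Q u"
proof (rule pres_induct[OF is_cring rels_closed assms(1)[unfolded B0_def], where Q = Q])
 fix k x assume "k : carrier K" "x : Mon"
 then show "Q (k \<odot>\<^bsub>pres K Mon rels\<^esub> pres_class K Mon rels (free_gen K x))"
  using mlin_scale_mon[OF g0_mlin, of x k] assms(3)[OF Mon_scale, of x k] by (simp add: g0_def B0_def)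
qed (use assms(2,4) in \<open>simp_all add: B0_def\<close>)

lemma B0_lift:
 assumes Q: "module K Q" and f: "mlin Q f"
 shows "EX h:mod_hom K B0 Q. ALL x:Mon. h (g0 x) = f x"
 unfolding B0_def g0_def
proof (rule pres_lift[OF is_cring rels_closed Q])
 interpret Q: module K Q by fact
 interpret F: module K "free_mod K Mon" by (rule free_mod_module[OF is_cring])
 show fc: "f : Mon \<rightarrow> carrier Q" using mlinD(1)[OF f] by auto
 note L = lin_ext_hom[OF Q fc]
 fix ph assume "ph : rels"
 then show "lin_ext K Q f ph = \<zero>\<^bsub>Q\<^esub>"
  unfolding rels_def Let_def
  by (elim UnE CollectE exE conjE)
  (simp_all add: lin_minus[OF F.module_axioms Q L(1)] lin_add[OF L(1)] lin_smult[OF L(1)]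
  free_gen_Mon Mon_upd piece_closed L(2) Q.minus_eq_zero_iff mlinD[OF f])
qed

text \<open>A monomial is recovered from the finite list of its nontrivial coordinates, each given
  by position, degree and element; \<open>g\<close> turns the two numbers into elements of the
  type.\<close>

lemma code_Mon: "EX c :: (nat => nat \<times> 'v) => 'v. inj_on c Mon"
proof -
 obtain c :: "'v list => 'v" where c: "inj c" using infinite_list_inj[OF infinite_carrier] by blast
 obtain g :: "nat => 'v" where g: "inj g" using infinite_countable_subset[OF infinite_carrier] by blast
 let ?t = "%x s. c [g s, g (fst (x s)), snd (x s)]"
 let ?C = "%x. c (map (?t x) (sorted_list_of_set {s. x s ~= hone}))"
 have t: "s = s' & p = q" if "c [g s, g (fst p), snd p] = c [g s', g (fst q), snd q]" for s s' and p q :: "nat \<times> 'v"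
  using injD[OF c that] injD[OF g] by (auto intro: prod_eqI)
 have "x = y" if x: "x : Mon" and y: "y : Mon" and e: "?C x = ?C y" for x y
 proof -
  have l: "map (?t x) (sorted_list_of_set {s. x s ~= hone}) = map (?t y) (sorted_list_of_set {s. y s ~= hone})"
  using injD[OF c e] .
  have "?t x ` {s. x s ~= hone} = ?t y ` {s. y s ~= hone}"
  using arg_cong[OF l, of set] MonD(2)[OF x] MonD(2)[OF y] by simp
  note im = this
  have *: "x s = y s" if "x s ~= hone" for s
  proof -
  have "?t x s : ?t y ` {s. y s ~= hone}" using that im by blast
  then obtain s' where e: "?t x s = ?t y s'" by blast
  show ?thesis using t[OF e] by auto
  qed
  have **: "x s = y s" if "y s ~= hone" for s
  proof -
  have "?t y s : ?t x ` {s. x s ~= hone}" using that im by blast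
  then obtain s' where e: "?t y s = ?t x s'" by blast
  show ?thesis using t[OF e] by auto
  qed
  show ?thesis using * ** by (intro ext) metis
 qed
 then show ?thesis by (intro exI[of _ ?C] inj_onI) blast
qed

lemma code_B0: "EX e :: _ => 'v. inj_on e (carrier B0)"
proof -
 interpret B: module K B0 by (rule B0_module)
 obtain c :: "'v list => 'v" where c: "inj c" using infinite_list_inj[OF infinite_carrier] by blast
 obtain m :: "(nat => nat \<times> 'v) => 'v" where m: "inj_on m Mon" using code_Mon by blast
 let ?S = "%l. foldr (%x r. g0 x \<oplus>\<^bsub>B0\<^esub> r) l \<zero>\<^bsub>B0\<^esub>"
 have Sc: "?S l : carrier B0" if "set l <= Mon" for l
  using that mlinD(1)[OF g0_mlin] by (induct l) auto
 have Sa: "?S (l @ l') = ?S l \<oplus>\<^bsub>B0\<^esub> ?S l'" if "set l <= Mon" "set l' <= Mon" for l l'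
  using that Sc mlinD(1)[OF g0_mlin] by (induct l) (auto simp: B.a_assoc)
 have ex: "EX l. set l <= Mon & u = ?S l" if "u : carrier B0" for u
  using that
 proof (rule B0_induct)
  show "EX l. set l <= Mon & \<zero>\<^bsub>B0\<^esub> = ?S l" by (rule exI[of _ "[]"]) simp
  show "EX l. set l <= Mon & g0 x = ?S l" if "x : Mon" for x
  using that mlinD(1)[OF g0_mlin] by (intro exI[of _ "[x]"]) simp
  fix u v assume "EX l. set l <= Mon & u = ?S l" "EX l. set l <= Mon & v = ?S l"
  then obtain l l' where "set l <= Mon" "u = ?S l" "set l' <= Mon" "v = ?S l'" by blast
  then show "EX l. set l <= Mon & u \<oplus>\<^bsub>B0\<^esub> v = ?S l" using Sa by (intro exI[of _ "l @ l'"]) simp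
 qed
 \<comment> \<open>For each element one list of monomials with this sum is chosen; the list
   determines the element.\<close>
 define l where "l u = (SOME l. set l <= Mon & u = ?S l)" for u
 have l: "set (l u) <= Mon & u = ?S (l u)" if "u : carrier B0" for u
  using someI_ex[OF ex[OF that]] unfolding l_def .
 have "inj_on (%u. c (map m (l u))) (carrier B0)"
 proof (rule inj_onI)
  fix u v assume u: "u : carrier B0" and v: "v : carrier B0" and e: "c (map m (l u)) = c (map m (l v))"
  have "map m (l u) = map m (l v)" using injD[OF c e] .
  moreover have "inj_on m (set (l u) Un set (l v))" using l[OF u] l[OF v] m by (auto intro: inj_on_subset)
  ultimately have "l u = l v" by (simp add: inj_on_map_eq_map)
  then show "u = v" using l[OF u] l[OF v] by metis
 qed
 then show ?thesis by blast
qed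

text \<open>The values of the functor must have carriers in the given type. The coproduct has a copy there,
as its elements are sums of monomials and hence coded by lists over an infinite type.\<close>

definition Bme :: "('k, 'v) module \<times> (_ => 'v)" where
 "Bme = (SOME p. module K (fst p) & snd p : mod_iso K B0 (fst p))"

abbreviation "Bm \<equiv> fst Bme"

definition mon where "mon x = snd Bme (g0 x)"

lemma Bme: "module K Bm" "snd Bme : mod_iso K B0 Bm"
proof -
 obtain e :: "_ => 'v" where e: "inj_on e (carrier B0)" using code_B0 by blast
 obtain N :: "('k, 'v) module" where "module K N" "e : mod_iso K B0 N"
  using transport_module[OF B0_module e] by blast
 then have "EX p :: ('k, 'v) module \<times> (_ => 'v). module K (fst p) & snd p : mod_iso K B0 (fst p)"
  by (intro exI[of _ "(N, e)"]) simp
 from someI_ex[OF this] show "module K Bm" "snd Bme : mod_iso K B0 Bm" unfolding Bme_def by blast+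
qed

lemma mon_mlin: "mlin Bm mon"
 unfolding mon_def[abs_def] by (rule mlin_comp[OF g0_mlin mod_isoD(1)[OF Bme(2)]])

lemma Bm_induct:
 assumes u: "u : carrier Bm" and z: "Q \<zero>\<^bsub>Bm\<^esub>" and m: "!!x. x : Mon ==> Q (mon x)"
  and a: "!!u v. u : carrier Bm ==> v : carrier Bm ==> Q u ==> Q v ==> Q (u \<oplus>\<^bsub>Bm\<^esub> v)"
 shows "Q u"
proof -
 let ?e = "snd Bme"
 note e = mod_isoD[OF Bme(2)]
 obtain w where w: "w : carrier B0" "u = ?e w" using u e(4) by blast
 have "Q (?e w)"
 proof (rule B0_induct[OF w(1)])
  show "Q (?e \<zero>\<^bsub>B0\<^esub>)" using lin_zero[OF B0_module Bme(1) e(1)] z by simp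
  show "Q (?e (g0 x))" if "x : Mon" for x using m[OF that] by (simp add: mon_def)
  show "Q (?e (u \<oplus>\<^bsub>B0\<^esub> v))" if "u : carrier B0" "v : carrier B0" "Q (?e u)" "Q (?e v)" for u v
  using a that lin_closed[OF e(1)] by (simp add: lin_add[OF e(1)])
 qed
 then show ?thesis using w by simp
qed

lemma Bm_hom_eqI:
 assumes "module K Q" "f : mod_hom K Bm Q" "g : mod_hom K Bm Q" "!!x. x : Mon ==> f (mon x) = g (mon x)" "u : carrier Bm"
 shows "f u = g u"
 using assms(5)
proof (rule Bm_induct)
 show "f \<zero>\<^bsub>Bm\<^esub> = g \<zero>\<^bsub>Bm\<^esub>" using lin_zero[OF Bme(1) assms(1,2)] lin_zero[OF Bme(1) assms(1,3)] by simp
qed (simp_all add: assms(4) lin_add[OF assms(2)] lin_add[OF assms(3)])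

definition lft :: "('k, 'p) module => ((nat => nat \<times> 'v) => 'p) => 'v => 'p" where
 "lft Q f = (SOME h. h : mod_hom K Bm Q & (ALL x:Mon. h (mon x) = f x))"

lemma lft:
 assumes Q: "module K Q" and f: "mlin Q f"
 shows lft_hom: "lft Q f : mod_hom K Bm Q" and lft_mon: "x : Mon ==> lft Q f (mon x) = f x"
proof -
 obtain h where h: "h : mod_hom K B0 Q" "!!x. x : Mon ==> h (g0 x) = f x" using B0_lift[OF assms] by blast
 let ?d = "inv_into (carrier B0) (snd Bme)"
 have "(%u. h (?d u)) : mod_hom K Bm Q"
  by (rule lin_comp[OF mod_isoD(1)[OF mod_iso_inv_into[OF B0_module Bme(2)]] h(1)])
 moreover have "h (?d (mon x)) = f x" if "x : Mon" for x
  unfolding mon_def lin_inv_into_eq[OF Bme(2) mlinD(1)[OF g0_mlin that]] by (rule h(2)[OF that])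
 ultimately have "EX h. h : mod_hom K Bm Q & (ALL x:Mon. h (mon x) = f x)" by blast
 from someI_ex[OF this] show "lft Q f : mod_hom K Bm Q" "x : Mon ==> lft Q f (mon x) = f x"
  unfolding lft_def by blast+
qed

lemma xm_upd: "xm x (y(s := q)) = (xm x y)(s := hm (x s) q)" "xm (y(s := q)) x = (xm y x)(s := hm q (x s))"
 by (auto simp: xm_def)

lemma mlin_xm: "x : Mon ==> mlin Bm (%y. mon (xm x y))"
proof (rule mlinI_hom)
 fix y s n assume x: "x : Mon" and y: "y : Mon"
 have "(%a. mon ((xm x y)(s := (fst (x s) + n, gmult A (fst (x s)) n (snd (x s)) a)))) : mod_hom K (piece A n) Bm"
  by (rule lin_comp[OF bilinear_map_right[OF gmult_bilinear MonD(3)[OF x]] mlin_hom[OF mon_mlin xm_Mon[OF x y]]])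
 then show "(%a. mon (xm x (y(s := (n, a))))) : mod_hom K (piece A n) Bm"
  by (simp add: xm_upd hm_def)
qed (use mlinD(1)[OF mon_mlin] xm_Mon in auto)

definition mulB where "mulB u v = lft Bm (%x. lft Bm (%y. mon (xm x y)) v) u"

text \<open>Induction on \<open>v\<close>. At a monomial, commutativity of \<open>xm\<close>
  exchanges the arguments, and multilinearity in the second argument is already known.\<close>

lemma mulB_inner_mlin:
 assumes "v : carrier Bm" shows "mlin Bm (%x. lft Bm (%y. mon (xm x y)) v)"
 using assms
proof (rule Bm_induct)
 interpret B: module K Bm by (rule Bme(1))
 note l = lft_hom[OF Bme(1) mlin_xm] and lm = lft_mon[OF Bme(1) mlin_xm]
 note lc = lin_closed[OF l] and la = lin_add[OF l] and lz = lin_zero[OF Bme(1) Bme(1) l]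
 show "mlin Bm (%x. lft Bm (%y. mon (xm x y)) \<zero>\<^bsub>Bm\<^esub>)"
  by (rule mlinI) (simp_all add: lz Mon_upd piece_closed)
 show "mlin Bm (%x. lft Bm (%y. mon (xm x y)) (mon y))" if y: "y : Mon" for y
 proof -
  have e: "mon (xm y x) = lft Bm (%y. mon (xm x y)) (mon y)" if "x : Mon" for x
  using lm[OF that y] xm(1)[OF that y] by simp
  note m = mlinD[OF mlin_xm[OF y]]
  show ?thesis
  by (rule mlinI) (simp_all add: e[symmetric] Mon_upd piece_closed m)
 qed
 show "mlin Bm (%x. lft Bm (%y. mon (xm x y)) (u \<oplus>\<^bsub>Bm\<^esub> v))"
  if u: "u : carrier Bm" "v : carrier Bm" "mlin Bm (%x. lft Bm (%y. mon (xm x y)) u)"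
  "mlin Bm (%x. lft Bm (%y. mon (xm x y)) v)" for u v
  by (rule mlinI)
  (use u(1,2) in \<open>simp_all add: la lc Mon_upd piece_closed mlinD(2,3)[OF u(3)] mlinD(2,3)[OF u(4)] B.smult_r_distr B.a_ac\<close>)
qed

lemma mulB:
 shows mulB_bilinear: "bilinear_map K Bm Bm Bm mulB"
  and mulB_mon: "x : Mon ==> y : Mon ==> mulB (mon x) (mon y) = mon (xm x y)"
proof -
 note l = lft_hom[OF Bme(1) mlin_xm] and lm = lft_mon[OF Bme(1) mlin_xm]
 note o = lft_hom[OF Bme(1) mulB_inner_mlin] and om = lft_mon[OF Bme(1) mulB_inner_mlin]
 interpret B: module K Bm by (rule Bme(1))
 have r: "mulB (mon x) v = lft Bm (%y. mon (xm x y)) v" if "x : Mon" "v : carrier Bm" for x v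
  unfolding mulB_def by (rule om[OF that(2,1)])
 have L: "(%u. mulB u v) : mod_hom K Bm Bm" if "v : carrier Bm" for v
  using o[OF that] by (simp add: mulB_def)
 have R: "(%v. mulB u v) : mod_hom K Bm Bm" if "u : carrier Bm" for u
  using that
 proof (rule Bm_induct)
  show "(%v. mulB \<zero>\<^bsub>Bm\<^esub> v) : mod_hom K Bm Bm"
  by (rule lin_cong[OF Bme(1) lin_const_zero[OF Bme(1)]])
  (rule lin_zero[OF Bme(1) Bme(1) L])
  show "(%v. mulB (mon x) v) : mod_hom K Bm Bm" if "x : Mon" for x
  by (rule lin_cong[OF Bme(1) l[OF that]]) (rule r[OF that])
  show "(%v. mulB (u \<oplus>\<^bsub>Bm\<^esub> w) v) : mod_hom K Bm Bm"
  if "u : carrier Bm" "w : carrier Bm" "mulB u : mod_hom K Bm Bm" "mulB w : mod_hom K Bm Bm" for u w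
  by (rule lin_cong[OF Bme(1) lin_plus[OF Bme(1) that(3,4)]]) (rule lin_add[OF L that(1,2)])
 qed
 show "bilinear_map K Bm Bm Bm mulB" using L R by (simp add: bilinear_map_def)
 show "mulB (mon x) (mon y) = mon (xm x y)" if "x : Mon" "y : Mon"
  using r[OF that(1) mlinD(1)[OF mon_mlin that(2)]] lm[OF that] by simp
qed

text \<open>Filling the two ring fields of the module record lets the library notion of an algebra
  over \<open>K\<close> apply to it.\<close>

definition B :: "('k, 'v) module" where
 "B = Bm\<lparr>monoid.mult := mulB, one := mon xone\<rparr>"

lemma B_simps [simp]: "carrier B = carrier Bm" "zero B = zero Bm" "add B = add Bm" "smult B = smult Bm"
 "monoid.mult B = mulB" "one B = mon xone"
 by (simp_all add: B_def)

lemma lin_B: "mod_hom K B Q = mod_hom K Bm Q" "mod_hom K Q' B = mod_hom K Q' Bm"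
 "mlin B = mlin Bm"
 by (auto simp: mod_hom_def mlin_def fun_eq_iff)

text \<open>The multiplicative laws are equations between maps linear in each variable, so they are
  inherited from the commutative monoid of monomials.\<close>

lemma B_algebra: "algebra K B"
proof -
 interpret M: module K Bm by (rule Bme(1))
 note bl = mulB_bilinear
 note c = bilinear_map_closed[OF bl] and L = bilinear_map_left[OF bl] and R = bilinear_map_right[OF bl]
 note mc = mlinD(1)[OF mon_mlin]
 have comm: "mulB u v = mulB v u" if u: "u : carrier Bm" and v: "v : carrier Bm" for u v
 proof (rule Bm_hom_eqI[OF Bme(1) L[OF v] R[OF v] _ u])
  fix x assume x: "x : Mon"
  show "mulB (mon x) v = mulB v (mon x)"
  by (rule Bm_hom_eqI[OF Bme(1) R[OF mc[OF x]] L[OF mc[OF x]] _ v]) (simp add: mulB_mon x xm(1))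
 qed
 have one: "mulB (mon xone) u = u" if u: "u : carrier Bm" for u
  by (rule Bm_hom_eqI[OF Bme(1) R[OF mc[OF xone_Mon]] lin_id _ u]) (simp add: mulB_mon xone_Mon xm(3))
 have assoc: "mulB (mulB u v) w = mulB u (mulB v w)"
  if u: "u : carrier Bm" and v: "v : carrier Bm" and w: "w : carrier Bm" for u v w
 proof (rule Bm_hom_eqI[OF Bme(1) lin_comp[OF L[OF v] L[OF w]] L[OF c[OF v w]] _ u])
  fix x assume x: "x : Mon"
  show "mulB (mulB (mon x) v) w = mulB (mon x) (mulB v w)"
  proof (rule Bm_hom_eqI[OF Bme(1) lin_comp[OF R[OF mc[OF x]] L[OF w]] lin_comp[OF L[OF w] R[OF mc[OF x]]] _ v])
  fix y assume y: "y : Mon"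
  show "mulB (mulB (mon x) (mon y)) w = mulB (mon x) (mulB (mon y) w)"
  by (rule Bm_hom_eqI[OF Bme(1) R[OF c[OF mc[OF x] mc[OF y]]] lin_comp[OF R[OF mc[OF y]] R[OF mc[OF x]]] _ w])
  (simp add: mulB_mon x y xm_Mon xm(2))
  qed
 qed
 have ag: "abelian_group B"
  by (rule abelian_groupI) (auto simp: M.a_ac intro!: bexI[of _ "\<ominus>\<^bsub>Bm\<^esub> _"] M.l_neg)
 have cr: "cring B"
 proof (rule cringI[OF ag])
  show "comm_monoid B"
  proof (rule comm_monoidI)
  show "x \<otimes>\<^bsub>B\<^esub> y \<otimes>\<^bsub>B\<^esub> z = x \<otimes>\<^bsub>B\<^esub> (y \<otimes>\<^bsub>B\<^esub> z)" if "x : carrier B" "y : carrier B" "z : carrier B" for x y z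
  using assoc that by simp
  show "x \<otimes>\<^bsub>B\<^esub> y = y \<otimes>\<^bsub>B\<^esub> x" if "x : carrier B" "y : carrier B" for x y
  using comm that by simp
  qed (simp_all add: c one mc[OF xone_Mon])
  show "(x \<oplus>\<^bsub>B\<^esub> y) \<otimes>\<^bsub>B\<^esub> z = x \<otimes>\<^bsub>B\<^esub> z \<oplus>\<^bsub>B\<^esub> y \<otimes>\<^bsub>B\<^esub> z" if "x : carrier B" "y : carrier B" "z : carrier B" for x y z
  using that lin_add[OF L] by simp
 qed
 show ?thesis
  by (rule algebraI[OF is_cring cr])
  (auto simp: M.smult_l_distr M.smult_r_distr M.smult_assoc1 lin_smult[OF L])
qed

lemmas B_hom_eqI = Bm_hom_eqI[folded lin_B(1) B_simps(1)]
lemmas lftB = lft_hom[folded lin_B(1)]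
lemmas mon_mlinB = mon_mlin[folded lin_B(3)]

end

section \<open>The convolution monoid and algebra endomorphisms\<close>

context big_bialgebra
begin

sublocale BB: algebra K B by (rule B_algebra)

abbreviation "BC \<equiv> carrier Bm"

lemma BB_module: "module K B" by (rule BB.module_axioms)

lemma B_bilinear: "bilinear_map K B B B (%u v. u \<otimes>\<^bsub>B\<^esub> v)"
 using mulB_bilinear by (simp add: bilinear_map_def lin_B)

lemma pm: "module K (piece A n)" by (rule piece_module)

abbreviation T2 where "T2 i j \<equiv> piece_tensor K A i j"

lemmas T2_module = tensor_module[OF pm pm]

text \<open>Linear maps from \<open>A\<close> to \<open>B\<close>, given by their components; these
  are extensional, so that families agreeing on the pieces are equal.\<close>

definition convs :: "(nat => 'v => 'v) set" where
 "convs = {f. ALL n. f n : mod_hom_ext K (piece A n) B}"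

lemma convsD: "f : convs ==> f n : mod_hom K (piece A n) B" "f : convs ==> a : P n ==> f n a : BC"
 "f : convs ==> f n : extensional (P n)"
proof -
 show h: "f : convs ==> f n : mod_hom K (piece A n) B" "f : convs ==> f n : extensional (P n)"
  by (auto simp: convs_def mod_hom_ext_def)
 show "f : convs ==> a : P n ==> f n a : BC" using lin_closed[OF h(1)] by simp
qed

lemma convs_eqI:
 assumes "f : convs" "g : convs" "!!n a. a : P n ==> f n a = g n a" shows "f = g"
proof
 fix n show "f n = g n"
  by (rule extensionalityI[OF convsD(3)[OF assms(1)] convsD(3)[OF assms(2)] assms(3)])
qed

lemma convsI:
 assumes "!!n. f n : mod_hom K (piece A n) B" shows "(%n. restrict (f n) (P n)) : convs"
 unfolding convs_def using restrict_mod_hom_ext[OF pm assms] by simp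

definition L2 where
 "L2 i j f g = tens_lift K (piece A i) (piece A j) B (%x y. f i x \<otimes>\<^bsub>B\<^esub> g j y)"

lemma L2:
 assumes "f : convs" "g : convs"
 shows L2_hom: "L2 i j f g : mod_hom K (T2 i j) B"
  and L2_ptens: "x : P i ==> y : P j ==> L2 i j f g (ptens K (piece A i) (piece A j) x y) = f i x \<otimes>\<^bsub>B\<^esub> g j y"
proof -
 have b: "bilinear_map K (piece A i) (piece A j) B (%x y. f i x \<otimes>\<^bsub>B\<^esub> g j y)"
  using bilinear_map_comp[OF B_bilinear convsD(1)[OF assms(1)] convsD(1)[OF assms(2)] lin_id] .
 show "L2 i j f g : mod_hom K (T2 i j) B"
  "x : P i ==> y : P j ==> L2 i j f g (ptens K (piece A i) (piece A j) x y) = f i x \<otimes>\<^bsub>B\<^esub> g j y"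
  unfolding L2_def using tens_lift_hom[OF pm pm BB_module b] tens_lift_ptens[OF pm pm BB_module b] by auto
qed

definition S2 :: "nat => (nat \<times> nat) set" where "S2 n = {(i, j). i + j = n}"

lemma finite_S2: "finite (S2 n)"
 by (rule finite_subset[of _ "{..n} \<times> {..n}"]) (auto simp: S2_def)

text \<open>The convolution product: the comultiplication of \<open>A\<close>, then \<open>f\<close>
  and \<open>g\<close> on the factors, then the multiplication of \<open>B\<close>. In each degree
  only finitely many bidegrees contribute.\<close>

definition cv :: "(nat => 'v => 'v) => (nat => 'v => 'v) => nat => 'v => 'v" where
 "cv f g = (%n. \<lambda>a\<in>P n. \<Oplus>\<^bsub>B\<^esub>p\<in>S2 n. L2 (fst p) (snd p) f g (gcomult A (fst p) (snd p) a))"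

text \<open>The unit of \<open>B\<close> after the counit of \<open>A\<close>, the neutral element
  of convolution.\<close>

definition ce :: "nat => 'v => 'v" where
 "ce = (%n. \<lambda>a\<in>P n. if n = 0 then gcounit A a \<odot>\<^bsub>B\<^esub> \<one>\<^bsub>B\<^esub> else \<zero>\<^bsub>B\<^esub>)"

text \<open>Once this is a commutative monoid, \<open>finprod\<close> takes the role of an iterated
  comultiplication followed by a multiplication, over a finite index set without any order.\<close>

definition CV :: "(nat => 'v => 'v) monoid" where
 "CV = \<lparr>carrier = convs, monoid.mult = cv, one = ce\<rparr>"

lemma CV_simps [simp]: "carrier CV = convs" "monoid.mult CV = cv" "one CV = ce"
 by (simp_all add: CV_def)

lemma gcomult_S2: "p : S2 n ==> gcomult A (fst p) (snd p) : mod_hom K (piece A n) (T2 (fst p) (snd p))"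
 using gcomult_hom[of "fst p" "snd p"] by (auto simp: S2_def)

lemma cv_term_hom: "f : convs ==> g : convs ==> p : S2 n ==>
  (%a. L2 (fst p) (snd p) f g (gcomult A (fst p) (snd p) a)) : mod_hom K (piece A n) B"
 by (rule lin_comp[OF gcomult_S2 L2_hom])

lemma cv_closed: "f : convs ==> g : convs ==> cv f g : convs"
 unfolding cv_def
 by (rule convsI[OF lin_finsum_fun[OF BB_module cv_term_hom]])

lemma cv_apply: "a : P n ==> cv f g n a = (\<Oplus>\<^bsub>B\<^esub>p\<in>S2 n. L2 (fst p) (snd p) f g (gcomult A (fst p) (snd p) a))"
 by (simp add: cv_def)

lemma cv_term_closed: "f : convs ==> g : convs ==> p : S2 n ==> a : P n ==>
  L2 (fst p) (snd p) f g (gcomult A (fst p) (snd p) a) : carrier B"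
 by (rule lin_closed[OF cv_term_hom])

lemma gcounit: "a : P 0 ==> gcounit A a : carrier K"
 "a : P 0 ==> b : P 0 ==> gcounit A (a \<oplus>\<^bsub>piece A 0\<^esub> b) = gcounit A a \<oplus>\<^bsub>K\<^esub> gcounit A b"
 "k : carrier K ==> a : P 0 ==> gcounit A (k \<odot>\<^bsub>piece A 0\<^esub> a) = k \<otimes>\<^bsub>K\<^esub> gcounit A a"
 using lin_closed[OF gcounit_hom] lin_add[OF gcounit_hom] lin_smult[OF gcounit_hom]
 by (simp_all add: self_mod_def)

lemma ce_closed: "ce : convs"
 unfolding ce_def
proof (rule convsI)
 fix n
 show "(%a. if n = 0 then gcounit A a \<odot>\<^bsub>B\<^esub> \<one>\<^bsub>B\<^esub> else \<zero>\<^bsub>B\<^esub>) : mod_hom K (piece A n) B"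
 proof (cases "n = 0")
  case True
  then show ?thesis
  using BB.smult_l_distr[OF gcounit(1) gcounit(1) BB.one_closed] BB.smult_assoc1[OF _ gcounit(1) BB.one_closed]
  BB.smult_closed[OF gcounit(1) BB.one_closed]
  by (intro mod_homI) (simp_all add: gcounit)
 next
  case False
  then show ?thesis using lin_const_zero[OF BB_module] by simp
 qed
qed

lemma ce_apply: "a : P 0 ==> ce 0 a = gcounit A a \<odot>\<^bsub>B\<^esub> \<one>\<^bsub>B\<^esub>" "n ~= 0 ==> a : P n ==> ce n a = \<zero>\<^bsub>B\<^esub>"
 by (simp_all add: ce_def)

text \<open>Cocommutativity of \<open>A\<close> and commutativity of \<open>B\<close>
  together.\<close>

lemma cv_comm:
 assumes f: "f : convs" and g: "g : convs" shows "cv f g = cv g f"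
proof (rule convs_eqI[OF cv_closed[OF f g] cv_closed[OF g f]])
 fix n a assume a: "a : P n"
 have sw: "L2 j i g f (tens_swap K (piece A i) (piece A j) u) = L2 i j f g u" if u: "u : carrier (T2 i j)" for i j u
 proof (rule tensor_hom_eqI[OF pm pm BB_module lin_comp[OF tens_swap_hom[OF pm pm] L2_hom[OF g f]] L2_hom[OF f g] _ u])
  fix x y assume xy: "x : P i" "y : P j"
  show "L2 j i g f (tens_swap K (piece A i) (piece A j) (ptens K (piece A i) (piece A j) x y)) =
  L2 i j f g (ptens K (piece A i) (piece A j) x y)"
  unfolding tens_swap_ptens[OF pm pm xy] L2_ptens[OF f g xy] L2_ptens[OF g f xy(2,1)]
  using BB.m_comm convsD(2)[OF f xy(1)] convsD(2)[OF g xy(2)] by simp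
 qed
 show "cv f g n a = cv g f n a"
  unfolding cv_apply[OF a]
 proof (rule BB.finsum_bij[where h = prod.swap])
  show "bij_betw prod.swap (S2 n) (S2 n)"
  by (rule bij_betw_byWitness[where f' = prod.swap]) (auto simp: S2_def)
  fix p assume p: "p : S2 n"
  have a': "a : P (fst p + snd p)" using a p by (auto simp: S2_def)
  show "L2 (fst p) (snd p) f g (gcomult A (fst p) (snd p) a) =
  L2 (fst (prod.swap p)) (snd (prod.swap p)) g f (gcomult A (fst (prod.swap p)) (snd (prod.swap p)) a)"
  using sw[OF lin_closed[OF gcomult_hom a']] gcomult_cocomm[OF a'] by simp
 qed (rule cv_term_closed[OF g f _ a])
qed

lemma L2_zero:
 assumes f: "f : convs" and g: "g : convs" and z: "!!x. x : P i ==> f i x = \<zero>\<^bsub>B\<^esub>" and u: "u : carrier (T2 i j)"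
 shows "L2 i j f g u = \<zero>\<^bsub>B\<^esub>"
 by (rule tensor_hom_eqI[OF pm pm BB_module L2_hom[OF f g] lin_const_zero[OF BB_module] _ u])
  (use BB.l_null[OF convsD(2)[OF g, unfolded B_simps(1)[symmetric]]] in \<open>simp add: L2_ptens[OF f g] z\<close>)

lemma cv_unit:
 assumes f: "f : convs" shows "cv ce f = f"
proof (rule convs_eqI[OF cv_closed[OF ce_closed f] f])
 fix n a assume a: "a : P n"
 let ?t = "%p. L2 (fst p) (snd p) ce f (gcomult A (fst p) (snd p) a)"
 have z: "(0, n) : S2 n" by (simp add: S2_def)
 have "(\<Oplus>\<^bsub>B\<^esub>p\<in>S2 n. ?t p) = (\<Oplus>\<^bsub>B\<^esub>p\<in>{(0, n)}. ?t p)"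
 \<comment> \<open>\<open>ce\<close> vanishes in positive degrees, so only the bidegree
   \<open>(0, n)\<close> remains, and there the counit axiom applies.\<close>
 proof (rule BB.finsum_neutral_right[OF finite_S2])
  fix p assume p: "p : S2 n - {(0, n)}"
  then have "fst p ~= 0" by (auto simp: S2_def)
  then show "?t p = \<zero>\<^bsub>B\<^esub>"
  using p a by (intro L2_zero[OF ce_closed f ce_apply(2)] lin_closed[OF gcomult_S2]) auto
 qed (use z cv_term_closed[OF ce_closed f _ a] in auto)
 also have "... = ?t (0, n)" using cv_term_closed[OF ce_closed f z a] by (simp del: B_simps)
 also have "... = f n a"
 proof -
  let ?l = "tens_lift K (piece A 0) (piece A n) (piece A n) (%a b. gcounit A a \<odot>\<^bsub>piece A n\<^esub> b)"
  interpret M: module K "piece A n" by (rule pm)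
  have bl: "bilinear_map K (piece A 0) (piece A n) (piece A n) (%a b. gcounit A a \<odot>\<^bsub>piece A n\<^esub> b)"
  by (rule bilinear_mapI)
  (auto simp: gcounit M.smult_l_distr M.smult_r_distr M.smult_assoc1[symmetric] m_comm)
  have key: "L2 0 n ce f u = f n (?l u)" if u: "u : carrier (T2 0 n)" for u
  proof (rule tensor_hom_eqI[OF pm pm BB_module L2_hom[OF ce_closed f] lin_comp[OF tens_lift_hom[OF pm pm pm bl] convsD(1)[OF f]] _ u])
  fix x y assume xy: "x : P 0" "y : P n"
  have fy: "f n y : carrier B" using convsD(2)[OF f xy(2)] by simp
  show "L2 0 n ce f (ptens K (piece A 0) (piece A n) x y) = f n (?l (ptens K (piece A 0) (piece A n) x y))"
  unfolding L2_ptens[OF ce_closed f xy] tens_lift_ptens[OF pm pm pm bl xy] ce_apply(1)[OF xy(1)]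
  BB.smult_assoc2[OF gcounit(1)[OF xy(1)] BB.one_closed fy] lin_smult[OF convsD(1)[OF f] gcounit(1)[OF xy(1)] xy(2)]
  using BB.l_one[OF fy] by simp
  qed
  have "gcomult A 0 n a : carrier (T2 0 n)" using lin_closed[OF gcomult_hom, of a 0 n] a by simp
  then show ?thesis using key gcomult_counit[OF a] by simp
 qed
 finally show "cv ce f n a = f n a" unfolding cv_apply[OF a] .
qed

definition L3 where
 "L3 i j l f g h = tens_lift K (T2 i j) (piece A l) B (%v z. L2 i j f g v \<otimes>\<^bsub>B\<^esub> h l z)"

definition L3' where
 "L3' i j l f g h = tens_lift K (piece A i) (T2 j l) B (%x v. f i x \<otimes>\<^bsub>B\<^esub> L2 j l g h v)"

text \<open>Both sides are sums over all tridegrees of total degree \<open>n\<close>.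
  \<open>L3\<close> and \<open>L3'\<close> are the two bracketings of the triple product: they match
  along the associator by associativity of \<open>B\<close>, and coassociativity identifies the
  tensors to which they are applied.\<close>

lemma cv_assoc:
 assumes f: "f : convs" and g: "g : convs" and h: "h : convs"
 shows "cv (cv f g) h = cv f (cv g h)"
proof (rule convs_eqI[OF cv_closed[OF cv_closed[OF f g] h] cv_closed[OF f cv_closed[OF g h]]])
 fix n a assume a: "a : P n"
 note fg = cv_closed[OF f g] and gh = cv_closed[OF g h]
 have b3: "bilinear_map K (T2 i j) (piece A l) B (%v z. L2 i j f g v \<otimes>\<^bsub>B\<^esub> h l z)" for i j l
  using bilinear_map_comp[OF B_bilinear L2_hom[OF f g] convsD(1)[OF h] lin_id] .
 have b3': "bilinear_map K (piece A i) (T2 j l) B (%x v. f i x \<otimes>\<^bsub>B\<^esub> L2 j l g h v)" for i j l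
  using bilinear_map_comp[OF B_bilinear convsD(1)[OF f] L2_hom[OF g h] lin_id] .
 have L3: "L3 i j l f g h : mod_hom K (tensor K (T2 i j) (piece A l)) B" for i j l
  unfolding L3_def by (rule tens_lift_hom[OF T2_module pm BB_module b3])
 have L3p: "L3 i j l f g h (ptens K (T2 i j) (piece A l) v z) = L2 i j f g v \<otimes>\<^bsub>B\<^esub> h l z"
  if "v : carrier (T2 i j)" "z : P l" for i j l v z
  unfolding L3_def by (rule tens_lift_ptens[OF T2_module pm BB_module b3 that])
 have L3': "L3' i j l f g h : mod_hom K (tensor K (piece A i) (T2 j l)) B" for i j l
  unfolding L3'_def by (rule tens_lift_hom[OF pm T2_module BB_module b3'])
 have L3p': "L3' i j l f g h (ptens K (piece A i) (T2 j l) x v) = f i x \<otimes>\<^bsub>B\<^esub> L2 j l g h v"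
  if "x : P i" "v : carrier (T2 j l)" for i j l x v
  unfolding L3'_def by (rule tens_lift_ptens[OF pm T2_module BB_module b3' that])
 have as: "L3' i j l f g h (tens_assoc K (piece A i) (piece A j) (piece A l) w) = L3 i j l f g h w"
  if w: "w : carrier (tensor K (T2 i j) (piece A l))" for i j l w
 proof (rule tensor_hom_eqI[OF T2_module pm BB_module lin_comp[OF tens_assoc_hom[OF pm pm pm] L3'] L3 _ w])
  fix v z assume v: "v : carrier (T2 i j)" and z: "z : P l"
  show "L3' i j l f g h (tens_assoc K (piece A i) (piece A j) (piece A l) (ptens K (T2 i j) (piece A l) v z)) =
  L3 i j l f g h (ptens K (T2 i j) (piece A l) v z)"
  proof (rule tensor_hom_eqI[OF pm pm BB_module
  lin_comp[OF lin_comp[OF bilinear_map_left[OF ptens_bilinear[OF T2_module pm] z] tens_assoc_hom[OF pm pm pm]] L3']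
  lin_comp[OF bilinear_map_left[OF ptens_bilinear[OF T2_module pm] z] L3] _ v])
  fix x y assume xy: "x : P i" "y : P j"
  note yz = ptens_closed[OF pm pm xy(2) z] and xyc = ptens_closed[OF pm pm xy]
  show "L3' i j l f g h (tens_assoc K (piece A i) (piece A j) (piece A l)
  (ptens K (T2 i j) (piece A l) (ptens K (piece A i) (piece A j) x y) z)) =
  L3 i j l f g h (ptens K (T2 i j) (piece A l) (ptens K (piece A i) (piece A j) x y) z)"
  unfolding tens_assoc_ptens[OF pm pm pm xy z] L3p'[OF xy(1) yz] L3p[OF xyc z] L2_ptens[OF g h xy(2) z] L2_ptens[OF f g xy]
  using BB.m_assoc convsD(2)[OF f xy(1)] convsD(2)[OF g xy(2)] convsD(2)[OF h z] by simp
  qed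
 qed
 let ?L = "%i j l. L3 i j l f g h (tens_map K (piece A (i + j)) (piece A l) (T2 i j) (piece A l) (gcomult A i j) id (gcomult A (i + j) l a))"
 let ?R = "%i j l. L3' i j l f g h (tens_map K (piece A i) (piece A (j + l)) (piece A i) (T2 j l) id (gcomult A j l) (gcomult A i (j + l) a))"
 have tl: "tens_map K (piece A m) (piece A l) (T2 i j) (piece A l) (gcomult A i j) id : mod_hom K (T2 m l) (tensor K (T2 i j) (piece A l))"
  "!!x z. x : P m ==> z : P l ==> tens_map K (piece A m) (piece A l) (T2 i j) (piece A l) (gcomult A i j) id (ptens K (piece A m) (piece A l) x z) =
  ptens K (T2 i j) (piece A l) (gcomult A i j x) z" if "i + j = m" for i j l m
  using tens_map_hom[OF pm pm T2_module pm gcomult_hom lin_id', of i j l] tens_map_ptens[OF pm pm T2_module pm gcomult_hom lin_id', of _ i j _ l] that by auto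
 have tr: "tens_map K (piece A i) (piece A m) (piece A i) (T2 j l) id (gcomult A j l) : mod_hom K (T2 i m) (tensor K (piece A i) (T2 j l))"
  "!!x z. x : P i ==> z : P m ==> tens_map K (piece A i) (piece A m) (piece A i) (T2 j l) id (gcomult A j l) (ptens K (piece A i) (piece A m) x z) =
  ptens K (piece A i) (T2 j l) x (gcomult A j l z)" if "j + l = m" for i j l m
  using tens_map_hom[OF pm pm pm T2_module lin_id' gcomult_hom, of i j l] tens_map_ptens[OF pm pm pm T2_module lin_id' gcomult_hom, of _ i _ j l] that by auto
 \<comment> \<open>The sum defining the inner convolution is moved out of the tensor product, by
   linearity in the first factor.\<close>
 have A1: "L2 m l (cv f g) h u = (\<Oplus>\<^bsub>B\<^esub>q\<in>S2 m. L3 (fst q) (snd q) l f g h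
  (tens_map K (piece A m) (piece A l) (T2 (fst q) (snd q)) (piece A l) (gcomult A (fst q) (snd q)) id u))"
  if u: "u : carrier (T2 m l)" for m l u
 proof (rule tensor_hom_eqI[OF pm pm BB_module L2_hom[OF fg h] lin_finsum_fun[OF BB_module] _ u])
  show "(%u. L3 (fst q) (snd q) l f g h (tens_map K (piece A m) (piece A l) (T2 (fst q) (snd q)) (piece A l) (gcomult A (fst q) (snd q)) id u))
  : mod_hom K (T2 m l) B" if "q : S2 m" for q
  by (rule lin_comp[OF tl(1) L3]) (use that in \<open>auto simp: S2_def\<close>)
  fix x z assume x: "x : P m" and z: "z : P l"
  have hz: "h l z : carrier B" using convsD(2)[OF h z] by simp
  show "L2 m l (cv f g) h (ptens K (piece A m) (piece A l) x z) = (\<Oplus>\<^bsub>B\<^esub>q\<in>S2 m. L3 (fst q) (snd q) l f g h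
  (tens_map K (piece A m) (piece A l) (T2 (fst q) (snd q)) (piece A l) (gcomult A (fst q) (snd q)) id (ptens K (piece A m) (piece A l) x z)))"
  unfolding L2_ptens[OF fg h x z] cv_apply[OF x]
  proof (subst BB.finsum_ldistr[OF finite_S2 hz], use cv_term_closed[OF f g _ x] in blast, rule BB.finsum_cong'[OF refl])
  fix q assume q: "q : S2 m"
  have gq: "gcomult A (fst q) (snd q) x : carrier (T2 (fst q) (snd q))" by (rule lin_closed[OF gcomult_S2[OF q] x])
  have qm: "fst q + snd q = m" using q by (auto simp: S2_def)
  show "L2 (fst q) (snd q) f g (gcomult A (fst q) (snd q) x) \<otimes>\<^bsub>B\<^esub> h l z =
  L3 (fst q) (snd q) l f g h (tens_map K (piece A m) (piece A l) (T2 (fst q) (snd q)) (piece A l)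
  (gcomult A (fst q) (snd q)) id (ptens K (piece A m) (piece A l) x z))"
  unfolding tl(2)[OF qm x z] L3p[OF gq z] ..
  next
  show "(%q. L3 (fst q) (snd q) l f g h (tens_map K (piece A m) (piece A l) (T2 (fst q) (snd q)) (piece A l)
  (gcomult A (fst q) (snd q)) id (ptens K (piece A m) (piece A l) x z))) : S2 m \<rightarrow> carrier B"
  using lin_closed[OF L3 lin_closed[OF tl(1) ptens_closed[OF pm pm x z]]] by (auto simp: S2_def)
  qed
 qed
 have A2: "L2 i m f (cv g h) u = (\<Oplus>\<^bsub>B\<^esub>q\<in>S2 m. L3' i (fst q) (snd q) f g h
  (tens_map K (piece A i) (piece A m) (piece A i) (T2 (fst q) (snd q)) id (gcomult A (fst q) (snd q)) u))"
  if u: "u : carrier (T2 i m)" for i m u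
 proof (rule tensor_hom_eqI[OF pm pm BB_module L2_hom[OF f gh] lin_finsum_fun[OF BB_module] _ u])
  show "(%u. L3' i (fst q) (snd q) f g h (tens_map K (piece A i) (piece A m) (piece A i) (T2 (fst q) (snd q)) id (gcomult A (fst q) (snd q)) u))
  : mod_hom K (T2 i m) B" if "q : S2 m" for q
  by (rule lin_comp[OF tr(1) L3']) (use that in \<open>auto simp: S2_def\<close>)
  fix x z assume x: "x : P i" and z: "z : P m"
  have fx: "f i x : carrier B" using convsD(2)[OF f x] by simp
  show "L2 i m f (cv g h) (ptens K (piece A i) (piece A m) x z) = (\<Oplus>\<^bsub>B\<^esub>q\<in>S2 m. L3' i (fst q) (snd q) f g h
  (tens_map K (piece A i) (piece A m) (piece A i) (T2 (fst q) (snd q)) id (gcomult A (fst q) (snd q)) (ptens K (piece A i) (piece A m) x z)))"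
  unfolding L2_ptens[OF f gh x z] cv_apply[OF z]
  proof (subst BB.finsum_rdistr[OF finite_S2 fx], use cv_term_closed[OF g h _ z] in blast, rule BB.finsum_cong'[OF refl])
  fix q assume q: "q : S2 m"
  have gq: "gcomult A (fst q) (snd q) z : carrier (T2 (fst q) (snd q))" by (rule lin_closed[OF gcomult_S2[OF q] z])
  have qm: "fst q + snd q = m" using q by (auto simp: S2_def)
  show "f i x \<otimes>\<^bsub>B\<^esub> L2 (fst q) (snd q) g h (gcomult A (fst q) (snd q) z) =
  L3' i (fst q) (snd q) f g h (tens_map K (piece A i) (piece A m) (piece A i) (T2 (fst q) (snd q))
  id (gcomult A (fst q) (snd q)) (ptens K (piece A i) (piece A m) x z))"
  unfolding tr(2)[OF qm x z] L3p'[OF x gq] ..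
  next
  show "(%q. L3' i (fst q) (snd q) f g h (tens_map K (piece A i) (piece A m) (piece A i) (T2 (fst q) (snd q))
  id (gcomult A (fst q) (snd q)) (ptens K (piece A i) (piece A m) x z))) : S2 m \<rightarrow> carrier B"
  using lin_closed[OF L3' lin_closed[OF tr(1) ptens_closed[OF pm pm x z]]] by (auto simp: S2_def)
  qed
 qed
 have LR: "?L i j l = ?R i j l" "?L i j l : carrier B" if "i + j + l = n" for i j l
 proof -
  have a': "a : P (i + j + l)" using a that by simp
  note g1 = lin_closed[OF gcomult_hom a']
  note t1 = lin_closed[OF tl(1)[OF refl] g1]
  show "?L i j l = ?R i j l" using as[OF t1] gcomult_coassoc[OF a'] by simp
  show "?L i j l : carrier B" by (rule lin_closed[OF L3 t1])
 qed
 have "cv (cv f g) h n a = (\<Oplus>\<^bsub>B\<^esub>p\<in>S2 n. \<Oplus>\<^bsub>B\<^esub>q\<in>S2 (fst p). ?L (fst q) (snd q) (snd p))"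
  unfolding cv_apply[OF a]
 proof (rule BB.finsum_cong'[OF refl])
  fix p assume p: "p : S2 n"
  show "L2 (fst p) (snd p) (cv f g) h (gcomult A (fst p) (snd p) a) = (\<Oplus>\<^bsub>B\<^esub>q\<in>S2 (fst p). ?L (fst q) (snd q) (snd p))"
  unfolding A1[OF lin_closed[OF gcomult_S2[OF p] a]]
  by (rule BB.finsum_cong'[OF refl]) (use p LR(2) in \<open>auto simp: S2_def\<close>)
 qed (use LR(2) in \<open>auto simp: S2_def simp del: B_simps intro!: BB.finsum_closed\<close>)
 also have "... = finsum B (%(p, q). ?L (fst q) (snd q) (snd p)) (SIGMA p:S2 n. S2 (fst p))"
  by (rule BB.finsum_Sigma[OF finite_S2 finite_S2]) (use LR(2) in \<open>auto simp: S2_def\<close>)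
 \<comment> \<open>A tridegree \<open>(i, j, l)\<close> is written as \<open>(i + j, l)\<close> with
   \<open>(i, j)\<close> on one side and as \<open>(i, j + l)\<close> with \<open>(j, l)\<close> on
   the other; coassociativity is applied term by term.\<close>
 also have "... = finsum B (%(p, q). ?R (fst p) (fst q) (snd q)) (SIGMA p:S2 n. S2 (snd p))"
 proof (rule BB.finsum_bij[where h = "%(p, q). ((fst q, snd q + snd p), (snd q, snd p))"])
  show "bij_betw (%(p, q). ((fst q, snd q + snd p), (snd q, snd p))) (SIGMA p:S2 n. S2 (fst p)) (SIGMA p:S2 n. S2 (snd p))"
  by (rule bij_betw_byWitness[where f' = "%(p, q). ((fst p + fst q, snd q), (fst p, fst q))"]) (auto simp: S2_def)
 qed (use LR in \<open>auto simp: S2_def add.assoc\<close>)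
 also have "... = (\<Oplus>\<^bsub>B\<^esub>p\<in>S2 n. \<Oplus>\<^bsub>B\<^esub>q\<in>S2 (snd p). ?R (fst p) (fst q) (snd q))"
  by (rule BB.finsum_Sigma[OF finite_S2 finite_S2, symmetric]) (use LR in \<open>auto simp: S2_def add.assoc\<close>)
 also have "... = cv f (cv g h) n a"
  unfolding cv_apply[OF a]
 proof (rule BB.finsum_cong'[OF refl])
  fix p assume p: "p : S2 n"
  show "(\<Oplus>\<^bsub>B\<^esub>q\<in>S2 (snd p). ?R (fst p) (fst q) (snd q)) = L2 (fst p) (snd p) f (cv g h) (gcomult A (fst p) (snd p) a)"
  unfolding A2[OF lin_closed[OF gcomult_S2[OF p] a]]
  proof (rule BB.finsum_cong'[OF refl])
  fix q assume q: "q : S2 (snd p)"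
  have e: "fst q + snd q = snd p" using q by (auto simp: S2_def)
  show "?R (fst p) (fst q) (snd q) = L3' (fst p) (fst q) (snd q) f g h (tens_map K (piece A (fst p)) (piece A (snd p)) (piece A (fst p))
  (T2 (fst q) (snd q)) id (gcomult A (fst q) (snd q)) (gcomult A (fst p) (snd p) a))"
  unfolding e ..
  qed (use lin_closed[OF L3' lin_closed[OF tr(1) lin_closed[OF gcomult_S2[OF p] a]]] in \<open>auto simp: S2_def\<close>)
 qed (use cv_term_closed[OF f gh _ a] in auto)
 finally show "cv (cv f g) h n a = cv f (cv g h) n a" .
qed

lemma CV_comm_monoid: "comm_monoid CV"
 by (rule comm_monoidI) (simp_all add: cv_closed ce_closed cv_assoc cv_unit, rule cv_comm)

sublocale CV: comm_monoid CV by (rule CV_comm_monoid)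

section \<open>Algebra maps under convolution, and the universal property of the coproduct\<close>

definition AH :: "(nat => 'v => 'v) set" where
 "AH = {f : convs. (ALL k:carrier K. f 0 (gunit A k) = k \<odot>\<^bsub>B\<^esub> \<one>\<^bsub>B\<^esub>) &
  (ALL i j. ALL x:P i. ALL y:P j. f (i + j) (gmult A i j x y) = f i x \<otimes>\<^bsub>B\<^esub> f j y)}"

lemma AHD: "f : AH ==> f : convs" "f : AH ==> k : carrier K ==> f 0 (gunit A k) = k \<odot>\<^bsub>B\<^esub> \<one>\<^bsub>B\<^esub>"
 "f : AH ==> x : P i ==> y : P j ==> f (i + j) (gmult A i j x y) = f i x \<otimes>\<^bsub>B\<^esub> f j y"
 by (auto simp: AH_def)

lemma gunit_scale: "k : carrier K ==> gunit A k = k \<odot>\<^bsub>piece A 0\<^esub> gunit A \<one>\<^bsub>K\<^esub>"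
 using lin_smult[OF mod_isoD(1)[OF connected], of k "\<one>\<^bsub>K\<^esub>"] by (simp add: self_mod_def)

lemma gcounit_gunit: "k : carrier K ==> gcounit A (gunit A k) = k"
 using gcounit(3)[of k "gunit A \<one>\<^bsub>K\<^esub>"] gunit_closed[of "\<one>\<^bsub>K\<^esub>"] gcounit_one gunit_scale[of k] by simp

lemma P0_gunit: "a : P 0 ==> gunit A (gcounit A a) = a"
proof -
 assume "a : P 0"
 then obtain k where "k : carrier K" "a = gunit A k"
  using mod_isoD(4)[OF connected] by (auto simp: self_mod_def)
 then show ?thesis using gcounit_gunit by simp
qed

text \<open>By connectedness, degree 0 consists of multiples of the unit, on which an algebra map
  has no choice.\<close>

lemma AH_degree0: "f : AH ==> a : P 0 ==> f 0 a = gcounit A a \<odot>\<^bsub>B\<^esub> \<one>\<^bsub>B\<^esub>"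
 using AHD(2)[of f "gcounit A a"] P0_gunit[of a] gcounit(1)[of a] by simp

lemma AH_one: "f : AH ==> f 0 (gunit A \<one>\<^bsub>K\<^esub>) = \<one>\<^bsub>B\<^esub>"
 using AHD(2)[of f "\<one>\<^bsub>K\<^esub>"] BB.smult_one[OF BB.one_closed] by simp

lemma ce_AH: "ce : AH"
proof -
 have "ce (i + j) (gmult A i j x y) = ce i x \<otimes>\<^bsub>B\<^esub> ce j y" if x: "x : P i" and y: "y : P j" for i j x y
 proof (cases "i = 0 & j = 0")
  case True
  then have x0: "x : P 0" and y0: "y : P 0" using x y by auto
  have "ce 0 (gmult A 0 0 x y) = (gcounit A x \<otimes>\<^bsub>K\<^esub> gcounit A y) \<odot>\<^bsub>B\<^esub> \<one>\<^bsub>B\<^esub>"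
  using ce_apply(1)[of "gmult A 0 0 x y"] gmult_closed[OF x0 y0] gcounit_gmult[OF x0 y0] by simp
  also have "... = gcounit A x \<odot>\<^bsub>B\<^esub> (\<one>\<^bsub>B\<^esub> \<otimes>\<^bsub>B\<^esub> (gcounit A y \<odot>\<^bsub>B\<^esub> \<one>\<^bsub>B\<^esub>))"
  using BB.smult_assoc1[OF gcounit(1)[OF x0] gcounit(1)[OF y0] BB.one_closed]
  BB.l_one[OF BB.smult_closed[OF gcounit(1)[OF y0] BB.one_closed]] by simp
  also have "... = ce 0 x \<otimes>\<^bsub>B\<^esub> ce 0 y"
  using BB.smult_assoc2[OF gcounit(1)[OF x0] BB.one_closed BB.smult_closed[OF gcounit(1)[OF y0] BB.one_closed]]
  by (simp add: ce_apply x0 y0)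
  finally show ?thesis using True by simp
 next
  case False
  have c: "ce i x : carrier B" "ce j y : carrier B" using convsD(2)[OF ce_closed] x y by auto
  have "ce i x = \<zero>\<^bsub>B\<^esub> | ce j y = \<zero>\<^bsub>B\<^esub>" using False ce_apply(2) x y by auto
  then have "ce i x \<otimes>\<^bsub>B\<^esub> ce j y = \<zero>\<^bsub>B\<^esub>" using BB.l_null[OF c(2)] BB.r_null[OF c(1)] by auto
  then show ?thesis using False ce_apply(2)[OF _ gmult_closed[OF x y]] by simp
 qed
 then show ?thesis using ce_closed ce_apply(1)[OF gunit_closed] gcounit_gunit by (simp add: AH_def)
qed

text \<open>The convolution of two algebra maps is the comultiplication, which is an algebra map,
  followed by a map out of the tensor square that is multiplicative because \<open>B\<close> is
  commutative.\<close>

lemma cv_AH: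
 assumes f: "f : AH" and g: "g : AH" shows "cv f g : AH"
proof -
 note fc = AHD(1)[OF f] and gc = AHD(1)[OF g]
 have unit: "cv f g 0 (gunit A k) = k \<odot>\<^bsub>B\<^esub> \<one>\<^bsub>B\<^esub>" if k: "k : carrier K" for k
 proof -
  have S: "S2 0 = {(0, 0)}" by (auto simp: S2_def)
  note u1 = gunit_closed[OF one_closed]
  have d1: "gcomult A 0 0 (gunit A \<one>\<^bsub>K\<^esub>) : carrier (T2 0 0)" using lin_closed[OF gcomult_hom[of 0 0]] u1 by simp
  have "cv f g 0 (gunit A \<one>\<^bsub>K\<^esub>) = L2 0 0 f g (gcomult A 0 0 (gunit A \<one>\<^bsub>K\<^esub>))"
  unfolding cv_apply[OF u1] S using lin_closed[OF L2_hom[OF fc gc] d1] by (simp del: B_simps)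
  also have "... = \<one>\<^bsub>B\<^esub>" unfolding gcomult_one L2_ptens[OF fc gc u1 u1] AH_one[OF f] AH_one[OF g]
  by (rule BB.l_one[OF BB.one_closed])
  finally show ?thesis
  using lin_smult[OF convsD(1)[OF cv_closed[OF fc gc]] k u1] gunit_scale[OF k] by simp
 qed
 have mult: "cv f g (i + j) (gmult A i j x y) = cv f g i x \<otimes>\<^bsub>B\<^esub> cv f g j y" if x: "x : P i" and y: "y : P j" for i j x y
 proof -
  let ?Q = "%p. {(a, b, c, d). a + b = i & c + d = j & a + c = fst p & b + d = snd p}"
  let ?t = "%(a, b, c, d). tens_gmult K A a b c d (gcomult A a b x) (gcomult A c d y)"
  let ?l = "%p. L2 (fst p) (snd p) f g (gcomult A (fst p) (snd p) x)"
  let ?r = "%p. L2 (fst p) (snd p) f g (gcomult A (fst p) (snd p) y)"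
  let ?u = "%(a, b, c, d). L2 a b f g (gcomult A a b x) \<otimes>\<^bsub>B\<^esub> L2 c d f g (gcomult A c d y)"
  have gx: "gcomult A a b x : carrier (T2 a b)" if "a + b = i" for a b
  using lin_closed[OF gcomult_hom[of a b]] x that by simp
  have gy: "gcomult A a b y : carrier (T2 a b)" if "a + b = j" for a b
  using lin_closed[OF gcomult_hom[of a b]] y that by simp
  note tb = tens_gmult_bilinear[OF pm gmult_bilinear]
  \<comment> \<open>Multiplicativity of the map out of the tensor square; commutativity of
    \<open>B\<close> exchanges the two middle factors.\<close>
  have key: "L2 (a + c) (b + d) f g (tens_gmult K A a b c d u v) = L2 a b f g u \<otimes>\<^bsub>B\<^esub> L2 c d f g v"
  if u: "u : carrier (T2 a b)" and v: "v : carrier (T2 c d)" for a b c d u v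
  proof (rule bilinear_eqI_tensor[OF pm pm pm pm BB_module bilinear_map_comp[OF tb lin_id lin_id L2_hom[OF fc gc]]
  bilinear_map_comp[OF B_bilinear L2_hom[OF fc gc] L2_hom[OF fc gc] lin_id] _ u v])
  fix x1 x2 y1 y2 assume xy: "x1 : P a" "x2 : P b" "y1 : P c" "y2 : P d"
  have cl: "f a x1 : carrier B" "g b x2 : carrier B" "f c y1 : carrier B" "g d y2 : carrier B"
  using convsD(2)[OF fc] convsD(2)[OF gc] xy by auto
  have "(f a x1 \<otimes>\<^bsub>B\<^esub> f c y1) \<otimes>\<^bsub>B\<^esub> (g b x2 \<otimes>\<^bsub>B\<^esub> g d y2) = (f a x1 \<otimes>\<^bsub>B\<^esub> g b x2) \<otimes>\<^bsub>B\<^esub> (f c y1 \<otimes>\<^bsub>B\<^esub> g d y2)"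
  using cl by (metis BB.m_assoc BB.m_lcomm BB.m_closed)
  then show "L2 (a + c) (b + d) f g (tens_gmult K A a b c d (ptens K (piece A a) (piece A b) x1 x2) (ptens K (piece A c) (piece A d) y1 y2)) =
  L2 a b f g (ptens K (piece A a) (piece A b) x1 x2) \<otimes>\<^bsub>B\<^esub> L2 c d f g (ptens K (piece A c) (piece A d) y1 y2)"
  unfolding tens_gmult_ptens[OF pm gmult_bilinear xy] L2_ptens[OF fc gc xy(1,2)] L2_ptens[OF fc gc xy(3,4)]
  L2_ptens[OF fc gc gmult_closed[OF xy(1,3)] gmult_closed[OF xy(2,4)]] AHD(3)[OF f xy(1,3)] AHD(3)[OF g xy(2,4)] .
  qed
  have tc: "?t q : carrier (T2 (fst p) (snd p))" "L2 (fst p) (snd p) f g (?t q) = ?u q" "?u q : carrier B"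
  if qp: "q : ?Q p" for q p
  proof -
  obtain a b c d where q: "q = (a, b, c, d)" "a + b = i" "c + d = j" "a + c = fst p" "b + d = snd p"
  using qp by (cases q) auto
  show "?t q : carrier (T2 (fst p) (snd p))"
  using bilinear_map_closed[OF tb gx[OF q(2)] gy[OF q(3)]] q by simp
  show "L2 (fst p) (snd p) f g (?t q) = ?u q" using key[OF gx[OF q(2)] gy[OF q(3)]] q by simp
  show "?u q : carrier B"
  using BB.m_closed[OF lin_closed[OF L2_hom[OF fc gc] gx[OF q(2)]] lin_closed[OF L2_hom[OF fc gc] gy[OF q(3)]]] q by simp
  qed
  have finQ: "finite (?Q p)" for p
  by (rule finite_subset[of _ "{..i} \<times> {..i} \<times> {..j} \<times> {..j}"]) auto
  have lc: "?l p : carrier B" if "p : S2 i" for p by (rule cv_term_closed[OF fc gc that x])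
  have rc: "?r p : carrier B" if "p : S2 j" for p by (rule cv_term_closed[OF fc gc that y])
  have "cv f g (i + j) (gmult A i j x y) = (\<Oplus>\<^bsub>B\<^esub>p\<in>S2 (i + j). \<Oplus>\<^bsub>B\<^esub>q\<in>?Q p. ?u q)"
  unfolding cv_apply[OF gmult_closed[OF x y]]
  proof (rule BB.finsum_cong'[OF refl])
  fix p assume "p : S2 (i + j)"
  then have p: "fst p + snd p = i + j" by (auto simp: S2_def)
  have "L2 (fst p) (snd p) f g (gcomult A (fst p) (snd p) (gmult A i j x y)) =
  L2 (fst p) (snd p) f g (\<Oplus>\<^bsub>T2 (fst p) (snd p)\<^esub>q\<in>?Q p. ?t q)"
  using gcomult_gmult[OF x y p] by simp
  also have "... = (\<Oplus>\<^bsub>B\<^esub>q\<in>?Q p. L2 (fst p) (snd p) f g (?t q))"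
  by (rule lin_finsum[OF T2_module BB_module L2_hom[OF fc gc]]) (use tc(1) in blast)
  also have "... = (\<Oplus>\<^bsub>B\<^esub>q\<in>?Q p. ?u q)"
  by (rule BB.finsum_cong'[OF refl]) (use tc(2,3) in blast)+
  finally show "L2 (fst p) (snd p) f g (gcomult A (fst p) (snd p) (gmult A i j x y)) = (\<Oplus>\<^bsub>B\<^esub>q\<in>?Q p. ?u q)" .
  next
  show "(%p. \<Oplus>\<^bsub>B\<^esub>q\<in>?Q p. ?u q) : S2 (i + j) \<rightarrow> carrier B"
  by (intro Pi_I BB.finsum_closed) (rule tc(3))
  qed
  also have "... = finsum B (%(p, q). ?u q) (SIGMA p:S2 (i + j). ?Q p)"
  by (rule BB.finsum_Sigma[OF finite_S2 finQ]) (rule tc(3))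
  \<comment> \<open>The quadruples of degrees are resorted, from the bidegree of the product to the
    bidegrees of its two factors.\<close>
  also have "... = finsum B (%(p, q). ?l p \<otimes>\<^bsub>B\<^esub> ?r q) (SIGMA p:S2 i. S2 j)"
  proof (rule BB.finsum_bij[where h = "%(p, a, b, c, d). ((a, b), (c, d))"])
  show "bij_betw (%(p, a, b, c, d). ((a, b), c, d)) (SIGMA p:S2 (i + j). ?Q p) (S2 i \<times> S2 j)"
  by (rule bij_betw_byWitness[where f' = "%((a, b), (c, d)). ((a + c, b + d), (a, b, c, d))"]) (auto simp: S2_def)
  qed (use lc rc BB.m_closed in auto)
  also have "... = (\<Oplus>\<^bsub>B\<^esub>p\<in>S2 i. \<Oplus>\<^bsub>B\<^esub>q\<in>S2 j. ?l p \<otimes>\<^bsub>B\<^esub> ?r q)"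
  by (rule BB.finsum_Sigma[OF finite_S2 finite_S2, symmetric]) (use lc rc BB.m_closed in blast)
  also have "... = (\<Oplus>\<^bsub>B\<^esub>p\<in>S2 i. ?l p \<otimes>\<^bsub>B\<^esub> (\<Oplus>\<^bsub>B\<^esub>q\<in>S2 j. ?r q))"
  by (rule BB.finsum_cong'[OF refl]) (use lc rc in \<open>auto intro!: BB.m_closed BB.finsum_closed BB.finsum_rdistr[symmetric] finite_S2 simp del: B_simps\<close>)
  also have "... = (\<Oplus>\<^bsub>B\<^esub>p\<in>S2 i. ?l p) \<otimes>\<^bsub>B\<^esub> (\<Oplus>\<^bsub>B\<^esub>q\<in>S2 j. ?r q)"
  by (rule BB.finsum_ldistr[symmetric]) (use lc rc in \<open>auto intro!: BB.finsum_closed finite_S2 simp del: B_simps\<close>)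
  finally show ?thesis unfolding cv_apply[OF x] cv_apply[OF y] .
 qed
 show ?thesis using cv_closed[OF fc gc] unit mult by (simp add: AH_def)
qed

lemma finprod_AH:
 assumes "finite S" "!!s. s : S ==> F s : AH"
 shows "finprod CV F S : AH"
 using assms
proof (induct S)
 case empty then show ?case using ce_AH by simp
next
 case (insert x S)
 then have "F : S \<rightarrow> convs" "F x : convs" using AHD(1) by auto
 then show ?case using insert cv_AH by simp
qed

definition AE :: "('v => 'v) set" where
 "AE = {ph : mod_hom K B B. (ALL u:BC. ALL v:BC. ph (u \<otimes>\<^bsub>B\<^esub> v) = ph u \<otimes>\<^bsub>B\<^esub> ph v) & ph \<one>\<^bsub>B\<^esub> = \<one>\<^bsub>B\<^esub>}"

lemma AED: "ph : AE ==> ph : mod_hom K B B" "ph : AE ==> u : BC ==> v : BC ==> ph (u \<otimes>\<^bsub>B\<^esub> v) = ph u \<otimes>\<^bsub>B\<^esub> ph v"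
 "ph : AE ==> ph \<one>\<^bsub>B\<^esub> = \<one>\<^bsub>B\<^esub>" "ph : AE ==> u : BC ==> ph u : BC"
proof -
 show "ph : AE ==> u : BC ==> ph u : BC" using lin_closed[of ph K B B u] by (simp add: AE_def)
qed (auto simp: AE_def)

lemma AE_comp: "ph : AE ==> psi : AE ==> (%u. ph (psi u)) : AE"
proof -
 assume p: "ph : AE" and q: "psi : AE"
 show ?thesis
  unfolding AE_def using lin_comp[OF AED(1)[OF q] AED(1)[OF p]]
  by (simp add: AED(2-4)[OF p] AED(2-4)[OF q] del: B_simps)
qed

lemma AE_finprod:
 assumes "ph : AE" "f : S \<rightarrow> BC"
 shows "ph (finprod B f S) = finprod B (%s. ph (f s)) S"
 using assms(2)
proof (induct S rule: infinite_finite_induct)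
 case (insert x S)
 then have f: "f : S \<rightarrow> carrier B" "f x : carrier B" by auto
 then have "(%s. ph (f s)) : S \<rightarrow> carrier B" "ph (f x) : carrier B" using AED(4)[OF assms(1)] by auto
 then show ?case using insert f AED(2)[OF assms(1), of "f x" "finprod B f S"] BB.finprod_closed[OF f(1)]
  by (simp del: B_simps add: B_simps(1)[symmetric])
qed (use AED(3)[OF assms(1)] in \<open>simp_all del: B_simps\<close>)

definition pc :: "('v => 'v) => (nat => 'v => 'v) => nat => 'v => 'v" where
 "pc ph f = (%n. \<lambda>a\<in>P n. ph (f n a))"

lemma pc_closed: "ph : AE ==> f : convs ==> pc ph f : convs"
 unfolding pc_def by (rule convsI[OF lin_comp[OF convsD(1) AED(1)]])

lemma pc_ce: "ph : AE ==> pc ph ce = ce"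
proof (rule convs_eqI[OF pc_closed ce_closed])
 fix n a assume p: "ph : AE" and a: "a : P n"
 show "pc ph ce n a = ce n a"
 proof (cases "n = 0")
  case True
  then show ?thesis
  using a lin_smult[OF AED(1)[OF p] gcounit(1) BB.one_closed, of a] AED(3)[OF p] by (simp add: pc_def ce_apply del: B_simps)
 next
  case False
  then show ?thesis using a lin_zero[OF BB_module BB_module AED(1)[OF p]] by (simp add: pc_def ce_apply del: B_simps)
 qed
qed (auto intro: ce_closed)

text \<open>Convolution ends with the multiplication of \<open>B\<close>, with which an algebra
  endomorphism commutes.\<close>

lemma pc_cv:
 assumes p: "ph : AE" and f: "f : convs" and g: "g : convs"
 shows "pc ph (cv f g) = cv (pc ph f) (pc ph g)"
proof (rule convs_eqI[OF pc_closed[OF p cv_closed[OF f g]] cv_closed[OF pc_closed[OF p f] pc_closed[OF p g]]])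
 fix n a assume a: "a : P n"
 note pf = pc_closed[OF p f] and pg = pc_closed[OF p g]
 have key: "ph (L2 i j f g u) = L2 i j (pc ph f) (pc ph g) u" if u: "u : carrier (T2 i j)" for i j u
 proof (rule tensor_hom_eqI[OF pm pm BB_module lin_comp[OF L2_hom[OF f g] AED(1)[OF p]] L2_hom[OF pf pg] _ u])
  fix x y assume xy: "x : P i" "y : P j"
  show "ph (L2 i j f g (ptens K (piece A i) (piece A j) x y)) = L2 i j (pc ph f) (pc ph g) (ptens K (piece A i) (piece A j) x y)"
  unfolding L2_ptens[OF f g xy] L2_ptens[OF pf pg xy] AED(2)[OF p convsD(2)[OF f xy(1)] convsD(2)[OF g xy(2)]]
  using xy by (simp add: pc_def)
 qed
 have "ph (cv f g n a) = (\<Oplus>\<^bsub>B\<^esub>q\<in>S2 n. ph (L2 (fst q) (snd q) f g (gcomult A (fst q) (snd q) a)))"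
  unfolding cv_apply[OF a]
  by (rule lin_finsum[OF BB_module BB_module AED(1)[OF p]]) (use cv_term_closed[OF f g _ a] in blast)
 also have "... = cv (pc ph f) (pc ph g) n a"
  unfolding cv_apply[OF a]
  by (rule BB.finsum_cong'[OF refl])
  (use cv_term_closed[OF pf pg _ a] key[OF lin_closed[OF gcomult_S2 a]] in blast)+
 finally show "pc ph (cv f g) n a = cv (pc ph f) (pc ph g) n a" using a by (simp add: pc_def)
qed

lemma pc_finprod:
 assumes p: "ph : AE" and F: "F : S \<rightarrow> convs"
 shows "pc ph (finprod CV F S) = finprod CV (%s. pc ph (F s)) S"
 using F
proof (induct S rule: infinite_finite_induct)
 case (insert x S)
 then have f: "F : S \<rightarrow> carrier CV" "F x : carrier CV" by auto
 then have "(%s. pc ph (F s)) : S \<rightarrow> carrier CV" "pc ph (F x) : carrier CV" using pc_closed[OF p] by auto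
 then show ?case using insert f pc_cv[OF p, of "F x" "finprod CV F S"] CV.finprod_closed[OF f(1)] by simp
qed (simp_all add: pc_ce[OF p])

text \<open>The inclusion of the copy with index \<open>s\<close> into the coproduct.\<close>

definition iota :: "nat => nat => 'v => 'v" where
 "iota s = (%n. \<lambda>a\<in>P n. mon (xone(s := (n, a))))"

lemma iota_AH: "iota s : AH"
proof -
 have c: "iota s : convs" unfolding iota_def
  by (rule convsI[OF mlin_hom[OF mon_mlinB xone_Mon]])
 have m: "iota s (i + j) (gmult A i j x y) = iota s i x \<otimes>\<^bsub>B\<^esub> iota s j y" if x: "x : P i" and y: "y : P j" for i j x y
 proof -
  have "xm (xone(s := (i, x))) (xone(s := (j, y))) = xone(s := (i + j, gmult A i j x y))"
  using hm(5)[OF hm(2)] by (auto simp: xm_def xone_def hm_def)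
  then show ?thesis using mulB_mon[OF Mon_upd[OF xone_Mon x] Mon_upd[OF xone_Mon y]] x y gmult_closed[OF x y]
  by (simp add: iota_def)
 qed
 have o: "iota s 0 (gunit A \<one>\<^bsub>K\<^esub>) = \<one>\<^bsub>B\<^esub>"
 proof -
  have "xone(s := (0, gunit A \<one>\<^bsub>K\<^esub>)) = xone" by (auto simp: xone_def hone_def)
  then show ?thesis using gunit_closed[OF one_closed] by (simp add: iota_def)
 qed
 have "iota s 0 (gunit A k) = k \<odot>\<^bsub>B\<^esub> \<one>\<^bsub>B\<^esub>" if k: "k : carrier K" for k
  using lin_smult[OF convsD(1)[OF c] k gunit_closed[OF one_closed]] o gunit_scale[OF k] by simp
 then show ?thesis using c m by (simp add: AH_def)
qed

lemma iota_apply: "a : P n ==> iota s n a = mon (xone(s := (n, a)))"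
 by (simp add: iota_def)

lemmas iota_closed = convsD(2)[OF AHD(1)[OF iota_AH]]

lemma mon_closed: "x : Mon ==> mon x : BC"
 using mlinD(1)[OF mon_mlin] .

lemma mon_finprod:
 assumes x: "x : Mon" and S: "finite S" "{s. x s ~= hone} <= S"
 shows "mon x = finprod B (%s. iota s (fst (x s)) (snd (x s))) S"
proof -
 \<comment> \<open>Induction over the truncations of \<open>x\<close> to finite sets of coordinates,
   which are again monomials.\<close>
 have ind: "mon (%s. if s : S' then x s else hone) = finprod B (%s. iota s (fst (x s)) (snd (x s))) S'" if "finite S'" for S'
  using that
 proof (induct S')
  case empty then show ?case using BB.finprod_empty by (simp add: xone_def)
 next
  case (insert t S')
  have c: "(%s. iota s (fst (x s)) (snd (x s))) : S' \<rightarrow> carrier B" "iota t (fst (x t)) (snd (x t)) : carrier B"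
  using iota_closed[OF MonD(3)[OF x]] by auto
  let ?y = "%s. if s : S' then x s else hone"
  have y: "?y : Mon"
  using MonD(1)[OF x] hm(2) insert(1) by (auto simp: Mon_def elim: rev_finite_subset)
  have "xm (xone(t := x t)) ?y = (%s. if s : insert t S' then x s else hone)"
  using insert(2) hm(5)[OF MonD(1)[OF x]] hm(6)[OF MonD(1)[OF x]] hm(5)[OF hm(2)] by (auto simp: xm_def xone_def)
  moreover have "xone(t := x t) : Mon" using Mon_upd[OF xone_Mon MonD(3)[OF x], of t t] by simp
  ultimately have "mon (%s. if s : insert t S' then x s else hone) = mon (xone(t := x t)) \<otimes>\<^bsub>B\<^esub> mon ?y"
  using mulB_mon[OF _ y] by simp
  also have "... = iota t (fst (x t)) (snd (x t)) \<otimes>\<^bsub>B\<^esub> finprod B (%s. iota s (fst (x s)) (snd (x s))) S'"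
  using insert(3) iota_apply[OF MonD(3)[OF x], of t t] by simp
  also have "... = finprod B (%s. iota s (fst (x s)) (snd (x s))) (insert t S')"
  by (rule BB.finprod_insert[OF insert(1,2) c, symmetric])
  finally show ?case .
 qed
 have e: "(%s. if s : S then x s else hone) = x" using S(2) by (intro ext) (metis (mono_tags, lifting) mem_Collect_eq subsetD)
 show ?thesis using ind[OF S(1)] unfolding e .
qed

text \<open>The universal property of the coproduct: one algebra map out of \<open>A\<close> for
  each copy yields an algebra endomorphism. At a trivial coordinate an algebra map has value 1, so
  the product over the nontrivial coordinates is enough.\<close>

definition HF :: "(nat => nat => 'v => 'v) => 'v => 'v" where
 "HF F = lft B (%x. finprod B (%s. F s (fst (x s)) (snd (x s))) {s. x s ~= hone})"

context
 fixes F :: "nat => nat => 'v => 'v" assumes F: "!!s. F s : AH"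
begin

lemma F_closed: "a : P n ==> F s n a : carrier B"
 using convsD(2)[OF AHD(1)[OF F]] by simp

lemma F_mon_closed: "x : Mon ==> F s (fst (x s)) (snd (x s)) : carrier B"
 by (rule F_closed[OF MonD(3)])

lemma F_superset:
 assumes "x : Mon" "finite S" "{s. x s ~= hone} <= S"
 shows "finprod B (%s. F s (fst (x s)) (snd (x s))) {s. x s ~= hone} = finprod B (%s. F s (fst (x s)) (snd (x s))) S"
proof (rule BB.finprod_mono_neutral_cong_left[OF assms(2,3)])
 fix s assume "s : S - {s. x s ~= hone}"
 then have "x s = (0, gunit A \<one>\<^bsub>K\<^esub>)" by (simp add: hone_def)
 then show "F s (fst (x s)) (snd (x s)) = \<one>\<^bsub>B\<^esub>" using AH_one[OF F] by simp
qed (use F_mon_closed[OF assms(1)] in auto)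

lemma F_mlin: "mlin B (%x. finprod B (%s. F s (fst (x s)) (snd (x s))) {s. x s ~= hone})"
proof (rule mlinI_hom)
 fix x assume x: "x : Mon"
 then show "finprod B (%s. F s (fst (x s)) (snd (x s))) {s. x s ~= hone} : carrier B"
  using F_mon_closed[OF x] by (intro BB.finprod_closed) blast
 fix s n
 \<comment> \<open>The factors away from \<open>s\<close> form the constant \<open>?r\<close>. The
   index set is enlarged to contain \<open>s\<close>, because the new entry at \<open>s\<close> may
   or may not be the unit.\<close>
 let ?S = "{t. x t ~= hone} - {s}"
 let ?r = "finprod B (%t. F t (fst (x t)) (snd (x t))) ?S"
 have r: "?r : carrier B" using F_mon_closed[OF x] by (intro BB.finprod_closed) blast
 have e: "finprod B (%t. F t (fst ((x(s := (n, a))) t)) (snd ((x(s := (n, a))) t))) {t. (x(s := (n, a))) t ~= hone} = F s n a \<otimes>\<^bsub>B\<^esub> ?r"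
  if a: "a : P n" for a
 proof -
  let ?y = "x(s := (n, a))"
  have y: "?y : Mon" by (rule Mon_upd[OF x a])
  have f: "finite ?S" using MonD(2)[OF x] by simp
  have "finprod B (%t. F t (fst (?y t)) (snd (?y t))) {t. ?y t ~= hone} = finprod B (%t. F t (fst (?y t)) (snd (?y t))) (insert s ?S)"
  by (rule F_superset[OF y]) (use f in auto)
  also have "... = F s (fst (?y s)) (snd (?y s)) \<otimes>\<^bsub>B\<^esub> finprod B (%t. F t (fst (?y t)) (snd (?y t))) ?S"
  by (rule BB.finprod_insert[OF f]) (use F_mon_closed[OF y] in blast)+
  also have "finprod B (%t. F t (fst (?y t)) (snd (?y t))) ?S = ?r"
  by (rule BB.finprod_cong'[OF refl]) (use F_mon_closed[OF x] in auto)
  finally show ?thesis by simp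
 qed
 show "(%a. finprod B (%t. F t (fst ((x(s := (n, a))) t)) (snd ((x(s := (n, a))) t))) {t. (x(s := (n, a))) t ~= hone}) : mod_hom K (piece A n) B"
  by (rule lin_cong[OF pm lin_comp[OF convsD(1)[OF AHD(1)[OF F]] bilinear_map_left[OF B_bilinear r]] e])
qed

lemma HF_hom: "HF F : mod_hom K B B"
 unfolding HF_def by (rule lftB[OF BB_module F_mlin])

lemma HF_mon: "x : Mon ==> finite S ==> {s. x s ~= hone} <= S ==> HF F (mon x) = finprod B (%s. F s (fst (x s)) (snd (x s))) S"
 unfolding HF_def lft_mon[OF BB_module F_mlin] by (rule F_superset)

lemma HF_iota: "a : P n ==> HF F (iota s n a) = F s n a"
proof -
 assume a: "a : P n"
 have "HF F (iota s n a) = finprod B (%t. F t (fst ((xone(s := (n, a))) t)) (snd ((xone(s := (n, a))) t))) {s}"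
  unfolding iota_apply[OF a] by (rule HF_mon[OF Mon_upd[OF xone_Mon a]]) (auto simp: xone_def)
 also have "... = F s n a" using BB.finprod_insert[of "{}" s] F_closed[OF a] BB.r_one by (simp del: B_simps)
 finally show ?thesis .
qed

lemma HF_AE: "HF F : AE"
proof -
 note h = HF_hom
 have m: "HF F (mon x \<otimes>\<^bsub>B\<^esub> mon y) = HF F (mon x) \<otimes>\<^bsub>B\<^esub> HF F (mon y)" if x: "x : Mon" and y: "y : Mon" for x y
 proof -
  let ?S = "{s. x s ~= hone} Un {s. y s ~= hone}"
  have S: "finite ?S" "{s. x s ~= hone} <= ?S" "{s. y s ~= hone} <= ?S" "{s. xm x y s ~= hone} <= ?S"
  using MonD(2)[OF x] MonD(2)[OF y] hm(5)[OF hm(2)] by (auto simp: xm_def)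
  have "HF F (mon x \<otimes>\<^bsub>B\<^esub> mon y) = finprod B (%s. F s (fst (xm x y s)) (snd (xm x y s))) ?S"
  using HF_mon[OF xm_Mon[OF x y] S(1,4)] mulB_mon[OF x y] by simp
  also have "... = finprod B (%s. F s (fst (x s)) (snd (x s)) \<otimes>\<^bsub>B\<^esub> F s (fst (y s)) (snd (y s))) ?S"
  proof (rule BB.finprod_cong'[OF refl])
  fix s
  show "F s (fst (xm x y s)) (snd (xm x y s)) = F s (fst (x s)) (snd (x s)) \<otimes>\<^bsub>B\<^esub> F s (fst (y s)) (snd (y s))"
  using AHD(3)[OF F MonD(3)[OF x] MonD(3)[OF y]] by (simp add: xm_def hm_def)
  qed (use BB.m_closed[OF F_mon_closed[OF x] F_mon_closed[OF y]] in blast)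
  also have "... = HF F (mon x) \<otimes>\<^bsub>B\<^esub> HF F (mon y)"
  unfolding HF_mon[OF x S(1,2)] HF_mon[OF y S(1,3)]
  by (rule BB.finprod_multf) (use F_mon_closed[OF x] F_mon_closed[OF y] in auto)
  finally show ?thesis .
 qed
 note bl = bilinear_map_left[OF B_bilinear, unfolded B_simps(1)] and br = bilinear_map_right[OF B_bilinear, unfolded B_simps(1)]
 have hc: "HF F u : BC" if "u : BC" for u using lin_closed[OF h] that by simp
 have "HF F (u \<otimes>\<^bsub>B\<^esub> v) = HF F u \<otimes>\<^bsub>B\<^esub> HF F v" if u: "u : BC" and v: "v : BC" for u v
 proof (rule B_hom_eqI[OF BB_module lin_comp[OF bl[OF v] h] lin_comp[OF h bl[OF hc[OF v]]] _ u[folded B_simps(1)]])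
  fix x assume x: "x : Mon"
  note mx = mon_closed[OF x]
  show "HF F (mon x \<otimes>\<^bsub>B\<^esub> v) = HF F (mon x) \<otimes>\<^bsub>B\<^esub> HF F v"
  by (rule B_hom_eqI[OF BB_module lin_comp[OF br[OF mx] h] lin_comp[OF h br[OF hc[OF mx]]] m[OF x] v[folded B_simps(1)]])
 qed
 moreover have "HF F \<one>\<^bsub>B\<^esub> = \<one>\<^bsub>B\<^esub>"
  using HF_mon[OF xone_Mon, of "{}"] BB.finprod_empty by (simp add: xone_def)
 ultimately show ?thesis using h by (simp add: AE_def)
qed

end

text \<open>Coordinates outside \<open>Y\<close> have degree 0, so by connectedness they are
  scalars, and every algebra endomorphism fixes these. The comparison is thereby confined to the
  copies in \<open>Y\<close>.\<close>

lemma AE_eq_mon: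
 assumes p: "ph : AE" and q: "psi : AE" and x: "x : Mon"
  and e: "!!s n a. s : Y ==> a : P n ==> ph (iota s n a) = psi (iota s n a)"
  and d: "!!s. s ~: Y ==> fst (x s) = 0"
 shows "ph (mon x) = psi (mon x)"
proof -
 have c: "(%s. iota s (fst (x s)) (snd (x s))) : {s. x s ~= hone} \<rightarrow> BC" using iota_closed[OF MonD(3)[OF x]] by blast
 have s: "ph (iota s (fst (x s)) (snd (x s))) = psi (iota s (fst (x s)) (snd (x s)))" for s
 proof (cases "s : Y")
  case True then show ?thesis by (rule e[OF _ MonD(3)[OF x]])
 next
  case False
  have a: "snd (x s) : P 0" using d[OF False] MonD(3)[OF x, of s] by simp
  have "\<theta> (iota s 0 (snd (x s))) = gcounit A (snd (x s)) \<odot>\<^bsub>B\<^esub> \<one>\<^bsub>B\<^esub>" if t: "\<theta> : AE" for \<theta>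
  unfolding AH_degree0[OF iota_AH a] lin_smult[OF AED(1)[OF t] gcounit(1)[OF a] BB.one_closed] AED(3)[OF t] ..
  from this[OF p] this[OF q] show ?thesis unfolding d[OF False] by simp
 qed
 show ?thesis
  unfolding mon_finprod[OF x MonD(2)[OF x] order_refl] AE_finprod[OF p c] AE_finprod[OF q c]
  by (rule BB.finprod_cong'[OF refl]) (use s AED(4)[OF q iota_closed[OF MonD(3)[OF x]]] in auto)
qed

lemma AE_eqI:
 assumes p: "ph : AE" and q: "psi : AE"
  and e: "!!s n a. a : P n ==> ph (iota s n a) = psi (iota s n a)" and u: "u : BC"
 shows "ph u = psi u"
 by (rule Bm_hom_eqI[OF Bme(1) _ _ _ u])
  (use AED(1)[OF p] AED(1)[OF q] AE_eq_mon[OF p q _ e] in \<open>auto simp: lin_B\<close>)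

end

section \<open>Degrees and spans\<close>

text \<open>Push-forward of a degree function along \<open>p\<close>. It describes how degrees add
  up under multiplication and, read backwards, how a comultiplication may distribute them.\<close>

definition psh :: "'i set => ('i => nat) => ('i => nat) => nat => nat" where
 "psh I p r = (%s. \<Sum>i\<in>{i:I. p i = s}. r i)"

context big_bialgebra
begin

definition deg :: "(nat => nat \<times> 'v) => nat => nat" where "deg x = (%s. fst (x s))"

lemma deg_upd: "deg (x(s := (n, a))) = (deg x)(s := n)"
 by (auto simp: deg_def)

text \<open>The projection onto the components with multidegree in \<open>D\<close>. Sets of degrees
  are allowed because a span spreads one degree over several.\<close>

definition proj :: "(nat => nat) set => 'v => 'v" where
 "proj D = lft B (%x. if deg x : D then mon x else \<zero>\<^bsub>B\<^esub>)"

lemma proj_mlin: "mlin B (%x. if deg x : D then mon x else \<zero>\<^bsub>B\<^esub>)"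
proof (rule mlinI_hom)
 fix x s n assume x: "x : Mon"
 show "(%a. if deg (x(s := (n, a))) : D then mon (x(s := (n, a))) else \<zero>\<^bsub>B\<^esub>) : mod_hom K (piece A n) B"
  using mlin_hom[OF mon_mlinB x, of s n] lin_const_zero[OF BB_module, where M = "piece A n"]
  by (cases "(deg x)(s := n) : D") (simp_all add: deg_upd)
qed (use mon_closed BB.zero_closed in auto)

lemma proj_hom: "proj D : mod_hom K B B"
 and proj_mon: "x : Mon ==> proj D (mon x) = (if deg x : D then mon x else \<zero>\<^bsub>B\<^esub>)"
 unfolding proj_def using lftB[OF BB_module proj_mlin] lft_mon[OF BB_module proj_mlin] by auto

lemma proj_closed: "u : BC ==> proj D u : BC"
 using lin_closed[OF proj_hom] by simp

lemma proj_zero: "proj D \<zero>\<^bsub>B\<^esub> = \<zero>\<^bsub>B\<^esub>"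
 by (rule lin_zero[OF BB_module BB_module proj_hom])

lemma proj_proj: "u : BC ==> proj D (proj E u) = proj (D Int E) u"
 by (rule B_hom_eqI[OF BB_module lin_comp[OF proj_hom proj_hom] proj_hom])
  (use proj_zero in \<open>simp_all add: proj_mon del: B_simps(2)\<close>)

lemma proj_empty: "u : BC ==> proj {} u = \<zero>\<^bsub>B\<^esub>"
 by (rule B_hom_eqI[OF BB_module proj_hom lin_const_zero[OF BB_module]]) (simp_all add: proj_mon)

lemma proj_Un: "u : BC ==> D Int E = {} ==> proj (D Un E) u = proj D u \<oplus>\<^bsub>B\<^esub> proj E u"
proof (rule B_hom_eqI[OF BB_module proj_hom lin_plus[OF BB_module proj_hom proj_hom]])
 fix x assume "x : Mon" "D Int E = {}"
 then show "proj (D Un E) (mon x) = proj D (mon x) \<oplus>\<^bsub>B\<^esub> proj E (mon x)"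
  using BB.l_zero BB.r_zero BB.zero_closed mon_closed[of x] by (auto simp: proj_mon)
qed simp

lemma proj_sum:
 assumes u: "u : BC" and f: "finite T" "inj_on F T"
 shows "proj (F ` T) u = (\<Oplus>\<^bsub>B\<^esub>t\<in>T. proj {F t} u)"
 using f
proof (induct T)
 case empty then show ?case using proj_empty[OF u] by (simp del: B_simps)
next
 case (insert t T)
 have c: "(%t. proj {F t} u) : T \<rightarrow> carrier B" "proj {F t} u : carrier B" using proj_closed[OF u] by auto
 have "{F t} Int F ` T = {}" using insert(2,4) by auto
 then have "proj (F ` insert t T) u = proj {F t} u \<oplus>\<^bsub>B\<^esub> proj (F ` T) u" using proj_Un[OF u, of "{F t}" "F ` T"] by simp
 also have "... = (\<Oplus>\<^bsub>B\<^esub>t\<in>insert t T. proj {F t} u)"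
  unfolding BB.finsum_insert[OF insert(1,2) c] using insert(3,4) by (simp add: inj_on_def)
 finally show ?case .
qed

definition TT :: "(nat => nat) set => 'v set" where "TT D = {u : BC. proj D u = u}"

lemma TTD: "u : TT D ==> u : BC" "u : TT D ==> proj D u = u"
 by (auto simp: TT_def)

lemma proj_TT: "u : BC ==> proj D u : TT D"
 using proj_closed proj_proj[of u D D] by (simp add: TT_def)

lemma proj_Int: "u : TT E ==> proj D u = proj (D Int E) u"
 using proj_proj[of u D E] TTD[of u E] by simp

lemma TT_mono:
 assumes "u : TT E" "E <= D" shows "u : TT D"
 using TTD[OF assms(1)] proj_Int[OF assms(1), of D] unfolding TT_def Int_absorb1[OF assms(2)] by simp

lemma TT_mon: "x : Mon ==> deg x : D ==> mon x : TT D"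
 using mon_closed by (simp add: TT_def proj_mon)

text \<open>An element of \<open>TT D\<close> equals its own projection, and the projection kills
  every monomial of another degree.\<close>

lemma TT_hom_eqI:
 assumes "module K Q" "f : mod_hom K B Q" "g : mod_hom K B Q"
  "!!x. x : Mon ==> deg x : D ==> f (mon x) = g (mon x)" "u : TT D"
 shows "f u = g u"
proof -
 have "f (proj D u) = g (proj D u)"
  by (rule B_hom_eqI[OF assms(1) lin_comp[OF proj_hom assms(2)] lin_comp[OF proj_hom assms(3)]])
  (use TTD(1)[OF assms(5)] assms(4) lin_zero[OF BB_module assms(1,2)] lin_zero[OF BB_module assms(1,3)] in
  \<open>simp_all add: proj_mon del: B_simps(2-)\<close>)
 then show ?thesis by (simp add: TTD(2)[OF assms(5)])
qed

lemma TT_submodule: "submodule (TT D) K B"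
proof (rule BB.submoduleI)
 show "TT D <= carrier B" by (auto simp: TT_def)
 show "\<zero>\<^bsub>B\<^esub> : TT D" unfolding TT_def using proj_zero BB.zero_closed by simp
 fix a assume a: "a : TT D"
 then have ac: "a : carrier B" and pa: "proj D a = a" using TTD by auto
 show "\<ominus>\<^bsub>B\<^esub> a : TT D" unfolding TT_def
  using BB.a_inv_closed[OF ac] lin_a_inv[OF BB_module BB_module proj_hom ac, of D] pa by simp
 show "k \<odot>\<^bsub>B\<^esub> a : TT D" if "k : carrier K" for k
  unfolding TT_def using BB.smult_closed[OF that ac] lin_smult[OF proj_hom that ac, of D] pa by simp
 fix b assume b: "b : TT D"
 then have bc: "b : carrier B" and pb: "proj D b = b" using TTD by auto
 show "a \<oplus>\<^bsub>B\<^esub> b : TT D" unfolding TT_def using BB.a_closed[OF ac bc] lin_add[OF proj_hom ac bc, of D] pa pb by simp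
qed

lemmas TT_smult = submodule.smult_closed[OF TT_submodule]

definition VV :: "(nat => nat) set => ('k, 'v) module" where "VV D = B\<lparr>carrier := TT D\<rparr>"

lemma VV_simps [simp]: "carrier (VV D) = TT D" "add (VV D) = add B" "zero (VV D) = zero B" "smult (VV D) = smult B"
 by (simp_all add: VV_def)

lemma VV_module: "module K (VV D)"
 unfolding VV_def by (rule submodule.submodule_is_module[OF TT_submodule BB_module])

lemma TT_add: "u : TT D ==> v : TT D ==> u \<oplus>\<^bsub>B\<^esub> v : TT D" and TT_0: "\<zero>\<^bsub>B\<^esub> : TT D"
 using module.axioms(2)[OF VV_module, of D] abelian_group.axioms(1)[THEN abelian_monoid.a_closed]
  abelian_group.axioms(1)[THEN abelian_monoid.zero_closed] VV_simps by metis+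

lemma TT_finsum: "(!!t. t : T ==> f t : TT D) ==> finsum B f T : TT D"
 and VV_finsum: "(!!t. t : T ==> f t : TT D) ==> finsum (VV D) f T = finsum B f T"
proof -
 interpret V: module K "VV D" by (rule VV_module)
 show e: "finsum (VV D) f T = finsum B f T" if "!!t. t : T ==> f t : TT D" for f
  using that
 proof (induct T rule: infinite_finite_induct)
  case (insert x T)
  then have "f : T \<rightarrow> carrier B" "f x : carrier B" using TTD(1) by auto
  then show ?case
  using insert V.finsum_insert[of T x f] BB.finsum_insert[of T x f] by (simp add: Pi_iff del: B_simps)
 qed (simp_all del: B_simps)
 show "finsum B f T : TT D" if "!!t. t : T ==> f t : TT D"
  using e[OF that] V.finsum_closed[of f T] that by (simp add: Pi_iff)
qed

lemma lin_VV: "f : mod_hom K M B ==> (!!u. u : carrier M ==> f u : TT D) ==> f : mod_hom K M (VV D)"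
 by (auto simp: mod_hom_def)

lemma lin_from_VV: assumes f: "f : mod_hom K B Q" shows "f : mod_hom K (VV D) Q"
 by (rule mod_homI) (use lin_closed[OF f] lin_add[OF f] lin_smult[OF f] TTD(1) in auto)

lemma proj_VV: "proj D : mod_hom K B (VV D)"
 by (rule lin_VV[OF proj_hom]) (simp add: proj_TT)

lemma TT_mult:
 assumes "u : TT D" "v : TT E"
 shows "u \<otimes>\<^bsub>B\<^esub> v : TT {(%s. d s + e s) | d e. d : D & e : E}"
proof -
 let ?F = "{(%s. d s + e s) | d e. d : D & e : E}"
 note bl = bilinear_map_left[OF B_bilinear, unfolded B_simps(1)] and br = bilinear_map_right[OF B_bilinear, unfolded B_simps(1)]
 have v: "v : BC" using assms TTD by auto
 have "proj ?F (u \<otimes>\<^bsub>B\<^esub> v) = u \<otimes>\<^bsub>B\<^esub> v"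
 proof (rule TT_hom_eqI[OF BB_module lin_comp[OF bl[OF v] proj_hom] bl[OF v] _ assms(1)])
  fix x assume x: "x : Mon" "deg x : D"
  note m = br[OF mon_closed[OF x(1)]]
  show "proj ?F (mon x \<otimes>\<^bsub>B\<^esub> v) = mon x \<otimes>\<^bsub>B\<^esub> v"
  proof (rule TT_hom_eqI[OF BB_module lin_comp[OF m proj_hom] m _ assms(2)])
  fix y assume y: "y : Mon" "deg y : E"
  have "deg (xm x y) = (%s. deg x s + deg y s)" by (auto simp: deg_def xm_def hm_def)
  then show "proj ?F (mon x \<otimes>\<^bsub>B\<^esub> mon y) = mon x \<otimes>\<^bsub>B\<^esub> mon y"
  using x y by (auto simp: mulB_mon proj_mon xm_Mon)
  qed
 qed
 moreover have "u \<otimes>\<^bsub>B\<^esub> v : BC" using lin_closed[OF bl[OF v]] TTD(1)[OF assms(1)] by simp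
 ultimately show ?thesis by (simp add: TT_def)
qed

text \<open>The iterated comultiplication of copy \<open>s\<close> with one factor for each
  \<open>i\<close> in the fibre over \<open>s\<close>, this factor being placed in copy
  \<open>q i\<close>. Over an empty fibre it is \<open>ce\<close>, the counit; by the convention for
  \<open>finprod\<close> also over an infinite one.\<close>

definition fan :: "'i set => ('i => nat) => ('i => nat) => nat => nat => 'v => 'v" where
 "fan I p q s = finprod CV (%i. iota (q i)) {i:I. p i = s}"

text \<open>The endomorphism induced by the span with source leg \<open>p\<close> and target leg
  \<open>q\<close>.\<close>

definition W :: "'i set => ('i => nat) => ('i => nat) => 'v => 'v" where
 "W I p q = HF (fan I p q)"

lemma fan_AH: "fan I p q s : AH"
 unfolding fan_def
 by (cases "finite {i:I. p i = s}") (use finprod_AH[OF _ iota_AH] ce_AH in auto)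

lemmas W_AE = HF_AE[of "fan I p q" for I p q, OF fan_AH, folded W_def]
lemmas W_iota = HF_iota[of "fan I p q" for I p q, OF fan_AH, folded W_def]
lemmas W_mon = HF_mon[of "fan I p q" for I p q, OF fan_AH, folded W_def]
lemmas W_hom = AED(1)[OF W_AE]
lemmas W_closed = AED(4)[OF W_AE]

lemma iota_convs: "iota s : convs" by (rule AHD(1)[OF iota_AH])

text \<open>\<open>R\<close> is the fibre product of the two spans, up to a bijection. On each copy
  the second endomorphism is moved inside the convolution product of the first by
  \<open>pc_finprod\<close>, and the resulting double product runs over the fibre product.\<close>

lemma W_comp:
 assumes u: "u : BC" and fI: "!!s. finite {i:I. p i = s}" and fN: "!!s. finite {j:N. q j = s}"
  and h: "bij_betw (%r. (h r, k r)) R {(i, j). i : I & j : N & p' i = q j}"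
  and e: "!!r. r : R ==> t r = p (h r) & t' r = q' (k r)"
 shows "W N q q' (W I p p' u) = W R t t' u"
proof (rule AE_eqI[OF AE_comp[OF W_AE W_AE] W_AE _ u])
 fix s n a assume a: "a : P n"
 let ?I = "{i:I. p i = s}" and ?N = "%i. {j:N. q j = p' i}"
 have c: "(%i. iota (p' i)) : ?I \<rightarrow> convs" using iota_convs by blast
 have pcW: "pc (W N q q') (iota m) = fan N q q' m" for m
  by (rule convs_eqI[OF pc_closed[OF W_AE iota_convs] AHD(1)[OF fan_AH]]) (simp add: pc_def W_iota)
 have fans: "finprod CV (%i. fan N q q' (p' i)) ?I = fan R t t' s"
 proof -
  have "finprod CV (%i. fan N q q' (p' i)) ?I = finprod CV (%(i, j). iota (q' j)) (Sigma ?I ?N)"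
  unfolding fan_def by (rule CV.finprod_Sigma[OF fI fN]) (simp add: iota_convs)
  also have "... = finprod CV (%r. iota (t' r)) {r:R. t r = s}"
  proof (rule CV.finprod_bij[symmetric])
  have "bij_betw (%r. (h r, k r)) {r:R. t r = s} {y:{(i, j). i : I & j : N & p' i = q j}. p (fst y) = s}"
  by (rule bij_betw_Collect[OF h]) (use e in simp)
  moreover have "{y:{(i, j). i : I & j : N & p' i = q j}. p (fst y) = s} = Sigma ?I ?N" by auto
  ultimately show "bij_betw (%r. (h r, k r)) {r:R. t r = s} (Sigma ?I ?N)" by simp
  qed (use e iota_convs in auto)
  finally show ?thesis by (simp add: fan_def)
 qed
 have "W N q q' (W I p p' (iota s n a)) = pc (W N q q') (finprod CV (%i. iota (p' i)) ?I) n a"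
  using a by (simp add: W_iota pc_def fan_def)
 also have "... = W R t t' (iota s n a)"
  unfolding pc_finprod[OF W_AE c] pcW fans W_iota[OF a] ..
 finally show "W N q q' (W I p p' (iota s n a)) = W R t t' (iota s n a)" .
qed

text \<open>The apex of a span matters only up to bijection.\<close>

lemma W_bij:
 assumes h: "bij_betw h R I" and e: "!!r. r : R ==> t r = p (h r) & t' r = q (h r)"
 shows "W R t t' = W I p q"
proof -
 have "fan R t t' s = fan I p q s" for s
  unfolding fan_def
 proof (rule CV.finprod_bij)
  show "bij_betw h {r:R. t r = s} {i:I. p i = s}" by (rule bij_betw_Collect[OF h]) (use e in simp)
 qed (use e iota_convs in auto)
 then have "fan R t t' = fan I p q" by (rule ext)
 then show ?thesis by (simp add: W_def)
qed

lemma iota_TT: "a : P n ==> iota s n a : TT {(%_. 0)(s := n)}"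
proof -
 assume a: "a : P n"
 have "deg (xone(s := (n, a))) = (%_. 0)(s := n)" by (auto simp: deg_def xone_def hone_def)
 then show ?thesis unfolding iota_apply[OF a] by (intro TT_mon Mon_upd[OF xone_Mon a]) simp
qed

text \<open>An iterated comultiplication distributes the degree \<open>n\<close> over the index set
  in all ways; \<open>r\<close> records one distribution.\<close>

lemma finprod_iota_TT:
 assumes "finite I" "c : P n"
 shows "finprod CV (%i. iota (q i)) I n c : TT {psh I q r | r. sum r I = n}"
 using assms
proof (induct I arbitrary: n c)
 case empty
 have "\<one>\<^bsub>B\<^esub> : TT {(%_. 0)}" using TT_mon[OF xone_Mon] by (simp add: deg_def xone_def hone_def)
 then show ?case
  using empty TT_smult[OF gcounit(1)] TT_0 by (cases "n = 0") (auto simp: ce_apply psh_def)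
next
 case (insert i I)
 let ?f = "finprod CV (%i. iota (q i)) I" and ?D = "%n. {psh I q r | r. sum r I = n}"
 let ?E = "{psh (insert i I) q r | r. sum r (insert i I) = n}"
 have f: "?f : convs" by (rule AHD(1)[OF finprod_AH[OF insert(1) iota_AH]])
 have key: "L2 a b (iota (q i)) ?f w : TT ?E" if w: "w : carrier (T2 a b)" and ab: "a + b = n" for a b w
  using w pm pm
 proof (induct rule: tensor_induct)
  case zero
  show ?case using lin_zero[OF T2_module BB_module L2_hom[OF iota_convs f]] TT_0 by (simp del: B_simps)
 next
  case (ptens x y)
  have "iota (q i) a x \<otimes>\<^bsub>B\<^esub> ?f b y : TT {(%s. d s + e s) | d e. d : {(%_. 0)(q i := a)} & e : ?D b}"
  by (rule TT_mult[OF iota_TT[OF ptens(1)] insert(3)[OF ptens(2)]])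
  then show ?case unfolding L2_ptens[OF iota_convs f ptens]
  proof (rule TT_mono, intro subsetI)
  fix g assume "g : {(%s. d s + e s) | d e. d : {(%_. 0)(q i := a)} & e : ?D b}"
  then obtain r where r: "g = (%s. ((%_. 0)(q i := a)) s + psh I q r s)" "sum r I = b" by auto
  have e: "sum (r(i := a)) S = sum r S" if "S <= I" for S
  using that insert(2) by (intro sum.cong) auto
  have i: "{j. (j = i | j : I) & q j = s} = (if q i = s then insert i {j:I. q j = s} else {j:I. q j = s})" for s by auto
  have "psh (insert i I) q (r(i := a)) s = ((%_. 0)(q i := a)) s + psh I q r s" for s
  unfolding psh_def using insert(1,2) e[of "{j:I. q j = s}"] sum.insert[of "{j:I. q j = s}" i "r(i := a)"]
  by (cases "q i = s") (simp_all add: i fun_upd_same fun_upd_other del: fun_upd_apply)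
  then have "g = psh (insert i I) q (r(i := a))" by (simp add: r(1) fun_eq_iff)
  moreover have "sum (r(i := a)) (insert i I) = n" using insert(1,2) ab r(2) e[of I] by simp
  ultimately show "g : ?E" by blast
  qed
 next
  case (add u v)
  then show ?case using TT_add lin_add[OF L2_hom[OF iota_convs f] add(1,2)] by simp
 qed
 have "finprod CV (%i. iota (q i)) (insert i I) = cv (iota (q i)) ?f"
  using CV.finprod_insert[OF insert(1,2), of "%i. iota (q i)"] iota_convs by simp
 moreover have "cv (iota (q i)) ?f n c : TT ?E"
  unfolding cv_apply[OF insert(4)]
 proof (rule TT_finsum)
  fix p assume p: "p : S2 n"
  show "L2 (fst p) (snd p) (iota (q i)) ?f (gcomult A (fst p) (snd p) c) : TT ?E"
  by (rule key[OF lin_closed[OF gcomult_S2[OF p] insert(4)]]) (use p in \<open>auto simp: S2_def\<close>)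
 qed
 ultimately show ?case by simp
qed

lemma finprod_TT:
 assumes "finite S" "!!s. s : S ==> g s : TT (D s)"
 shows "finprod B g S : TT {(%t. \<Sum>s\<in>S. d s t) | d. ALL s:S. d s : D s}"
 using assms
proof (induct S)
 case empty
 have "\<one>\<^bsub>B\<^esub> : TT {(%_. 0)}" using TT_mon[OF xone_Mon] by (simp add: deg_def xone_def hone_def)
 then show ?case by (simp del: B_simps)
next
 case (insert s S)
 have g: "g : S \<rightarrow> carrier B" "g s : carrier B" using insert(4) TTD(1) by auto
 have "g s \<otimes>\<^bsub>B\<^esub> finprod B g S : TT {(%t. d t + e t) | d e. d : D s & e : {(%t. \<Sum>s\<in>S. d s t) | d. ALL s:S. d s : D s}}"
  by (rule TT_mult[OF insert(4) insert(3)]) (use insert(4) in auto)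
 then show ?case
  unfolding BB.finprod_insert[OF insert(1,2) g]
 proof (rule TT_mono, intro subsetI)
  fix f assume "f : {(%t. d t + e t) | d e. d : D s & e : {(%t. \<Sum>s\<in>S. d s t) | d. ALL s:S. d s : D s}}"
  then obtain d e where de: "f = (%t. d t + (\<Sum>s\<in>S. e s t))" "d : D s" "ALL s:S. e s : D s" by auto
  have "(\<Sum>r\<in>S. (e(s := d)) r t) = (\<Sum>r\<in>S. e r t)" for t
  using insert(2) by (intro sum.cong) auto
  then have "f = (%t. \<Sum>r\<in>insert s S. (e(s := d)) r t)" using insert(1,2) by (simp add: de(1))
  moreover have "ALL r:insert s S. (e(s := d)) r : D r" using de insert(2) by auto
  ultimately show "f : {(%t. \<Sum>s\<in>insert s S. d s t) | d. ALL s:insert s S. d s : D s}" by blast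
 qed
qed

text \<open>\<open>r\<close> distributes the degree at every copy over the fibre of \<open>p\<close>
  above it, and multiplying along \<open>q\<close> adds the parts up again.\<close>

lemma W_mon_TT:
 assumes I: "finite I" and x: "x : Mon"
 shows "W I p q (mon x) : TT {psh I q r | r. psh I p r = deg x}"
proof -
 let ?S = "{s. x s ~= hone} Un p ` I"
 let ?D = "%s. {psh {i:I. p i = s} q r | r. sum r {i:I. p i = s} = deg x s}"
 have S: "finite ?S" using I MonD(2)[OF x] by simp
 have t: "fan I p q s (fst (x s)) (snd (x s)) : TT (?D s)" for s
  unfolding fan_def deg_def by (rule finprod_iota_TT[OF _ MonD(3)[OF x]]) (use I in simp)
 have "W I p q (mon x) : TT {(%t. \<Sum>s\<in>?S. d s t) | d. ALL s:?S. d s : ?D s}"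
  unfolding W_mon[OF x S Un_upper1] by (rule finprod_TT[OF S t])
 then show ?thesis
 proof (rule TT_mono, intro subsetI)
  fix f assume "f : {(%t. \<Sum>s\<in>?S. d s t) | d. ALL s:?S. d s : ?D s}"
  then obtain d where f: "f = (%t. \<Sum>s\<in>?S. d s t)" and "ALL s:?S. d s : ?D s" by blast
  then have "ALL s:?S. EX r. d s = psh {i:I. p i = s} q r & sum r {i:I. p i = s} = deg x s" by (simp only: mem_Collect_eq)
  from bchoice[OF this] obtain R
  where R: "!!s. s : ?S ==> d s = psh {i:I. p i = s} q (R s) & sum (R s) {i:I. p i = s} = deg x s" by blast
  \<comment> \<open>The distributions chosen over the single fibres of \<open>p\<close> are glued to
    one function on \<open>I\<close>.\<close>
  let ?r = "%i. R (p i) i"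
  have "psh I p ?r s = deg x s" for s
  proof (cases "s : ?S")
  case True
  have "psh I p ?r s = sum (R s) {i:I. p i = s}" unfolding psh_def by (rule sum.cong) auto
  then show ?thesis using R[OF True] by simp
  next
  case False
  then have "{i:I. p i = s} = {}" "x s = hone" by auto
  then show ?thesis by (simp only: psh_def sum.empty deg_def hm(8))
  qed
  moreover have "f t = psh I q ?r t" for t
  proof -
  have "f t = (\<Sum>s\<in>?S. \<Sum>i\<in>{i:{i:I. q i = t}. p i = s}. ?r i)"
  unfolding f
  proof (rule sum.cong[OF refl])
  fix s assume "s : ?S"
  then have "d s t = (\<Sum>i\<in>{i:{i:I. p i = s}. q i = t}. R s i)" using R by (simp add: psh_def)
  also have "... = (\<Sum>i\<in>{i:{i:I. q i = t}. p i = s}. ?r i)" by (rule sum.cong) auto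
  finally show "d s t = ..." .
  qed
  also have "... = psh I q ?r t"
  unfolding psh_def by (rule sum.group) (use I S in auto)
  finally show ?thesis .
  qed
  ultimately show "f : {psh I q r | r. psh I p r = deg x}" by blast
 qed
qed

text \<open>By \<open>W_mon_TT\<close>, a monomial of degree in \<open>D\<close> goes to degrees in
  \<open>E\<close>, and any other monomial to degrees outside \<open>E\<close>.\<close>

lemma proj_W:
 assumes I: "finite I" and D: "!!r. psh I p r : D \<longleftrightarrow> psh I q r : E" and u: "u : BC"
 shows "proj E (W I p q u) = W I p q (proj D u)"
proof (rule B_hom_eqI[OF BB_module lin_comp[OF W_hom proj_hom] lin_comp[OF proj_hom W_hom] _ u[folded B_simps(1)]])
 fix x assume x: "x : Mon"
 note w = W_mon_TT[OF I x, of p q]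
 show "proj E (W I p q (mon x)) = W I p q (proj D (mon x))"
 proof (cases "deg x : D")
  case True
  have "W I p q (mon x) : TT E"
  proof (rule TT_mono[OF w], intro subsetI)
  fix g assume "g : {psh I q r | r. psh I p r = deg x}"
  then obtain r where "g = psh I q r" "psh I p r = deg x" by blast
  then show "g : E" using D[of r] True by simp
  qed
  then show ?thesis using True x by (simp add: proj_mon TTD(2))
 next
  case False
  have "psh I q r ~: E" if "psh I p r = deg x" for r using D[of r] that False by simp
  then have "E Int {psh I q r | r. psh I p r = deg x} = {}" by blast
  then show ?thesis
  using False x proj_Int[OF w, of E] proj_empty[OF W_closed[OF mon_closed[OF x], of I p q]]
  lin_zero[OF BB_module BB_module W_hom[of I p q]] by (simp add: proj_mon del: B_simps)
 qed
qed

text \<open>On a copy outside \<open>I\<close> this span is the counit, which acts as the identity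
  in degree 0; hence the condition on the degree.\<close>

lemma W_id:
 assumes I: "finite I" and d: "!!s. s ~: I ==> d s = 0" and u: "u : TT {d}"
 shows "W I (%s. s) (%s. s) u = u"
proof (rule TT_hom_eqI[OF BB_module W_hom lin_id _ u])
 fix x assume x: "x : Mon" "deg x : {d}"
 have e: "W I (%s. s) (%s. s) (iota s n a) = iota s n a" if "s : I" "a : P n" for s n a
 proof -
  have "{i:I. i = s} = {s}" using that by auto
  then have "fan I (%s. s) (%s. s) s = iota s" using CV.r_one[of "iota s"] iota_convs by (simp add: fan_def)
  then show ?thesis by (simp add: W_iota[OF that(2)])
 qed
 have i: "(%u. u) : AE" by (simp add: AE_def lin_id)
 show "W I (%s. s) (%s. s) (mon x) = mon x"
  by (rule AE_eq_mon[OF W_AE i x(1) e, of I]) (use x(2) d in \<open>auto simp: deg_def\<close>)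
qed

end

section \<open>The partition functor of a bialgebra\<close>

lemma psh_id: "finite I ==> psh I (%s. s) r s = (if s : I then r s else 0)"
proof -
 have "{i:I. i = s} = (if s : I then {s} else {})" by auto
 then show ?thesis by (simp add: psh_def)
qed

lemma psh_cong: "(!!i. i : I ==> p i = p' i & r i = r' i) ==> psh I p r = psh I p' r'"
 unfolding psh_def by (rule ext, rule sum.cong) auto

lemma psh_inj: "inj_on p I ==> i : I ==> psh I p r (p i) = r i"
proof -
 assume "inj_on p I" "i : I"
 then have "{j:I. p j = p i} = {i}" by (auto dest: inj_onD)
 then show ?thesis by (simp add: psh_def)
qed

lemma psh_outside: "s ~: p ` I ==> psh I p r s = 0"
 unfolding psh_def by (rule sum.neutral) auto

lemma pdeg_outside: "is_part X ==> s ~: labs X ==> pdeg X s = 0"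
 using pdeg_pos_iff by blast

lemma pdeg_psh: "pmor X Y f ==> psh (labs X) (%p. lab Y (f p)) (pdeg X) = pdeg Y"
 by (rule ext) (simp add: psh_def pdeg_push)

context big_bialgebra
begin

lemma W_cong: "(!!i. i : I ==> p i = p' i & q i = q' i) ==> W I p q = W I p' q'"
 by (rule W_bij[OF bij_betw_id]) simp

lemma finite_eq: "finite {i:I. i = s}"
 by (rule finite_subset[of _ "{s}"]) auto

text \<open>Composition with a span whose source leg is the identity: the fibre product is
  \<open>I\<close> itself.\<close>

lemma W_push:
 assumes "u : BC" "!!s. finite {i:I. p i = s}" "!!i. i : I ==> g i : N"
 shows "W N (%s. s) h (W I p g u) = W I p (%i. h (g i)) u"
 by (rule W_comp[OF assms(1,2) finite_eq, where h = "%i. i" and k = g])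
  (use assms(3) in \<open>auto intro!: bij_betw_byWitness[where f' = fst]\<close>)

lemma W_pull:
 assumes "u : BC" "!!s. finite {n:N. b n = s}" "!!s. finite {i:I. a i = s}" "!!i. i : I ==> a i : N"
 shows "W I a q (W N b (%s. s) u) = W I (%i. b (a i)) q u"
 by (rule W_comp[OF assms(1-3), where h = a and k = "%i. i"])
  (use assms(4) in \<open>auto intro!: bij_betw_byWitness[where f' = snd]\<close>)

lemma proj_push:
 assumes I: "finite I" and u: "u : BC"
 shows "proj E (W I (%s. s) q u) = W I (%s. s) q (proj {e. psh I q e : E} u)"
proof (rule proj_W[OF I _ u])
 fix r show "psh I (%s. s) r : {e. psh I q e : E} \<longleftrightarrow> psh I q r : E"
  using psh_cong[of I q q "psh I (%s. s) r" r] psh_id[OF I, of r] by simp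
qed

lemma proj_pull:
 assumes I: "finite I" and u: "u : BC"
 shows "proj {e. psh I p e : D} (W I p (%s. s) u) = W I p (%s. s) (proj D u)"
proof (rule proj_W[OF I _ u])
 fix r show "psh I p r : D \<longleftrightarrow> psh I (%s. s) r : {e. psh I p e : D}"
  using psh_cong[of I p p "psh I (%s. s) r" r] psh_id[OF I, of r] by simp
qed

abbreviation VP :: "part => ('k, 'v) module" where "VP X \<equiv> VV {pdeg X}"
abbreviation TP :: "part => 'v set" where "TP X \<equiv> TT {pdeg X}"

definition trf :: "part => part => (nat => nat) => 'v => 'v" where
 "trf X Y f = W (labs X) (%p. p) (%p. lab Y (f p))"

text \<open>Comultiplying along the labels distributes a degree in all possible ways; the projection
  keeps the distribution given by the block sizes of \<open>X\<close>. For \<open>trf\<close>, a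
  pure multiplication, degrees simply add up.\<close>

definition rsf :: "part => part => (nat => nat) => 'v => 'v" where
 "rsf X Y f u = proj {pdeg X} (W (labs X) (%p. lab Y (f p)) (%p. p) u)"

lemma W_TP: "is_part X ==> u : TP X ==> W (labs X) (%s. s) (%s. s) u = u"
 by (rule W_id) (auto simp: finite_labs pdeg_outside)

lemma trf_TP: assumes f: "pmor X Y f" and u: "u : TP X" shows "trf X Y f u : TP Y"
proof -
 have uc: "u : BC" and pu: "proj {pdeg X} u = u" using TTD[OF u] .
 have "{e. psh (labs X) (%p. lab Y (f p)) e : {pdeg Y}} Int {pdeg X} = {pdeg X}" using pdeg_psh[OF f] by auto
 then have "proj {pdeg Y} (trf X Y f u) = trf X Y f u"
  unfolding trf_def proj_push[OF finite_labs[OF pmorD(1)[OF f]] uc] proj_Int[OF u, of "{e. _ e : _}"] by (simp only: pu)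
 then show ?thesis using W_closed[OF uc] by (simp add: TT_def trf_def)
qed

lemma trf_comp:
 assumes f: "pmor X Y f" and g: "pmor Y Z g" and u: "u : BC"
 shows "trf X Z (g o f) u = trf Y Z g (trf X Y f u)"
proof -
 note L = pmorD(1)[OF f]
 have "trf Y Z g (trf X Y f u) = W (labs X) (%p. p) (%p. lab Z (g (lab Y (f p)))) u"
  unfolding trf_def by (rule W_push[OF u finite_eq pmor_labs[OF f]])
 also have "W (labs X) (%p. p) (%p. lab Z (g (lab Y (f p)))) = trf X Z (g o f)"
  unfolding trf_def using pmor_lab[OF g] pmorD(6)[OF f] labs_pts[OF L] by (intro W_cong) auto
 finally show ?thesis by simp
qed

lemma rsf_comp:
 assumes f: "pmor X Y f" and g: "pmor Y Z g" and u: "u : BC"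
 shows "rsf X Z (g o f) u = rsf X Y f (rsf Y Z g u)"
proof -
 note L = pmorD(1)[OF f] and O = pmorD(1)[OF g]
 note fl = finite_labs[OF L] and fo = finite_labs[OF O]
 let ?a = "%p. lab Y (f p)" and ?b = "%p. lab Z (g p)"
 let ?D = "{e. psh (labs X) ?a e : {pdeg Y}}"
 \<comment> \<open>The intermediate projection is absorbed by the last one: a component of degree
   \<open>pdeg X\<close> after the second comultiplication comes from degree \<open>pdeg Y\<close>
   before it.\<close>
 have i: "{pdeg X} Int ?D = {pdeg X}" using pdeg_psh[OF f] by auto
 have "rsf X Y f (rsf Y Z g u) = proj {pdeg X} (proj ?D (W (labs X) ?a (%p. p) (W (labs Y) ?b (%p. p) u)))"
  unfolding rsf_def proj_pull[OF fl W_closed[OF u]] ..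
 also have "... = proj {pdeg X} (W (labs X) ?a (%p. p) (W (labs Y) ?b (%p. p) u))"
  unfolding proj_proj[OF W_closed[OF W_closed[OF u]]] i ..
 also have "W (labs X) ?a (%p. p) (W (labs Y) ?b (%p. p) u) = W (labs X) (%p. ?b (?a p)) (%p. p) u"
  by (rule W_pull[OF u _ _ pmor_labs[OF f]]) (use fl fo in auto)
 also have "W (labs X) (%p. ?b (?a p)) (%p. p) = W (labs X) (%p. lab Z ((g o f) p)) (%p. p)"
  using pmor_lab[OF g] pmorD(6)[OF f] labs_pts[OF L] by (intro W_cong) auto
 finally show ?thesis by (simp add: rsf_def)
qed

lemma tr_rs_id:
 assumes L: "is_part X" and u: "u : TP X"
 shows "trf X X id u = u" "rsf X X id u = u"
proof -
 have e: "W (labs X) (%p. p) (%p. lab X (id p)) = W (labs X) (%p. p) (%p. p)"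
  "W (labs X) (%p. lab X (id p)) (%p. p) = W (labs X) (%p. p) (%p. p)"
  using lab_labs[OF L] by (auto intro!: W_cong)
 show "trf X X id u = u" "rsf X X id u = u"
  unfolding trf_def rsf_def e W_TP[OF L u] using TTD(2)[OF u] by simp_all
qed

lemma tr_rs_two_iso:
 assumes f: "pmor X Y f" and g: "pmor X Y g" and t: "two_iso X Y f g"
 shows "trf X Y f = trf X Y g" "rsf X Y f = rsf X Y g"
proof -
 have e: "lab Y (f p) = lab Y (g p)" if "p : labs X" for p
  using t lab_eq_iff[OF pmorD(2)[OF f] pmorD(6)[OF f] pmorD(6)[OF g]] labs_pts[OF pmorD(1)[OF f]] that
  by (auto simp: two_iso_def)
 show "trf X Y f = trf X Y g" unfolding trf_def by (rule W_cong) (simp add: e)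
 have "W (labs X) (%p. lab Y (f p)) (%p. p) = W (labs X) (%p. lab Y (g p)) (%p. p)" by (rule W_cong) (simp add: e)
 then show "rsf X Y f = rsf X Y g" by (intro ext) (simp add: rsf_def)
qed

text \<open>An isomorphism is a bijection on labels, so its span can be read from either
  end.\<close>

lemma trf_iso:
 assumes f: "piso X Y f" and u: "u : TP X"
 shows "trf X Y f u = rsf Y X (inv_into (pts X) f) u"
proof -
 have F: "pmor X Y f" using f by (simp add: piso_def)
 let ?g = "inv_into (pts X) f"
 note G = piso_inv[OF f]
 note L = pmorD(1)[OF F] and O = pmorD(2)[OF F]
 have gf: "lab X (?g (lab Y (f p))) = p" if "p : labs X" for p
 proof -
  have p: "p : pts X" using labs_pts[OF L] that by blast
  show ?thesis using pmor_lab[OF G(1) pmorD(6)[OF F p]] G(2)[OF p] lab_labs[OF L that] by simp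
 qed
 have fg: "lab Y (f (lab X (?g q))) = q" if "q : labs Y" for q
 proof -
  have q: "q : pts Y" using labs_pts[OF O] that by blast
  show ?thesis using pmor_lab[OF F pmorD(6)[OF G(1) q]] G(3)[OF q] lab_labs[OF O that] by simp
 qed
 have "bij_betw (%p. lab Y (f p)) (labs X) (labs Y)"
  by (rule bij_betw_byWitness[where f' = "%q. lab X (?g q)"])
  (use gf fg pmor_labs[OF F] pmor_labs[OF G(1)] in auto)
 then have "trf X Y f = W (labs Y) (%q. lab X (?g q)) (%q. q)"
  unfolding trf_def by (rule W_bij) (simp add: gf)
 then show ?thesis using TTD(2)[OF trf_TP[OF F u]] by (simp add: rsf_def)
qed

lemma proj_W_embedded:
 assumes u: "u : BC" and I: "finite I" "inj_on c I" and k: "inj_on k S" "k ` S <= I" and S: "finite S"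
  and d: "!!s. s ~: S ==> d s = 0"
 shows "proj {psh S (%s. c (k s)) d} (W I p c u) =
  W S (%s. s) (%s. c (k s)) (proj {d} (W S (%s. p (k s)) (%s. s) u))"
proof -
 let ?ck = "%s. c (k s)" let ?Q = "?ck ` S" let ?m = "psh S ?ck d"
 note w = W_closed[OF u]
 have ck: "inj_on ?ck S" using comp_inj_on[OF k(1) inj_on_subset[OF I(2) k(2)]] by (simp add: comp_def)
 have Q: "finite ?Q" using S by simp
 have "proj {?m} (W I p c u) = W ?Q (%s. s) (%s. s) (proj {?m} (W I p c u))"
  by (rule W_id[OF Q psh_outside proj_TT[OF w], symmetric])
 also have "... = proj {?m} (W ?Q (%s. s) (%s. s) (W I p c u))"
  by (rule proj_W[OF Q refl w, symmetric])
 also have "W ?Q (%s. s) (%s. s) (W I p c u) = W S (%s. p (k s)) ?ck u"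
 proof (rule W_comp[OF u _ finite_eq, where h = k and k = ?ck])
  show "bij_betw (%s. (k s, ?ck s)) S {(i, j). i : I & j : ?Q & c i = j}"
  proof (rule bij_betw_imageI)
  show "inj_on (%s. (k s, ?ck s)) S" using k(1) unfolding inj_on_def by blast
  have "i = k s" if "i : I" "s : S" "c i = c (k s)" for i s using inj_onD[OF I(2) that(3,1)] that(2) k(2) by blast
  then show "(%s. (k s, ?ck s)) ` S = {(i, j). i : I & j : ?Q & c i = j}" using k(2) by blast
  qed
 qed (use I(1) in auto)
 also have "... = W S (%s. s) ?ck (W S (%s. p (k s)) (%s. s) u)"
  by (rule W_push[OF u, symmetric]) (use S in auto)
 also have "proj {?m} ... = W S (%s. s) ?ck (proj {d} (W S (%s. p (k s)) (%s. s) u))"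
 proof (rule proj_W[OF S _ W_closed[OF u]])
  fix r
  have "psh S (%s. s) r = d \<longleftrightarrow> (ALL s:S. r s = d s)" using psh_id[OF S] d by (auto simp: fun_eq_iff)
  also have "... \<longleftrightarrow> psh S ?ck r = ?m"
  proof
  assume "ALL s:S. r s = d s" then show "psh S ?ck r = ?m" by (intro psh_cong) simp
  next
  assume "psh S ?ck r = ?m" then show "ALL s:S. r s = d s" using psh_inj[OF ck] by metis
  qed
  finally show "psh S (%s. s) r : {d} \<longleftrightarrow> psh S ?ck r : {?m}" by simp
 qed
 finally show ?thesis .
qed

text \<open>Both sides factor through the product indexed by the pairs of a block of the source and a
 block of the target with the same image: the degrees on these pairs are the matrices that classify
 the double cosets, and the support of such a matrix is the set of blocks of the meet.\<close>

lemma tr_rs_double_coset: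
 assumes G: "prefines Z Y" and L: "prefines X Y" and T: "dcoset_reps Z Y X T" and u: "u : TP X"
 shows "rsf Z Y id (trf X Y id u) = (\<Oplus>\<^bsub>B\<^esub>si\<in>T.
  trf (pmeet Z (ptransport si X)) Z id (trf (pmeet (ptransport (inv_into UNIV si) Z) X) (pmeet Z (ptransport si X)) si
  (rsf (pmeet (ptransport (inv_into UNIV si) Z) X) X id u)))"
proof -
 note P = dc_parts[OF G L]
 note uc = TTD(1)[OF u]
 define I where "I = {(x, z). x : labs X & z : labs Z & lab Y x = lab Y z}"
 \<comment> \<open>Copies of the algebra are indexed by numbers, so the pairs in \<open>I\<close>
   are encoded.\<close>
 let ?c = "prod_encode"
 let ?w = "W I fst ?c u"
 note fL = finite_labs[OF P(3)] and fG = finite_labs[OF P(1)]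
 have I: "finite I" by (rule finite_subset[of _ "labs X \<times> labs Z"]) (use fL fG in \<open>auto simp: I_def\<close>)
 then have fin: "finite {i:I. Q i}" for Q by simp
 have c: "inj_on ?c I" by (rule inj_prod_encode)
 note wc = W_closed[OF uc, of I fst ?c]
 have Tb: "T <= block_perms Y" using T by (simp add: dcoset_reps_def)
 have fT: "finite T" by (rule finite_subset[OF Tb finite_block_perms[OF P(2)]])
 let ?M = "%m t. m (fst (prod_decode t)) (snd (prod_decode t))"
 \<comment> \<open>A matrix is stored as a degree function on encoded pairs; \<open>?E\<close>
   prescribes its column sums, \<open>?D\<close> its row sums and its support.\<close>
 let ?E = "{e. psh I snd (%i. e (?c i)) = pdeg Z}"
 let ?D = "{e. psh I fst (%i. e (?c i)) = pdeg X & (ALL t. t ~: ?c ` I --> e t = 0)}"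
 have pc: "psh I q (%i. psh I ?c r (?c i)) = psh I q r" for q r
  by (rule psh_cong) (simp add: psh_inj[OF c])
 \<comment> \<open>The row sums come from the degree of \<open>u\<close>, the support from the image
   of \<open>?c\<close>.\<close>
 have w: "?w : TT ?D"
 proof -
  have "proj ?D ?w = W I fst ?c (proj {pdeg X} u)"
  by (rule proj_W[OF I _ uc]) (simp add: pc psh_outside)
  then show ?thesis using TTD(2)[OF u] wc by (simp add: TT_def)
 qed
 have sums: "psh I fst (%i. e (?c i)) x = (\<Sum>z\<in>labs Z. e (?c (x, z)))" "psh I snd (%i. e (?c i)) z = (\<Sum>x\<in>labs X. e (?c (x, z)))"
  if s: "ALL t. t ~: ?c ` I --> e t = 0" for e x z
 proof -
  have z: "e (?c i) = 0" if "i ~: I" for i using s that c by (auto simp: inj_prod_encode[of UNIV, unfolded inj_def] dest: injD[OF inj_prod_encode])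
  have "psh I fst (%i. e (?c i)) x = (\<Sum>i\<in>Pair x ` labs Z. e (?c i))"
  unfolding psh_def by (rule sum.mono_neutral_left) (use fG in \<open>auto simp: I_def intro!: z[unfolded I_def]\<close>)
  then show "psh I fst (%i. e (?c i)) x = (\<Sum>z\<in>labs Z. e (?c (x, z)))" by (simp add: sum.reindex inj_on_def)
  have "psh I snd (%i. e (?c i)) z = (\<Sum>i\<in>(%x. (x, z)) ` labs X. e (?c i))"
  unfolding psh_def by (rule sum.mono_neutral_left) (use fL in \<open>auto simp: I_def intro!: z[unfolded I_def]\<close>)
  then show "psh I snd (%i. e (?c i)) z = (\<Sum>x\<in>labs X. e (?c (x, z)))" by (simp add: sum.reindex inj_on_def)
 qed
 have ED: "?E Int ?D = ?M ` dmats Z Y X"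
 proof (intro equalityI subsetI)
  fix e assume e: "e : ?E Int ?D"
  then have s: "ALL t. t ~: ?c ` I --> e t = 0" and es: "psh I fst (%i. e (?c i)) = pdeg X" "psh I snd (%i. e (?c i)) = pdeg Z" by simp_all
  have "(x, z) : I" if "e (?c (x, z)) ~= 0" for x z
  proof -
  have "?c (x, z) : ?c ` I" using s that by metis
  then show ?thesis by (simp add: image_iff prod_encode_eq)
  qed
  then have "(%x z. e (?c (x, z))) : dmats Z Y X"
  using sums[OF s] es by (simp add: dmats_def I_def)
  then show "e : ?M ` dmats Z Y X" by (rule rev_image_eqI) (simp add: fun_eq_iff)
 next
  fix e assume "e : ?M ` dmats Z Y X"
  then obtain m where m: "m : dmats Z Y X" "e = ?M m" by blast
  have s: "ALL t. t ~: ?c ` I --> e t = 0"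
  proof (intro allI impI)
  fix t assume "t ~: ?c ` I"
  then have "prod_decode t ~: I" by (metis image_eqI prod_decode_inverse)
  then show "e t = 0" using m by (auto simp: I_def dmats_def split: prod.splits)
  qed
  show "e : ?E Int ?D" using s sums[OF s] m by (auto simp: dmats_def fun_eq_iff)
 qed
 have inj: "inj_on (%si. ?M (dmat Z X si)) T"
 proof (rule inj_onI)
  fix si tau assume s: "si : T" "tau : T" and e: "?M (dmat Z X si) = ?M (dmat Z X tau)"
  have "dmat Z X si x z = dmat Z X tau x z" for x z using fun_cong[OF e, of "?c (x, z)"] by simp
  then have "dmat Z X si = dmat Z X tau" by (intro ext)
  then show "si = tau" using dcoset_reps_bij[OF G L T] s by (auto simp: bij_betw_def dest: inj_onD)
 qed
 have ED': "?E Int ?D = (%si. ?M (dmat Z X si)) ` T"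
  unfolding ED bij_betw_imp_surj_on[OF dcoset_reps_bij[OF G L T], symmetric] image_image ..
 have "rsf Z Y id (trf X Y id u) = proj {pdeg Z} (W I fst snd u)"
 proof -
  have "W (labs Z) (%p. lab Y (id p)) (%p. p) (W (labs X) (%p. p) (%p. lab Y (id p)) u) = W I fst snd u"
  by (rule W_comp[OF uc finite_eq, where h = fst and k = snd]) (use fG in \<open>auto simp: I_def bij_betw_def inj_on_def\<close>)
  then show ?thesis by (simp add: rsf_def trf_def)
 qed
 \<comment> \<open>The span is factored at its apex: comultiply into one copy for each pair, then
   multiply along the columns. The projection can then be applied in between.\<close>
 also have "W I fst snd u = W I ?c snd ?w"
  by (rule W_comp[OF uc fin fin, where h = "%i. i" and k = "%i. i", symmetric])
  (use injD[OF inj_prod_encode] in \<open>auto simp: bij_betw_def inj_on_def\<close>)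
 also have "proj {pdeg Z} ... = W I ?c snd (proj ?E ?w)"
  by (rule proj_W[OF I _ wc]) (simp add: pc)
 also have "proj ?E ?w = (\<Oplus>\<^bsub>B\<^esub>si\<in>T. proj {?M (dmat Z X si)} ?w)"
  unfolding proj_Int[OF w, of ?E] ED' by (rule proj_sum[OF wc fT inj])
 also have "W I ?c snd ... = (\<Oplus>\<^bsub>B\<^esub>si\<in>T. W I ?c snd (proj {?M (dmat Z X si)} ?w))"
  by (rule lin_finsum[OF BB_module BB_module W_hom]) (use proj_closed[OF wc] in simp)
 also have "... = (\<Oplus>\<^bsub>B\<^esub>si\<in>T.
  trf (pmeet Z (ptransport si X)) Z id (trf (pmeet (ptransport (inv_into UNIV si) Z) X) (pmeet Z (ptransport si X)) si
  (rsf (pmeet (ptransport (inv_into UNIV si) Z) X) X id u)))"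
 proof (rule BB.finsum_cong'[OF refl])
  fix si assume "si : T"
  then have s: "si : block_perms Y" using Tb by blast
  let ?N = "pmeet (ptransport (inv_into UNIV si) Z) X"
  let ?k = "%r. (lab X r, lab Z (si r))"
  note m = dc_meet_pmor[OF G L s]
  note S = block_permsD[OF s]
  have N: "is_part ?N" by (rule pmorD(1)[OF m(1)])
  note Np = dc_meet_pts[OF G L s]
  have lp: "labs ?N <= pts Y" using labs_pts[OF N] unfolding Np .
  have klab: "?k r = ?k r' \<longleftrightarrow> (r, r') : eqv ?N" if "r : pts Y" "r' : pts Y" for r r'
  unfolding dc_meet_eqv[OF G L s] using that S(4) P lab_eq_iff[OF P(1), of "si r" "si r'"] lab_eq_iff[OF P(3), of r r'] by auto
  have kN: "?k (lab ?N r) = ?k r" "(lab ?N r = r') = (?k r = ?k r')" if "r : pts Y" "r' : labs ?N" for r r'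
  proof -
  have r: "r : pts ?N" "lab ?N r : pts Y" "r' : pts Y" using that lab_pts[OF N] lp unfolding Np by auto
  show a: "?k (lab ?N r) = ?k r" using klab[OF r(2) that(1)] lab_eqv[OF N r(1)] is_partD(4)[OF N] by blast
  show "(lab ?N r = r') = (?k r = ?k r')"
  unfolding klab[OF that(1) r(3)] using lab_eq_iff[OF N r(1), of r'] r(3) lab_labs[OF N that(2)] unfolding Np by simp
  qed
  have k: "inj_on ?k (labs ?N)" "?k ` labs ?N <= I"
  proof (rule inj_onI)
  fix r r' assume r: "r : labs ?N" "r' : labs ?N" and e: "?k r = ?k r'"
  show "r = r'" using kN(2)[OF _ r(2), of r] e lab_labs[OF N r(1)] r(1) lp by auto
  next
  show "?k ` labs ?N <= I"
  proof (intro image_subsetI)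
  fix r assume "r : labs ?N"
  then have r: "r : pts Y" "si r : pts Y" using lp S(4) by auto
  then show "?k r : I"
  using P dc_lab[OF G L] block_perms_lab[OF P(2) s r(1)] by (auto simp: I_def labs_def)
  qed
  qed
  \<comment> \<open>The nonzero entries of the matrix of \<open>si\<close> are the block sizes of
    the meet, placed at the pairs of labels that the blocks determine.\<close>
  have M: "?M (dmat Z X si) = psh (labs ?N) (%r. ?c (?k r)) (pdeg ?N)"
  proof
  fix t
  obtain x z where t: "t = ?c (x, z)" by (metis prod_decode_inverse surj_pair)
  have d: "?M (dmat Z X si) t = card {r:pts Y. ?k r = (x, z)}" by (simp add: t dmat_def P(5))
  have ck: "inj_on (%r. ?c (?k r)) (labs ?N)" using k(1) by (auto simp: inj_on_def)
  show "?M (dmat Z X si) t = psh (labs ?N) (%r. ?c (?k r)) (pdeg ?N) t"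
  proof (cases "EX r:labs ?N. ?k r = (x, z)")
  case True
  then obtain r where r: "r : labs ?N" "?k r = (x, z)" by blast
  have "{s:pts Y. ?k s = (x, z)} = {s:pts ?N. lab ?N s = r}" using kN(2)[OF _ r(1)] r(2) unfolding Np by auto
  then show ?thesis using d psh_inj[OF ck r(1), of "pdeg ?N"] r(2) t by (simp add: pdeg_def)
  next
  case False
  have "lab ?N s : labs ?N" if "s : pts Y" for s using that Np by (auto simp: labs_def)
  then have e: "{s:pts Y. ?k s = (x, z)} = {}" using False kN(1) by (metis (mono_tags, lifting) empty_Collect_eq)
  have o: "t ~: (%r. ?c (?k r)) ` labs ?N" using False unfolding t by (auto dest: injD[OF inj_prod_encode])
  show ?thesis unfolding d e psh_outside[OF o] by simp
  qed
  qed
  note fN = finite_labs[OF N]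
  let ?v = "rsf ?N X id u"
  have v: "?v : BC" unfolding rsf_def by (rule proj_closed[OF W_closed[OF uc]])
  have "proj {?M (dmat Z X si)} ?w = W (labs ?N) (%s. s) (%r. ?c (?k r)) ?v"
  unfolding M using proj_W_embedded[OF uc I c k fN pdeg_outside[OF N], where p = fst] by (simp add: rsf_def)
  then have "W I ?c snd (proj {?M (dmat Z X si)} ?w) = W I ?c snd (W (labs ?N) (%s. s) (%r. ?c (?k r)) ?v)" by simp
  also have "... = W (labs ?N) (%s. s) (%r. lab Z (si r)) ?v"
  proof (rule W_comp[OF v finite_eq fin, where h = "%r. r" and k = ?k])
  show "bij_betw (%r. (r, ?k r)) (labs ?N) {(i, j). i : labs ?N & j : I & ?c (?k i) = ?c j}"
  using k(2) injD[OF inj_prod_encode] by (auto simp: bij_betw_def inj_on_def)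
  qed simp
  also have "... = trf ?N Z (id o si) ?v" by (simp add: trf_def)
  also have "... = trf (pmeet Z (ptransport si X)) Z id (trf ?N (pmeet Z (ptransport si X)) si ?v)"
  by (rule trf_comp[OF m(2,3) v])
  finally show "W I ?c snd (proj {?M (dmat Z X si)} ?w) = trf (pmeet Z (ptransport si X)) Z id (trf ?N (pmeet Z (ptransport si X)) si ?v)" .
 next
  show "(%si. trf (pmeet Z (ptransport si X)) Z id (trf (pmeet (ptransport (inv_into UNIV si) Z) X) (pmeet Z (ptransport si X)) si
  (rsf (pmeet (ptransport (inv_into UNIV si) Z) X) X id u))) : T \<rightarrow> carrier B"
  unfolding trf_def rsf_def by (intro Pi_I) (simp add: W_closed proj_closed uc)
 qed
 finally show ?thesis .
qed

end

section \<open>The external product\<close>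

definition join :: "(nat => 'a) => (nat => 'a) => nat => 'a" where
 "join x y s = (case sum_decode s of Inl a => x a | Inr b => y b)"

lemma join_simps [simp]: "join x y (inl s) = x s" "join x y (inr s) = y s"
 by (simp_all add: join_def)

lemma inl_inr_cases: obtains a where "s = inl a" | b where "s = inr b"
 by (metis sum_decode_inverse old.sum.exhaust)

lemma join_eqI: "(!!a. f (inl a) = x a) ==> (!!b. f (inr b) = y b) ==> f = join x y"
 by (rule ext) (metis inl_inr_cases join_simps)

lemma join_eq_iff: "join x y = join x' y' \<longleftrightarrow> x = x' & y = y'"
 by (metis join_simps ext)

text \<open>Labels are minima, and \<open>inl\<close> and \<open>inr\<close> are monotone.\<close>

lemma lab_psum:
 assumes L: "is_part X" and O: "is_part Y"
 shows "s : pts X ==> lab (X |+| Y) (inl s) = inl (lab X s)" "t : pts Y ==> lab (X |+| Y) (inr t) = inr (lab Y t)"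
proof -
 have m: "mono inl" "mono inr" by (auto simp: mono_def sum_encode_def)
 have e: "eqv (X |+| Y) `` {inl s} = inl ` (eqv X `` {s})" "eqv (X |+| Y) `` {inr t} = inr ` (eqv Y `` {t})"
  by (auto simp: eqv_psum)
 have f: "finite (eqv X `` {s})" "finite (eqv Y `` {t})"
  using is_partD(1,2)[OF L] is_partD(1,2)[OF O] by (auto intro: finite_subset[of _ "pts X"] finite_subset[of _ "pts Y"])
 show "s : pts X ==> lab (X |+| Y) (inl s) = inl (lab X s)"
  unfolding lab_def e by (rule mono_Min_commute[OF m(1) f(1), symmetric]) (use is_partD(3)[OF L] in auto)
 show "t : pts Y ==> lab (X |+| Y) (inr t) = inr (lab Y t)"
  unfolding lab_def e by (rule mono_Min_commute[OF m(2) f(2), symmetric]) (use is_partD(3)[OF O] in auto)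
qed

lemma labs_psum: "is_part X ==> is_part Y ==> labs (X |+| Y) = inl ` labs X Un inr ` labs Y"
 unfolding labs_def pts_simps image_Un image_image using lab_psum[of X Y] by (intro arg_cong2[of _ _ _ _ "(Un)"] image_cong) auto

lemma pdeg_psum:
 assumes L: "is_part X" and O: "is_part Y" shows "pdeg (X |+| Y) = join (pdeg X) (pdeg Y)"
proof (rule join_eqI)
 fix a
 have "{s:pts (X |+| Y). lab (X |+| Y) s = inl a} = inl ` {s:pts X. lab X s = a}"
  using lab_psum[OF L O] by auto
 then show "pdeg (X |+| Y) (inl a) = pdeg X a" by (simp add: pdeg_def card_image inj_inl)
next
 fix b
 have "{s:pts (X |+| Y). lab (X |+| Y) s = inr b} = inr ` {s:pts Y. lab Y s = b}"
  using lab_psum[OF L O] by auto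
 then show "pdeg (X |+| Y) (inr b) = pdeg Y b" by (simp add: pdeg_def card_image inj_inr)
qed

context big_bialgebra
begin

abbreviation E1 :: "'v => 'v" where "E1 \<equiv> W UNIV (%s. s) (%s. inl s)"
abbreviation E2 :: "'v => 'v" where "E2 \<equiv> W UNIV (%s. s) (%s. inr s)"

text \<open>\<open>inl\<close> and \<open>inr\<close> split the numbers into two copies of
  themselves. Relabelling \<open>u\<close> and \<open>v\<close> apart before multiplying lets
  \<open>bx u v\<close> play the role of their pure tensor inside \<open>B\<close>.\<close>

definition bx :: "'v => 'v => 'v" where "bx u v = E1 u \<otimes>\<^bsub>B\<^esub> E2 v"

lemma bx_bilinear: "bilinear_map K B B B bx"
 unfolding bx_def using bilinear_map_comp[OF B_bilinear W_hom W_hom lin_id] .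

lemma bx_closed: "u : BC ==> v : BC ==> bx u v : BC"
 using bilinear_map_closed[OF bx_bilinear] by simp

lemma bx_left: "v : BC ==> (%u. bx u v) : mod_hom K B B" and bx_right: "u : BC ==> (%v. bx u v) : mod_hom K B B"
 using bilinear_map_left[OF bx_bilinear] bilinear_map_right[OF bx_bilinear] by simp_all

lemma fan_UNIV: "fan UNIV (%s. s) q s = iota (q s)"
 using CV.r_one[of "iota (q s)"] iota_convs by (simp add: fan_def)

lemma join_facts: assumes "x : Mon" "y : Mon" shows join_Mon: "join x y : Mon"
 and join_supp: "{s. join x y s ~= hone} = inl ` {s. x s ~= hone} Un inr ` {s. y s ~= hone}"
proof -
 show e: "{s. join x y s ~= hone} = inl ` {s. x s ~= hone} Un inr ` {s. y s ~= hone}"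
 proof (intro equalityI subsetI)
  fix s assume "s : {s. join x y s ~= hone}"
  then show "s : inl ` {s. x s ~= hone} Un inr ` {s. y s ~= hone}" by (cases s rule: inl_inr_cases) auto
 qed auto
 have "join x y s : Hs" for s using MonD(1)[OF assms(1)] MonD(1)[OF assms(2)] by (cases s rule: inl_inr_cases) auto
 then show "join x y : Mon" using e MonD(2)[OF assms(1)] MonD(2)[OF assms(2)] by (simp add: Mon_def)
qed

lemma bx_mon: assumes x: "x : Mon" and y: "y : Mon" shows "bx (mon x) (mon y) = mon (join x y)"
proof -
 let ?X = "{s. x s ~= hone}" and ?Y = "{s. y s ~= hone}" and ?z = "join x y"
 let ?g = "%s. iota s (fst (?z s)) (snd (?z s))"
 have g: "?g s : carrier B" for s using iota_closed[OF MonD(3)[OF join_Mon[OF x y]]] by simp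
 have "finprod B ?g (inl ` ?X) = E1 (mon x)" "finprod B ?g (inr ` ?Y) = E2 (mon y)"
  unfolding W_mon[OF x MonD(2)[OF x] order_refl] W_mon[OF y MonD(2)[OF y] order_refl] fan_UNIV
  using BB.finprod_reindex[of ?g inl ?X] BB.finprod_reindex[of ?g inr ?Y] g by (simp_all add: inj_inl inj_inr)
 moreover have "mon ?z = finprod B ?g (inl ` ?X Un inr ` ?Y)"
  by (rule mon_finprod[OF join_Mon[OF x y]]) (use MonD(2)[OF x] MonD(2)[OF y] join_supp[OF x y] in auto)
 moreover have "finprod B ?g (inl ` ?X Un inr ` ?Y) = finprod B ?g (inl ` ?X) \<otimes>\<^bsub>B\<^esub> finprod B ?g (inr ` ?Y)"
  by (rule BB.finprod_Un_disjoint) (use MonD(2)[OF x] MonD(2)[OF y] g in auto)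
 ultimately show ?thesis by (simp add: bx_def)
qed

lemma bx_eqI:
 assumes Q: "module K Q" and f: "!!v. v : BC ==> (%u. f u v) : mod_hom K B Q" "!!u. u : BC ==> (%v. f u v) : mod_hom K B Q"
  and g: "!!v. v : BC ==> (%u. g u v) : mod_hom K B Q" "!!u. u : BC ==> (%v. g u v) : mod_hom K B Q"
  and e: "!!x y. x : Mon ==> y : Mon ==> f (mon x) (mon y) = g (mon x) (mon y)" and u: "u : BC" "v : BC"
 shows "f u v = g u v"
proof (rule B_hom_eqI[OF Q f(1)[OF u(2)] g(1)[OF u(2)] _ u(1)[folded B_simps(1)]])
 fix x assume x: "x : Mon"
 show "f (mon x) v = g (mon x) v"
  by (rule B_hom_eqI[OF Q f(2)[OF mon_closed[OF x]] g(2)[OF mon_closed[OF x]] e[OF x] u(2)[folded B_simps(1)]])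
qed

lemma proj_bx:
 assumes u: "u : BC" "v : BC" shows "proj {join d e} (bx u v) = bx (proj {d} u) (proj {e} v)"
proof (rule bx_eqI[OF BB_module, of "%u v. proj {join d e} (bx u v)" "%u v. bx (proj {d} u) (proj {e} v)"])
 show "(%u. proj {join d e} (bx u v)) : mod_hom K B B" "(%u. bx (proj {d} u) (proj {e} v)) : mod_hom K B B" if "v : BC" for v
  by (rule lin_comp[OF bx_left[OF that] proj_hom], rule lin_comp[OF proj_hom bx_left[OF proj_closed[OF that]]])
 show "(%v. proj {join d e} (bx u v)) : mod_hom K B B" "(%v. bx (proj {d} u) (proj {e} v)) : mod_hom K B B" if "u : BC" for u
  by (rule lin_comp[OF bx_right[OF that] proj_hom], rule lin_comp[OF proj_hom bx_right[OF proj_closed[OF that]]])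
 fix x y assume xy: "x : Mon" "y : Mon"
 have "deg (join x y) = join (deg x) (deg y)" by (rule join_eqI) (simp_all add: deg_def)
 then have "deg (join x y) : {join d e} \<longleftrightarrow> deg x : {d} & deg y : {e}" by (simp add: join_eq_iff)
 then show "proj {join d e} (bx (mon x) (mon y)) = bx (proj {d} (mon x)) (proj {e} (mon y))"
  unfolding bx_mon[OF xy] proj_mon[OF join_Mon[OF xy]] proj_mon[OF xy(1)] proj_mon[OF xy(2)]
  using lin_zero[OF BB_module BB_module bx_left, of "mon y"] lin_zero[OF BB_module BB_module bx_left, of "\<zero>\<^bsub>B\<^esub>"]
  lin_zero[OF BB_module BB_module bx_right, of "mon x"] mon_closed[OF xy(1)] mon_closed[OF xy(2)] BB.zero_closed
  by (auto simp: bx_mon[OF xy])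
qed (use u in auto)

lemma bx_TP:
 assumes "is_part X" "is_part Y" and u: "u : TP X" "v : TP Y" shows "bx u v : TP (X |+| Y)"
 unfolding pdeg_psum[OF assms(1,2)] TT_def
 using proj_bx[OF TTD(1)[OF u(1)] TTD(1)[OF u(2)], of "pdeg X" "pdeg Y"] bx_closed[OF TTD(1)[OF u(1)] TTD(1)[OF u(2)]]
 by (simp add: TTD(2)[OF u(1)] TTD(2)[OF u(2)])

lemma E_TP:
 assumes "is_part X" "u : TP X"
 shows "W UNIV (%s. s) g u = W (labs X) (%s. s) g u"
 using W_push[of u "labs X" "%s. s" "%s. s" UNIV g] TTD(1)[OF assms(2)] finite_labs[OF assms(1)] W_TP[OF assms] by simp

lemma W_bx:
 assumes L: "is_part X" "is_part Y" and u: "u : TP X" "v : TP Y"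
 shows "W (labs (X |+| Y)) (%s. s) g (bx u v) =
  W (labs X) (%s. s) (%s. g (inl s)) u \<otimes>\<^bsub>B\<^esub> W (labs Y) (%s. s) (%s. g (inr s)) v"
proof -
 note uc = TTD(1)[OF u(1)] TTD(1)[OF u(2)]
 have a: "W (labs (X |+| Y)) (%s. s) g (W (labs X) (%s. s) (%s. inl s) u) = W (labs X) (%s. s) (%s. g (inl s)) u"
  by (rule W_push[OF uc(1) finite_eq]) (simp add: labs_psum[OF L])
 have b: "W (labs (X |+| Y)) (%s. s) g (W (labs Y) (%s. s) (%s. inr s) v) = W (labs Y) (%s. s) (%s. g (inr s)) v"
  by (rule W_push[OF uc(2) finite_eq]) (simp add: labs_psum[OF L])
 show ?thesis
  unfolding bx_def AED(2)[OF W_AE W_closed[OF uc(1)] W_closed[OF uc(2)]] E_TP[OF L(1) u(1)] E_TP[OF L(2) u(2)] a b ..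
qed

text \<open>The partition functor assigned to \<open>A\<close>. The block of a nonempty
  \<open>indiscrete n\<close> has label 1, so the unit and the comparison with \<open>A\<close> use
  copy 1; in degree 0 all copies give the same scalars.\<close>

definition fnc :: "('k, 'v) smpf" where
 "fnc = \<lparr>val = VP, res = rsf, tr = trf, kunit = (%k. iota 1 0 (gunit A k)),
  ext = (%X Y. tens_lift K (VP X) (VP Y) (VP (X |+| Y)) bx)\<rparr>"

lemma fnc_simps [simp]: "val fnc = VP" "res fnc = rsf" "tr fnc = trf" "kunit fnc k = iota 1 0 (gunit A k)"
 "ext fnc X Y = tens_lift K (VP X) (VP Y) (VP (X |+| Y)) bx"
 by (simp_all add: fnc_def)

lemma bx_VP: "is_part X ==> is_part Y ==> bilinear_map K (VP X) (VP Y) (VP (X |+| Y)) bx"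
proof (rule bilinear_mapI_hom)
 assume L: "is_part X" "is_part Y"
 show "(%u. bx u v) : mod_hom K (VP X) (VP (X |+| Y))" if "v : carrier (VP Y)" for v
  by (rule lin_VV[OF lin_from_VV[OF bx_left]]) (use that bx_TP[OF L] TTD(1) in auto)
 show "(%v. bx u v) : mod_hom K (VP Y) (VP (X |+| Y))" if "u : carrier (VP X)" for u
  by (rule lin_VV[OF lin_from_VV[OF bx_right]]) (use that bx_TP[OF L] TTD(1) in auto)
qed

lemmas ext_fnc_hom = tens_lift_hom[OF VV_module VV_module VV_module bx_VP]
lemmas ext_fnc_ptens = tens_lift_ptens[OF VV_module VV_module VV_module bx_VP]

lemma box_fnc: "is_part X ==> is_part Y ==> u : TP X ==> v : TP Y ==> box K fnc X Y u v = bx u v"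
 unfolding box_def using ext_fnc_ptens by simp

lemma Mon_comp: "x : Mon ==> inj q ==> (%s. x (q s)) : Mon"
 using finite_vimageI[of "{s. x s ~= hone}" q] by (simp add: Mon_def vimage_def)

text \<open>A monomial splits uniquely into its coordinates at \<open>inl\<close> and those at
  \<open>inr\<close>. Sending it to the tensor of the two parts, each projected to its required
  degree, gives the inverse.\<close>

lemma ext_fnc_iso:
 assumes L: "is_part X" "is_part Y"
 shows "ext fnc X Y : mod_iso K (tensor K (VP X) (VP Y)) (VP (X |+| Y))"
proof -
 let ?T = "tensor K (VP X) (VP Y)" and ?pt = "ptens K (VP X) (VP Y)" and ?p = "proj {pdeg X}" and ?q = "proj {pdeg Y}"
 note V = VV_module and T = tensor_module[OF VV_module VV_module]
 note pb = ptens_bilinear[OF V[of "{pdeg X}"] V[of "{pdeg Y}"]]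
 let ?f = "%x. ?pt (?p (mon (%s. x (inl s)))) (?q (mon (%s. x (inr s))))"
 define th where "th = lft ?T ?f"
 have ii: "inj (%s. inl s)" "inj (%s. inr s)" by (simp_all add: inj_def)
 note M = Mon_comp[OF _ ii(1)] Mon_comp[OF _ ii(2)]
 have pl: "(%u. ?pt (?p u) w) : mod_hom K B ?T" if "w : TP Y" for w
  using lin_comp[OF proj_VV bilinear_map_left[OF pb]] that by simp
 have pr: "(%w. ?pt u (?q w)) : mod_hom K B ?T" if "u : TP X" for u
  using lin_comp[OF proj_VV bilinear_map_right[OF pb]] that by simp
 have pc: "?p (mon x) : TP X" "?q (mon x) : TP Y" if "x : Mon" for x
  using proj_TT[OF mon_closed[OF that]] by auto
 have f: "mlin ?T ?f"
 proof (rule mlinI_hom)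
  fix x assume x: "x : Mon"
  show "?f x : carrier ?T" by (rule ptens_closed[OF V V]) (use pc M x in simp_all)
  fix s n
  show "(%a. ?f (x(s := (n, a)))) : mod_hom K (piece A n) ?T"
  proof (cases s rule: inl_inr_cases)
  case (1 t)
  have "(%r. (x(s := (n, a))) (inl r)) = (%r. x (inl r))(t := (n, a))" "(%r. (x(s := (n, a))) (inr r)) = (%r. x (inr r))" for a
  by (auto simp: 1)
  then show ?thesis using lin_comp[OF mlin_hom[OF mon_mlinB M(1)[OF x]] pl[OF pc(2)[OF M(2)[OF x]]]] by simp
  next
  case (2 t)
  have "(%r. (x(s := (n, a))) (inr r)) = (%r. x (inr r))(t := (n, a))" "(%r. (x(s := (n, a))) (inl r)) = (%r. x (inl r))" for a
  by (auto simp: 2)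
  then show ?thesis using lin_comp[OF mlin_hom[OF mon_mlinB M(2)[OF x]] pr[OF pc(1)[OF M(1)[OF x]]]] by simp
  qed
 qed
 have th: "th : mod_hom K B ?T" "!!x. x : Mon ==> th (mon x) = ?f x"
  unfolding th_def using lftB[OF T f] lft_mon[OF T f] by auto
 have th_bx: "th (bx u v) = ?pt (?p u) (?q v)" if "u : BC" "v : BC" for u v
 proof (rule bx_eqI[OF T, where f = "%u v. th (bx u v)" and g = "%u v. ?pt (?p u) (?q v)"])
  show "(%u. th (bx u v)) : mod_hom K B ?T" "(%u. ?pt (?p u) (?q v)) : mod_hom K B ?T" if "v : BC" for v
  by (rule lin_comp[OF bx_left[OF that] th(1)], rule pl[OF proj_TT[OF that]])
  show "(%v. th (bx u v)) : mod_hom K B ?T" "(%v. ?pt (?p u) (?q v)) : mod_hom K B ?T" if "u : BC" for u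
  by (rule lin_comp[OF bx_right[OF that] th(1)], rule pr[OF proj_TT[OF that]])
 qed (use that in \<open>simp_all add: bx_mon th(2) join_Mon\<close>)
 have ext_th: "ext fnc X Y (th w) = proj {pdeg (X |+| Y)} w" if w: "w : BC" for w
 proof (rule B_hom_eqI[OF V lin_comp[OF th(1)] proj_VV _ w[folded B_simps(1)]])
  show "ext fnc X Y : mod_hom K ?T (VP (X |+| Y))" using ext_fnc_hom[OF L] by simp
  fix x assume x: "x : Mon"
  have j: "x = join (%s. x (inl s)) (%s. x (inr s))" by (rule join_eqI) simp_all
  have "ext fnc X Y (th (mon x)) = bx (?p (mon (%s. x (inl s)))) (?q (mon (%s. x (inr s))))"
  unfolding th(2)[OF x] using ext_fnc_ptens[OF L] pc M x by simp
  also have "... = proj {pdeg (X |+| Y)} (mon x)"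
  unfolding pdeg_psum[OF L] using proj_bx[OF mon_closed[OF M(1)[OF x]] mon_closed[OF M(2)[OF x]]]
  bx_mon[OF M[OF x]] j by metis
  finally show "ext fnc X Y (th (mon x)) = proj {pdeg (X |+| Y)} (mon x)" .
 qed
 have th_ext: "th (ext fnc X Y t) = t" if t: "t : carrier ?T" for t
 proof (rule tensor_hom_eqI[OF V V T lin_comp[OF _ lin_from_VV[OF th(1)]] lin_id _ t])
  show "ext fnc X Y : mod_hom K ?T (VP (X |+| Y))" using ext_fnc_hom[OF L] by simp
  show "th (ext fnc X Y (?pt u v)) = ?pt u v" if "u : carrier (VP X)" "v : carrier (VP Y)" for u v
  using ext_fnc_ptens[OF L that] th_bx[of u v] TTD[of u] TTD[of v] that by simp
 qed
 show ?thesis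
 proof (rule mod_isoI_inverse[where g = th])
  show "ext fnc X Y : mod_hom K ?T (VP (X |+| Y))" using ext_fnc_hom[OF L] by simp
  show "th : carrier (VP (X |+| Y)) \<rightarrow> carrier ?T" using lin_closed[OF lin_from_VV[OF th(1)]] by blast
  show "ext fnc X Y (th w) = w" if "w : carrier (VP (X |+| Y))" for w
  using ext_th[of w] TTD[of w] that by simp
 qed (rule th_ext)
qed

end

section \<open>Essential surjectivity\<close>

lemma lab_indiscrete: "s : {1..n} ==> lab (indiscrete n) s = 1"
 unfolding lab_def by (rule Min_eqI) (auto simp: indiscrete_J)

lemma labs_indiscrete: "labs (indiscrete n) <= {1}"
 using lab_indiscrete[of _ n] by (auto simp: labs_def)

lemma pdeg_indiscrete: "pdeg (indiscrete n) = (%_. 0)(1 := n)"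
proof
 fix t
 have "{s:pts (indiscrete n). lab (indiscrete n) s = t} = (if t = 1 then {1..n} else {})"
  using lab_indiscrete[of _ n] by auto
 then show "pdeg (indiscrete n) t = ((%_. 0)(1 := n)) t" by (simp add: pdeg_def)
qed

context big_bialgebra
begin

definition HM :: "(nat \<times> 'v) monoid" where "HM = \<lparr>carrier = Hs, monoid.mult = hm, one = hone\<rparr>"

lemma HM_simps [simp]: "carrier HM = Hs" "monoid.mult HM = hm" "one HM = hone"
 by (simp_all add: HM_def)

sublocale HM: comm_monoid HM
proof (rule comm_monoidI)
 show "p \<otimes>\<^bsub>HM\<^esub> q = q \<otimes>\<^bsub>HM\<^esub> p" if "p : carrier HM" "q : carrier HM" for p q using that hm(3) by simp
qed (simp_all add: hm(1,2,4,5))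

abbreviation tot :: "(nat => nat \<times> 'v) => nat \<times> 'v" where "tot x \<equiv> finprod HM x {s. x s ~= hone}"

lemma tot_superset: "x : Mon ==> finite S ==> {s. x s ~= hone} <= S ==> tot x = finprod HM x S"
 by (rule HM.finprod_mono_neutral_cong_left) (auto simp: MonD)

text \<open>The fold map from the coproduct to \<open>A\<close>, which multiplies all coordinates
  together, in its component of degree \<open>n\<close>. It is going to invert
  \<open>iota 1\<close>.\<close>

lemma fold_mlin: "mlin (piece A n) (%x. if fst (tot x) = n then snd (tot x) else \<zero>\<^bsub>piece A n\<^esub>)"
proof (rule mlinI_hom)
 interpret M: module K "piece A n" by (rule pm)
 fix x assume x: "x : Mon"
 have "tot x : Hs" using HM.finprod_closed[of x] MonD(1)[OF x] by simp
 then show "(if fst (tot x) = n then snd (tot x) else \<zero>\<^bsub>piece A n\<^esub>) : P n" by (auto simp: Hs_def)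
 fix s m
 let ?S = "{t. x t ~= hone} - {s}"
 define r where "r = finprod HM x ?S"
 have r: "snd r : P (fst r)" using HM.finprod_closed[of x ?S] MonD(1)[OF x] by (simp add: r_def Hs_def)
 have e: "tot (x(s := (m, a))) = hm (m, a) r" if a: "a : P m" for a
 proof -
  let ?y = "x(s := (m, a))"
  have y: "?y : Mon" by (rule Mon_upd[OF x a])
  have "tot ?y = finprod HM ?y (insert s ?S)" by (rule tot_superset[OF y]) (use MonD(2)[OF x] in auto)
  also have "... = hm (m, a) (finprod HM ?y ?S)"
  proof -
  have "?y : ?S \<rightarrow> carrier HM" "?y s : carrier HM" using MonD(1)[OF y] by (auto simp del: fun_upd_apply)
  from HM.finprod_insert[OF _ _ this] show ?thesis
  using MonD(2)[OF x] by (simp add: fun_upd_same del: fun_upd_apply)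
  qed
  also have "finprod HM ?y ?S = r" unfolding r_def by (rule HM.finprod_cong'[OF refl]) (use MonD(1)[OF x] in auto)
  finally show ?thesis .
 qed
 show "(%a. if fst (tot (x(s := (m, a)))) = n then snd (tot (x(s := (m, a)))) else \<zero>\<^bsub>piece A n\<^esub>) : mod_hom K (piece A m) (piece A n)"
 proof (cases "m + fst r = n")
  case True
  then show ?thesis
  by (intro lin_cong[OF pm bilinear_map_left[OF gmult_bilinear r, of m, unfolded True]]) (simp add: e hm_def del: fun_upd_apply)
 next
  case False
  then show ?thesis by (intro lin_cong[OF pm lin_const_zero[OF pm]]) (simp add: e hm_def del: fun_upd_apply)
 qed
qed

text \<open>Folding after the inclusion is the identity. Conversely, folding and including again
  acts on the value as \<open>HF (%_. iota 1)\<close>, which sends every copy to copy 1 and so fixes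
  elements whose degree is concentrated there.\<close>

lemma iota_iso: "iota 1 n : mod_iso K (piece A n) (VP (indiscrete n))"
proof -
 let ?V = "VP (indiscrete n)"
 have h: "iota 1 n : mod_hom K (piece A n) ?V"
  unfolding pdeg_indiscrete by (rule lin_VV[OF convsD(1)[OF iota_convs] iota_TT])
 define fd where "fd = lft (piece A n) (%x. if fst (tot x) = n then snd (tot x) else \<zero>\<^bsub>piece A n\<^esub>)"
 have fd: "fd : mod_hom K B (piece A n)"
  "!!x. x : Mon ==> fd (mon x) = (if fst (tot x) = n then snd (tot x) else \<zero>\<^bsub>piece A n\<^esub>)"
  unfolding fd_def using lftB[OF pm fold_mlin] lft_mon[OF pm fold_mlin] by auto
 have q: "iota 1 (fst (finprod HM x S)) (snd (finprod HM x S)) = finprod B (%s. iota 1 (fst (x s)) (snd (x s))) S"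
  "fst (finprod HM x S) = (\<Sum>s\<in>S. fst (x s))" if x: "x : Mon" and S: "finite S" for x S
  using S
 proof (induct S)
  case empty
  show "iota 1 (fst (finprod HM x {})) (snd (finprod HM x {})) = finprod B (%s. iota 1 (fst (x s)) (snd (x s))) {}"
  using AH_one[OF iota_AH, of 1] by (simp add: hone_def)
  show "fst (finprod HM x {}) = (\<Sum>s\<in>{}. fst (x s))" by (simp add: hone_def)
 next
  case (insert s S)
  have c: "(%s. iota 1 (fst (x s)) (snd (x s))) : S \<rightarrow> carrier B" "iota 1 (fst (x s)) (snd (x s)) : carrier B"
  using iota_closed[OF MonD(3)[OF x]] by auto
  have xc: "x : S \<rightarrow> carrier HM" "x s : carrier HM" using MonD(1)[OF x] by auto
  then have fc: "snd (finprod HM x S) : P (fst (finprod HM x S))" using HM.finprod_closed[OF xc(1)] by (simp add: Hs_def)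
  note e = HM.finprod_insert[OF insert(1,2) xc]
  show "iota 1 (fst (finprod HM x (insert s S))) (snd (finprod HM x (insert s S))) = finprod B (%s. iota 1 (fst (x s)) (snd (x s))) (insert s S)"
  unfolding e BB.finprod_insert[OF insert(1,2) c] insert(3)[symmetric]
  using AHD(3)[OF iota_AH MonD(3)[OF x] fc] by (simp add: hm_def)
  show "fst (finprod HM x (insert s S)) = (\<Sum>s\<in>insert s S. fst (x s))"
  unfolding e using insert by (simp add: hm_def)
 qed
 have "fd (iota 1 n a) = a" if a: "a : P n" for a
 proof -
  let ?x = "xone(1 := (n, a))"
  note x = Mon_upd[OF xone_Mon a, of 1]
  have "tot ?x = finprod HM ?x {1}" by (rule tot_superset[OF x]) (auto simp: xone_def)
  also have "... = (n, a)"
  using HM.finprod_insert[of "{}" 1 ?x] MonD(1)[OF x, of 1] HM.r_one[of "(n, a)"] by simp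
  finally show ?thesis using fd(2)[OF x] iota_apply[OF a, of 1] by simp
 qed
 moreover have "iota 1 n (fd u) = u" if "u : carrier ?V" for u
 proof (rule TT_hom_eqI[OF BB_module lin_comp[OF fd(1) convsD(1)[OF iota_convs]] lin_id])
  show "u : TT {(%_. 0)(1 := n)}" using that by (simp add: pdeg_indiscrete)
  fix x assume x: "x : Mon" "deg x : {(%_. 0)(1 := n)}"
  let ?S = "insert 1 {s. x s ~= hone}"
  have S: "finite ?S" "{s. x s ~= hone} <= ?S" using MonD(2)[OF x(1)] by auto
  have d: "fst (x s) = (if s = 1 then n else 0)" for s using x(2) by (auto simp: deg_def dest: fun_cong[of _ _ s])
  note t = tot_superset[OF x(1) S]
  have "fst (tot x) = n" unfolding t q(2)[OF x(1) S(1)] d using S(1) by simp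
  then have "iota 1 n (fd (mon x)) = finprod B (%s. iota 1 (fst (x s)) (snd (x s))) ?S"
  using fd(2)[OF x(1)] q(1)[OF x(1) S(1)] t by simp
  also have "... = HF (%_. iota 1) (mon x)" by (rule HF_mon[OF iota_AH x(1) S, symmetric])
  also have "... = mon x"
  proof (rule AE_eq_mon[OF HF_AE[OF iota_AH] _ x(1), of _ "{1}"])
  show "(%u. u) : AE" by (simp add: AE_def lin_id)
  qed (simp_all add: HF_iota[OF iota_AH] d)
  finally show "iota 1 n (fd (mon x)) = mon x" .
 qed
 ultimately show ?thesis using lin_closed[OF lin_from_VV[OF fd(1)]] by (intro mod_isoI_inverse[OF h, of fd]) auto
qed

section \<open>The axioms of a symmetric monoidal partition functor\<close>

lemma rsf_TP: "u : BC ==> rsf X Y f u : TP X"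
 unfolding rsf_def by (rule proj_TT[OF W_closed])

lemma fnc_partition_functor: "partition_functor K fnc"
proof (rule partition_functor.intro[OF is_cring partition_functor_axioms.intro], unfold fnc_simps VV_simps(1))
 show "rsf X Y f : mod_hom K (VP Y) (VP X)" for X Y f
  unfolding rsf_def[abs_def] by (rule lin_comp[OF lin_from_VV[OF W_hom] proj_VV])
 show "trf X Y f : mod_hom K (VP X) (VP Y)" if "pmor X Y f" for X Y f
  by (rule lin_VV[OF lin_from_VV]) (use that trf_TP W_hom in \<open>auto simp: trf_def\<close>)
 fix Z Y X T u assume G: "prefines Z Y" and L: "prefines X Y" and T: "dcoset_reps Z Y X T" and u: "u : TP X"
 have Tb: "T <= block_perms Y" using T by (simp add: dcoset_reps_def)
 show "rsf Z Y id (trf X Y id u) = (\<Oplus>\<^bsub>VP Z\<^esub>si\<in>T.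
  trf (pmeet Z (ptransport si X)) Z id (trf (pmeet (ptransport (inv_into UNIV si) Z) X) (pmeet Z (ptransport si X)) si
  (rsf (pmeet (ptransport (inv_into UNIV si) Z) X) X id u)))"
  unfolding tr_rs_double_coset[OF G L T u]
 proof (rule VV_finsum[symmetric])
  fix si assume "si : T"
  then have s: "si : block_perms Y" using Tb by blast
  show "trf (pmeet Z (ptransport si X)) Z id (trf (pmeet (ptransport (inv_into UNIV si) Z) X) (pmeet Z (ptransport si X)) si
  (rsf (pmeet (ptransport (inv_into UNIV si) Z) X) X id u)) : TP Z"
  by (rule trf_TP[OF dc_meet_pmor(3)[OF G L s] trf_TP[OF dc_meet_pmor(2)[OF G L s] rsf_TP[OF TTD(1)[OF u]]]])
 qed
qed (use VV_module tr_rs_id tr_rs_two_iso trf_iso trf_comp rsf_comp TTD(1) in auto)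

lemma kunit_fnc: "k : carrier K ==> kunit fnc k = k \<odot>\<^bsub>B\<^esub> \<one>\<^bsub>B\<^esub>" "k : carrier K ==> kunit fnc k : TP pempty"
 using AHD(2)[OF iota_AH] iota_TT[OF gunit_closed, of k 1] pdeg_indiscrete[of 0] by simp_all

lemma AE_scalar: "ph : AE ==> k : carrier K ==> ph (k \<odot>\<^bsub>B\<^esub> \<one>\<^bsub>B\<^esub>) = k \<odot>\<^bsub>B\<^esub> \<one>\<^bsub>B\<^esub>"
 using lin_smult[OF AED(1) _ BB.one_closed] AED(3) by metis

lemma scalar_mult: "k : carrier K ==> u : BC ==> (k \<odot>\<^bsub>B\<^esub> \<one>\<^bsub>B\<^esub>) \<otimes>\<^bsub>B\<^esub> u = k \<odot>\<^bsub>B\<^esub> u" "k : carrier K ==> u : BC ==> u \<otimes>\<^bsub>B\<^esub> (k \<odot>\<^bsub>B\<^esub> \<one>\<^bsub>B\<^esub>) = k \<odot>\<^bsub>B\<^esub> u"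
proof -
 show l: "(k \<odot>\<^bsub>B\<^esub> \<one>\<^bsub>B\<^esub>) \<otimes>\<^bsub>B\<^esub> u = k \<odot>\<^bsub>B\<^esub> u" if "k : carrier K" "u : BC"
  using BB.smult_assoc2[OF that(1) BB.one_closed, of u] BB.l_one[of u] that by simp
 show "u \<otimes>\<^bsub>B\<^esub> (k \<odot>\<^bsub>B\<^esub> \<one>\<^bsub>B\<^esub>) = k \<odot>\<^bsub>B\<^esub> u" if "k : carrier K" "u : BC"
  using l[OF that] BB.m_comm[of u "k \<odot>\<^bsub>B\<^esub> \<one>\<^bsub>B\<^esub>"] BB.smult_closed[OF that(1) BB.one_closed] that by simp
qed

lemma trf_bx:
 assumes L: "is_part X" "is_part Y" and u: "u : TP X" "v : TP Y"
  and p: "!!s. s : labs X ==> lab Z (f (inl s)) = p s" and q: "!!s. s : labs Y ==> lab Z (f (inr s)) = q s"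
 shows "trf (X |+| Y) Z f (bx u v) = W (labs X) (%s. s) p u \<otimes>\<^bsub>B\<^esub> W (labs Y) (%s. s) q v"
 unfolding trf_def W_bx[OF L u]
 using W_cong[of "labs X" "%s. s" "%s. s" "%s. lab Z (f (inl s))" p] W_cong[of "labs Y" "%s. s" "%s. s" "%s. lab Z (f (inr s))" q] p q
 by simp

lemma fnc_smpf: "symmetric_monoidal_partition_functor K fnc"
proof (rule symmetric_monoidal_partition_functor.intro[OF fnc_partition_functor symmetric_monoidal_partition_functor_axioms.intro])
 have "kunit fnc = (%k. iota 1 0 (gunit A k))" by (rule ext) simp
 then show "kunit fnc : mod_iso K (self_mod K) (val fnc pempty)"
  using mod_iso_comp[OF connected iota_iso] by simp
 show "ext fnc X Y : mod_iso K (tensor K (val fnc X) (val fnc Y)) (val fnc (X |+| Y))" if "is_part X" "is_part Y" for X Y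
  using ext_fnc_iso[OF that] by simp
next
 fix X X' f Y Y' g u v
 assume f: "pmor X X' f" and g: "pmor Y Y' g" and "u : carrier (val fnc X')" "v : carrier (val fnc Y')"
 then have u: "u : TP X'" "v : TP Y'" by simp_all
 note uc = TTD(1)[OF u(1)] TTD(1)[OF u(2)]
 note F = pmorD[OF f] and G = pmorD[OF g]
 note lp = labs_psum[OF F(1) G(1)] and fl = finite_labs[OF F(1)] finite_labs[OF G(1)]
 have fN: "finite (labs (X |+| Y))" using lp fl by simp
 let ?a = "%p. lab (X' |+| Y') (psum_map f g p)"
 have a: "?a (inl s) = inl (lab X' (f s))" if "s : labs X" for s
  using lab_psum(1)[OF F(2) G(2) F(6)] that labs_pts[OF F(1)] by auto
 have b: "?a (inr s) = inr (lab Y' (g s))" if "s : labs Y" for s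
  using lab_psum(2)[OF F(2) G(2) G(6)] that labs_pts[OF G(1)] by auto
 \<comment> \<open>In the fibre product only labels of the form \<open>inl s\<close> lie over the
   copies reached by \<open>E1\<close>.\<close>
 have "W (labs (X |+| Y)) ?a (%s. s) (E1 u) = W (labs X) (%p. lab X' (f p)) (%s. inl s) u"
  by (rule W_comp[OF uc(1), where h = "%p. lab X' (f p)" and k = "%s. inl s"])
  (use fN a b in \<open>auto simp: lp bij_betw_def inj_on_def\<close>)
 also have "... = E1 (W (labs X) (%p. lab X' (f p)) (%s. s) u)"
  by (rule W_push[OF uc(1), symmetric]) (use fl in auto)
 finally have e1: "W (labs (X |+| Y)) ?a (%s. s) (E1 u) = ..." .
 have "W (labs (X |+| Y)) ?a (%s. s) (E2 v) = W (labs Y) (%p. lab Y' (g p)) (%s. inr s) v"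
  by (rule W_comp[OF uc(2), where h = "%p. lab Y' (g p)" and k = "%s. inr s"])
  (use fN a b in \<open>auto simp: lp bij_betw_def inj_on_def\<close>)
 also have "... = E2 (W (labs Y) (%p. lab Y' (g p)) (%s. s) v)"
  by (rule W_push[OF uc(2), symmetric]) (use fl in auto)
 finally have e2: "W (labs (X |+| Y)) ?a (%s. s) (E2 v) = ..." .
 have "rsf (X |+| Y) (X' |+| Y') (psum_map f g) (bx u v) = bx (rsf X X' f u) (rsf Y Y' g v)"
  unfolding rsf_def bx_def AED(2)[OF W_AE W_closed[OF uc(1)] W_closed[OF uc(2)]] e1 e2 pdeg_psum[OF F(1) G(1)]
  using proj_bx[OF W_closed[OF uc(1)] W_closed[OF uc(2)]] by (simp add: bx_def)
 then show "res fnc (X |+| Y) (X' |+| Y') (psum_map f g) (box K fnc X' Y' u v) = box K fnc X Y (res fnc X X' f u) (res fnc Y Y' g v)"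
  by (simp add: box_fnc[OF F(2) G(2) u] box_fnc[OF F(1) G(1) rsf_TP[OF uc(1)] rsf_TP[OF uc(2)]])
next
 fix X X' f Y Y' g u v
 assume f: "pmor X X' f" and g: "pmor Y Y' g" and "u : carrier (val fnc X)" "v : carrier (val fnc Y)"
 then have u: "u : TP X" "v : TP Y" by simp_all
 note uc = TTD(1)[OF u(1)] TTD(1)[OF u(2)]
 note F = pmorD[OF f] and G = pmorD[OF g]
 have "trf (X |+| Y) (X' |+| Y') (psum_map f g) (bx u v) =
  W (labs X) (%s. s) (%s. inl (lab X' (f s))) u \<otimes>\<^bsub>B\<^esub> W (labs Y) (%s. s) (%s. inr (lab Y' (g s))) v"
  by (rule trf_bx[OF F(1) G(1) u])
  (use lab_psum[OF F(2) G(2)] F(6) G(6) labs_pts[OF F(1)] labs_pts[OF G(1)] in auto)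
 also have "... = bx (trf X X' f u) (trf Y Y' g v)"
  unfolding bx_def trf_def W_push[OF uc(1) finite_eq UNIV_I] W_push[OF uc(2) finite_eq UNIV_I] ..
 finally show "tr fnc (X |+| Y) (X' |+| Y') (psum_map f g) (box K fnc X Y u v) = box K fnc X' Y' (tr fnc X X' f u) (tr fnc Y Y' g v)"
  by (simp add: box_fnc[OF F(1) G(1) u] box_fnc[OF F(2) G(2) trf_TP[OF f u(1)] trf_TP[OF g u(2)]])
next
 fix X Y Z u v w
 assume L: "is_part X" "is_part Y" "is_part Z" and "u : carrier (val fnc X)" "v : carrier (val fnc Y)" "w : carrier (val fnc Z)"
 then have u: "u : TP X" "v : TP Y" "w : TP Z" by simp_all
 note uc = TTD(1)[OF u(1)] TTD(1)[OF u(2)] TTD(1)[OF u(3)]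
 note LO = is_part_psum[OF L(1,2)] and OG = is_part_psum[OF L(2,3)]
 have pa: "lab (X |+| (Y |+| Z)) (passoc (inl s)) = passoc (inl s)" if "s : labs (X |+| Y)" for s
  using that lab_psum[OF L(1) OG] lab_psum[OF L(2,3)] labs_pts[OF L(1)] labs_pts[OF L(2)] lab_labs[OF L(1)] lab_labs[OF L(2)]
  by (auto simp: labs_psum[OF L(1,2)])
 have pb: "lab (X |+| (Y |+| Z)) (passoc (inr s)) = inr (inr s)" if "s : labs Z" for s
  using that lab_psum[OF L(1) OG] lab_psum[OF L(2,3)] labs_pts[OF L(3)] lab_labs[OF L(3)] by auto
 have i: "W (labs Y) (%s. s) (%s. inr (inl s)) v = E2 (E1 v)" "W (labs Z) (%s. s) (%s. inr (inr s)) w = E2 (E2 w)"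
  unfolding W_push[OF uc(2) finite_eq UNIV_I] W_push[OF uc(3) finite_eq UNIV_I] E_TP[OF L(2) u(2)] E_TP[OF L(3) u(3)] by simp_all
 have "trf ((X |+| Y) |+| Z) (X |+| (Y |+| Z)) passoc (bx (bx u v) w) =
  W (labs (X |+| Y)) (%s. s) (%s. passoc (inl s)) (bx u v) \<otimes>\<^bsub>B\<^esub> W (labs Z) (%s. s) (%s. inr (inr s)) w"
  by (rule trf_bx[OF LO L(3) bx_TP[OF L(1,2) u(1,2)] u(3) pa pb])
 also have "... = (E1 u \<otimes>\<^bsub>B\<^esub> E2 (E1 v)) \<otimes>\<^bsub>B\<^esub> E2 (E2 w)"
  unfolding W_bx[OF L(1,2) u(1,2)] by (simp add: i E_TP[OF L(1) u(1)])
 also have "... = bx u (bx v w)"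
  unfolding bx_def AED(2)[OF W_AE W_closed[OF uc(2)] W_closed[OF uc(3)]] by (rule BB.m_assoc) (simp_all add: W_closed uc)
 finally show "tr fnc ((X |+| Y) |+| Z) (X |+| (Y |+| Z)) passoc (box K fnc (X |+| Y) Z (box K fnc X Y u v) w) =
  box K fnc X (Y |+| Z) u (box K fnc Y Z v w)"
  by (simp add: box_fnc L LO OG u bx_TP)
next
 fix X k u assume L: "is_part X" and k: "k : carrier K" and "u : carrier (val fnc X)"
 then have u: "u : TP X" by simp
 note O = is_part_indiscrete[of 0] and K = kunit_fnc(2)[OF k]
 note a = trf_bx[OF O L K u, of X pcodiag "%s. lab X s" "%s. s"] trf_bx[OF L O u K, of X pcodiag "%s. s" "%s. lab X s"]
 have "trf (pempty |+| X) X pcodiag (bx (kunit fnc k) u) = k \<odot>\<^bsub>B\<^esub> u" "trf (X |+| pempty) X pcodiag (bx u (kunit fnc k)) = k \<odot>\<^bsub>B\<^esub> u"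
  using a lab_labs[OF L] unfolding kunit_fnc(1)[OF k] AE_scalar[OF W_AE k] W_TP[OF L u] scalar_mult[OF k TTD(1)[OF u]]
  by simp_all
 then show "tr fnc (pempty |+| X) X pcodiag (box K fnc pempty X (kunit fnc k) u) = k \<odot>\<^bsub>val fnc X\<^esub> u"
  "tr fnc (X |+| pempty) X pcodiag (box K fnc X pempty u (kunit fnc k)) = k \<odot>\<^bsub>val fnc X\<^esub> u"
  using box_fnc[OF O L K u] box_fnc[OF L O u K] by simp_all
next
 fix X Y u v assume L: "is_part X" "is_part Y" and "u : carrier (val fnc X)" "v : carrier (val fnc Y)"
 then have u: "u : TP X" "v : TP Y" by simp_all
 have "trf (X |+| Y) (Y |+| X) pswap (bx u v) = W (labs X) (%s. s) (%s. inr s) u \<otimes>\<^bsub>B\<^esub> W (labs Y) (%s. s) (%s. inl s) v"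
  by (rule trf_bx[OF L u]) (use lab_psum[OF L(2,1)] labs_pts[OF L(1)] labs_pts[OF L(2)] lab_labs[OF L(1)] lab_labs[OF L(2)] in auto)
 also have "... = bx v u"
  unfolding bx_def E_TP[OF L(2) u(2)] E_TP[OF L(1) u(1)] using W_closed TTD(1)[OF u(1)] TTD(1)[OF u(2)] by (intro BB.m_comm) simp_all
 finally show "tr fnc (X |+| Y) (Y |+| X) pswap (box K fnc X Y u v) = box K fnc Y X v u"
  by (simp add: box_fnc L u)
qed

end

section \<open>The comparison with the original bialgebra\<close>

context big_bialgebra
begin

text \<open>Copies outside \<open>S\<close> are projected to degree 0, where only the counit
  contributes, so the comultiplication into them can be omitted. This handles empty blocks, which
  have no label.\<close>

lemma proj_pull_restrict:
 assumes u: "u : BC" and I: "finite I" "S <= I" and d: "!!s. s ~: S ==> d s = 0"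
 shows "proj {d} (W I p (%s. s) u) = proj {d} (W S p (%s. s) u)"
proof -
 have S: "finite S" using I finite_subset by blast
 have "psh S (%s. s) d = d" using psh_id[OF S, of d] d by (intro ext) simp
 then have "proj {d} (W I p (%s. s) u) = W S (%s. s) (%s. s) (proj {d} (W S p (%s. s) u))"
  using proj_W_embedded[OF u I(1), of "%s. s" "%s. s" S d p] I(2) S d by (simp add: inj_on_def)
 also have "... = proj {d} (W S p (%s. s) u)" by (rule W_id[OF S d proj_TT[OF W_closed[OF u]]])
 finally show ?thesis .
qed

lemma iota_TP: "a : P n ==> iota 1 n a : TP (indiscrete n)"
 unfolding pdeg_indiscrete by (rule iota_TT)

lemma iota_VP: "iota 1 n : mod_hom K (piece A n) (VP (indiscrete n))"
 by (rule mod_isoD(1)[OF iota_iso])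

lemma iota_mult:
 assumes x: "x : P i" and y: "y : P j"
 shows "trf (indiscrete i |+| indiscrete j) (indiscrete (i + j)) (pconcat i)
  (box K fnc (indiscrete i) (indiscrete j) (iota 1 i x) (iota 1 j y)) = iota 1 (i + j) (gmult A i j x y)"
proof -
 note p = is_part_indiscrete and t = iota_TP[OF x] iota_TP[OF y]
 have l: "lab (indiscrete (i + j)) (pconcat i s) = 1" if "s : labs (indiscrete i |+| indiscrete j)" for s
  using pmor_labs[OF pmor_pconcat that] labs_indiscrete by blast
 have "trf (indiscrete i |+| indiscrete j) (indiscrete (i + j)) (pconcat i) (bx (iota 1 i x) (iota 1 j y)) =
  W (labs (indiscrete i)) (%s. s) (%s. s) (iota 1 i x) \<otimes>\<^bsub>B\<^esub> W (labs (indiscrete j)) (%s. s) (%s. s) (iota 1 j y)"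
 proof (rule trf_bx[OF p p t])
  show "lab (indiscrete (i + j)) (pconcat i (inl s)) = s" if "s : labs (indiscrete i)" for s
  using l[of "inl s"] labs_indiscrete[of i] that by (auto simp: labs_psum simp del: pconcat_simps)
  show "lab (indiscrete (i + j)) (pconcat i (inr s)) = s" if "s : labs (indiscrete j)" for s
  using l[of "inr s"] labs_indiscrete[of j] that by (auto simp: labs_psum simp del: pconcat_simps)
 qed
 also have "... = iota 1 (i + j) (gmult A i j x y)"
  unfolding W_TP[OF p t(1)] W_TP[OF p t(2)] by (rule AHD(3)[OF iota_AH x y, symmetric])
 finally show ?thesis using box_fnc[OF p p t] by simp
qed

lemma ext_tens_map:
 assumes w: "w : carrier (T2 i j)"
 shows "ext fnc (indiscrete i) (indiscrete j) (tens_map K (piece A i) (piece A j) (VP (indiscrete i)) (VP (indiscrete j)) (iota 1 i) (iota 1 j) w) =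
  L2 i j (iota (inl 1)) (iota (inr 1)) w"
  and "tens_map K (piece A i) (piece A j) (VP (indiscrete i)) (VP (indiscrete j)) (iota 1 i) (iota 1 j) w :
  carrier (tensor K (VP (indiscrete i)) (VP (indiscrete j)))"
  and "L2 i j (iota (inl 1)) (iota (inr 1)) w : TP (indiscrete i |+| indiscrete j)"
proof -
 let ?e = "ext fnc (indiscrete i) (indiscrete j)"
 let ?t = "tens_map K (piece A i) (piece A j) (VP (indiscrete i)) (VP (indiscrete j)) (iota 1 i) (iota 1 j)"
 note p = is_part_indiscrete
 note th = tens_map_hom[OF pm pm VV_module VV_module iota_VP iota_VP]
 have e: "?e : mod_hom K (tensor K (VP (indiscrete i)) (VP (indiscrete j))) (VP (indiscrete i |+| indiscrete j))"
  by (rule mod_isoD(1)[OF ext_fnc_iso[OF p p]])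
 note et = lin_comp[OF th e]
 have etB: "(%w. ?e (?t w)) : mod_hom K (T2 i j) B"
  by (rule mod_homI) (use lin_closed[OF et] TTD(1) lin_add[OF et] lin_smult[OF et] in auto)
 show *: "?e (?t w) = L2 i j (iota (inl 1)) (iota (inr 1)) w"
 proof (rule tensor_hom_eqI[OF pm pm BB_module etB L2_hom[OF iota_convs iota_convs] _ w])
  fix x y assume x: "x : P i" and y: "y : P j"
  have "?e (?t (ptens K (piece A i) (piece A j) x y)) = bx (iota 1 i x) (iota 1 j y)"
  unfolding tens_map_ptens[OF pm pm VV_module VV_module iota_VP iota_VP x y]
  using ext_fnc_ptens[OF p p] iota_TP[OF x] iota_TP[OF y] by simp
  also have "... = L2 i j (iota (inl 1)) (iota (inr 1)) (ptens K (piece A i) (piece A j) x y)"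
  unfolding bx_def W_iota[OF x] W_iota[OF y] fan_UNIV L2_ptens[OF iota_convs iota_convs x y] ..
  finally show "?e (?t (ptens K (piece A i) (piece A j) x y)) = L2 i j (iota (inl 1)) (iota (inr 1)) (ptens K (piece A i) (piece A j) x y)" .
 qed
 show "?t w : carrier (tensor K (VP (indiscrete i)) (VP (indiscrete j)))" by (rule lin_closed[OF th w])
 show "L2 i j (iota (inl 1)) (iota (inr 1)) w : TP (indiscrete i |+| indiscrete j)"
  using lin_closed[OF et w] unfolding * by (simp only: VV_simps)
qed

text \<open>Comultiplying into the copies \<open>inl 1\<close> and \<open>inr 1\<close> is the
  convolution of two inclusions, a sum over all bidegrees of total degree \<open>i + j\<close>; the
  projection in \<open>rsf\<close> retains the bidegree \<open>(i, j)\<close>.\<close>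

lemma iota_comult:
 assumes x: "x : P (i + j)"
 shows "L2 i j (iota (inl 1)) (iota (inr 1)) (gcomult A i j x) =
  rsf (indiscrete i |+| indiscrete j) (indiscrete (i + j)) (pconcat i) (iota 1 (i + j) x)"
proof -
 let ?I = indiscrete
 let ?N = "labs (?I i |+| ?I j)" and ?d = "pdeg (?I i |+| ?I j)" and ?Q = "{inl 1, inr 1}"
 let ?u = "iota 1 (i + j) x" and ?g = "%q. L2 (fst q) (snd q) (iota (inl 1)) (iota (inr 1)) (gcomult A (fst q) (snd q) x)"
 note p = is_part_indiscrete
 have uc: "?u : BC" by (rule TTD(1)[OF iota_TP[OF x]])
 have pI: "is_part (?I i |+| ?I j)" by (rule is_part_psum[OF p p])
 have N: "?N <= ?Q" using labs_indiscrete by (auto simp: labs_psum[OF p p])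
 have l: "lab (?I (i + j)) (pconcat i s) = 1" if "s : ?N" for s
  using pmor_labs[OF pmor_pconcat that] labs_indiscrete by blast
 have gt: "?g q : TP (?I (fst q) |+| ?I (snd q))" if "q : S2 (i + j)" for q
  by (rule ext_tens_map(3)[OF lin_closed[OF gcomult_S2[OF that] x]])
 have de: "pdeg (?I a |+| ?I b) = ?d \<longleftrightarrow> a = i & b = j" for a b
  unfolding pdeg_psum[OF p p] join_eq_iff pdeg_indiscrete by (metis fun_upd_same)
 have W1: "W ?N (%s. lab (?I (i + j)) (pconcat i s)) (%s. s) = W ?N (%_. 1) (%s. s)"
  by (rule W_cong) (simp add: l)
 have WQ: "W ?Q (%_. 1) (%s. s) ?u = (\<Oplus>\<^bsub>B\<^esub>q\<in>S2 (i + j). ?g q)"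
 proof -
  have "finprod CV iota ?Q = cv (iota (inl 1)) (iota (inr 1))"
  using CV.finprod_insert[of "{inr 1}" "inl 1" iota] CV.finprod_insert[of "{}" "inr 1" iota] iota_convs CV.r_one[of "iota (inr 1)"]
  by (simp add: Pi_iff)
  then have "fan ?Q (%_. 1) (%s. s) 1 = cv (iota (inl 1)) (iota (inr 1))"
  unfolding fan_def by (simp only: simp_thms Collect_mem_eq)
  then show ?thesis unfolding W_iota[OF x] cv_apply[OF x, symmetric] by simp
 qed
 \<comment> \<open>If \<open>i\<close> or \<open>j\<close> is 0, the disjoint union has fewer than
   two labels, whereas the convolution runs over both copies.\<close>
 have "proj {?d} (W ?Q (%_. 1) (%s. s) ?u) = proj {?d} (W ?N (%_. 1) (%s. s) ?u)"
  by (rule proj_pull_restrict[OF uc _ N pdeg_outside[OF pI]]) simp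
 then have "rsf (?I i |+| ?I j) (?I (i + j)) (pconcat i) ?u = proj {?d} (\<Oplus>\<^bsub>B\<^esub>q\<in>S2 (i + j). ?g q)"
  unfolding rsf_def W1 WQ by (rule sym)
 also have "... = (\<Oplus>\<^bsub>B\<^esub>q\<in>S2 (i + j). proj {?d} (?g q))"
  by (rule lin_finsum[OF BB_module BB_module proj_hom]) (use TTD(1)[OF gt] in auto)
 also have "... = (\<Oplus>\<^bsub>B\<^esub>q\<in>{(i, j)}. ?g q)"
 proof (rule BB.finsum_neutral_right[OF finite_S2])
  show "{(i, j)} <= S2 (i + j)" by (simp add: S2_def)
  then show "(%q. proj {?d} (?g q)) : S2 (i + j) \<rightarrow> carrier B" using proj_closed[OF TTD(1)[OF gt]] by auto
  show "proj {?d} (?g q) = ?g q" if "q : {(i, j)}" for q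
  using that TTD(2)[OF gt, of "(i, j)"] by (auto simp: S2_def)
  fix q assume q: "q : S2 (i + j) - {(i, j)}"
  then have "{?d} Int {pdeg (?I (fst q) |+| ?I (snd q))} = {}" using de[of "fst q" "snd q"] by (cases q) auto
  then show "proj {?d} (?g q) = \<zero>\<^bsub>B\<^esub>" using proj_Int[OF gt, of q "{?d}"] proj_empty[OF TTD(1)[OF gt, of q]] q by (simp del: B_simps)
 qed
 also have "... = ?g (i, j)" using TTD(1)[OF gt, of "(i, j)"] BB.r_zero[of "?g (i, j)"] by (simp add: S2_def)
 finally show ?thesis by simp
qed

lemma iota_mor: "gbialg_mor K A (sigma_alg K fnc) (iota 1)"
 unfolding gbialg_mor_def
proof (intro conjI allI ballI)
 let ?I = indiscrete
 note p = is_part_indiscrete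
 show "iota 1 n : mod_hom_ext K (piece A n) (piece (sigma_alg K fnc) n)" for n
  using iota_VP[of n] convsD(3)[OF iota_convs] by (simp add: mod_hom_ext_def sigma_alg_def)
 show "iota 1 (i + j) (gmult A i j x y) = gmult (sigma_alg K fnc) i j (iota 1 i x) (iota 1 j y)"
  if "x : P i" "y : P j" for i j x y
  using iota_mult[OF that] by (simp add: sigma_alg_def)
 show "iota 1 0 (gunit A k) = gunit (sigma_alg K fnc) k" for k by (simp add: sigma_alg_def)
 show "tens_map K (piece A i) (piece A j) (piece (sigma_alg K fnc) i) (piece (sigma_alg K fnc) j) (iota 1 i) (iota 1 j) (gcomult A i j x) =
  gcomult (sigma_alg K fnc) i j (iota 1 (i + j) x)" if x: "x : P (i + j)" for i j x
 proof -
  note w = lin_closed[OF gcomult_hom x]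
  note e = ext_tens_map[OF w, unfolded iota_comult[OF x]]
  show ?thesis
  using inv_into_f_eq[OF mod_isoD(3)[OF ext_fnc_iso[OF p p]] e(2,1)] by (simp add: sigma_alg_def)
 qed
 show "gcounit (sigma_alg K fnc) (iota 1 0 x) = gcounit A x" if x: "x : P 0" for x
 proof -
  interpret F: symmetric_monoidal_partition_functor K fnc by (rule fnc_smpf)
  have "inj_on (kunit fnc) (carrier K)" using mod_isoD(3)[OF F.kunit_iso] by (simp add: self_mod_def)
  moreover have "kunit fnc (gcounit A x) = iota 1 0 x" using P0_gunit[OF x] by simp
  ultimately show ?thesis using inv_into_f_eq[of "kunit fnc" "carrier K" "gcounit A x"] gcounit(1)[OF x] by (simp add: sigma_alg_def)
 qed
qed

end

section \<open>The equivalence\<close>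

lemma gbialg_mor_id:
 assumes A: "connected_graded_bialgebra K A"
 shows "gbialg_mor K A A (%n. \<lambda>x\<in>carrier (piece A n). x)"
proof -
 interpret A: connected_graded_bialgebra K A by fact
 show ?thesis
  unfolding gbialg_mor_def
  using restrict_mod_hom_ext[OF A.piece_module lin_id] bilinear_map_closed[OF A.gmult_bilinear]
  lin_closed[OF mod_isoD(1)[OF A.connected]] lin_closed[OF A.gcomult_hom]
  by (intro conjI allI ballI) (simp_all add: self_mod_def tens_map_ident[OF A.piece_module A.piece_module])
qed

lemma gbialg_mor_comp:
 assumes A: "connected_graded_bialgebra K A" and B: "connected_graded_bialgebra K B" and C: "connected_graded_bialgebra K C"
  and h: "gbialg_mor K A B h" and g: "gbialg_mor K B C g"
 shows "gbialg_mor K A C (%n. compose (carrier (piece A n)) (g n) (h n))"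
proof -
 interpret A: connected_graded_bialgebra K A by fact
 interpret B: connected_graded_bialgebra K B by fact
 interpret C: connected_graded_bialgebra K C by fact
 note H = gbialg_morD[OF h] and G = gbialg_morD[OF g]
 note pA = A.piece_module and pB = B.piece_module and pC = C.piece_module
 show ?thesis
  unfolding gbialg_mor_def
 proof (intro conjI allI ballI)
  show "compose (carrier (piece A n)) (g n) (h n) : mod_hom_ext K (piece A n) (piece C n)" for n
  unfolding compose_def by (rule restrict_mod_hom_ext[OF pA lin_comp[OF H(2) G(2)]])
  fix i j
  show "compose (carrier (piece A (i + j))) (g (i + j)) (h (i + j)) (gmult A i j x y) =
  gmult C i j (compose (carrier (piece A i)) (g i) (h i) x) (compose (carrier (piece A j)) (g j) (h j) y)"
  if "x : carrier (piece A i)" "y : carrier (piece A j)" for x y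
  using that bilinear_map_closed[OF A.gmult_bilinear that] H(3,4) G(4) by (simp add: compose_eq)
  fix x assume x: "x : carrier (piece A (i + j))"
  have "tens_map K (piece A i) (piece A j) (piece C i) (piece C j) (compose (carrier (piece A i)) (g i) (h i))
  (compose (carrier (piece A j)) (g j) (h j)) (gcomult A i j x) =
  tens_map K (piece B i) (piece B j) (piece C i) (piece C j) (g i) (g j)
  (tens_map K (piece A i) (piece A j) (piece B i) (piece B j) (h i) (h j) (gcomult A i j x))"
  by (rule tens_map_comp[OF pA pA pB pB pC pC H(2) H(2) G(2) G(2) _ _ lin_closed[OF A.gcomult_hom x], symmetric])
  (simp_all add: compose_eq)
  then show "tens_map K (piece A i) (piece A j) (piece C i) (piece C j) (compose (carrier (piece A i)) (g i) (h i))
  (compose (carrier (piece A j)) (g j) (h j)) (gcomult A i j x) =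
  gcomult C i j (compose (carrier (piece A (i + j))) (g (i + j)) (h (i + j)) x)"
  using H(6)[OF x] G(6)[OF H(3)[OF x]] x by (simp add: compose_eq)
 next
  show "compose (carrier (piece A 0)) (g 0) (h 0) (gunit A k) = gunit C k" if "k : carrier K" for k
  using that lin_closed[OF mod_isoD(1)[OF A.connected], of k] H(5) G(5) by (simp add: compose_eq self_mod_def)
  show "gcounit C (compose (carrier (piece A 0)) (g 0) (h 0) x) = gcounit A x" if "x : carrier (piece A 0)" for x
  using that H(3,7) G(7) by (simp add: compose_eq)
 qed
qed

lemma gbialg_is_category: "is_category (gbialg_cat K :: (('k, 'v) gbialg, nat => 'v => 'v) cat)"
proof -
 have e: "(%n. compose (carrier (piece A n)) (h n) (\<lambda>x\<in>carrier (piece A n). x)) = h"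
  "(%n. compose (carrier (piece A n)) (\<lambda>x\<in>carrier (piece B n). x) (h n)) = h"
  if "gbialg_mor K A B h" for A B :: "('k, 'v) gbialg" and h
  using gbialg_morD(1)[OF that] gbialg_morD(3)[OF that]
  by (auto simp: mod_hom_ext_def intro!: ext[of _ h] compose_Id Id_compose)
 have a: "(%n. compose (carrier (piece W n)) (h n) (compose (carrier (piece W n)) (g n) (f n))) =
  (%n. compose (carrier (piece W n)) (compose (carrier (piece X n)) (h n) (g n)) (f n))"
  if "gbialg_mor K W X f" for W X :: "('k, 'v) gbialg" and f g h
  by (rule ext, rule compose_assoc) (use gbialg_morD(3)[OF that] in auto)
 let ?C = "gbialg_cat K :: (('k, 'v) gbialg, _) cat"
 show ?thesis
  unfolding is_category_def
 proof (intro conjI ballI)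
  fix X assume X: "X : Obj ?C"
  show "Ident ?C X : Hom ?C X X" using gbialg_mor_id X by (simp add: gbialg_cat_def)
  fix Y assume Y: "Y : Obj ?C"
  fix f assume f: "f : Hom ?C X Y"
  show "Comp ?C X X Y f (Ident ?C X) = f" "Comp ?C X Y Y (Ident ?C Y) f = f"
  using e[of X Y f] f by (simp_all add: gbialg_cat_def)
 next
  fix X Y Z f g assume "X : Obj ?C" "Y : Obj ?C" "Z : Obj ?C" "f : Hom ?C X Y" "g : Hom ?C Y Z"
  then show "Comp ?C X Y Z g f : Hom ?C X Z"
  using gbialg_mor_comp[of K X Y Z f g] by (simp add: gbialg_cat_def)
 next
  fix W X Y Z f g h assume "f : Hom ?C W X"
  then show "Comp ?C W Y Z h (Comp ?C W X Y g f) = Comp ?C W X Z (Comp ?C X Y Z h g) f"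
  using a[of W X f h g] by (simp add: gbialg_cat_def)
 qed
qed

text \<open>A morphism bijective in each degree is invertible: the inverse functions inherit
  compatibility with the products and units directly, and with the comultiplication by functoriality
  of the tensor product.\<close>

lemma gbialg_iso:
 assumes A: "connected_graded_bialgebra K A" and B: "connected_graded_bialgebra K B" and h: "gbialg_mor K A B h"
  and i: "!!n. h n : mod_iso K (piece A n) (piece B n)"
 shows "EX g. is_iso (gbialg_cat K) B A g"
proof -
 interpret A: connected_graded_bialgebra K A by fact
 interpret B: connected_graded_bialgebra K B by fact
 note H = gbialg_morD[OF h]
 note pA = A.piece_module and pB = B.piece_module
 define g where "g n = restrict (inv_into (carrier (piece A n)) (h n)) (carrier (piece B n))" for n
 have gh: "g n (h n a) = a" if "a : carrier (piece A n)" for n a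
  using lin_inv_into_eq[OF i that] H(3)[OF that] by (simp add: g_def)
 have hg: "h n (g n b) = b" "g n b : carrier (piece A n)" if "b : carrier (piece B n)" for n b
  using lin_f_inv_into[OF i that] that by (simp_all add: g_def)
 have ge: "g n : mod_hom_ext K (piece B n) (piece A n)" for n
  unfolding g_def by (rule restrict_mod_hom_ext[OF pB mod_isoD(1)[OF mod_iso_inv_into[OF pA i]]])
 have gm: "gbialg_mor K B A g"
  unfolding gbialg_mor_def
 proof (intro conjI allI ballI)
  fix i j
  show "g (i + j) (gmult B i j x y) = gmult A i j (g i x) (g j y)" if "x : carrier (piece B i)" "y : carrier (piece B j)" for x y
  using H(4)[OF hg(2)[OF that(1)] hg(2)[OF that(2)]] gh[OF bilinear_map_closed[OF A.gmult_bilinear hg(2)[OF that(1)] hg(2)[OF that(2)]]]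
  by (simp add: hg(1)[OF that(1)] hg(1)[OF that(2)])
  fix x assume x: "x : carrier (piece B (i + j))"
  note a = hg(2)[OF x] and G = lin_extD[OF ge]
  note w = lin_closed[OF A.gcomult_hom a]
  have "tens_map K (piece B i) (piece B j) (piece A i) (piece A j) (g i) (g j)
  (tens_map K (piece A i) (piece A j) (piece B i) (piece B j) (h i) (h j) (gcomult A i j (g (i + j) x))) =
  tens_map K (piece A i) (piece A j) (piece A i) (piece A j) (%x. x) (%x. x) (gcomult A i j (g (i + j) x))"
  by (rule tens_map_comp[OF pA pA pB pB pA pA H(2) H(2) G G _ _ w]) (simp_all add: gh)
  also have "... = gcomult A i j (g (i + j) x)" by (rule tens_map_ident[OF pA pA _ _ w]) auto
  finally show "tens_map K (piece B i) (piece B j) (piece A i) (piece A j) (g i) (g j) (gcomult B i j x) = gcomult A i j (g (i + j) x)"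
  unfolding H(6)[OF a] hg(1)[OF x] .
 next
  show "g 0 (gunit B k) = gunit A k" if "k : carrier K" for k
  using gh[OF lin_closed[OF mod_isoD(1)[OF A.connected], of k]] H(5)[OF that] that by (simp add: self_mod_def)
  show "gcounit A (g 0 x) = gcounit B x" if "x : carrier (piece B 0)" for x
  using H(7)[OF hg(2)[OF that]] hg(1)[OF that] by simp
 qed (rule ge)
 have "is_iso (gbialg_cat K) B A g"
  unfolding is_iso_def gbialg_cat_def using h gm by (auto simp: compose_def gh hg H(3) fun_eq_iff intro!: bexI[of _ h])
 then show ?thesis by blast
qed

lemma smpf_mor_id:
 assumes R: "symmetric_monoidal_partition_functor K R"
 shows "smpf_mor K R R (\<lambda>X\<in>Collect is_part. \<lambda>x\<in>carrier (val R X). x)"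
proof -
 interpret R: symmetric_monoidal_partition_functor K R by fact
 show ?thesis
  unfolding smpf_mor_def
  using R.kunit_closed R.res_closed R.tr_closed R.box_closed restrict_mod_hom_ext[OF R.val_module lin_id]
  by (auto simp: is_part_psum dest: pmorD(1,2))
qed

lemma smpf_mor_comp:
 assumes R: "symmetric_monoidal_partition_functor K R" and h: "smpf_mor K R S eta" and g: "smpf_mor K S T \<theta>"
 shows "smpf_mor K R T (\<lambda>X\<in>Collect is_part. compose (carrier (val R X)) (\<theta> X) (eta X))"
proof -
 interpret R: symmetric_monoidal_partition_functor K R by fact
 have "compose (carrier (val R X)) (\<theta> X) (eta X) : mod_hom_ext K (val R X) (val T X)" if "is_part X" for X
  unfolding compose_def by (rule restrict_mod_hom_ext[OF R.val_module[OF that] lin_comp[OF smpf_morD(3)[OF h that] smpf_morD(3)[OF g that]]])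
 then show ?thesis
  using h g smpf_morD(4)[OF h] R.kunit_closed R.res_closed R.tr_closed R.box_closed
  unfolding smpf_mor_def by (auto simp: is_part_psum compose_eq dest: pmorD(1,2))
qed

lemma smpf_is_category: "is_category (smpf_cat K :: (('k, 'v) smpf, part => 'v => 'v) cat)"
proof -
 let ?P = "Collect is_part"
 have e: "(\<lambda>\<Lambda>\<in>?P. compose (carrier (val R \<Lambda>)) (eta \<Lambda>) ((\<lambda>\<Lambda>\<in>?P. \<lambda>x\<in>carrier (val R \<Lambda>). x) \<Lambda>)) = eta"
  "(\<lambda>\<Lambda>\<in>?P. compose (carrier (val R \<Lambda>)) ((\<lambda>\<Lambda>\<in>?P. \<lambda>x\<in>carrier (val S \<Lambda>). x) \<Lambda>) (eta \<Lambda>)) = eta"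
  if "smpf_mor K R S eta" for R S :: "('k, 'v) smpf" and eta
 proof -
  note m = smpf_morD[OF that]
  show "(\<lambda>\<Lambda>\<in>?P. compose (carrier (val R \<Lambda>)) (eta \<Lambda>) ((\<lambda>\<Lambda>\<in>?P. \<lambda>x\<in>carrier (val R \<Lambda>). x) \<Lambda>)) = eta"
  by (rule extensionalityI[OF restrict_extensional m(1)])
  (use m(2,4) in \<open>auto simp: mod_hom_ext_def intro!: compose_Id\<close>)
  show "(\<lambda>\<Lambda>\<in>?P. compose (carrier (val R \<Lambda>)) ((\<lambda>\<Lambda>\<in>?P. \<lambda>x\<in>carrier (val S \<Lambda>). x) \<Lambda>) (eta \<Lambda>)) = eta"
  by (rule extensionalityI[OF restrict_extensional m(1)])
  (use m(2,4) in \<open>auto simp: mod_hom_ext_def intro!: Id_compose\<close>)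
 qed
 have a: "(\<lambda>\<Lambda>\<in>?P. compose (carrier (val W \<Lambda>)) (h \<Lambda>) ((\<lambda>\<Lambda>\<in>?P. compose (carrier (val W \<Lambda>)) (g \<Lambda>) (f \<Lambda>)) \<Lambda>)) =
  (\<lambda>\<Lambda>\<in>?P. compose (carrier (val W \<Lambda>)) ((\<lambda>\<Lambda>\<in>?P. compose (carrier (val X \<Lambda>)) (h \<Lambda>) (g \<Lambda>)) \<Lambda>) (f \<Lambda>))"
  if "smpf_mor K W X f" for W X :: "('k, 'v) smpf" and f g h
  by (rule restrict_ext, simp, rule compose_assoc) (use smpf_morD(4)[OF that] in auto)
 let ?C = "smpf_cat K :: (('k, 'v) smpf, _) cat"
 show ?thesis
  unfolding is_category_def
 proof (intro conjI ballI)
  fix X assume X: "X : Obj ?C"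
  show "Ident ?C X : Hom ?C X X" using smpf_mor_id X by (simp add: smpf_cat_def)
  fix Y assume Y: "Y : Obj ?C"
  fix f assume f: "f : Hom ?C X Y"
  show "Comp ?C X X Y f (Ident ?C X) = f" "Comp ?C X Y Y (Ident ?C Y) f = f"
  using e[of X Y f] f by (simp_all add: smpf_cat_def)
 next
  fix X Y Z f g assume "X : Obj ?C" "Y : Obj ?C" "Z : Obj ?C" "f : Hom ?C X Y" "g : Hom ?C Y Z"
  then show "Comp ?C X Y Z g f : Hom ?C X Z"
  using smpf_mor_comp[of K X Y f Z g] by (simp add: smpf_cat_def)
 next
  fix W X Y Z f g h assume "f : Hom ?C W X"
  then show "Comp ?C W Y Z h (Comp ?C W X Y g f) = Comp ?C W X Z (Comp ?C X Y Z h g) f"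
  using a[of W X f h g] by (simp add: smpf_cat_def)
 qed
qed

lemma sigma_alg_functor: "is_functor (smpf_cat K) (gbialg_cat K) (sigma_alg K) sigma_alg_map"
 unfolding is_functor_def
proof (intro conjI ballI)
 fix R :: "('a, 'v) smpf" assume "R : Obj (smpf_cat K)"
 then have R: "symmetric_monoidal_partition_functor K R" by (simp add: smpf_cat_def)
 show "sigma_alg K R : Obj (gbialg_cat K)"
  using symmetric_monoidal_partition_functor.sigma_alg_bialgebra[OF R] by (simp add: gbialg_cat_def)
 show "sigma_alg_map R R (Ident (smpf_cat K) R) = Ident (gbialg_cat K) (sigma_alg K R)"
  by (simp add: smpf_cat_def gbialg_cat_def sigma_alg_map_def sigma_alg_def restrict_def)
 fix S :: "('a, 'v) smpf" assume "S : Obj (smpf_cat K)"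
 then have S: "symmetric_monoidal_partition_functor K S" by (simp add: smpf_cat_def)
 show "sigma_alg_map R S eta : Hom (gbialg_cat K) (sigma_alg K R) (sigma_alg K S)" if "eta : Hom (smpf_cat K) R S" for eta
  using sigma_alg_map_mor[OF R S] that by (simp add: smpf_cat_def gbialg_cat_def)
 show "sigma_alg_map R T (Comp (smpf_cat K) R S T \<theta> eta) =
  Comp (gbialg_cat K) (sigma_alg K R) (sigma_alg K S) (sigma_alg K T) (sigma_alg_map S T \<theta>) (sigma_alg_map R S eta)" for T eta \<theta>
  by (simp add: smpf_cat_def gbialg_cat_def sigma_alg_map_def sigma_alg_def)
qed

theorem proposition8p7:
 fixes K :: "'k ring"
 assumes "cring K"
  and "infinite (UNIV :: 'v set)"
 shows "is_equivalence
  (smpf_cat K :: (('k, 'v) smpf, part \<Rightarrow> 'v \<Rightarrow> 'v) cat)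
  (gbialg_cat K :: (('k, 'v) gbialg, nat \<Rightarrow> 'v \<Rightarrow> 'v) cat)
  (sigma_alg K) sigma_alg_map"
proof (rule equivalence_from_ff_es[OF smpf_is_category gbialg_is_category sigma_alg_functor])
 show "bij_betw (sigma_alg_map R S) (Hom (smpf_cat K) R S) (Hom (gbialg_cat K) (sigma_alg K R) (sigma_alg K S))"
  if "R : Obj (smpf_cat K)" "S : Obj (smpf_cat K)" for R S :: "('k, 'v) smpf"
  using sigma_alg_map_bij[of K R S] that by (simp add: smpf_cat_def gbialg_cat_def)
 fix A :: "('k, 'v) gbialg" assume "A : Obj (gbialg_cat K)"
 then have A: "connected_graded_bialgebra K A" by (simp add: gbialg_cat_def)
 \<comment> \<open>An infinite type has room for the coproduct of countably many copies of
   \<open>A\<close>.\<close>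
 interpret big_bialgebra K A by (intro big_bialgebra.intro A big_bialgebra_axioms.intro assms(2))
 have "EX g. is_iso (gbialg_cat K) (sigma_alg K fnc) A g"
  by (rule gbialg_iso[OF A symmetric_monoidal_partition_functor.sigma_alg_bialgebra[OF fnc_smpf] iota_mor])
  (use iota_iso in \<open>simp add: sigma_alg_def\<close>)
 then show "EX R:Obj (smpf_cat K). EX f. is_iso (gbialg_cat K) (sigma_alg K R) A f"
  using fnc_smpf by (auto simp: smpf_cat_def)
qed

end
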